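(* Fix an integer $p\ge1$. Let $f:[0,\infty)^2\to\mathbb{R}$ be the viscosity solution of \[ \partial_t f - 2^{p-1}(\partial_h f)^p = 0 \ \text{ in } (0,\infty)^2, \qquad -\partial_h f = 0 \ \text{ on } (0,\infty)\times\{0\}, \] with initial condition $f(0,h)=\psi(h)$ for $h\ge0$. Then for every $M\ge1$, \[ \lim_{N\to\infty}\mathbb{E}\Big[\sup_{(t,h)\in[0,M]^2}\big(F_N(t,h)-f(t,h)\big)^2\Big]=0. \]
   Context: Let $P$ be a probability measure on $\mathbb{R}$ with bounded support, $P_N:=P^{\otimes N}$. Under $\mathbb{P}$ (expectation $\mathbb{E}$), let $\bar x\in\mathbb{R}^N$ have i.i.d. entries of law $P$, let $W=(W_{i_1\dots i_p})_{1\le i_1,\dots,i_p\le N}$ be a tensor of order $p$ of independent standard Gaussians, and $z=(z_i)_{i\le N}$ independent standard Gaussians, with $\bar x,W,z$ independent. For $x\in\mathbb{R}^N$, $x^{\otimes p}$ is the tensor with entries $x_{i_1}\cdots x_{i_p}$, and $W:x^{\otimes p}:=\sum_{i_1,\dots,i_p}W_{i_1\dots i_p}x_{i_1}\cdots x_{i_p}$. For $t,h\ge0$ set \[ H_N(t,h,x):=\frac{\sqrt t}{N^{(p-1)/2}}W:x^{\otimes p}+\frac{t}{N^{p-1}}(x\cdot\bar x)^p-\frac{t}{2N^{p-1}}|x|^{2p}+\sqrt h\,z\cdot x+h\,x\cdot\bar x-\frac h2|x|^2, \] and $F_N(t,h):=\frac1N\log\int_{\mathbb{R}^N}e^{H_N(t,h,x)}\,dP_N(x)$.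 Let $\psi(h):=\mathbb{E}\log\int_{\mathbb{R}}\exp(\sqrt h z_1x+hx\bar x_1-\tfrac h2x^2)\,dP(x)$. Viscosity solutions: $f\in C([0,\infty)^2)$ is a subsolution if for every $(t,h)\in(0,\infty)\times[0,\infty)$ and $\phi\in C^\infty((0,\infty)\times[0,\infty))$ with $f-\phi$ having a local maximum at $(t,h)$: $(\partial_t\phi-2^{p-1}(\partial_h\phi)^p)(t,h)\le0$ if $h>0$, and $\min(-\partial_h\phi,\partial_t\phi-2^{p-1}(\partial_h\phi)^p)(t,h)\le0$ if $h=0$; a supersolution if for every such $(t,h),\phi$ with a local minimum: $(\partial_t\phi-2^{p-1}(\partial_h\phi)^p)(t,h)\ge0$ if $h>0$, and $\max(-\partial_h\phi,\partial_t\phi-2^{p-1}(\partial_h\phi)^p)(t,h)\ge0$ if $h=0$; a solution if both.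
   Formalization: The viscosity solution f is additionally assumed Lipschitz on [0,∞)²; among merely continuous functions uniqueness can fail (e.g. p=3, P=δ_0), and any f for which the limit holds for all M is Lipschitz. *)

theory Defs
  imports "HOL-Analysis.Analysis" "HOL-Probability.Probability"
begin

definition gauss :: "real measure" where
  "gauss = density lborel std_normal_density"

definition tidx :: "nat \<Rightarrow> nat \<Rightarrow> nat list set" where
  "tidx N p = {is. length is = p \<and> set is \<subseteq> {..<N}}"

definition tensor_contr :: "nat \<Rightarrow> nat \<Rightarrow> (nat list \<Rightarrow> real) \<Rightarrow> (nat \<Rightarrow> real) \<Rightarrow> real" where
  "tensor_contr N p W x = (\<Sum>is\<in>tidx N p. W is * prod_list (map x is))"

definition dotN :: "nat \<Rightarrow> (nat \<Rightarrow> real) \<Rightarrow> (nat \<Rightarrow> real) \<Rightarrow> real" where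
  "dotN N x y = (\<Sum>i<N. x i * y i)"

definition HN :: "nat \<Rightarrow> nat \<Rightarrow> real \<Rightarrow> real \<Rightarrow> (nat \<Rightarrow> real) \<Rightarrow> (nat list \<Rightarrow> real)
    \<Rightarrow> (nat \<Rightarrow> real) \<Rightarrow> (nat \<Rightarrow> real) \<Rightarrow> real" where
  "HN p N t h xb W z x =
     sqrt t / real N powr ((real p - 1) / 2) * tensor_contr N p W x
     + t / real N ^ (p - 1) * (dotN N x xb) ^ p
     - t / (2 * real N ^ (p - 1)) * (dotN N x x) ^ p
     + sqrt h * dotN N z x + h * dotN N x xb - h / 2 * dotN N x x"

definition FN :: "real measure \<Rightarrow> nat \<Rightarrow> nat \<Rightarrow> real \<Rightarrow> real
    \<Rightarrow> (nat \<Rightarrow> real) \<times> (nat list \<Rightarrow> real) \<times> (nat \<Rightarrow> real) \<Rightarrow> real" where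
  "FN P p N t h \<omega> = (case \<omega> of (xb, W, z) \<Rightarrow>
     1 / real N * ln (LINT x | PiM {..<N} (\<lambda>_. P). exp (HN p N t h xb W z x)))"

definition sample_space :: "real measure \<Rightarrow> nat \<Rightarrow> nat
    \<Rightarrow> ((nat \<Rightarrow> real) \<times> (nat list \<Rightarrow> real) \<times> (nat \<Rightarrow> real)) measure" where
  "sample_space P p N =
     PiM {..<N} (\<lambda>_. P) \<Otimes>\<^sub>M (PiM (tidx N p) (\<lambda>_. gauss) \<Otimes>\<^sub>M PiM {..<N} (\<lambda>_. gauss))"

definition psi :: "real measure \<Rightarrow> real \<Rightarrow> real" where
  "psi P h = (LINT \<omega> | (gauss \<Otimes>\<^sub>M P). (case \<omega> of (z1, xb1) \<Rightarrow>
      ln (LINT x | P. exp (sqrt h * z1 * x + h * x * xb1 - h / 2 * x ^ 2))))"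

text \<open>C^infinity functions on a set U of R^2 (derivatives taken within U), with the
  two partial derivatives as explicit witnesses.\<close>
coinductive C_inf :: "(real \<times> real) set \<Rightarrow> (real \<times> real \<Rightarrow> real) \<Rightarrow> bool" for U where
  "(\<And>y. y \<in> U \<Longrightarrow> (g has_derivative (\<lambda>v. fst v * g1 y + snd v * g2 y)) (at y within U))
   \<Longrightarrow> C_inf U g1 \<Longrightarrow> C_inf U g2 \<Longrightarrow> C_inf U g"

definition test_fn :: "(real \<times> real \<Rightarrow> real) \<Rightarrow> (real \<times> real \<Rightarrow> real) \<Rightarrow> (real \<times> real \<Rightarrow> real) \<Rightarrow> bool" where
  "test_fn \<phi> \<phi>t \<phi>h \<longleftrightarrow>
     (\<forall>y\<in>{0<..} \<times> {0..}. (\<phi> has_derivative (\<lambda>v. fst v * \<phi>t y + snd v * \<phi>h y)) (at y within {0<..} \<times> {0..}))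
     \<and> C_inf ({0<..} \<times> {0..}) \<phi>t \<and> C_inf ({0<..} \<times> {0..}) \<phi>h"

definition loc_max_at :: "(real \<times> real \<Rightarrow> real) \<Rightarrow> real \<times> real \<Rightarrow> bool" where
  "loc_max_at g y \<longleftrightarrow> (\<exists>e>0. \<forall>y'\<in>({0<..} \<times> {0..}) \<inter> ball y e. g y' \<le> g y)"

definition loc_min_at :: "(real \<times> real \<Rightarrow> real) \<Rightarrow> real \<times> real \<Rightarrow> bool" where
  "loc_min_at g y \<longleftrightarrow> (\<exists>e>0. \<forall>y'\<in>({0<..} \<times> {0..}) \<inter> ball y e. g y \<le> g y')"

definition visc_sub :: "nat \<Rightarrow> (real \<Rightarrow> real \<Rightarrow> real) \<Rightarrow> bool" where
  "visc_sub p f \<longleftrightarrow> continuous_on ({0..} \<times> {0..}) (\<lambda>(t, h). f t h) \<and>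
    (\<forall>t h \<phi> \<phi>t \<phi>h. t > 0 \<and> h \<ge> 0 \<and> test_fn \<phi> \<phi>t \<phi>h
        \<and> loc_max_at (\<lambda>(s, k). f s k - \<phi> (s, k)) (t, h) \<longrightarrow>
       (if h > 0 then \<phi>t (t, h) - 2 ^ (p - 1) * (\<phi>h (t, h)) ^ p \<le> 0
        else min (- \<phi>h (t, h)) (\<phi>t (t, h) - 2 ^ (p - 1) * (\<phi>h (t, h)) ^ p) \<le> 0))"

definition visc_super :: "nat \<Rightarrow> (real \<Rightarrow> real \<Rightarrow> real) \<Rightarrow> bool" where
  "visc_super p f \<longleftrightarrow> continuous_on ({0..} \<times> {0..}) (\<lambda>(t, h). f t h) \<and>
    (\<forall>t h \<phi> \<phi>t \<phi>h. t > 0 \<and> h \<ge> 0 \<and> test_fn \<phi> \<phi>t \<phi>h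
        \<and> loc_min_at (\<lambda>(s, k). f s k - \<phi> (s, k)) (t, h) \<longrightarrow>
       (if h > 0 then \<phi>t (t, h) - 2 ^ (p - 1) * (\<phi>h (t, h)) ^ p \<ge> 0
        else max (- \<phi>h (t, h)) (\<phi>t (t, h) - 2 ^ (p - 1) * (\<phi>h (t, h)) ^ p) \<ge> 0))"

definition visc_sol :: "nat \<Rightarrow> (real \<Rightarrow> real \<Rightarrow> real) \<Rightarrow> bool" where
  "visc_sol p f \<longleftrightarrow> visc_sub p f \<and> visc_super p f"

end

theory Submission imports Defs
begin

text \<open>The mean free energy \<open>F t h\<close> of the finite system is Lipschitz and semiconvex. Since the model
  is a Bayes-optimal Gaussian channel, exchanging the signal with a replica preserves the joint law (Nishimori), and the
  derivatives of \<open>F\<close> are half the mean \<open>p\<close>-th power and half the mean of the overlap \<open>R\<close>. A large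
  deviation bound for the Gibbs measure turns the Efron--Stein concentration of the free energy into concentration of
  \<open>R\<close> around a difference quotient of \<open>F\<close> in \<open>h\<close>. Hence \<open>F\<close> satisfies the
  Hamilton--Jacobi equation up to an error controlled by \<open>(F t (h + l) - F t h) / l - \<partial>\<^sub>h F\<close>. At a point
  touched from above by a paraboloid this error is of order \<open>l\<close>; touched from below it becomes small after
  averaging over shifts of \<open>h\<close>, where convexity of the \<open>p\<close>-th power is used. Doubling of variables with quadratic
  test functions then yields the convergence of \<open>F\<close> to the viscosity solution. Finally, the random free energy is convex
  in \<open>(sqrt t, sqrt h)\<close> up to a quadratic, so its deviation on a square is controlled by the deviations
  on a finite grid.\<close>

section \<open>Jets and doubling of variables\<close>

text \<open>The error in the approximate equation is a forward difference quotient minus a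
  derivative, in effect a second difference of \<open>F\<close> in \<open>h\<close>. The model
  bounds it from below only, by semiconvexity, uniformly in the system size; this one-sidedness is
  what makes the two halves of the comparison different. Gaussian integration by parts never occurs.
  In the energy the noise multiplies the Gibbs sample; after the Nishimori exchange it multiplies
  the signal, of which it is independent, so its contribution is visibly centred. Derivatives then
  come from tangent inequalities between finite strengths. The factor \<open>2 ^ (p - 1)\<close> is
  produced by the two factors one half: if \<open>R\<close> is concentrated, half the mean of
  \<open>R ^ p\<close> is \<open>2 ^ (p - 1)\<close> times the \<open>p\<close>-th power of half the
  mean of \<open>R\<close>. Square roots serve as parameters because the energy is polynomial in
  them, whereas in \<open>h\<close> itself the semiconvexity constant degenerates like
  \<open>1 / h\<close>. This is why the comparison evaluates \<open>F\<close> at arguments shifted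
  into the interior.\<close>

lemma C_inf_quadratic:
  "C_inf U (\<lambda>y. a + b * fst y + c * snd y + d * (fst y)\<^sup>2 + e * (snd y)\<^sup>2)"
proof -
  \<comment> \<open>The coinduction invariant: quadratics without mixed term are closed under both
    partial derivatives.\<close>
  let ?X = "\<lambda>g. \<exists>a b c d e. g = (\<lambda>y::real\<times>real. a + b * fst y + c * snd y + d * (fst y)\<^sup>2 + e * (snd y)\<^sup>2)"
  have "?X g \<Longrightarrow> C_inf U g" for g
  proof (coinduction arbitrary: g rule: C_inf.coinduct)
    case C_inf
    then obtain a b c d e where g: "g = (\<lambda>y::real\<times>real. a + b * fst y + c * snd y + d * (fst y)\<^sup>2 + e * (snd y)\<^sup>2)"
      by blast
    have 1: "?X (\<lambda>y. b + 2 * d * fst y)"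
      by (rule exI[of _ b], rule exI[of _ "2*d"], rule exI[of _ 0], rule exI[of _ 0], rule exI[of _ 0]) simp
    have 2: "?X (\<lambda>y. c + 2 * e * snd y)"
      by (rule exI[of _ c], rule exI[of _ 0], rule exI[of _ "2*e"], rule exI[of _ 0], rule exI[of _ 0]) simp
    have 3: "\<forall>y. y \<in> U \<longrightarrow> (g has_derivative (\<lambda>v. fst v * (b + 2 * d * fst y) + snd v * (c + 2 * e * snd y))) (at y within U)"
      unfolding g by (auto intro!: derivative_eq_intros simp: algebra_simps fun_eq_iff)
    show ?case
      by (rule exI[of _ g], rule exI[of _ "\<lambda>y. b + 2 * d * fst y"], rule exI[of _ "\<lambda>y. c + 2 * e * snd y"])
        (use 1 2 3 in blast)
  qed
  then show ?thesis by blast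
qed

lemma test_fn_quadratic:
  "test_fn (\<lambda>y. a + b * fst y + c * snd y + d * (fst y)\<^sup>2 + e * (snd y)\<^sup>2)
     (\<lambda>y. b + 2 * d * fst y) (\<lambda>y. c + 2 * e * snd y)"
proof -
  have "C_inf U (\<lambda>y. b + 2 * d * fst y)" for U
    using C_inf_quadratic[of U b "2 * d" 0 0 0] by simp
  moreover have "C_inf U (\<lambda>y. c + 2 * e * snd y)" for U
    using C_inf_quadratic[of U c 0 "2 * e" 0 0] by simp
  ultimately show ?thesis
    unfolding test_fn_def by (auto intro!: derivative_eq_intros simp: algebra_simps fun_eq_iff)
qed

text \<open>Contact is required on the whole closed quadrant rather than near the point, because the
  upper paraboloid is later compared with \<open>F\<close> at a finite step \<open>b\<close> from
  the contact point. The maxima that produce these jets are global, so nothing is lost.\<close>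

definition touches_above :: "(real \<Rightarrow> real \<Rightarrow> real) \<Rightarrow> real \<Rightarrow> real \<Rightarrow> real \<Rightarrow> real \<Rightarrow> real \<Rightarrow> bool" where
  "touches_above u t h \<alpha> \<beta> A \<longleftrightarrow>
     (\<forall>t'\<ge>0. \<forall>h'\<ge>0. u t' h' \<le> u t h + \<alpha> * (t' - t) + \<beta> * (h' - h) + A * ((t' - t)\<^sup>2 + (h' - h)\<^sup>2))"

definition touches_below :: "(real \<Rightarrow> real \<Rightarrow> real) \<Rightarrow> real \<Rightarrow> real \<Rightarrow> real \<Rightarrow> real \<Rightarrow> real \<Rightarrow> bool" where
  "touches_below v t h \<alpha> \<beta> A \<longleftrightarrow>
     (\<forall>t'\<ge>0. \<forall>h'\<ge>0. v t' h' \<ge> v t h + \<alpha> * (t' - t) + \<beta> * (h' - h) - A * ((t' - t)\<^sup>2 + (h' - h)\<^sup>2))"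

lemma test_fn_jet:
  fixes t h \<alpha> \<beta> A :: real
  obtains \<phi> \<phi>t \<phi>h where "test_fn \<phi> \<phi>t \<phi>h" "\<phi>t (t, h) = \<alpha>" "\<phi>h (t, h) = \<beta>"
    "\<And>t' h'. \<phi> (t', h') = \<alpha> * (t' - t) + \<beta> * (h' - h) + A * ((t' - t)\<^sup>2 + (h' - h)\<^sup>2)"
proof
  let ?b = "\<alpha> - 2 * A * t" and ?c = "\<beta> - 2 * A * h"
  show "test_fn (\<lambda>y. (- \<alpha> * t - \<beta> * h + A * t\<^sup>2 + A * h\<^sup>2) + ?b * fst y + ?c * snd y + A * (fst y)\<^sup>2 + A * (snd y)\<^sup>2)
     (\<lambda>y. ?b + 2 * A * fst y) (\<lambda>y. ?c + 2 * A * snd y)"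
    by (rule test_fn_quadratic)
qed (auto simp: algebra_simps power2_eq_square)

text \<open>At \<open>h = 0\<close> the sign of \<beta> makes the Neumann term strictly positive, so
  the minimum can be nonpositive only through the equation. The supersolution case is the mirror
  image.\<close>

lemma visc_sub_jet:
  assumes "visc_sub p f" "t > 0" "h \<ge> 0" "touches_above f t h \<alpha> \<beta> A" "h = 0 \<Longrightarrow> \<beta> < 0"
  shows "\<alpha> \<le> 2 ^ (p - 1) * \<beta> ^ p"
proof -
  obtain \<phi> \<phi>t \<phi>h where \<phi>: "test_fn \<phi> \<phi>t \<phi>h" "\<phi>t (t, h) = \<alpha>" "\<phi>h (t, h) = \<beta>"
    "\<And>t' h'. \<phi> (t', h') = \<alpha> * (t' - t) + \<beta> * (h' - h) + A * ((t' - t)\<^sup>2 + (h' - h)\<^sup>2)"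
    using test_fn_jet by metis
  have "loc_max_at (\<lambda>(s, k). f s k - \<phi> (s, k)) (t, h)"
    unfolding loc_max_at_def
    by (rule exI[of _ 1]) (use assms(4) in \<open>auto simp: touches_above_def \<phi>(4) algebra_simps\<close>)
  then have "if h > 0 then \<phi>t (t, h) - 2 ^ (p - 1) * (\<phi>h (t, h)) ^ p \<le> 0
        else min (- \<phi>h (t, h)) (\<phi>t (t, h) - 2 ^ (p - 1) * (\<phi>h (t, h)) ^ p) \<le> 0"
    using assms(1-3) \<phi>(1) unfolding visc_sub_def by blast
  then show ?thesis using assms(3,5) \<phi>(2,3) by (cases "h = 0") (auto simp: min_def split: if_splits)
qed

lemma visc_super_jet:
  assumes "visc_super p f" "t > 0" "h \<ge> 0" "touches_below f t h \<alpha> \<beta> A" "h = 0 \<Longrightarrow> \<beta> > 0"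
  shows "\<alpha> \<ge> 2 ^ (p - 1) * \<beta> ^ p"
proof -
  obtain \<phi> \<phi>t \<phi>h where \<phi>: "test_fn \<phi> \<phi>t \<phi>h" "\<phi>t (t, h) = \<alpha>" "\<phi>h (t, h) = \<beta>"
    "\<And>t' h'. \<phi> (t', h') = \<alpha> * (t' - t) + \<beta> * (h' - h) + (- A) * ((t' - t)\<^sup>2 + (h' - h)\<^sup>2)"
    using test_fn_jet by metis
  have "loc_min_at (\<lambda>(s, k). f s k - \<phi> (s, k)) (t, h)"
    unfolding loc_min_at_def
    by (rule exI[of _ 1]) (use assms(4) in \<open>auto simp: touches_below_def \<phi>(4) algebra_simps\<close>)
  then have "if h > 0 then \<phi>t (t, h) - 2 ^ (p - 1) * (\<phi>h (t, h)) ^ p \<ge> 0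
        else max (- \<phi>h (t, h)) (\<phi>t (t, h) - 2 ^ (p - 1) * (\<phi>h (t, h)) ^ p) \<ge> 0"
    using assms(1-3) \<phi>(1) unfolding visc_super_def by blast
  then show ?thesis using assms(3,5) \<phi>(2,3) by (cases "h = 0") (auto simp: max_def split: if_splits)
qed

section \<open>Lipschitz functions and the penalised doubling functional\<close>

definition lip1 :: "real \<Rightarrow> (real \<Rightarrow> real \<Rightarrow> real) \<Rightarrow> bool" where
  "lip1 L u \<longleftrightarrow> (\<forall>t\<ge>0. \<forall>h\<ge>0. \<forall>t'\<ge>0. \<forall>h'\<ge>0. \<bar>u t h - u t' h'\<bar> \<le> L * (\<bar>t - t'\<bar> + \<bar>h - h'\<bar>))"

lemma lip1D: "lip1 L u \<Longrightarrow> t \<ge> 0 \<Longrightarrow> h \<ge> 0 \<Longrightarrow> t' \<ge> 0 \<Longrightarrow> h' \<ge> 0 \<Longrightarrow>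
    \<bar>u t h - u t' h'\<bar> \<le> L * (\<bar>t - t'\<bar> + \<bar>h - h'\<bar>)"
  by (simp add: lip1_def)

lemma lip1_continuous:
  assumes "lip1 L u" "L \<ge> 0"
  shows "continuous_on ({0..} \<times> {0..}) (\<lambda>y. u (fst y) (snd y))"
proof (rule lipschitz_on_continuous_on)
  show "(2 * L)-lipschitz_on ({0..} \<times> {0..}) (\<lambda>y. u (fst y) (snd y))"
  proof (rule lipschitz_onI)
    fix x y :: "real \<times> real" assume xy: "x \<in> {0..} \<times> {0..}" "y \<in> {0..} \<times> {0..}"
    have "\<bar>fst x - fst y\<bar> \<le> dist x y" "\<bar>snd x - snd y\<bar> \<le> dist x y"
      using dist_fst_le[of x y] dist_snd_le[of x y] by (auto simp: dist_real_def)
    then have "L * (\<bar>fst x - fst y\<bar> + \<bar>snd x - snd y\<bar>) \<le> L * (2 * dist x y)"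
      using assms(2) by (intro mult_left_mono) auto
    then show "dist (u (fst x) (snd x)) (u (fst y) (snd y)) \<le> 2 * L * dist x y"
      using lip1D[OF assms(1), of "fst x" "snd x" "fst y" "snd y"] xy by (auto simp: dist_real_def)
  qed (use assms in auto)
qed

text \<open>Completing the square. The second form pays a larger constant to retain half of the
  quadratic term, which is what coercivity of the doubled functional uses.\<close>

lemma linear_minus_square_le:
  fixes x L :: real assumes "a > 0"
  shows "L * x - a * x\<^sup>2 \<le> L\<^sup>2 / (4 * a)" "L * x - a * x\<^sup>2 \<le> L\<^sup>2 / (2 * a) - a / 2 * x\<^sup>2"
proof -
  have "0 \<le> (2 * a * x - L)\<^sup>2" "0 \<le> (a * x - L)\<^sup>2" by auto
  then show "L * x - a * x\<^sup>2 \<le> L\<^sup>2 / (4 * a)" "L * x - a * x\<^sup>2 \<le> L\<^sup>2 / (2 * a) - a / 2 * x\<^sup>2"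
    using assms by (auto simp: field_simps power2_eq_square)
qed

lemma le_one_plus_of_square_le:
  fixes x X :: real assumes "x\<^sup>2 \<le> X"
  shows "x \<le> 1 + X"
proof (rule ccontr)
  assume "\<not> x \<le> 1 + X"
  moreover have "X \<ge> 0" using assms zero_le_power2[of x] by linarith
  ultimately have "x > 1 + X" "x > 1" by auto
  then have "x * x > (1 + X) * 1" using \<open>X \<ge> 0\<close> by (intro mult_strict_mono) auto
  then show False using assms by (simp add: power2_eq_square)
qed

text \<open>The penalty \<open>h\<^sup>2 - h\<close> has slope \<open>-1\<close> at \<open>0\<close>: at a maximum with \<open>h = 0\<close> (or \<open>k = 0\<close>) the slope of the
  resulting jet has the strict sign that rules out the Neumann alternative.\<close>

definition doubled ::
  "real \<Rightarrow> real \<Rightarrow> real \<Rightarrow> (real \<Rightarrow> real \<Rightarrow> real) \<Rightarrow> (real \<Rightarrow> real \<Rightarrow> real) \<Rightarrow> real \<Rightarrow> real \<Rightarrow> real \<Rightarrow> real \<Rightarrow> real" where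
  "doubled a l d u v t h s k =
     u t h - v s k - a * ((t - s)\<^sup>2 + (h - k)\<^sup>2) - l * (t + t\<^sup>2) - d * (h\<^sup>2 - h + (k\<^sup>2 - k))"

text \<open>Time zero is the bridge: \<open>u t h\<close> is compared with \<open>u 0 h\<close>,
  then with \<open>v 0 h\<close>, then with \<open>v s k\<close>. The loss is linear in the times
  and in \<open>\<bar>h - k\<bar>\<close>, so quadratic penalties can absorb it.\<close>

lemma doubled_le:
  assumes "lip1 L u" "lip1 L v" "\<forall>h\<ge>0. \<bar>u 0 h - v 0 h\<bar> \<le> c" "L \<ge> 0" "t \<ge> 0" "h \<ge> 0" "s \<ge> 0" "k \<ge> 0"
  shows "u t h - v s k \<le> c + L * t + L * s + L * \<bar>h - k\<bar>"
proof -
  have "\<bar>u t h - u 0 h\<bar> \<le> L * t" using lip1D[OF assms(1), of t h 0 h] assms by auto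
  moreover have "\<bar>v 0 h - v s k\<bar> \<le> L * s + L * \<bar>h - k\<bar>"
    using lip1D[OF assms(2), of 0 h s k] assms by (auto simp: algebra_simps)
  moreover have "u 0 h - v 0 h \<le> c" using assms(3,6) by (auto simp: abs_le_iff)
  ultimately show ?thesis by linarith
qed

text \<open>The value at the origin is at least -1 because \<open>c \<le> 1\<close>, so only the set
  where the functional reaches -1 matters. On it, half of the quadratic time penalties survives the
  absorption of the linear growth. The bounds depend on \<open>u\<close> and \<open>v\<close> only
  through \<open>L\<close>.\<close>

lemma doubled_coercive:
  assumes "lip1 L u" "lip1 L v" "\<forall>h\<ge>0. \<bar>u 0 h - v 0 h\<bar> \<le> c" "L \<ge> 0" "c \<le> 1" "a > 0" "l > 0" "d > 0" "d \<le> 1"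
    "t \<ge> 0" "h \<ge> 0" "s \<ge> 0" "k \<ge> 0" "doubled a l d u v t h s k \<ge> -1"
  defines "C \<equiv> 3 + 2 * L\<^sup>2 / l + L\<^sup>2 / a"
  shows "t\<^sup>2 \<le> 2 * C / l" "(t - s)\<^sup>2 \<le> 2 * C / a" "h * (h - 1) \<le> C / d" "k * (k - 1) \<le> C / d"
proof -
  have s: "L * s \<le> L * t + L * \<bar>t - s\<bar>"
    using assms(4) by (auto simp flip: distrib_left intro!: mult_left_mono)
  have 1: "L * \<bar>t - s\<bar> - a * (t - s)\<^sup>2 \<le> L\<^sup>2 / (2 * a) - a / 2 * (t - s)\<^sup>2"
    using linear_minus_square_le(2)[OF assms(6), of L "\<bar>t - s\<bar>"] by simp
  have 2: "L * \<bar>h - k\<bar> - a * (h - k)\<^sup>2 \<le> L\<^sup>2 / (2 * a)"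
  proof -
    have "a / 2 * \<bar>h - k\<bar>\<^sup>2 \<ge> 0" using assms(6) by simp
    then have "L * \<bar>h - k\<bar> - a * \<bar>h - k\<bar>\<^sup>2 \<le> L\<^sup>2 / (2 * a)"
      using linear_minus_square_le(2)[OF assms(6), of L "\<bar>h - k\<bar>"] by linarith
    then show ?thesis by simp
  qed
  have 3: "(2 * L) * t - l * t\<^sup>2 \<le> 2 * L\<^sup>2 / l - l / 2 * t\<^sup>2"
    using linear_minus_square_le(2)[OF assms(7), of "2 * L" t] by (simp add: power2_eq_square)
  have q: "x\<^sup>2 - x \<ge> - (1/4)" for x :: real
  proof -
    have "(x - 1/2)\<^sup>2 \<ge> 0" by simp
    then show ?thesis by (simp add: power2_eq_square algebra_simps)
  qed
  have dq: "d * (x\<^sup>2 - x) \<ge> - (1/4)" for x :: real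
  proof -
    have "d * (x\<^sup>2 - x) \<ge> d * (- (1/4))" using q[of x] assms(8) by (intro mult_left_mono) auto
    then show ?thesis using assms(9) by linarith
  qed
  have lt: "l * t \<ge> 0" using assms by simp
  have "-1 \<le> c + 2 * L * t + L * \<bar>t - s\<bar> + L * \<bar>h - k\<bar> - a * ((t - s)\<^sup>2 + (h - k)\<^sup>2) - l * (t + t\<^sup>2) - d * (h\<^sup>2 - h + (k\<^sup>2 - k))"
    using assms(14) doubled_le[OF assms(1-4,10-13)] s unfolding doubled_def by linarith
  then have "-1 \<le> c + (2 * L * t - l * t\<^sup>2) - l * t + (L * \<bar>t - s\<bar> - a * (t - s)\<^sup>2) + (L * \<bar>h - k\<bar> - a * (h - k)\<^sup>2) - d * (h\<^sup>2 - h) - d * (k\<^sup>2 - k)"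
    by (simp add: algebra_simps)
  then have "l / 2 * t\<^sup>2 + a / 2 * (t - s)\<^sup>2 + d * (h\<^sup>2 - h) + d * (k\<^sup>2 - k) \<le> 2 + 2 * L\<^sup>2 / l + (L\<^sup>2 / (2 * a) + L\<^sup>2 / (2 * a))"
    using 1 2 3 lt assms(5) by linarith
  also have "\<dots> = C - 1" unfolding C_def by simp
  finally have main: "l / 2 * t\<^sup>2 + a / 2 * (t - s)\<^sup>2 + d * (h\<^sup>2 - h) + d * (k\<^sup>2 - k) \<le> C - 1" .
  have nn: "l / 2 * t\<^sup>2 \<ge> 0" "a / 2 * (t - s)\<^sup>2 \<ge> 0" using assms by auto
  have "l / 2 * t\<^sup>2 \<le> C" "a / 2 * (t - s)\<^sup>2 \<le> C" "d * (h\<^sup>2 - h) \<le> C" "d * (k\<^sup>2 - k) \<le> C"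
    using main nn dq[of h] dq[of k] by linarith+
  then show "t\<^sup>2 \<le> 2 * C / l" "(t - s)\<^sup>2 \<le> 2 * C / a" "h * (h - 1) \<le> C / d" "k * (k - 1) \<le> C / d"
    using assms(6-8) by (auto simp: field_simps power2_eq_square)
qed

text \<open>Outside the box the functional is below -1, hence below its value at the origin; a
  maximum over the box is therefore a maximum over all nonnegative arguments.\<close>

lemma doubled_max_exists:
  assumes "lip1 L u" "lip1 L v" "\<forall>h\<ge>0. \<bar>u 0 h - v 0 h\<bar> \<le> c" "L \<ge> 0" "c \<le> 1" "a > 0" "l > 0" "d > 0" "d \<le> 1"
  defines "C \<equiv> 3 + 2 * L\<^sup>2 / l + L\<^sup>2 / a"
  defines "B \<equiv> 2 + 2 * C / l + 2 * C / a + C / d"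
  obtains t h s k where "0 \<le> t" "t \<le> B" "0 \<le> h" "h \<le> B" "0 \<le> s" "s \<le> B" "0 \<le> k" "k \<le> B"
    "h * (h - 1) \<le> C / d" "k * (k - 1) \<le> C / d"
    "\<And>t' h' s' k'. t' \<ge> 0 \<Longrightarrow> h' \<ge> 0 \<Longrightarrow> s' \<ge> 0 \<Longrightarrow> k' \<ge> 0 \<Longrightarrow>
       doubled a l d u v t' h' s' k' \<le> doubled a l d u v t h s k"
proof -
  have C: "C \<ge> 0" unfolding C_def using assms by auto
  have box: "t \<le> B \<and> h \<le> B \<and> s \<le> B \<and> k \<le> B" if "t \<ge> 0" "h \<ge> 0" "s \<ge> 0" "k \<ge> 0" "doubled a l d u v t h s k \<ge> -1" for t h s k
  proof -
    note b = doubled_coercive[OF assms(1-9) that, folded C_def]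
    have lin: "x \<le> 1 + C / d" if "x * (x - 1) \<le> C / d" for x
    proof (rule ccontr)
      assume "\<not> x \<le> 1 + C / d"
      moreover have "C / d \<ge> 0" using C assms by auto
      ultimately have "x > 1" "x - 1 > C / d" by auto
      then have "x * (x - 1) > 1 * (C / d)" using \<open>C / d \<ge> 0\<close> by (intro mult_strict_mono) auto
      then show False using that by simp
    qed
    have "t \<le> 1 + 2 * C / l" "s - t \<le> 1 + 2 * C / a"
      using le_one_plus_of_square_le[OF b(1)] le_one_plus_of_square_le[of "s - t" "2 * C / a"] b(2)
      by (auto simp: power2_commute)
    moreover have "C / d \<ge> 0" "2 * C / l \<ge> 0" "2 * C / a \<ge> 0" using C assms by auto
    ultimately show ?thesis using lin[OF b(3)] lin[OF b(4)] unfolding B_def by linarith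
  qed
  have B: "B \<ge> 0" unfolding B_def using C assms(6-8) by simp
  define S where "S = {0..B} \<times> {0..B} \<times> {0..B} \<times> {0..B}"
  define \<Phi> where "\<Phi> = (\<lambda>(t, h, s, k). doubled a l d u v t h s k)"
  have "continuous_on S (\<lambda>y. u (fst (fst y, fst (snd y))) (snd (fst y, fst (snd y))))"
    by (rule continuous_on_compose2[OF lip1_continuous[OF assms(1,4)]])
      (auto intro!: continuous_intros simp: S_def)
  moreover have "continuous_on S (\<lambda>y. v (fst (fst (snd (snd y)), snd (snd (snd y)))) (snd (fst (snd (snd y)), snd (snd (snd y)))))"
    by (rule continuous_on_compose2[OF lip1_continuous[OF assms(2,4)]])
      (auto intro!: continuous_intros simp: S_def)
  ultimately have "continuous_on S \<Phi>"
    unfolding \<Phi>_def doubled_def case_prod_beta by (intro continuous_intros) auto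
  moreover have "compact S" "S \<noteq> {}" unfolding S_def using B by (auto intro!: compact_Times)
  ultimately obtain y where y: "y \<in> S" "\<forall>x\<in>S. \<Phi> x \<le> \<Phi> y"
    using continuous_attains_sup by blast
  obtain t h s k where tk: "y = (t, h, s, k)" by (cases y)
  have r: "0 \<le> t" "t \<le> B" "0 \<le> h" "h \<le> B" "0 \<le> s" "s \<le> B" "0 \<le> k" "k \<le> B"
    using y(1) unfolding tk S_def by auto
  have z: "\<Phi> (0,0,0,0) \<ge> -1" using assms(3,5) unfolding \<Phi>_def doubled_def by force
  moreover have "\<Phi> (0,0,0,0) \<le> \<Phi> y" using y(2) B by (auto simp: S_def)
  ultimately have m: "doubled a l d u v t h s k \<ge> -1" unfolding tk \<Phi>_def by simp
  show thesis
  proof (rule that[OF r doubled_coercive(3,4)[OF assms(1-9) r(1,3,5,7) m, folded C_def]])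
    fix t' h' s' k' :: real assume nn: "t' \<ge> 0" "h' \<ge> 0" "s' \<ge> 0" "k' \<ge> 0"
    show "doubled a l d u v t' h' s' k' \<le> doubled a l d u v t h s k"
    proof (cases "doubled a l d u v t' h' s' k' \<ge> -1")
      case True
      then have "(t', h', s', k') \<in> S" using box[OF nn True] nn unfolding S_def by auto
      then show ?thesis using y(2) unfolding tk \<Phi>_def by force
    next
      case False then show ?thesis using m by linarith
    qed
  qed
qed

text \<open>\<open>A\<close> and \<open>B\<close> are fixed before \<open>u\<close>,
  \<open>v\<close> and \<open>c\<close>: the lemma is applied to a whole sequence of functions, and
  \<open>N\<close> is taken large only after curvature and location of the contact points are under
  control. Either a time vanishes at the maximum, which gives the comparison estimate, or the
  maximum yields two jets. Their time slopes differ by at least \<open>l\<close>, because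
  \<open>l\<close> penalises the time of \<open>u\<close> alone.\<close>

lemma doubling:
  fixes L l a \<kappa> :: real
  assumes "L \<ge> 0" "l > 0" "a > 0" "\<kappa> > 0"
  obtains A B where "A > 0" "B > 0"
    "\<And>u v c. lip1 L u \<Longrightarrow> lip1 L v \<Longrightarrow> c \<le> 1 \<Longrightarrow> \<forall>h\<ge>0. \<bar>u 0 h - v 0 h\<bar> \<le> c \<Longrightarrow>
      (\<forall>t\<ge>0. \<forall>h\<ge>0. u t h - v t h \<le> c + L\<^sup>2 / (2 * a) + \<kappa> + l * (t + t\<^sup>2) + \<kappa> * h\<^sup>2) \<or>
      (\<exists>t h s k \<alpha>1 \<alpha>2 \<beta>1 \<beta>2. 0 < t \<and> t \<le> B \<and> 0 \<le> h \<and> h \<le> B \<and> 0 < s \<and> s \<le> B \<and> 0 \<le> k \<and> k \<le> B \<and>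
        \<alpha>2 + l \<le> \<alpha>1 \<and> \<bar>\<beta>1 - \<beta>2\<bar> \<le> \<kappa> \<and> (h = 0 \<longrightarrow> \<beta>1 < 0) \<and> (k = 0 \<longrightarrow> \<beta>2 > 0) \<and>
        touches_above u t h \<alpha>1 \<beta>1 A \<and> touches_below v s k \<alpha>2 \<beta>2 A)"
proof -
  define C where "C = 3 + 2 * L\<^sup>2 / l + L\<^sup>2 / a"
  have C: "C > 0" unfolding C_def using assms by (intro add_pos_nonneg) auto
  \<comment> \<open>At a maximum \<open>h\<close> can be as large as order
    \<open>1 / sqrt d\<close>, so the slope \<open>d * h\<close> of the penalty is of order
    \<open>sqrt d\<close>. The last bound on \<open>d\<close> brings it below
    \<open>\<kappa> / 8\<close>, see \<open>small\<close>.\<close>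
  define d where "d = min (min 1 (\<kappa> / 4)) (\<kappa> / (16 * (1 + 8 * C / \<kappa>)))"
  have "1 + 8 * C / \<kappa> > 0" using assms C by (intro add_pos_pos) auto
  then have d: "d > 0" unfolding d_def using assms by simp
  have d: "d > 0" "d \<le> 1" "d \<le> \<kappa> / 4" "d \<le> \<kappa> / (16 * (1 + 8 * C / \<kappa>))"
    using d unfolding d_def by linarith+
  define A where "A = a + l + d"
  define B where "B = 2 + 2 * C / l + 2 * C / a + C / d"
  have small: "d * x \<le> \<kappa> / 8" if "x * (x - 1) \<le> C / d" "x \<ge> 0" for x :: real
  proof (rule ccontr)
    assume "\<not> d * x \<le> \<kappa> / 8"
    then have x: "x > \<kappa> / (8 * d)" using d(1) by (simp add: field_simps)
    have "d * (16 * (1 + 8 * C / \<kappa>)) \<le> \<kappa>" using d(4) assms(4) C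
      by (subst (asm) pos_le_divide_eq) (auto intro!: add_pos_pos)
    then have "\<kappa> / (8 * d) \<ge> 2 * (1 + 8 * C / \<kappa>)" using d(1) by (simp add: field_simps)
    moreover have "8 * C / \<kappa> > 0" using C assms(4) by simp
    moreover have "x - 1 > Z" if "Z > 0" "D \<ge> 2 * (1 + Z)" "x > D" for D Z :: real using that by simp
    ultimately have "x - 1 > 8 * C / \<kappa>" using x by blast
    moreover have "x > 0" using x assms(4) d(1) divide_pos_pos[of \<kappa> "8 * d"] by linarith
    ultimately have "x * (x - 1) > \<kappa> / (8 * d) * (8 * C / \<kappa>)"
      using x assms(4) d(1) C by (intro mult_strict_mono) auto
    then show False using that(1) assms(4) d(1) by (simp add: field_simps)
  qed
  show thesis
  proof (rule that[of A B])
    show "A > 0" "B > 0" unfolding A_def B_def using assms C d(1) by (auto intro!: add_pos_nonneg)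
  next
    fix u v c assume H: "lip1 L u" "lip1 L v" "c \<le> 1" "\<forall>h\<ge>0. \<bar>u 0 h - v 0 h\<bar> \<le> (c::real)"
    obtain t h s k where m: "0 \<le> t" "t \<le> B" "0 \<le> h" "h \<le> B" "0 \<le> s" "s \<le> B" "0 \<le> k" "k \<le> B"
      "h * (h - 1) \<le> C / d" "k * (k - 1) \<le> C / d"
      "\<And>t' h' s' k'. t' \<ge> 0 \<Longrightarrow> h' \<ge> 0 \<Longrightarrow> s' \<ge> 0 \<Longrightarrow> k' \<ge> 0 \<Longrightarrow>
         doubled a l d u v t' h' s' k' \<le> doubled a l d u v t h s k"
      using doubled_max_exists[OF H(1,2,4) assms(1) H(3) assms(3,2) d(1,2), folded C_def, folded B_def] by blast
    show "(\<forall>t\<ge>0. \<forall>h\<ge>0. u t h - v t h \<le> c + L\<^sup>2 / (2 * a) + \<kappa> + l * (t + t\<^sup>2) + \<kappa> * h\<^sup>2) \<or>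
      (\<exists>t h s k \<alpha>1 \<alpha>2 \<beta>1 \<beta>2. 0 < t \<and> t \<le> B \<and> 0 \<le> h \<and> h \<le> B \<and> 0 < s \<and> s \<le> B \<and> 0 \<le> k \<and> k \<le> B \<and>
        \<alpha>2 + l \<le> \<alpha>1 \<and> \<bar>\<beta>1 - \<beta>2\<bar> \<le> \<kappa> \<and> (h = 0 \<longrightarrow> \<beta>1 < 0) \<and> (k = 0 \<longrightarrow> \<beta>2 > 0) \<and>
        touches_above u t h \<alpha>1 \<beta>1 A \<and> touches_below v s k \<alpha>2 \<beta>2 A)"
    proof (cases "t = 0 \<or> s = 0")
      case True
      have q: "- d * (x\<^sup>2 - x) \<le> d / 4" for x :: real
      proof -
        have "d * (x - 1/2)\<^sup>2 \<ge> 0" using d(1) by simp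
        then show ?thesis by (simp add: power2_eq_square algebra_simps)
      qed
      \<comment> \<open>One of the times vanishes, so the loss in time is
        \<open>L * \<bar>t - s\<bar>\<close> and the penalty with parameter \<open>a\<close> absorbs
        it; time and field cost \<open>L\<^sup>2 / (4 * a)\<close> each.\<close>
      have "L * t + L * s = L * \<bar>t - s\<bar>" using True m by auto
      moreover have "L * \<bar>t - s\<bar> - a * (t - s)\<^sup>2 \<le> L\<^sup>2 / (4 * a)" "L * \<bar>h - k\<bar> - a * (h - k)\<^sup>2 \<le> L\<^sup>2 / (4 * a)"
        using linear_minus_square_le(1)[OF assms(3), of L "\<bar>t - s\<bar>"] linear_minus_square_le(1)[OF assms(3), of L "\<bar>h - k\<bar>"] by auto
      moreover have "l * (t + t\<^sup>2) \<ge> 0" using assms m by auto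
      moreover have "L\<^sup>2 / (4 * a) + L\<^sup>2 / (4 * a) = L\<^sup>2 / (2 * a)" by simp
      ultimately have M: "doubled a l d u v t h s k \<le> c + L\<^sup>2 / (2 * a) + d / 2"
        using doubled_le[OF H(1,2,4) assms(1) m(1,3,5,7)] q[of h] q[of k] unfolding doubled_def
        by (simp add: algebra_simps)
      show ?thesis
      proof (intro disjI1 allI impI)
        fix t h :: real assume th: "t \<ge> 0" "h \<ge> 0"
        have "u t h - v t h - l * (t + t\<^sup>2) - 2 * (d * (h\<^sup>2 - h)) \<le> c + L\<^sup>2 / (2 * a) + d / 2"
          using m(11)[OF th th] M by (simp add: doubled_def algebra_simps)
        moreover have "2 * (d * (h\<^sup>2 - h)) \<le> \<kappa> * h\<^sup>2"
        proof -
          have "2 * (d * (h\<^sup>2 - h)) \<le> 2 * (d * h\<^sup>2)" using d(1) th by simp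
          also have "\<dots> = (2 * d) * h\<^sup>2" by simp
          also have "\<dots> \<le> \<kappa> * h\<^sup>2" using d(3) assms(4) by (intro mult_right_mono) auto
          finally show ?thesis .
        qed
        ultimately show "u t h - v t h \<le> c + L\<^sup>2 / (2 * a) + \<kappa> + l * (t + t\<^sup>2) + \<kappa> * h\<^sup>2"
          using d(3) assms(4) by linarith
      qed
    next
      case False
      then have ts: "t > 0" "s > 0" using m by auto
      \<comment> \<open>The slopes at the maximum of all penalty terms, first for the pair of
        \<open>u\<close>, then for the pair of \<open>v\<close>.\<close>
      define \<alpha>1 where "\<alpha>1 = 2 * a * (t - s) + l * (1 + 2 * t)"
      define \<alpha>2 where "\<alpha>2 = 2 * a * (t - s)"
      define \<beta>1 where "\<beta>1 = 2 * a * (h - k) + d * (2 * h - 1)"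
      define \<beta>2 where "\<beta>2 = 2 * a * (h - k) - d * (2 * k - 1)"
      have "\<alpha>2 + l \<le> \<alpha>1" unfolding \<alpha>1_def \<alpha>2_def using ts assms by (simp add: algebra_simps)
      moreover have "\<bar>\<beta>1 - \<beta>2\<bar> \<le> \<kappa>"
      proof -
        have "\<beta>1 - \<beta>2 = 2 * (d * h) + 2 * (d * k) - 2 * d" unfolding \<beta>1_def \<beta>2_def by (simp add: algebra_simps)
        moreover have "d * h \<ge> 0" "d * k \<ge> 0" using d m by auto
        ultimately show ?thesis using small[OF m(9,3)] small[OF m(10,7)] d(1,3) by (auto simp: abs_le_iff)
      qed
      moreover have "h = 0 \<longrightarrow> \<beta>1 < 0" "k = 0 \<longrightarrow> \<beta>2 > 0"
      proof -
        have "a * k \<ge> 0" "a * h \<ge> 0" using assms(3) m(3,7) by auto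
        moreover have "h = 0 \<longrightarrow> \<beta>1 = - 2 * (a * k) - d" "k = 0 \<longrightarrow> \<beta>2 = 2 * (a * h) + d"
          by (auto simp: \<beta>1_def \<beta>2_def)
        ultimately show "h = 0 \<longrightarrow> \<beta>1 < 0" "k = 0 \<longrightarrow> \<beta>2 > 0" using d(1) by linarith+
      qed
      moreover have "touches_above u t h \<alpha>1 \<beta>1 A"
        unfolding touches_above_def
      proof (intro allI impI)
        fix t' h' :: real assume "t' \<ge> 0" "h' \<ge> 0"
        then have "doubled a l d u v t' h' s k \<le> doubled a l d u v t h s k" using m by auto
        then have "u t' h' \<le> u t h + \<alpha>1 * (t' - t) + \<beta>1 * (h' - h) + (a + l) * (t' - t)\<^sup>2 + (a + d) * (h' - h)\<^sup>2"
          unfolding doubled_def \<alpha>1_def \<beta>1_def by (simp add: algebra_simps power2_eq_square)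
        moreover have "(a + l) * (t' - t)\<^sup>2 \<le> A * (t' - t)\<^sup>2" "(a + d) * (h' - h)\<^sup>2 \<le> A * (h' - h)\<^sup>2"
          unfolding A_def using assms d by (auto intro!: mult_right_mono)
        ultimately show "u t' h' \<le> u t h + \<alpha>1 * (t' - t) + \<beta>1 * (h' - h) + A * ((t' - t)\<^sup>2 + (h' - h)\<^sup>2)"
          by (simp add: distrib_left)
      qed
      moreover have "touches_below v s k \<alpha>2 \<beta>2 A"
        unfolding touches_below_def
      proof (intro allI impI)
        fix t' h' :: real assume "t' \<ge> 0" "h' \<ge> 0"
        then have "doubled a l d u v t h t' h' \<le> doubled a l d u v t h s k" using m by auto
        then have "v t' h' \<ge> v s k + \<alpha>2 * (t' - s) + \<beta>2 * (h' - k) - a * (t' - s)\<^sup>2 - (a + d) * (h' - k)\<^sup>2"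
          unfolding doubled_def \<alpha>2_def \<beta>2_def by (simp add: algebra_simps power2_eq_square)
        moreover have "a * (t' - s)\<^sup>2 \<le> A * (t' - s)\<^sup>2" "(a + d) * (h' - k)\<^sup>2 \<le> A * (h' - k)\<^sup>2"
          unfolding A_def using assms d by (auto intro!: mult_right_mono)
        ultimately show "v t' h' \<ge> v s k + \<alpha>2 * (t' - s) + \<beta>2 * (h' - k) - A * ((t' - s)\<^sup>2 + (h' - k)\<^sup>2)"
          by (simp add: distrib_left)
      qed
      ultimately show ?thesis using ts m(2,3,4,6,7,8) by blast
    qed
  qed
qed

section \<open>Approximate solutions of the Hamilton--Jacobi equation\<close>

lemma touches_above_deriv_t:
  assumes "touches_above u t h \<alpha> \<beta> A" "t > 0" "h \<ge> 0" "((\<lambda>t. u t h) has_real_derivative D) (at t)"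
  shows "D = \<alpha>"
proof -
  have "((\<lambda>t'. u t' h - \<alpha> * (t' - t) - A * (t' - t)\<^sup>2) has_real_derivative D - \<alpha>) (at t)"
    by (rule derivative_eq_intros assms(4) refl | simp)+
  then have "D - \<alpha> = 0"
  proof (rule DERIV_local_max[OF _ \<open>t > 0\<close>], intro allI impI)
    fix y assume "\<bar>t - y\<bar> < t"
    then have "y \<ge> 0" by (auto simp: abs_if split: if_splits)
    then show "u y h - \<alpha> * (y - t) - A * (y - t)\<^sup>2 \<le> u t h - \<alpha> * (t - t) - A * (t - t)\<^sup>2"
      using assms(1,3) unfolding touches_above_def by (elim allE[of _ y] allE[of _ h] impE) auto
  qed
  then show ?thesis by simp
qed

text \<open>At \<open>h = 0\<close> only increments into the domain are admissible, so contact
  leaves a one-sided relation between the slopes.\<close>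

lemma touches_above_deriv_h:
  assumes "touches_above u t h \<alpha> \<beta> A" "t \<ge> 0" "h \<ge> 0" "((\<lambda>h. u t h) has_real_derivative D) (at h)"
  shows "D \<le> \<beta>" "h > 0 \<Longrightarrow> D = \<beta>"
proof -
  have d: "((\<lambda>h'. u t h' - \<beta> * (h' - h) - A * (h' - h)\<^sup>2) has_real_derivative D - \<beta>) (at h)"
    by (rule derivative_eq_intros assms(4) refl | simp)+
  show "D \<le> \<beta>"
  proof (rule ccontr)
    assume "\<not> D \<le> \<beta>"
    then obtain e where e: "e > 0" "\<forall>x>0. x < e \<longrightarrow> u t h < u t (h + x) - \<beta> * x - A * x\<^sup>2"
      using DERIV_pos_inc_right[OF d] by auto
    have "u t h < u t (h + e/2) - \<beta> * (e/2) - A * (e/2)\<^sup>2"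
      by (rule e(2)[rule_format]) (use e(1) in auto)
    moreover have "u t (h + e/2) \<le> u t h + \<beta> * (e/2) + A * (e/2)\<^sup>2"
      using assms(1-3) e(1) unfolding touches_above_def
      by (elim allE[of _ t] allE[of _ "h + e/2"] impE) auto
    ultimately show False by linarith
  qed
  have "D - \<beta> = 0" if "h > 0"
  proof (rule DERIV_local_max[OF d that], intro allI impI)
    fix y assume "\<bar>h - y\<bar> < h"
    then have "y \<ge> 0" by (auto simp: abs_if split: if_splits)
    then show "u t y - \<beta> * (y - h) - A * (y - h)\<^sup>2 \<le> u t h - \<beta> * (h - h) - A * (h - h)\<^sup>2"
      using assms(1,2) unfolding touches_above_def by (elim allE[of _ t] allE[of _ y] impE) auto
  qed
  then show "D = \<beta>" if "h > 0" using that by simp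
qed

lemma touches_below_uminus:
  "touches_below v t h \<alpha> \<beta> A \<longleftrightarrow> touches_above (\<lambda>t h. - v t h) t h (- \<alpha>) (- \<beta>) A"
  unfolding touches_below_def touches_above_def by (auto simp: algebra_simps)

lemma touches_below_deriv:
  assumes "touches_below v t h \<alpha> \<beta> A" "t > 0" "h \<ge> 0"
  shows "((\<lambda>t. v t h) has_real_derivative D) (at t) \<Longrightarrow> D = \<alpha>"
    "((\<lambda>h. v t h) has_real_derivative D) (at h) \<Longrightarrow> \<beta> \<le> D"
    "((\<lambda>h. v t h) has_real_derivative D) (at h) \<Longrightarrow> h > 0 \<Longrightarrow> D = \<beta>"
  using touches_above_deriv_t[OF assms(1)[unfolded touches_below_uminus] assms(2,3), of "- D"]
    touches_above_deriv_h[OF assms(1)[unfolded touches_below_uminus] _ assms(3), of "- D"] assms(2)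
  by (auto dest: DERIV_minus)

text \<open>Since \<open>R \<ge> 1\<close>, the exponent \<open>n\<close> can stand in for the
  sharper one; this avoids truncated subtraction and covers \<open>n = 0\<close>.\<close>

lemma abs_power_diff_le:
  fixes x y R :: real
  assumes "\<bar>x\<bar> \<le> R" "\<bar>y\<bar> \<le> R" "1 \<le> R"
  shows "\<bar>x ^ n - y ^ n\<bar> \<le> n * R ^ n * \<bar>x - y\<bar>"
proof (induction n)
  case (Suc n)
  have "x ^ Suc n - y ^ Suc n = x * (x ^ n - y ^ n) + y ^ n * (x - y)" by (simp add: algebra_simps)
  then have "\<bar>x ^ Suc n - y ^ Suc n\<bar> \<le> \<bar>x\<bar> * \<bar>x ^ n - y ^ n\<bar> + \<bar>y\<bar> ^ n * \<bar>x - y\<bar>"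
    by (metis abs_mult abs_triangle_ineq power_abs)
  also have "\<dots> \<le> R * (n * R ^ n * \<bar>x - y\<bar>) + R ^ Suc n * \<bar>x - y\<bar>"
  proof (intro add_mono mult_mono Suc.IH assms)
    have "\<bar>y\<bar> ^ n \<le> R ^ n" using assms by (intro power_mono) auto
    also have "\<dots> \<le> R ^ Suc n" using assms by (intro power_increasing) auto
    finally show "\<bar>y\<bar> ^ n \<le> R ^ Suc n" .
  qed (use assms in auto)
  also have "\<dots> = Suc n * R ^ Suc n * \<bar>x - y\<bar>" by (simp add: algebra_simps)
  finally show ?case .
qed simp

text \<open>Jensen's inequality on the half line, where odd powers are convex as well. It transfers
  the equation from single shifts of \<open>F\<close> to their average.\<close>

lemma power_average_le:
  fixes x :: "nat \<Rightarrow> real"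
  assumes "n > 0" "\<And>i. i < n \<Longrightarrow> x i \<ge> 0"
  shows "((\<Sum>i<n. x i) / n) ^ p \<le> (\<Sum>i<n. x i ^ p) / n"
proof -
  have "convex_on {0..} (\<lambda>x::real. x ^ p)"
  proof (cases "even p")
    case True
    then show ?thesis using convex_on_subset[OF convex_power_even[OF True]] by auto
  next
    case False then show ?thesis by (rule convex_power_odd)
  qed
  from convex_on_sum[OF _ _ this, of "{..<n}" "\<lambda>_. 1 / n" x] assms
  have "(\<Sum>i<n. (1 / n) *\<^sub>R x i) ^ p \<le> (\<Sum>i<n. (1 / n) * x i ^ p)" by auto
  then show ?thesis by (simp flip: sum_divide_distrib)
qed

lemma eventually_inv_sqrt_le:
  fixes c e C :: real
  assumes "c > 0" "C \<ge> 0" "e > 0"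
  shows "eventually (\<lambda>N::nat. C / (c * sqrt N) \<le> e) sequentially"
proof -
  have "(\<lambda>N::nat. C / c * inverse (sqrt N)) \<longlonglongrightarrow> C / c * 0"
    by (intro tendsto_intros tendsto_inverse_0_at_top filterlim_compose[OF sqrt_at_top] filterlim_real_sequentially)
  then have "eventually (\<lambda>N::nat. C / c * inverse (sqrt N) < e) sequentially"
    using order_tendstoD(2)[of _ "C / c * 0" sequentially e] assms by simp
  then show ?thesis by (rule eventually_mono) (simp add: field_simps)
qed

text \<open>The interface between the probabilistic and the analytic part. All constants, including
  the \<open>C\<close> of \<open>err\<close>, are independent of \<open>N\<close>. By
  \<open>semi\<close>, the difference quotient minus the derivative becomes nonnegative once
  \<open>C0 * l / h\<close> is added, so the bracket in \<open>err\<close> has a sign. Nothing is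
  asked of the derivatives at \<open>h = 0\<close>.\<close>

locale approx_HJ =
  fixes p :: nat and f :: "real \<Rightarrow> real \<Rightarrow> real" and L C0 :: real
    and F Ft Fh :: "nat \<Rightarrow> real \<Rightarrow> real \<Rightarrow> real"
  assumes sol: "visc_sol p f" and lip_f: "lip1 L f" and L: "L \<ge> 0" and C0: "C0 \<ge> 0"
    and lip_F: "\<And>N. N \<ge> 1 \<Longrightarrow> lip1 L (F N)"
    and init: "\<And>N h. N \<ge> 1 \<Longrightarrow> h \<ge> 0 \<Longrightarrow> F N 0 h = f 0 h"
    and dt: "\<And>N t h. N \<ge> 1 \<Longrightarrow> t > 0 \<Longrightarrow> h > 0 \<Longrightarrow> ((\<lambda>t. F N t h) has_real_derivative Ft N t h) (at t)"
    and dh: "\<And>N t h. N \<ge> 1 \<Longrightarrow> t > 0 \<Longrightarrow> h > 0 \<Longrightarrow> ((\<lambda>h. F N t h) has_real_derivative Fh N t h) (at h)"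
    and Fh: "\<And>N t h. N \<ge> 1 \<Longrightarrow> t > 0 \<Longrightarrow> h > 0 \<Longrightarrow> 0 \<le> Fh N t h \<and> Fh N t h \<le> L"
    and semi: "\<And>N t h h'. N \<ge> 1 \<Longrightarrow> t > 0 \<Longrightarrow> h > 0 \<Longrightarrow> h' \<ge> 0 \<Longrightarrow>
        F N t h' \<ge> F N t h + Fh N t h * (h' - h) - C0 * (h' - h)\<^sup>2 / h"
    and err: "\<And>T. \<exists>C\<ge>0. \<forall>N\<ge>1. \<forall>t h l. 0 < t \<and> t \<le> T \<and> 0 < h \<and> h \<le> T \<and> 0 < l \<and> l \<le> 1 \<longrightarrow>
        \<bar>Ft N t h - 2 ^ (p - 1) * Fh N t h ^ p\<bar> \<le>
          C * ((F N t (h + l) - F N t h) / l - Fh N t h + C0 * l / h + 1 / (l * sqrt N) + 1 / (sqrt h * sqrt N))"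
begin

text \<open>A Lipschitz constant of the Hamiltonian on \<open>[- (L + 1), L + 1]\<close>: one of the
  two compared slopes lies in \<open>[0, L]\<close> and the other within
  \<open>\<kappa> \<le> 1\<close> of it.\<close>

definition "ham_lip = 2 ^ (p - 1) * (real p * (L + 1) ^ p)"

lemma ham_lip: "ham_lip \<ge> 0" "\<bar>x\<bar> \<le> L + 1 \<Longrightarrow> \<bar>y\<bar> \<le> L + 1 \<Longrightarrow> \<bar>2 ^ (p - 1) * x ^ p - 2 ^ (p - 1) * y ^ p\<bar> \<le> ham_lip * \<bar>x - y\<bar>"
proof -
  show "ham_lip \<ge> 0" unfolding ham_lip_def using L by auto
  assume "\<bar>x\<bar> \<le> L + 1" "\<bar>y\<bar> \<le> L + 1"
  then have "\<bar>x ^ p - y ^ p\<bar> \<le> real p * (L + 1) ^ p * \<bar>x - y\<bar>" using L by (intro abs_power_diff_le) auto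
  then have "2 ^ (p - 1) * \<bar>x ^ p - y ^ p\<bar> \<le> 2 ^ (p - 1) * (real p * (L + 1) ^ p * \<bar>x - y\<bar>)"
    by (intro mult_left_mono) auto
  moreover have "\<bar>2 ^ (p - 1) * x ^ p - 2 ^ (p - 1) * y ^ p\<bar> = 2 ^ (p - 1) * \<bar>x ^ p - y ^ p\<bar>"
    by (simp only: right_diff_distrib[symmetric] abs_mult) simp
  ultimately show "\<bar>2 ^ (p - 1) * x ^ p - 2 ^ (p - 1) * y ^ p\<bar> \<le> ham_lip * \<bar>x - y\<bar>"
    unfolding ham_lip_def by (simp add: mult.assoc)
qed

text \<open>The budget of the comparison: the initial gap takes \<open>\<eta> / 4\<close>, the three
  penalty contributions at most \<open>\<eta> / 8\<close> each, and the slack below \<eta> pays for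
  replacing \<open>F\<close> by shifts of it. Moreover \<kappa> is small relative to
  \<open>l\<close>, so that the mismatch of the field slopes cannot bridge the gap between the time
  slopes.\<close>

lemma doubling_parameters:
  fixes M \<eta> :: real assumes "M \<ge> 0" "\<eta> > 0"
  obtains l a \<kappa> where "l > 0" "a > 0" "\<kappa> > 0" "\<kappa> \<le> 1" "ham_lip * \<kappa> \<le> l / 4"
    "\<And>t h c. 0 \<le> t \<Longrightarrow> t \<le> M \<Longrightarrow> 0 \<le> h \<Longrightarrow> h \<le> M \<Longrightarrow> c \<le> \<eta> / 4 \<Longrightarrow> 
       c + L\<^sup>2 / (2 * a) + \<kappa> + l * (t + t\<^sup>2) + \<kappa> * h\<^sup>2 \<le> 3 / 4 * \<eta>"
proof -
  define l where "l = \<eta> / (8 * (M + M\<^sup>2 + 1))"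
  define a where "a = 4 * (L\<^sup>2 + 1) / \<eta>"
  define \<kappa> where "\<kappa> = min (min 1 (\<eta> / (8 * (1 + M\<^sup>2)))) (l / (4 * (ham_lip + 1)))"
  have pos: "M + M\<^sup>2 + 1 > 0" "1 + M\<^sup>2 > 0" "L\<^sup>2 + 1 > 0" "ham_lip + 1 > 0"
    using assms(1) ham_lip(1) zero_le_power2[of M] zero_le_power2[of L] by linarith+
  have l: "l > 0" and a: "a > 0" unfolding l_def a_def using assms pos by auto
  have \<kappa>: "\<kappa> > 0" "\<kappa> \<le> 1" "\<kappa> \<le> \<eta> / (8 * (1 + M\<^sup>2))" "\<kappa> \<le> l / (4 * (ham_lip + 1))"
  proof -
    show "\<kappa> > 0" unfolding \<kappa>_def using assms pos l by simp
  qed (unfold \<kappa>_def, linarith+)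
  show thesis
  proof (rule that[OF l a \<kappa>(1,2)])
    have "(ham_lip + 1) * \<kappa> \<le> l / 4" using \<kappa>(4) pos by (simp add: field_simps)
    then show "ham_lip * \<kappa> \<le> l / 4" using \<kappa>(1) by (simp add: algebra_simps)
  next
    fix t h c assume H: "0 \<le> t" "t \<le> M" "0 \<le> h" "h \<le> M" "c \<le> \<eta> / 4"
    have "t\<^sup>2 \<le> M\<^sup>2" "h\<^sup>2 \<le> M\<^sup>2" using H by (auto intro!: power_mono)
    then have "l * (t + t\<^sup>2) \<le> l * (M + M\<^sup>2 + 1)" "\<kappa> * (1 + h\<^sup>2) \<le> \<kappa> * (1 + M\<^sup>2)"
      using H l \<kappa> by (intro mult_left_mono; linarith)+
    moreover have "l * (M + M\<^sup>2 + 1) = \<eta> / 8" unfolding l_def using pos by (simp add: field_simps)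
    moreover have "\<kappa> * (1 + M\<^sup>2) \<le> \<eta> / 8" using \<kappa>(3) pos by (simp add: field_simps)
    moreover have "L\<^sup>2 / (2 * a) \<le> \<eta> / 8"
    proof -
      have "L\<^sup>2 / (2 * a) = \<eta> / 8 * (L\<^sup>2 / (L\<^sup>2 + 1))" unfolding a_def using assms pos by (simp add: field_simps)
      also have "\<dots> \<le> \<eta> / 8 * 1" using assms pos by (intro mult_left_mono) auto
      finally show ?thesis by simp
    qed
    moreover have "\<kappa> * (1 + h\<^sup>2) = \<kappa> + \<kappa> * h\<^sup>2" by (simp add: algebra_simps)
    ultimately show "c + L\<^sup>2 / (2 * a) + \<kappa> + l * (t + t\<^sup>2) + \<kappa> * h\<^sup>2 \<le> 3 / 4 * \<eta>" using H(5) assms(2) by argo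
  qed
qed

text \<open>\<open>F\<close> is replaced by its shift by \<open>a0\<close> in \<open>h\<close>,
  which keeps all arguments away from zero, where the error bound degenerates. Contact from above
  with curvature \<open>A\<close> means that the difference quotient exceeds the derivative by at
  most \<open>A * b\<close>, so the approximate equation is accurate exactly at the contact
  point.\<close>

lemma upper_bound:
  assumes "M \<ge> 0" "\<eta> > 0"
  shows "\<exists>N0. \<forall>N\<ge>N0. \<forall>t\<in>{0..M}. \<forall>h\<in>{0..M}. F N t h - f t h \<le> \<eta>"
proof -
  obtain l a \<kappa> where par: "l > 0" "a > 0" "\<kappa> > 0" "\<kappa> \<le> 1" "ham_lip * \<kappa> \<le> l / 4"
    "\<And>t h c. 0 \<le> t \<Longrightarrow> t \<le> M \<Longrightarrow> 0 \<le> h \<Longrightarrow> h \<le> M \<Longrightarrow> c \<le> \<eta> / 4 \<Longrightarrow> 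
       c + L\<^sup>2 / (2 * a) + \<kappa> + l * (t + t\<^sup>2) + \<kappa> * h\<^sup>2 \<le> 3 / 4 * \<eta>"
    using doubling_parameters[OF assms] by blast
  obtain A B where AB: "A > 0" "B > 0" and
    dbl: "\<And>u v c. lip1 L u \<Longrightarrow> lip1 L v \<Longrightarrow> c \<le> 1 \<Longrightarrow> \<forall>h\<ge>0. \<bar>u 0 h - v 0 h\<bar> \<le> c \<Longrightarrow>
      (\<forall>t\<ge>0. \<forall>h\<ge>0. u t h - v t h \<le> c + L\<^sup>2 / (2 * a) + \<kappa> + l * (t + t\<^sup>2) + \<kappa> * h\<^sup>2) \<or>
      (\<exists>t h s k \<alpha>1 \<alpha>2 \<beta>1 \<beta>2. 0 < t \<and> t \<le> B \<and> 0 \<le> h \<and> h \<le> B \<and> 0 < s \<and> s \<le> B \<and> 0 \<le> k \<and> k \<le> B \<and>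
        \<alpha>2 + l \<le> \<alpha>1 \<and> \<bar>\<beta>1 - \<beta>2\<bar> \<le> \<kappa> \<and> (h = 0 \<longrightarrow> \<beta>1 < 0) \<and> (k = 0 \<longrightarrow> \<beta>2 > 0) \<and>
        touches_above u t h \<alpha>1 \<beta>1 A \<and> touches_below v s k \<alpha>2 \<beta>2 A)"
    using doubling[OF L par(1,2,3)] by blast
  define a0 where "a0 = min 1 (min 1 (\<eta> / 4) / (L + 1))"
  have "a0 > 0" "a0 \<le> 1" "a0 \<le> min 1 (\<eta> / 4) / (L + 1)" unfolding a0_def using assms L by auto
  then have a0: "a0 > 0" "a0 \<le> 1" "L * a0 \<le> 1" "L * a0 \<le> \<eta> / 4"
    using L by (auto simp: field_simps)
  obtain C where C: "C \<ge> 0" "\<And>N t h l. N \<ge> 1 \<Longrightarrow> 0 < t \<Longrightarrow> t \<le> B + 1 \<Longrightarrow> 0 < h \<Longrightarrow> h \<le> B + 1 \<Longrightarrow> 0 < l \<Longrightarrow> l \<le> 1 \<Longrightarrow>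
        \<bar>Ft N t h - 2 ^ (p - 1) * Fh N t h ^ p\<bar> \<le>
          C * ((F N t (h + l) - F N t h) / l - Fh N t h + C0 * l / h + 1 / (l * sqrt N) + 1 / (sqrt h * sqrt N))"
    using err[of "B + 1"] by blast
  \<comment> \<open>The step \<open>b\<close> brings the part of the error proportional to the step
    below \<open>l / 4\<close>; the two parts that decay in \<open>N\<close> get
    \<open>l / 8\<close> each.\<close>
  define b where "b = min 1 (l / (4 * (C * (A + C0 / a0) + 1)))"
  have Cpos: "C * (A + C0 / a0) \<ge> 0" using C(1) C0 AB a0 by auto
  have "b > 0" "b \<le> 1" "b \<le> l / (4 * (C * (A + C0 / a0) + 1))"
    unfolding b_def using par(1) Cpos by auto
  moreover have "b * X \<le> l / 4" if "b \<le> l / (4 * (X + 1))" "X \<ge> 0" "b > 0" for X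
  proof -
    have "4 * (X + 1) > 0" using that by simp
    then have "b * (4 * (X + 1)) \<le> l" using that(1) by (simp only: pos_le_divide_eq)
    then show ?thesis using that(3) by (simp add: algebra_simps)
  qed
  ultimately have b: "b > 0" "b \<le> 1" "b * (C * (A + C0 / a0)) \<le> l / 4"
    using Cpos by blast+
  have "eventually (\<lambda>N::nat. C / (b * sqrt N) \<le> l / 8) sequentially"
    "eventually (\<lambda>N::nat. C / (sqrt a0 * sqrt N) \<le> l / 8) sequentially"
    using par(1) C(1) b(1) a0(1) by (auto intro!: eventually_inv_sqrt_le)
  with eventually_ge_at_top[of "1::nat"]
  have "eventually (\<lambda>N::nat. N \<ge> (1::nat) \<and> C / (b * sqrt N) \<le> l / 8 \<and> C / (sqrt a0 * sqrt N) \<le> l / 8) sequentially"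
    by eventually_elim auto
  then have "\<exists>N0. \<forall>N\<ge>N0. N \<ge> (1::nat) \<and> C / (b * sqrt N) \<le> l / 8 \<and> C / (sqrt a0 * sqrt N) \<le> l / 8"
    by (simp only: eventually_sequentially)
  then obtain N0 where N0: "\<forall>N\<ge>N0. N \<ge> (1::nat) \<and> C / (b * sqrt N) \<le> l / 8 \<and> C / (sqrt a0 * sqrt N) \<le> l / 8"
    by (rule exE)
  show ?thesis
  proof (intro exI[of _ N0] allI impI ballI)
    fix N t h assume N: "N \<ge> N0" and th: "t \<in> {0..M}" "h \<in> {0..M}"
    have N1: "N \<ge> 1" "C / (b * sqrt N) \<le> l / 8" "C / (sqrt a0 * sqrt N) \<le> l / 8" using N0[rule_format, OF N] by auto
    define G where "G = (\<lambda>t h. F N t (h + a0))"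
    have GF: "\<bar>F N t h - G t h\<bar> \<le> L * a0" if "t \<ge> 0" "h \<ge> 0" for t h
      using lip1D[OF lip_F[OF N1(1)], of t h t "h + a0"] that a0 unfolding G_def by auto
    have "lip1 L G" 
    proof -
      have "\<bar>G t h - G t' h'\<bar> \<le> L * (\<bar>t - t'\<bar> + \<bar>h - h'\<bar>)"
        if "t \<ge> 0" "h \<ge> 0" "t' \<ge> 0" "h' \<ge> 0" for t h t' h'
        using lip1D[OF lip_F[OF N1(1)], of t "h + a0" t' "h' + a0"] that a0(1) by (simp add: G_def)
      then show ?thesis by (simp add: lip1_def)
    qed
    moreover have "\<forall>h\<ge>0. \<bar>G 0 h - f 0 h\<bar> \<le> L * a0"
      using GF[of 0] init[OF N1(1)] by (auto simp: abs_minus_commute)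
    ultimately consider
      "\<forall>t\<ge>0. \<forall>h\<ge>0. G t h - f t h \<le> L * a0 + L\<^sup>2 / (2 * a) + \<kappa> + l * (t + t\<^sup>2) + \<kappa> * h\<^sup>2" |
      t h s k \<alpha>1 \<alpha>2 \<beta>1 \<beta>2 where "0 < t" "t \<le> B" "0 \<le> h" "h \<le> B" "0 < s" "s \<le> B" "0 \<le> k" "k \<le> B"
        "\<alpha>2 + l \<le> \<alpha>1" "\<bar>\<beta>1 - \<beta>2\<bar> \<le> \<kappa>" "h = 0 \<longrightarrow> \<beta>1 < 0" "k = 0 \<longrightarrow> \<beta>2 > 0"
        "touches_above G t h \<alpha>1 \<beta>1 A" "touches_below f s k \<alpha>2 \<beta>2 A"
      using dbl[OF _ lip_f a0(3), of G] by blast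
    then show "F N t h - f t h \<le> \<eta>"
    proof cases
      case 1
      have "G t h - f t h \<le> 3 / 4 * \<eta>" using 1 par(6)[of t h "L * a0"] th a0(4) by force
      then show ?thesis using GF[of t h] th a0(4) by (auto simp: abs_le_iff)
    next
      case (2 t h s k \<alpha>1 \<alpha>2 \<beta>1 \<beta>2)
      let ?h = "h + a0"
      have h: "?h > 0" using 2 a0 by auto
      have "((\<lambda>h. F N t (h + a0)) has_real_derivative Fh N t ?h) (at h)"
        using dh[OF N1(1) 2(1) h] by (simp add: DERIV_shift)
      then have Gh: "((\<lambda>h. G t h) has_real_derivative Fh N t ?h) (at h)" unfolding G_def by simp
      have Gt: "((\<lambda>t. G t h) has_real_derivative Ft N t ?h) (at t)"
        using dt[OF N1(1) 2(1) h] unfolding G_def by simp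
      have fh: "0 \<le> Fh N t ?h" "Fh N t ?h \<le> L" using Fh[OF N1(1) 2(1) h] by auto
      have "Ft N t ?h = \<alpha>1" by (rule touches_above_deriv_t[OF 2(13,1,3) Gt])
      \<comment> \<open>At \<open>h = 0\<close> the penalty would give \<open>\<beta>1 < 0\<close>,
        while contact gives that \<beta>1 is at least the nonnegative derivative.\<close>
      moreover have "h > 0"
        using touches_above_deriv_h(1)[OF 2(13) _ 2(3) Gh] 2 fh by (cases "h = 0") auto
      then have \<beta>1: "Fh N t ?h = \<beta>1" using touches_above_deriv_h(2)[OF 2(13) _ 2(3) Gh] 2 by auto
      moreover have "\<alpha>2 \<ge> 2 ^ (p - 1) * \<beta>2 ^ p"
        by (rule visc_super_jet[OF _ 2(5,7,14)]) (use sol 2(12) in \<open>auto simp: visc_sol_def\<close>)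
      moreover have "\<bar>2 ^ (p - 1) * \<beta>1 ^ p - 2 ^ (p - 1) * \<beta>2 ^ p\<bar> \<le> ham_lip * \<bar>\<beta>1 - \<beta>2\<bar>"
        using fh \<beta>1 2(10) par(4) by (intro ham_lip(2)) auto
      moreover have "ham_lip * \<bar>\<beta>1 - \<beta>2\<bar> \<le> ham_lip * \<kappa>" using 2(10) ham_lip(1) by (intro mult_left_mono)
      moreover have "\<bar>Ft N t ?h - 2 ^ (p - 1) * Fh N t ?h ^ p\<bar> \<le> l / 2"
      proof -
        have "G t (h + b) \<le> G t h + \<beta>1 * b + A * b\<^sup>2"
          using 2(13) 2(1,3) b(1) unfolding touches_above_def
          by (elim allE[of _ t] allE[of _ "h + b"] impE) auto
        then have "(F N t (?h + b) - F N t ?h) / b \<le> \<beta>1 + A * b"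
          using b(1) unfolding G_def by (simp add: field_simps power2_eq_square)
        moreover have "C0 * b / ?h \<le> C0 * b / a0" using 2 a0 b C0 by (intro divide_left_mono) auto
        moreover have "1 / (sqrt ?h * sqrt N) \<le> 1 / (sqrt a0 * sqrt N)"
          using 2 a0 N1(1) by (intro divide_left_mono mult_right_mono) auto
        ultimately have *: "(F N t (?h + b) - F N t ?h) / b - Fh N t ?h + C0 * b / ?h + 1 / (b * sqrt N) + 1 / (sqrt ?h * sqrt N)
            \<le> A * b + C0 * b / a0 + 1 / (b * sqrt N) + 1 / (sqrt a0 * sqrt N)" using \<beta>1 by linarith
        have "\<bar>Ft N t ?h - 2 ^ (p - 1) * Fh N t ?h ^ p\<bar> \<le>
          C * ((F N t (?h + b) - F N t ?h) / b - Fh N t ?h + C0 * b / ?h + 1 / (b * sqrt N) + 1 / (sqrt ?h * sqrt N))"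
          using 2 a0 b h N1(1) by (intro C(2)) auto
        also have "\<dots> \<le> C * (A * b + C0 * b / a0 + 1 / (b * sqrt N) + 1 / (sqrt a0 * sqrt N))"
          using * C(1) by (rule mult_left_mono)
        also have "\<dots> = b * (C * (A + C0 / a0)) + C / (b * sqrt N) + C / (sqrt a0 * sqrt N)"
          by (simp add: algebra_simps)
        also have "\<dots> \<le> l / 2" using b(3) N1 by linarith
        finally show ?thesis .
      qed
      \<comment> \<open>With \<open>H\<close> for the Hamiltonian, \<open>\<alpha>1 \<le> H \<beta>1
        + l / 2 \<le> H \<beta>2 + 3 * l / 4 \<le> \<alpha>2 + 3 * l / 4\<close>, against
        \<open>\<alpha>2 + l \<le> \<alpha>1\<close>. So this case cannot occur.\<close>
      ultimately show ?thesis using 2(9) par(1,5) by (simp add: abs_le_iff) 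
    qed
  qed
qed

text \<open>For the supersolution side the approximate equation is averaged over \<open>n\<close> shifts of \<open>h\<close>: the difference
  quotients telescope, so that the error is of order \<open>1 / n\<close> without any upper bound on the second derivative.\<close>

lemma averaged_err:
  fixes n N :: nat and t T b a0 k C :: real
  assumes N: "N \<ge> 1" and n: "n > 0" and t: "0 < t" "t \<le> T" and b: "0 < b" "b \<le> 1" "b \<le> a0" and k: "k \<ge> 0" "k + 2 * a0 + n * b \<le> T"
    and C: "C \<ge> 0" "\<And>N t h l. N \<ge> 1 \<Longrightarrow> 0 < t \<Longrightarrow> t \<le> T \<Longrightarrow> 0 < h \<Longrightarrow> h \<le> T \<Longrightarrow> 0 < l \<Longrightarrow> l \<le> 1 \<Longrightarrow>
        \<bar>Ft N t h - 2 ^ (p - 1) * Fh N t h ^ p\<bar> \<le>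
          C * ((F N t (h + l) - F N t h) / l - Fh N t h + C0 * l / h + 1 / (l * sqrt N) + 1 / (sqrt h * sqrt N))"
  shows "(\<Sum>j<n. \<bar>Ft N t (k + 2 * a0 + j * b) - 2 ^ (p - 1) * Fh N t (k + 2 * a0 + j * b) ^ p\<bar>) / n \<le>
    C * (2 * L / n + (C0 + C0) * b / a0 + 1 / (b * sqrt N) + 1 / (sqrt a0 * sqrt N))"
proof -
  have a0: "a0 > 0" using b by simp
  \<comment> \<open>Indices are moved by one: \<open>K (Suc j)\<close> is the \<open>j\<close>-th
    evaluation point and \<open>K 0\<close> lies one step to its left, as the backward differences
    require. The offset \<open>2 * a0\<close> with \<open>b \<le> a0\<close> keeps even
    \<open>K 0\<close> above \<open>a0\<close>.\<close>
  define K where "K j = k + 2 * a0 + (real j - 1) * b" for j :: nat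
  have Kpos: "K j \<ge> a0" for j
  proof -
    have "K j = k + a0 + (a0 - b) + j * b" unfolding K_def by (simp add: algebra_simps)
    moreover have "j * b \<ge> 0" using b by simp
    ultimately show ?thesis using k(1) b by linarith
  qed
  have KS: "K (Suc j) = k + 2 * a0 + j * b" "K (Suc j) = K j + b" for j
    unfolding K_def by (auto simp: algebra_simps)
  have one: "\<bar>Ft N t (K (Suc j)) - 2 ^ (p - 1) * Fh N t (K (Suc j)) ^ p\<bar> \<le>
     C * ((F N t (K (Suc (Suc j))) - F N t (K (Suc j))) / b - (F N t (K (Suc j)) - F N t (K j)) / b
        + ((C0 + C0) * b / a0 + 1 / (b * sqrt N) + 1 / (sqrt a0 * sqrt N)))" if j: "j < n" for j
  proof -
    let ?h = "K (Suc j)"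
    have h: "?h \<ge> a0" by (rule Kpos)
    have "real j * b \<le> real n * b" using j b by (intro mult_right_mono) auto
    then have hT: "?h \<le> T" unfolding KS(1) using k(2) by linarith
    \<comment> \<open>Semiconvexity read one step to the left: the derivative is at least the
      backward difference quotient, up to order \<open>b\<close>. The error thereby becomes a
      difference of successive difference quotients.\<close>
    have "F N t (K j) \<ge> F N t ?h + Fh N t ?h * (K j - ?h) - C0 * (K j - ?h)\<^sup>2 / ?h"
      using semi[OF N t(1), of ?h "K j"] h a0 Kpos[of j] by linarith
    moreover have "K j - ?h = - b" using KS(2)[of j] by simp
    ultimately have "F N t ?h - F N t (K j) \<le> Fh N t ?h * b + C0 * b\<^sup>2 / ?h" by simp
    moreover have "C0 * b\<^sup>2 / ?h \<le> C0 * b\<^sup>2 / a0" using h a0 C0 by (intro divide_left_mono) auto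
    ultimately have "(F N t ?h - F N t (K j)) / b \<le> (Fh N t ?h * b + C0 * b\<^sup>2 / a0) / b"
      using b by (intro divide_right_mono) auto
    also have "\<dots> = Fh N t ?h + C0 * b / a0" using b by (simp add: field_simps power2_eq_square)
    finally have 1: "- Fh N t ?h \<le> - (F N t ?h - F N t (K j)) / b + C0 * b / a0" by linarith
    have 2: "C0 * b / ?h \<le> C0 * b / a0" using h a0 b C0 by (intro divide_left_mono) auto
    have 3: "1 / (sqrt ?h * sqrt N) \<le> 1 / (sqrt a0 * sqrt N)"
      using h a0 N by (intro divide_left_mono mult_right_mono) auto
    have 4: "(C0 + C0) * b / a0 = C0 * b / a0 + C0 * b / a0" using a0 by (simp add: field_simps)
    have 5: "- (F N t ?h - F N t (K j)) / b = - ((F N t ?h - F N t (K j)) / b)" by (rule minus_divide_left[symmetric])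
    have "\<bar>Ft N t ?h - 2 ^ (p - 1) * Fh N t ?h ^ p\<bar> \<le>
      C * ((F N t (?h + b) - F N t ?h) / b - Fh N t ?h + C0 * b / ?h + 1 / (b * sqrt N) + 1 / (sqrt ?h * sqrt N))"
      using h a0 hT b t N by (intro C(2)) auto
    also have "\<dots> \<le> C * ((F N t (K (Suc (Suc j))) - F N t (K (Suc j))) / b - (F N t (K (Suc j)) - F N t (K j)) / b
        + ((C0 + C0) * b / a0 + 1 / (b * sqrt N) + 1 / (sqrt a0 * sqrt N)))"
      using 1 2 3 unfolding 4 5 by (intro mult_left_mono C(1)) (simp add: KS(2)[of "Suc j"])
    finally show ?thesis .
  qed
  let ?e = "(C0 + C0) * b / a0 + 1 / (b * sqrt N) + 1 / (sqrt a0 * sqrt N)"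
  have "(\<Sum>j<n. \<bar>Ft N t (K (Suc j)) - 2 ^ (p - 1) * Fh N t (K (Suc j)) ^ p\<bar>) \<le>
    (\<Sum>j<n. C * ((F N t (K (Suc (Suc j))) - F N t (K (Suc j))) / b - (F N t (K (Suc j)) - F N t (K j)) / b + ?e))"
    by (intro sum_mono one) auto
  also have "\<dots> = C * ((\<Sum>j<n. (F N t (K (Suc (Suc j))) - F N t (K (Suc j))) / b - (F N t (K (Suc j)) - F N t (K j)) / b) + n * ?e)"
    by (simp add: sum_distrib_left[symmetric] sum.distrib)
  also have "(\<Sum>j<n. (F N t (K (Suc (Suc j))) - F N t (K (Suc j))) / b - (F N t (K (Suc j)) - F N t (K j)) / b)
     = (F N t (K (Suc n)) - F N t (K n)) / b - (F N t (K (Suc 0)) - F N t (K 0)) / b"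
    by (rule sum_lessThan_telescope)
  also have "\<dots> \<le> 2 * L"
  proof -
    have "\<bar>F N t (K (Suc j)) - F N t (K j)\<bar> \<le> L * b" for j
      using lip1D[OF lip_F[OF N], of t "K (Suc j)" t "K j"] t Kpos[of j] Kpos[of "Suc j"] a0 KS(2)[of j] b by simp
    then have "\<bar>(F N t (K (Suc j)) - F N t (K j)) / b\<bar> \<le> L" for j
      using b by (simp add: abs_divide field_simps)
    from this[of n] this[of 0] show ?thesis by linarith
  qed
  finally have "(\<Sum>j<n. \<bar>Ft N t (K (Suc j)) - 2 ^ (p - 1) * Fh N t (K (Suc j)) ^ p\<bar>) \<le> C * (2 * L + n * ?e)"
    using C(1) by (simp add: mult_left_mono)
  then have "(\<Sum>j<n. \<bar>Ft N t (K (Suc j)) - 2 ^ (p - 1) * Fh N t (K (Suc j)) ^ p\<bar>) / n \<le> C * (2 * L + n * ?e) / n"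
    by (intro divide_right_mono) auto
  also have "\<dots> = C * (2 * L / n + ?e)" using n by (simp add: field_simps)
  finally show ?thesis unfolding KS(1) by (simp add: add.assoc)
qed

text \<open>A paraboloid from below gives no upper bound on second differences, so contact is made
  with the average \<open>G\<close> of \<open>n\<close> shifts. The parameters are chosen in the
  order \<open>a0\<close>, \<open>n\<close>, \<open>b\<close>, \<open>N0\<close>: the shifts stay
  between \<open>2 * a0\<close> and \<open>3 * a0\<close>, \<open>n\<close> settles the boundary
  term of the averaged error, \<open>b\<close> the semiconvexity term, and \<open>N0\<close> the
  rest.\<close>

lemma lower_bound:
  assumes "M \<ge> 0" "\<eta> > 0"
  shows "\<exists>N0. \<forall>N\<ge>N0. \<forall>t\<in>{0..M}. \<forall>h\<in>{0..M}. f t h - F N t h \<le> \<eta>"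
proof -
  obtain l a \<kappa> where par: "l > 0" "a > 0" "\<kappa> > 0" "\<kappa> \<le> 1" "ham_lip * \<kappa> \<le> l / 4"
    "\<And>t h c. 0 \<le> t \<Longrightarrow> t \<le> M \<Longrightarrow> 0 \<le> h \<Longrightarrow> h \<le> M \<Longrightarrow> c \<le> \<eta> / 4 \<Longrightarrow> 
       c + L\<^sup>2 / (2 * a) + \<kappa> + l * (t + t\<^sup>2) + \<kappa> * h\<^sup>2 \<le> 3 / 4 * \<eta>"
    using doubling_parameters[OF assms] by blast
  obtain A B where AB: "A > 0" "B > 0" and
    dbl: "\<And>u v c. lip1 L u \<Longrightarrow> lip1 L v \<Longrightarrow> c \<le> 1 \<Longrightarrow> \<forall>h\<ge>0. \<bar>u 0 h - v 0 h\<bar> \<le> c \<Longrightarrow>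
      (\<forall>t\<ge>0. \<forall>h\<ge>0. u t h - v t h \<le> c + L\<^sup>2 / (2 * a) + \<kappa> + l * (t + t\<^sup>2) + \<kappa> * h\<^sup>2) \<or>
      (\<exists>t h s k \<alpha>1 \<alpha>2 \<beta>1 \<beta>2. 0 < t \<and> t \<le> B \<and> 0 \<le> h \<and> h \<le> B \<and> 0 < s \<and> s \<le> B \<and> 0 \<le> k \<and> k \<le> B \<and>
        \<alpha>2 + l \<le> \<alpha>1 \<and> \<bar>\<beta>1 - \<beta>2\<bar> \<le> \<kappa> \<and> (h = 0 \<longrightarrow> \<beta>1 < 0) \<and> (k = 0 \<longrightarrow> \<beta>2 > 0) \<and>
        touches_above u t h \<alpha>1 \<beta>1 A \<and> touches_below v s k \<alpha>2 \<beta>2 A)"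
    using doubling[OF L par(1,2,3)] by blast
  define a0 where "a0 = min 1 (min 1 (\<eta> / 4) / (3 * (L + 1)))"
  have "a0 > 0" "a0 \<le> 1" "a0 \<le> min 1 (\<eta> / 4) / (3 * (L + 1))" unfolding a0_def using assms L by auto
  then have a0: "a0 > 0" "a0 \<le> 1" "L * (3 * a0) \<le> 1" "L * (3 * a0) \<le> \<eta> / 4"
    using L by (auto simp: field_simps)
  obtain C where C: "C \<ge> 0" "\<And>N t h l. N \<ge> 1 \<Longrightarrow> 0 < t \<Longrightarrow> t \<le> B + 3 \<Longrightarrow> 0 < h \<Longrightarrow> h \<le> B + 3 \<Longrightarrow> 0 < l \<Longrightarrow> l \<le> 1 \<Longrightarrow>
        \<bar>Ft N t h - 2 ^ (p - 1) * Fh N t h ^ p\<bar> \<le>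
          C * ((F N t (h + l) - F N t h) / l - Fh N t h + C0 * l / h + 1 / (l * sqrt N) + 1 / (sqrt h * sqrt N))"
    using err[of "B + 3"] by blast
  obtain n :: nat where n: "n > 0" "C * (2 * L) / n \<le> l / 8"
  proof -
    obtain n :: nat where "n > C * (2 * L) / (l / 8)" using reals_Archimedean2 by blast
    moreover have "C * (2 * L) / (l / 8) \<ge> 0" using C(1) L par(1) by auto
    ultimately have "real n > 0" "C * (2 * L) < n * (l / 8)"
      using par(1) by (linarith, simp add: pos_divide_less_eq)
    then show thesis by (intro that[of n]) (auto simp: field_simps)
  qed
  define b where "b = min (a0 / n) (l / (8 * (C * ((C0 + C0) / a0) + 1)))"
  have Cpos: "C * ((C0 + C0) / a0) \<ge> 0" using C(1) C0 a0 by auto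
  have b1: "b > 0" "b \<le> l / (8 * (C * ((C0 + C0) / a0) + 1))" "b \<le> a0 / n"
    unfolding b_def using par(1) Cpos a0 n by auto
  have b2: "b * X \<le> l / 8" if "b \<le> l / (8 * (X + 1))" "X \<ge> 0" "b > 0" for X
  proof -
    have "8 * (X + 1) > 0" using that by simp
    then have "b * (8 * (X + 1)) \<le> l" using that(1) by (simp only: pos_le_divide_eq)
    then show ?thesis using that(3) by (simp add: algebra_simps)
  qed
  have "n * b \<le> a0" using b1(3) n by (simp add: field_simps)
  note b = b1(1) b2[OF b1(2) Cpos b1(1)] this
  have "1 * b \<le> n * b" using n b by (intro mult_right_mono) auto
  then have ba: "b \<le> a0" "b \<le> 1" using b(3) a0(2) by auto
  have "eventually (\<lambda>N::nat. C / (b * sqrt N) \<le> l / 8) sequentially"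
    "eventually (\<lambda>N::nat. C / (sqrt a0 * sqrt N) \<le> l / 8) sequentially"
    using par(1) C(1) b(1) a0(1) by (auto intro!: eventually_inv_sqrt_le)
  with eventually_ge_at_top[of "1::nat"]
  have "eventually (\<lambda>N::nat. N \<ge> (1::nat) \<and> C / (b * sqrt N) \<le> l / 8 \<and> C / (sqrt a0 * sqrt N) \<le> l / 8) sequentially"
    by eventually_elim auto
  then have "\<exists>N0. \<forall>N\<ge>N0. N \<ge> (1::nat) \<and> C / (b * sqrt N) \<le> l / 8 \<and> C / (sqrt a0 * sqrt N) \<le> l / 8"
    by (simp only: eventually_sequentially)
  then obtain N0 where N0: "\<forall>N\<ge>N0. N \<ge> (1::nat) \<and> C / (b * sqrt N) \<le> l / 8 \<and> C / (sqrt a0 * sqrt N) \<le> l / 8"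
    by (rule exE)
  show ?thesis
  proof (intro exI[of _ N0] allI impI ballI)
    fix N t h assume N: "N \<ge> N0" and th: "t \<in> {0..M}" "h \<in> {0..M}"
    have N1: "N \<ge> 1" "C / (b * sqrt N) \<le> l / 8" "C / (sqrt a0 * sqrt N) \<le> l / 8" using N0[rule_format, OF N] by auto
    define K where "K k j = k + 2 * a0 + real j * b" for k j
    define G where "G = (\<lambda>t k. (\<Sum>j<n. F N t (K k j)) / n)"
    have average: "\<bar>(\<Sum>j<n. x j) / n - (\<Sum>j<n. y j) / n\<bar> \<le> z" if "\<And>j. j < n \<Longrightarrow> \<bar>x j - y j\<bar> \<le> z" for x y :: "nat \<Rightarrow> real" and z
    proof -
      have "\<bar>\<Sum>j<n. x j - y j\<bar> \<le> (\<Sum>j<n. \<bar>x j - y j\<bar>)" by (rule sum_abs)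
      also have "\<dots> \<le> (\<Sum>j<n. z)" by (intro sum_mono) (use that in auto)
      finally have "\<bar>\<Sum>j<n. x j - y j\<bar> / n \<le> z" using n by (simp add: field_simps)
      then show ?thesis by (simp add: sum_subtractf abs_divide flip: diff_divide_distrib)
    qed
    have GF: "\<bar>G t h - F N t h\<bar> \<le> L * (3 * a0)" if "t \<ge> 0" "h \<ge> 0" for t h
    proof -
      have "\<bar>F N t (K h j) - F N t h\<bar> \<le> L * (3 * a0)" if j: "j < n" for j
      proof -
        have "real j * b \<le> n * b" using j b by (intro mult_right_mono) auto
        then have "real j * b \<le> a0" using b(3) by linarith
        moreover have "0 \<le> real j * b" using b(1) by simp
        ultimately have "0 \<le> K h j" "\<bar>K h j - h\<bar> \<le> 3 * a0" unfolding K_def using \<open>h \<ge> 0\<close> a0(1) by linarith+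
        then have "L * (\<bar>t - t\<bar> + \<bar>K h j - h\<bar>) \<le> L * (3 * a0)" using L by (intro mult_left_mono) auto
        then show ?thesis using lip1D[OF lip_F[OF N1(1)], of t "K h j" t h] \<open>0 \<le> K h j\<close> \<open>t \<ge> 0\<close> \<open>h \<ge> 0\<close> by linarith
      qed
      from average[of "\<lambda>j. F N t (K h j)" "\<lambda>j. F N t h", OF this] show ?thesis
        unfolding G_def using n by simp
    qed
    have "lip1 L G"
    proof -
      have "\<bar>G t h - G t' h'\<bar> \<le> L * (\<bar>t - t'\<bar> + \<bar>h - h'\<bar>)"
        if "t \<ge> 0" "h \<ge> 0" "t' \<ge> 0" "h' \<ge> 0" for t h t' h'
        unfolding G_def
      proof (rule average)
        fix j assume "j < n"
        show "\<bar>F N t (K h j) - F N t' (K h' j)\<bar> \<le> L * (\<bar>t - t'\<bar> + \<bar>h - h'\<bar>)"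
          using lip1D[OF lip_F[OF N1(1)], of t "K h j" t' "K h' j"] that a0(1) b by (simp add: K_def)
      qed
      then show ?thesis by (simp add: lip1_def)
    qed
    moreover have "\<forall>h\<ge>0. \<bar>f 0 h - G 0 h\<bar> \<le> L * (3 * a0)"
      using GF[of 0] init[OF N1(1)] by (auto simp: abs_minus_commute)
    ultimately consider
      "\<forall>t\<ge>0. \<forall>h\<ge>0. f t h - G t h \<le> L * (3 * a0) + L\<^sup>2 / (2 * a) + \<kappa> + l * (t + t\<^sup>2) + \<kappa> * h\<^sup>2" |
      t h s k \<alpha>1 \<alpha>2 \<beta>1 \<beta>2 where "0 < t" "t \<le> B" "0 \<le> h" "h \<le> B" "0 < s" "s \<le> B" "0 \<le> k" "k \<le> B"
        "\<alpha>2 + l \<le> \<alpha>1" "\<bar>\<beta>1 - \<beta>2\<bar> \<le> \<kappa>" "h = 0 \<longrightarrow> \<beta>1 < 0" "k = 0 \<longrightarrow> \<beta>2 > 0"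
        "touches_above f t h \<alpha>1 \<beta>1 A" "touches_below G s k \<alpha>2 \<beta>2 A"
      using dbl[OF lip_f _ a0(3), of G] by blast
    then show "f t h - F N t h \<le> \<eta>"
    proof cases
      case 1
      have "f t h - G t h \<le> 3 / 4 * \<eta>" using 1 par(6)[of t h "L * (3 * a0)"] th a0(4) by force
      then show ?thesis using GF[of t h] th a0(4) by (auto simp: abs_le_iff)
    next
      case (2 t h s k \<alpha>1 \<alpha>2 \<beta>1 \<beta>2)
      have K: "K k j > 0" for j
      proof -
        have "real j * b \<ge> 0" using b(1) by simp
        then show ?thesis unfolding K_def using 2(7) a0(1) by linarith
      qed
      define D where "D = (\<Sum>j<n. Fh N s (K k j)) / n"
      have "((\<lambda>k. F N s (K k j)) has_real_derivative Fh N s (K k j)) (at k)" for j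
        using dh[OF N1(1) 2(5) K[of j]] unfolding K_def by (simp add: add.assoc DERIV_shift)
      then have Gh: "((\<lambda>k. G s k) has_real_derivative D) (at k)"
        unfolding G_def D_def by (intro DERIV_cdivide DERIV_sum)
      have Gt: "((\<lambda>s. G s k) has_real_derivative (\<Sum>j<n. Ft N s (K k j)) / n) (at s)"
        unfolding G_def by (intro DERIV_cdivide DERIV_sum dt N1(1) 2(5) K)
      have fh: "0 \<le> Fh N s (K k j)" "Fh N s (K k j) \<le> L" for j using Fh[OF N1(1) 2(5) K] by auto
      have D: "0 \<le> D" "D \<le> L"
      proof -
        show "0 \<le> D" unfolding D_def using fh by (auto intro!: sum_nonneg divide_nonneg_nonneg)
        have "(\<Sum>j<n. Fh N s (K k j)) \<le> (\<Sum>j<n. L)" by (intro sum_mono fh)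
        then show "D \<le> L" unfolding D_def using n by (simp add: field_simps)
      qed
      have \<alpha>2: "(\<Sum>j<n. Ft N s (K k j)) / n = \<alpha>2" by (rule touches_below_deriv(1)[OF 2(14,5,7) Gt])
      \<comment> \<open>For \<open>k > 0\<close> the slopes agree. At \<open>k = 0\<close> contact
        gives only an inequality, but there the penalty makes \<beta>2 positive, and monotonicity of
        the power on the half line makes the inequality sufficient.\<close>
      have \<beta>2: "0 \<le> \<beta>2" "\<beta>2 \<le> D"
        using touches_below_deriv(2,3)[OF 2(14,5,7) Gh] 2(7,12) D by (cases "k = 0"; force)+
      have "2 ^ (p - 1) * \<beta>2 ^ p \<le> 2 ^ (p - 1) * D ^ p" using \<beta>2 by (intro mult_left_mono power_mono) auto
      \<comment> \<open>Convexity points the right way: the Hamiltonian of the averaged slope is at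
        most the average of the Hamiltonians, which the averaged time derivative nearly
        dominates.\<close>
      also have "\<dots> \<le> 2 ^ (p - 1) * ((\<Sum>j<n. Fh N s (K k j) ^ p) / n)"
        unfolding D_def using fh n by (intro mult_left_mono power_average_le) auto
      also have "\<dots> \<le> \<alpha>2 + l / 2"
      proof -
        have "(\<Sum>j<n. 2 ^ (p - 1) * Fh N s (K k j) ^ p) \<le> (\<Sum>j<n. Ft N s (K k j) + \<bar>Ft N s (K k j) - 2 ^ (p - 1) * Fh N s (K k j) ^ p\<bar>)"
          by (intro sum_mono) auto
        then have "(\<Sum>j<n. 2 ^ (p - 1) * Fh N s (K k j) ^ p) / n \<le>
           (\<Sum>j<n. Ft N s (K k j) + \<bar>Ft N s (K k j) - 2 ^ (p - 1) * Fh N s (K k j) ^ p\<bar>) / n"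
          by (rule divide_right_mono) simp
        also have "\<dots> = \<alpha>2 + (\<Sum>j<n. \<bar>Ft N s (K k j) - 2 ^ (p - 1) * Fh N s (K k j) ^ p\<bar>) / n"
          by (simp add: sum.distrib add_divide_distrib flip: \<alpha>2)
        also have "(\<Sum>j<n. \<bar>Ft N s (K k j) - 2 ^ (p - 1) * Fh N s (K k j) ^ p\<bar>) / n \<le>
          C * (2 * L / n + (C0 + C0) * b / a0 + 1 / (b * sqrt N) + 1 / (sqrt a0 * sqrt N))"
          unfolding K_def using 2 ba a0 b n N1(1)
          by (intro averaged_err[where T = "B + 3"] C) auto
        also have "\<dots> = C * (2 * L) / n + b * (C * ((C0 + C0) / a0)) + C / (b * sqrt N) + C / (sqrt a0 * sqrt N)"
          by (simp add: algebra_simps)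
        also have "\<dots> \<le> l / 2" using n(2) b(2) N1(2,3) by linarith
        finally show ?thesis by (simp add: sum_distrib_left)
      qed
      finally have "\<alpha>2 + l / 2 \<ge> 2 ^ (p - 1) * \<beta>2 ^ p" .
      moreover have "\<alpha>1 \<le> 2 ^ (p - 1) * \<beta>1 ^ p"
        by (rule visc_sub_jet[OF _ 2(1,3,13)]) (use sol 2(11) in \<open>auto simp: visc_sol_def\<close>)
      moreover have "\<bar>2 ^ (p - 1) * \<beta>1 ^ p - 2 ^ (p - 1) * \<beta>2 ^ p\<bar> \<le> ham_lip * \<bar>\<beta>1 - \<beta>2\<bar>"
        using D \<beta>2 2(10) par(4) by (intro ham_lip(2)) auto
      moreover have "ham_lip * \<bar>\<beta>1 - \<beta>2\<bar> \<le> ham_lip * \<kappa>" using 2(10) ham_lip(1) by (intro mult_left_mono)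
      ultimately show ?thesis using 2(9) par(1,5) by (simp add: abs_le_iff) 
    qed
  qed
qed

theorem uniform_limit:
  assumes "M \<ge> 0" "\<eta> > 0"
  shows "\<exists>N0. \<forall>N\<ge>N0. \<forall>t\<in>{0..M}. \<forall>h\<in>{0..M}. \<bar>F N t h - f t h\<bar> \<le> \<eta>"
proof -
  obtain N1 N2 where "\<forall>N\<ge>N1. \<forall>t\<in>{0..M}. \<forall>h\<in>{0..M}. F N t h - f t h \<le> \<eta>"
    "\<forall>N\<ge>N2. \<forall>t\<in>{0..M}. \<forall>h\<in>{0..M}. f t h - F N t h \<le> \<eta>"
    using upper_bound[OF assms] lower_bound[OF assms] by blast
  then show ?thesis by (intro exI[of _ "max N1 N2"]) (auto simp: abs_le_iff)
qed

end

section \<open>Gaussian measures and the Efron--Stein inequality\<close>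

lemma prob_space_gauss: "prob_space gauss"
  unfolding gauss_def by (rule prob_space_normal_density) simp

lemma sets_gauss [simp, measurable_cong]: "sets gauss = sets borel"
  and space_gauss [simp]: "space gauss = UNIV"
  unfolding gauss_def by auto

lemma gauss_moments:
  "integrable gauss (\<lambda>x. x)" "integrable gauss (\<lambda>x. x\<^sup>2)" "integrable gauss (\<lambda>x. \<bar>x\<bar>)"
  "(\<integral>x. x \<partial>gauss) = 0" "(\<integral>x. x\<^sup>2 \<partial>gauss) = 1"
proof -
  have eq: "integrable gauss f \<longleftrightarrow> integrable lborel (\<lambda>x. std_normal_density x * f x)"
    "(\<integral>x. f x \<partial>gauss) = (\<integral>x. std_normal_density x * f x \<partial>lborel)"
    if [measurable]: "f \<in> borel_measurable borel" for f :: "real \<Rightarrow> real"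
    unfolding gauss_def by (auto simp: integrable_density integral_density)
  show "integrable gauss (\<lambda>x. x)" using integrable_std_normal_moment[of 1] by (subst eq) auto
  show "integrable gauss (\<lambda>x. x\<^sup>2)" using integrable_std_normal_moment[of 2] by (subst eq) auto
  show "integrable gauss (\<lambda>x. \<bar>x\<bar>)" using integrable_std_normal_moment_abs[of 1] by (subst eq) auto
  show "(\<integral>x. x \<partial>gauss) = 0" using integral_std_normal_moment_odd[of 0] by (subst eq) auto
  show "(\<integral>x. x\<^sup>2 \<partial>gauss) = 1" using integral_std_normal_moment_even[of 1] by (subst eq) auto
qed

text \<open>The Cameron-Martin formula in one dimension: the exponential is the ratio of the shifted
  to the original density. Nonnegative integrals spare all integrability conditions.\<close>

lemma nn_integral_gauss_shift:
  assumes [measurable]: "f \<in> borel_measurable borel"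
  shows "(\<integral>\<^sup>+x. f (x + v) \<partial>gauss) = (\<integral>\<^sup>+x. ennreal (exp (v * x - v\<^sup>2 / 2)) * f x \<partial>gauss)"
proof -
  have "(\<integral>\<^sup>+x. f (x + v) \<partial>gauss) = (\<integral>\<^sup>+x. ennreal (std_normal_density x) * f (x + v) \<partial>lborel)"
    unfolding gauss_def by (subst nn_integral_density) auto
  also have "\<dots> = (\<integral>\<^sup>+x. ennreal (std_normal_density (- v + 1 * x)) * f ((- v + 1 * x) + v) \<partial>lborel)"
    by (subst nn_integral_real_affine[where c = 1 and t = "- v"]) auto
  also have "\<dots> = (\<integral>\<^sup>+x. ennreal (std_normal_density x) * (ennreal (exp (v * x - v\<^sup>2 / 2)) * f x) \<partial>lborel)"
  proof (rule nn_integral_cong)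
    fix x
    have "- (x - v)\<^sup>2 / 2 = - x\<^sup>2 / 2 + (v * x - v\<^sup>2 / 2)" by (simp add: power2_eq_square field_simps)
    then have "std_normal_density (x - v) = std_normal_density x * exp (v * x - v\<^sup>2 / 2)"
      unfolding std_normal_density_def by (simp only: exp_add)
    then show "ennreal (std_normal_density (- v + 1 * x)) * f ((- v + 1 * x) + v) =
        ennreal (std_normal_density x) * (ennreal (exp (v * x - v\<^sup>2 / 2)) * f x)"
      by (simp add: ennreal_mult mult.assoc)
  qed
  also have "\<dots> = (\<integral>\<^sup>+x. ennreal (exp (v * x - v\<^sup>2 / 2)) * f x \<partial>gauss)"
    unfolding gauss_def by (subst nn_integral_density) auto
  finally show ?thesis .
qed

lemma product_prob_space_gauss: "product_prob_space (\<lambda>_. gauss)"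
  by (rule product_prob_spaceI) (rule prob_space_gauss)

text \<open>Induction on the index set, splitting off one coordinate by Fubini. The shifted point is
  restricted to \<open>J\<close> because points of the product space are extensional
  functions.\<close>

lemma nn_integral_PiM_gauss_shift:
  assumes "finite J" "f \<in> borel_measurable (PiM J (\<lambda>_. gauss))"
  shows "(\<integral>\<^sup>+g. f (\<lambda>j\<in>J. g j + v j) \<partial>PiM J (\<lambda>_. gauss)) =
    (\<integral>\<^sup>+y. ennreal (exp (\<Sum>j\<in>J. v j * y j - (v j)\<^sup>2 / 2)) * f y \<partial>PiM J (\<lambda>_. gauss))"
  using assms
proof (induction J arbitrary: f)
  case empty
  show ?case by (simp add: PiM_empty nn_integral_count_space_finite)
next
  case (insert i I)
  interpret product_prob_space "\<lambda>_. gauss" by (rule product_prob_space_gauss)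
  note [measurable] = insert.prems
  have add_dim [measurable]: "(\<lambda>z. (fst z)(i := snd z)) \<in> measurable (PiM I (\<lambda>_. gauss) \<Otimes>\<^sub>M borel) (PiM (insert i I) (\<lambda>_. gauss))"
    using measurable_add_dim[of i I "\<lambda>_. gauss"] by (simp add: case_prod_beta cong: measurable_cong_sets)
  have upd [measurable]: "(\<lambda>y. x(i := y)) \<in> measurable borel (PiM (insert i I) (\<lambda>_. gauss))" if "x \<in> space (PiM I (\<lambda>_. gauss))" for x
    using measurable_component_update[OF that insert.hyps(2)] by (simp cong: measurable_cong_sets)
  have res: "(\<lambda>g. \<lambda>j\<in>K. g j + v j) \<in> measurable (PiM K (\<lambda>_. gauss)) (PiM K (\<lambda>_. gauss))" for K
    by (intro measurable_restrict) measurable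
  note [measurable] = res
  let ?E = "\<lambda>y. ennreal (exp (v i * y - (v i)\<^sup>2 / 2))"
  define h where "h x = (\<integral>\<^sup>+y. ?E y * f (x(i := y)) \<partial>gauss)" for x
  have h [measurable]: "h \<in> borel_measurable (PiM I (\<lambda>_. gauss))" unfolding h_def
    by (rule sigma_finite_measure.borel_measurable_nn_integral) (auto intro: prob_space_imp_sigma_finite prob_space_gauss simp: case_prod_beta)
  have "(\<integral>\<^sup>+g. f (\<lambda>j\<in>insert i I. g j + v j) \<partial>PiM (insert i I) (\<lambda>_. gauss)) =
     (\<integral>\<^sup>+x. (\<integral>\<^sup>+y. f (\<lambda>j\<in>insert i I. (x(i := y)) j + v j) \<partial>gauss) \<partial>PiM I (\<lambda>_. gauss))"
    using insert.hyps by (intro product_nn_integral_insert) measurable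
  also have "\<dots> = (\<integral>\<^sup>+x. h (\<lambda>j\<in>I. x j + v j) \<partial>PiM I (\<lambda>_. gauss))"
  proof (rule nn_integral_cong)
    fix x assume x: "x \<in> space (PiM I (\<lambda>_. gauss))"
    have "(\<lambda>j\<in>insert i I. (x(i := y)) j + v j) = (\<lambda>j\<in>I. x j + v j)(i := y + v i)" for y
      using insert.hyps(2) by (auto simp: fun_eq_iff)
    moreover have "(\<lambda>j\<in>I. x j + v j) \<in> space (PiM I (\<lambda>_. gauss))" by (auto simp: space_PiM)
    ultimately show "(\<integral>\<^sup>+y. f (\<lambda>j\<in>insert i I. (x(i := y)) j + v j) \<partial>gauss) = h (\<lambda>j\<in>I. x j + v j)"
      unfolding h_def by (subst nn_integral_gauss_shift[symmetric]) auto
  qed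
  also have "\<dots> = (\<integral>\<^sup>+x. ennreal (exp (\<Sum>j\<in>I. v j * x j - (v j)\<^sup>2 / 2)) * h x \<partial>PiM I (\<lambda>_. gauss))"
    by (rule insert.IH[OF h])
  also have "\<dots> = (\<integral>\<^sup>+x. (\<integral>\<^sup>+y. ennreal (exp (\<Sum>j\<in>insert i I. v j * (x(i := y)) j - (v j)\<^sup>2 / 2)) * f (x(i := y)) \<partial>gauss) \<partial>PiM I (\<lambda>_. gauss))"
  proof (rule nn_integral_cong)
    fix x assume [simp]: "x \<in> space (PiM I (\<lambda>_. gauss))"
    have "(\<Sum>j\<in>I. v j * (x(i := y)) j - (v j)\<^sup>2 / 2) = (\<Sum>j\<in>I. v j * x j - (v j)\<^sup>2 / 2)" for y
      using insert.hyps(2) by (intro sum.cong) auto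
    then have "exp (\<Sum>j\<in>insert i I. v j * (x(i := y)) j - (v j)\<^sup>2 / 2) =
       exp (\<Sum>j\<in>I. v j * x j - (v j)\<^sup>2 / 2) * exp (v i * y - (v i)\<^sup>2 / 2)" for y
      using insert.hyps by (simp add: exp_add)
    then show "ennreal (exp (\<Sum>j\<in>I. v j * x j - (v j)\<^sup>2 / 2)) * h x =
       (\<integral>\<^sup>+y. ennreal (exp (\<Sum>j\<in>insert i I. v j * (x(i := y)) j - (v j)\<^sup>2 / 2)) * f (x(i := y)) \<partial>gauss)"
      unfolding h_def by (subst nn_integral_cmult[symmetric]) (auto simp: ennreal_mult mult.assoc)
  qed
  also have "\<dots> = (\<integral>\<^sup>+y. ennreal (exp (\<Sum>j\<in>insert i I. v j * y j - (v j)\<^sup>2 / 2)) * f y \<partial>PiM (insert i I) (\<lambda>_. gauss))"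
    using insert.hyps by (intro product_nn_integral_insert[symmetric]) measurable
  finally show ?case .
qed

section \<open>Square integrability and variance on finite products\<close>

lemma integrable_PiM_component:
  fixes f :: "'b \<Rightarrow> real"
  assumes "\<And>i. i \<in> I \<Longrightarrow> prob_space (M i)" "i \<in> I" "integrable (M i) f"
  shows "integrable (PiM I M) (\<lambda>x. f (x i))" "(\<integral>x. f (x i) \<partial>PiM I M) = (\<integral>y. f y \<partial>M i)"
proof -
  have d: "distr (PiM I M) (M i) (\<lambda>x. x i) = M i" using assms by (intro distr_PiM_component) auto
  have [measurable]: "(\<lambda>x. x i) \<in> measurable (PiM I M) (M i)" using assms(2) by (rule measurable_component_singleton)
  have [measurable]: "f \<in> borel_measurable (M i)" using assms(3) by auto
  show "integrable (PiM I M) (\<lambda>x. f (x i))"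
    using assms(3) by (subst (asm) d[symmetric], subst (asm) integrable_distr_eq) auto
  have "(\<integral>y. f y \<partial>M i) = (\<integral>y. f y \<partial>distr (PiM I M) (M i) (\<lambda>x. x i))" by (simp only: d)
  also have "\<dots> = (\<integral>x. f (x i) \<partial>PiM I M)" by (rule integral_distr) auto
  finally show "(\<integral>x. f (x i) \<partial>PiM I M) = (\<integral>y. f y \<partial>M i)" ..
qed

text \<open>Cauchy-Schwarz for \<open>card I + 1\<close> summands, the constant \<open>C\<close>
  being one of them.\<close>

lemma sum_square_le: "(C + (\<Sum>i\<in>I. d i))\<^sup>2 \<le> (real (card I) + 1) * (C\<^sup>2 + (\<Sum>i\<in>I. (d i)\<^sup>2))"
  if "finite I" for C :: real and d :: "'i \<Rightarrow> real"
  using that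
proof (induction I arbitrary: C)
  case (insert i I)
  let ?n = "real (card I)"
  define S where "S = C + (\<Sum>i\<in>I. d i)"
  define R where "R = C\<^sup>2 + (\<Sum>i\<in>I. (d i)\<^sup>2)"
  have IH: "S\<^sup>2 \<le> (?n + 1) * R" unfolding S_def R_def by (rule insert.IH)
  have n: "?n + 1 > 0" by simp
  have "0 \<le> (S - (?n + 1) * d i)\<^sup>2 / (?n + 1)" using n by simp
  also have "\<dots> = S\<^sup>2 / (?n + 1) - 2 * S * d i + (?n + 1) * (d i)\<^sup>2"
    using n by (simp add: power2_eq_square field_simps)
  finally have "2 * S * d i \<le> S\<^sup>2 / (?n + 1) + (?n + 1) * (d i)\<^sup>2" by simp
  moreover have "S\<^sup>2 / (?n + 1) \<le> R" using IH n by (simp add: field_simps)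
  ultimately have "(S + d i)\<^sup>2 \<le> (?n + 2) * (R + (d i)\<^sup>2)"
    using IH by (simp add: power2_eq_square algebra_simps)
  then show ?case using insert.hyps unfolding S_def R_def by (simp add: algebra_simps)
qed simp

lemma integrable_PiM_growth:
  fixes f :: "('i \<Rightarrow> 'b) \<Rightarrow> real"
  assumes I: "finite I" and M: "\<And>i. i \<in> I \<Longrightarrow> prob_space (M i)"
    and d: "\<And>i. i \<in> I \<Longrightarrow> integrable (M i) (\<lambda>y. (d i y)\<^sup>2)" "\<And>i. i \<in> I \<Longrightarrow> d i \<in> borel_measurable (M i)"
    and f: "f \<in> borel_measurable (PiM I M)" "\<And>x. x \<in> space (PiM I M) \<Longrightarrow> \<bar>f x\<bar> \<le> C + (\<Sum>i\<in>I. d i (x i))"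
  shows "integrable (PiM I M) (\<lambda>x. (f x)\<^sup>2)" "integrable (PiM I M) f"
proof -
  interpret prob_space "PiM I M" using M by (rule prob_space_PiM)
  note [measurable] = f(1)
  show i2: "integrable (PiM I M) (\<lambda>x. (f x)\<^sup>2)"
  proof (rule Bochner_Integration.integrable_bound)
    show "integrable (PiM I M) (\<lambda>x. (real (card I) + 1) * (C\<^sup>2 + (\<Sum>i\<in>I. (d i (x i))\<^sup>2)))"
      using M d(1) by (intro integrable_mult_right Bochner_Integration.integrable_add integrable_const
          Bochner_Integration.integrable_sum integrable_PiM_component(1)[where f = "\<lambda>y. (d _ y)\<^sup>2"]) auto
    show "AE x in PiM I M. norm ((f x)\<^sup>2) \<le> norm ((real (card I) + 1) * (C\<^sup>2 + (\<Sum>i\<in>I. (d i (x i))\<^sup>2)))"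
    proof (rule AE_I2)
      fix x assume x: "x \<in> space (PiM I M)"
      have "\<bar>f x\<bar>\<^sup>2 \<le> (C + (\<Sum>i\<in>I. d i (x i)))\<^sup>2" using f(2)[OF x] by (intro power_mono) auto
      also have "\<dots> \<le> (real (card I) + 1) * (C\<^sup>2 + (\<Sum>i\<in>I. (d i (x i))\<^sup>2))" by (rule sum_square_le[OF I])
      finally show "norm ((f x)\<^sup>2) \<le> norm ((real (card I) + 1) * (C\<^sup>2 + (\<Sum>i\<in>I. (d i (x i))\<^sup>2)))"
        by (simp add: sum_nonneg)
    qed
  qed simp
  show "integrable (PiM I M) f" by (rule square_integrable_imp_integrable[OF f(1) i2])
qed

text \<open>The mean minimises the mean square distance to a constant, so any reference value
  \<open>c\<close> bounds the variance from above.\<close>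

lemma (in prob_space) variance_le_reference:
  fixes f :: "'a \<Rightarrow> real"
  assumes "integrable M f" "integrable M (\<lambda>x. (f x)\<^sup>2)" "integrable M (\<lambda>x. (d x)\<^sup>2)"
    "\<And>x. x \<in> space M \<Longrightarrow> \<bar>f x - c\<bar> \<le> d x"
  shows "(\<integral>x. (f x)\<^sup>2 \<partial>M) - (\<integral>x. f x \<partial>M)\<^sup>2 \<le> (\<integral>x. (d x)\<^sup>2 \<partial>M)"
proof -
  have i: "integrable M (\<lambda>x. (f x)\<^sup>2 - 2 * c * f x + c\<^sup>2)"
    using assms by auto
  have "(\<integral>x. (f x)\<^sup>2 \<partial>M) - (\<integral>x. f x \<partial>M)\<^sup>2 \<le> (\<integral>x. (f x)\<^sup>2 \<partial>M) - 2 * c * (\<integral>x. f x \<partial>M) + c\<^sup>2"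
    using zero_le_power2[of "(\<integral>x. f x \<partial>M) - c"] by (simp add: power2_eq_square algebra_simps)
  also have "\<dots> = (\<integral>x. (f x)\<^sup>2 - 2 * c * f x + c\<^sup>2 \<partial>M)" using assms by (simp add: prob_space)
  also have "\<dots> \<le> (\<integral>x. (d x)\<^sup>2 \<partial>M)"
  proof (rule integral_mono[OF i assms(3)])
    fix x assume "x \<in> space M"
    then have "\<bar>f x - c\<bar>\<^sup>2 \<le> (d x)\<^sup>2" by (intro power_mono assms(4)) auto
    then show "(f x)\<^sup>2 - 2 * c * f x + c\<^sup>2 \<le> (d x)\<^sup>2" by (simp add: power2_eq_square algebra_simps)
  qed
  finally show ?thesis .
qed

text \<open>The conditional variance in each coordinate is bounded by the second moment of the distance to
  the value at a reference point, which avoids introducing an independent copy.\<close>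

lemma efron_stein:
  fixes f :: "('i \<Rightarrow> 'b) \<Rightarrow> real"
  assumes I: "finite I" and M: "\<And>i. prob_space (M i)"
    and d: "\<And>i. integrable (M i) (\<lambda>y. (d i y)\<^sup>2)" "\<And>i. d i \<in> borel_measurable (M i)"
    and y0: "\<And>i. y0 i \<in> space (M i)"
    and f: "f \<in> borel_measurable (PiM I M)" "\<exists>C. \<forall>x\<in>space (PiM I M). \<bar>f x\<bar> \<le> C + (\<Sum>i\<in>I. d i (x i))"
    and osc: "\<And>x i y. x \<in> space (PiM I M) \<Longrightarrow> i \<in> I \<Longrightarrow> y \<in> space (M i) \<Longrightarrow>
        \<bar>f (x(i := y)) - f (x(i := y0 i))\<bar> \<le> d i y"
  shows "(\<integral>x. (f x)\<^sup>2 \<partial>PiM I M) - (\<integral>x. f x \<partial>PiM I M)\<^sup>2 \<le> (\<Sum>i\<in>I. \<integral>y. (d i y)\<^sup>2 \<partial>M i)"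
  using I f osc
proof (induction I arbitrary: f)
  case empty
  show ?case by (simp add: PiM_empty lebesgue_integral_count_space_finite power2_eq_square)
next
  case (insert k I)
  have psf: "product_sigma_finite M"
    unfolding product_sigma_finite_def using M by (blast intro: prob_space_imp_sigma_finite)
  interpret PI: prob_space "PiM I M" using M by (intro prob_space_PiM)
  note [measurable] = insert.prems(1)
  obtain C where C: "\<And>x. x \<in> space (PiM (insert k I) M) \<Longrightarrow> \<bar>f x\<bar> \<le> C + (\<Sum>i\<in>insert k I. d i (x i))"
    using insert.prems(2) by blast
  have add_dim [measurable]: "(\<lambda>z. (fst z)(k := snd z)) \<in> measurable (PiM I M \<Otimes>\<^sub>M M k) (PiM (insert k I) M)"
    using measurable_add_dim[of k I M] by (simp add: case_prod_beta)
  have spc: "x(k := y) \<in> space (PiM (insert k I) M)" if "x \<in> space (PiM I M)" "y \<in> space (M k)" for x y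
    using that by (auto simp: space_PiM PiE_iff extensional_def)
  have dint: "integrable (M k) (d k)"
  proof -
    interpret k: prob_space "M k" by (rule M)
    show ?thesis by (rule k.square_integrable_imp_integrable[OF d(2,1)])
  qed
  \<comment> \<open>Total variance: the variance of \<open>f\<close> is the mean of its conditional
    variances in coordinate \<open>k\<close> plus the variance of the partial average
    \<open>g\<close>. Growth and oscillation bounds pass from \<open>f\<close> to \<open>g\<close>,
    so the induction hypothesis applies to \<open>g\<close>.\<close>
  define g where "g x = (\<integral>y. f (x(k := y)) \<partial>M k)" for x
  have fk [measurable]: "(\<lambda>y. f (x(k := y))) \<in> borel_measurable (M k)" if "x \<in> space (PiM I M)" for x
    using measurable_comp[OF measurable_component_update[OF that insert.hyps(2)] insert.prems(1)] by (simp add: comp_def)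
  have Ck: "\<bar>f (x(k := y))\<bar> \<le> (C + (\<Sum>i\<in>I. d i (x i))) + d k y" if "x \<in> space (PiM I M)" "y \<in> space (M k)" for x y
  proof -
    have "(\<Sum>i\<in>I. d i ((x(k := y)) i)) = (\<Sum>i\<in>I. d i (x i))" using insert.hyps(2) by (intro sum.cong) auto
    then show ?thesis using C[OF spc[OF that]] insert.hyps by simp
  qed
  have fki: "integrable (M k) (\<lambda>y. f (x(k := y)))" "integrable (M k) (\<lambda>y. (f (x(k := y)))\<^sup>2)" if x: "x \<in> space (PiM I M)" for x
  proof -
    interpret k: prob_space "M k" by (rule M)
    show "integrable (M k) (\<lambda>y. (f (x(k := y)))\<^sup>2)"
    proof (rule Bochner_Integration.integrable_bound)
      show "integrable (M k) (\<lambda>y. ((C + (\<Sum>i\<in>I. d i (x i))) + d k y)\<^sup>2)"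
        using dint d(1)[of k] by (simp add: power2_sum)
      show "AE y in M k. norm ((f (x(k := y)))\<^sup>2) \<le> norm (((C + (\<Sum>i\<in>I. d i (x i))) + d k y)\<^sup>2)"
      proof (rule AE_I2)
        fix y assume "y \<in> space (M k)"
        then have "\<bar>f (x(k := y))\<bar>\<^sup>2 \<le> ((C + (\<Sum>i\<in>I. d i (x i))) + d k y)\<^sup>2"
          by (intro power_mono Ck[OF x]) auto
        then show "norm ((f (x(k := y)))\<^sup>2) \<le> norm (((C + (\<Sum>i\<in>I. d i (x i))) + d k y)\<^sup>2)" by simp
      qed
      show "(\<lambda>y. (f (x(k := y)))\<^sup>2) \<in> borel_measurable (M k)"
        by (rule borel_measurable_power[OF fk[OF x]])
    qed
    then show "integrable (M k) (\<lambda>y. f (x(k := y)))"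
      by (rule k.square_integrable_imp_integrable[OF fk[OF x]])
  qed
  have g [measurable]: "g \<in> borel_measurable (PiM I M)"
  proof -
    interpret k: prob_space "M k" by (rule M)
    show ?thesis unfolding g_def
      using measurable_compose[OF add_dim insert.prems(1)]
      by (intro k.borel_measurable_lebesgue_integral) (simp only: case_prod_beta')
  qed
  have gC: "\<exists>C. \<forall>x\<in>space (PiM I M). \<bar>g x\<bar> \<le> C + (\<Sum>i\<in>I. d i (x i))"
  proof (intro exI ballI)
    fix x assume x: "x \<in> space (PiM I M)"
    interpret k: prob_space "M k" by (rule M)
    have "\<bar>g x\<bar> \<le> (\<integral>y. \<bar>f (x(k := y))\<bar> \<partial>M k)" unfolding g_def by (rule integral_abs_bound)
    also have "\<dots> \<le> (\<integral>y. (C + (\<Sum>i\<in>I. d i (x i))) + d k y \<partial>M k)"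
      using fki[OF x] dint Ck[OF x] by (intro integral_mono) auto
    also have "\<dots> = (C + (\<integral>y. d k y \<partial>M k)) + (\<Sum>i\<in>I. d i (x i))" using dint by (simp add: k.prob_space)
    finally show "\<bar>g x\<bar> \<le> (C + (\<integral>y. d k y \<partial>M k)) + (\<Sum>i\<in>I. d i (x i))" .
  qed
  have gosc: "\<bar>g (x(i := y)) - g (x(i := y0 i))\<bar> \<le> d i y" if x: "x \<in> space (PiM I M)" and i: "i \<in> I" and y: "y \<in> space (M i)" for x i y
  proof -
    interpret k: prob_space "M k" by (rule M)
    have ki: "k \<noteq> i" using i insert.hyps by auto
    have xi: "x(i := u) \<in> space (PiM I M)" if "u \<in> space (M i)" for u
      using x i that by (auto simp: space_PiM PiE_iff extensional_def)
    have e: "g (x(i := y)) - g (x(i := y0 i)) = (\<integral>u. f (x(i := y, k := u)) - f (x(i := y0 i, k := u)) \<partial>M k)"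
      unfolding g_def using fki(1)[OF xi[OF y]] fki(1)[OF xi[OF y0]] by simp
    have "\<bar>g (x(i := y)) - g (x(i := y0 i))\<bar> \<le> (\<integral>u. \<bar>f (x(i := y, k := u)) - f (x(i := y0 i, k := u))\<bar> \<partial>M k)"
      unfolding e by (rule integral_abs_bound)
    also have "\<dots> \<le> (\<integral>u. d i y \<partial>M k)"
    proof (rule integral_mono)
      fix u assume u: "u \<in> space (M k)"
      show "\<bar>f (x(i := y, k := u)) - f (x(i := y0 i, k := u))\<bar> \<le> d i y"
        using insert.prems(3)[OF spc[OF x u] _ y] i by (simp only: fun_upd_twist[OF ki] insert_iff simp_thms)
    qed (use fki(1)[OF xi[OF y]] fki(1)[OF xi[OF y0]] in auto)
    finally show ?thesis by (simp add: k.prob_space)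
  qed
  have gint: "integrable (PiM I M) (\<lambda>x. (g x)\<^sup>2)" "integrable (PiM I M) g"
    using gC integrable_PiM_growth[OF insert.hyps(1) M d(1,2) g] by blast+
  have fint: "integrable (PiM (insert k I) M) (\<lambda>x. (f x)\<^sup>2)" "integrable (PiM (insert k I) M) f"
    using integrable_PiM_growth[of "insert k I" M d f C] insert.hyps(1) M d insert.prems(1) C by auto
  have e1: "(\<integral>x. f x \<partial>PiM (insert k I) M) = (\<integral>x. g x \<partial>PiM I M)"
    unfolding g_def by (rule product_sigma_finite.product_integral_insert[OF psf insert.hyps fint(2)])
  have e2: "(\<integral>x. (f x)\<^sup>2 \<partial>PiM (insert k I) M) = (\<integral>x. (\<integral>y. (f (x(k := y)))\<^sup>2 \<partial>M k) \<partial>PiM I M)"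
    by (rule product_sigma_finite.product_integral_insert[OF psf insert.hyps fint(1)])
  have cond: "(\<integral>y. (f (x(k := y)))\<^sup>2 \<partial>M k) \<le> (\<integral>y. (d k y)\<^sup>2 \<partial>M k) + (g x)\<^sup>2" if x: "x \<in> space (PiM I M)" for x
  proof -
    interpret k: prob_space "M k" by (rule M)
    have "(\<integral>y. (f (x(k := y)))\<^sup>2 \<partial>M k) - (\<integral>y. f (x(k := y)) \<partial>M k)\<^sup>2 \<le> (\<integral>y. (d k y)\<^sup>2 \<partial>M k)"
    proof (rule k.variance_le_reference[where c = "f (x(k := y0 k))"])
      show "\<bar>f (x(k := y)) - f (x(k := y0 k))\<bar> \<le> d k y" if y: "y \<in> space (M k)" for y
        using insert.prems(3)[OF spc[OF x y0] insertI1 y] by (simp only: fun_upd_upd)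
    qed (use fki[OF x] d in auto)
    then show ?thesis unfolding g_def by linarith
  qed
  have "(\<integral>x. (f x)\<^sup>2 \<partial>PiM (insert k I) M) \<le> (\<integral>x. (\<integral>y. (d k y)\<^sup>2 \<partial>M k) + (g x)\<^sup>2 \<partial>PiM I M)"
    unfolding e2
  proof (rule integral_mono')
    show "0 \<le> (\<integral>y. (d k y)\<^sup>2 \<partial>M k) + (g x)\<^sup>2" for x by (intro add_nonneg_nonneg) auto
  qed (use gint cond in auto)
  also have "\<dots> = (\<integral>y. (d k y)\<^sup>2 \<partial>M k) + (\<integral>x. (g x)\<^sup>2 \<partial>PiM I M)" using gint by (simp add: PI.prob_space)
  finally have "(\<integral>x. (f x)\<^sup>2 \<partial>PiM (insert k I) M) - (\<integral>x. f x \<partial>PiM (insert k I) M)\<^sup>2 \<le>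
     (\<integral>y. (d k y)\<^sup>2 \<partial>M k) + ((\<integral>x. (g x)\<^sup>2 \<partial>PiM I M) - (\<integral>x. g x \<partial>PiM I M)\<^sup>2)"
    unfolding e1 by linarith
  also have "\<dots> \<le> (\<integral>y. (d k y)\<^sup>2 \<partial>M k) + (\<Sum>i\<in>I. \<integral>y. (d i y)\<^sup>2 \<partial>M i)"
    using insert.IH[OF g gC gosc] by simp
  finally show ?case using insert.hyps by simp
qed

section \<open>Gaussian channels and the Nishimori identity\<close>

lemma (in prob_space) distr_pair_snd:
  assumes "sigma_finite_measure N"
  shows "distr (M \<Otimes>\<^sub>M N) N snd = N"
proof (intro measure_eqI)
  interpret N: sigma_finite_measure N by fact
  fix A assume A: "A \<in> sets (distr (M \<Otimes>\<^sub>M N) N snd)"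
  then have "emeasure (distr (M \<Otimes>\<^sub>M N) N snd) A = emeasure (M \<Otimes>\<^sub>M N) (space M \<times> A)"
    by (auto simp add: emeasure_distr space_pair_measure dest: sets.sets_into_space intro!: arg_cong2[where f=emeasure])
  with A show "emeasure (distr (M \<Otimes>\<^sub>M N) N snd) A = emeasure N A"
    by (simp add: N.emeasure_pair_measure_Times emeasure_space_1)
qed simp

text \<open>The logarithm of an exponential integral is monotone in the exponent and follows
  additive constants, hence it is nonexpansive for the uniform distance of exponents.\<close>

lemma abs_ln_integral_exp_diff:
  fixes E1 E2 :: "'a \<Rightarrow> real"
  assumes "prob_space M" and int: "integrable M (\<lambda>x. exp (E1 x))" "integrable M (\<lambda>x. exp (E2 x))"
    and pos: "(\<integral>x. exp (E1 x) \<partial>M) > 0" "(\<integral>x. exp (E2 x) \<partial>M) > 0"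
    and e: "\<And>x. x \<in> space M \<Longrightarrow> \<bar>E1 x - E2 x\<bar> \<le> e"
  shows "\<bar>ln (\<integral>x. exp (E1 x) \<partial>M) - ln (\<integral>x. exp (E2 x) \<partial>M)\<bar> \<le> e"
proof -
  have 1: "ln (\<integral>x. exp (F x) \<partial>M) \<le> e + ln (\<integral>x. exp (G x) \<partial>M)"
    if "integrable M (\<lambda>x. exp (F x))" "integrable M (\<lambda>x. exp (G x))"
      "(\<integral>x. exp (F x) \<partial>M) > 0" "(\<integral>x. exp (G x) \<partial>M) > 0" "\<And>x. x \<in> space M \<Longrightarrow> F x \<le> e + G x"
    for F G :: "'a \<Rightarrow> real"
  proof -
    have "(\<integral>x. exp (F x) \<partial>M) \<le> (\<integral>x. exp e * exp (G x) \<partial>M)"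
      using that by (intro integral_mono integrable_mult_right) (auto simp flip: exp_add)
    also have "\<dots> = exp e * (\<integral>x. exp (G x) \<partial>M)" by simp
    finally have "ln (\<integral>x. exp (F x) \<partial>M) \<le> ln (exp e * (\<integral>x. exp (G x) \<partial>M))"
      using that(3) by simp
    also have "\<dots> = e + ln (\<integral>x. exp (G x) \<partial>M)" using that(4) by (subst ln_mult) auto
    finally show ?thesis .
  qed
  have "ln (\<integral>x. exp (E1 x) \<partial>M) \<le> e + ln (\<integral>x. exp (E2 x) \<partial>M)"
    by (rule 1[OF int pos]) (use e in \<open>fastforce simp: abs_le_iff\<close>)
  moreover have "ln (\<integral>x. exp (E2 x) \<partial>M) \<le> e + ln (\<integral>x. exp (E1 x) \<partial>M)"
    by (rule 1[OF int(2,1) pos(2,1)]) (use e in \<open>fastforce simp: abs_le_iff\<close>)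
  ultimately show ?thesis by linarith
qed

text \<open>A signal \<open>x\<close> of law \<open>Q\<close> is observed through \<open>dat \<theta> j = g j + \<theta> j * a j x\<close> with Gaussian noise \<open>g\<close>; \<open>S\<close> is
  the law of signal and noise, \<open>En\<close> the logarithm of the likelihood ratio, \<open>Gm\<close> the posterior (Gibbs) measure,
  and \<open>T\<close> the joint law of signal, noise and one sample of \<open>Gm\<close>. All strengths \<open>\<theta>\<close> are coupled
  through the same signal and noise.\<close>

locale channel = prob_space Q for Q :: "'x measure" +
  fixes J :: "'j set" and a :: "'j \<Rightarrow> 'x \<Rightarrow> real" and B :: real
  assumes finite_J: "finite J" and a_meas [measurable]: "\<And>j. a j \<in> borel_measurable Q"
    and a_bound: "\<And>j x. \<bar>a j x\<bar> \<le> B" and B: "B \<ge> 0"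
begin

abbreviation "G \<equiv> PiM J (\<lambda>_::'j. gauss)"
abbreviation "S \<equiv> Q \<Otimes>\<^sub>M G"

sublocale G: prob_space G by (rule prob_space_PiM) (rule prob_space_gauss)
sublocale S: pair_prob_space Q G ..
sublocale SQ: pair_prob_space S Q ..

definition En :: "('j \<Rightarrow> real) \<Rightarrow> ('j \<Rightarrow> real) \<Rightarrow> 'x \<Rightarrow> real" where
  "En \<theta> y x = (\<Sum>j\<in>J. \<theta> j * y j * a j x - (\<theta> j)\<^sup>2 * (a j x)\<^sup>2 / 2)"

definition bnd :: "('j \<Rightarrow> real) \<Rightarrow> ('j \<Rightarrow> real) \<Rightarrow> real" where
  "bnd \<theta> y = (\<Sum>j\<in>J. B * \<bar>\<theta> j\<bar> * \<bar>y j\<bar> + B\<^sup>2 * (\<theta> j)\<^sup>2 / 2)"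

lemma a_square_bound: "(a j x)\<^sup>2 \<le> B\<^sup>2"
  using power_mono[OF a_bound[of j x] abs_ge_zero, of 2] by simp

lemma En_bound: "\<bar>En \<theta> y x\<bar> \<le> bnd \<theta> y"
  unfolding En_def bnd_def
proof (rule order_trans[OF sum_abs sum_mono])
  fix j
  have "\<bar>\<theta> j * y j * a j x\<bar> \<le> B * \<bar>\<theta> j\<bar> * \<bar>y j\<bar>"
    using mult_left_mono[OF a_bound[of j x], of "\<bar>\<theta> j\<bar> * \<bar>y j\<bar>"] by (simp add: abs_mult mult_ac)
  moreover have "(\<theta> j)\<^sup>2 * (a j x)\<^sup>2 \<le> B\<^sup>2 * (\<theta> j)\<^sup>2"
    using mult_left_mono[OF a_square_bound[of j x], of "(\<theta> j)\<^sup>2"] by (simp add: mult_ac)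
  moreover have "0 \<le> (\<theta> j)\<^sup>2 * (a j x)\<^sup>2" by simp
  ultimately show "\<bar>\<theta> j * y j * a j x - (\<theta> j)\<^sup>2 * (a j x)\<^sup>2 / 2\<bar> \<le> B * \<bar>\<theta> j\<bar> * \<bar>y j\<bar> + B\<^sup>2 * (\<theta> j)\<^sup>2 / 2"
    by linarith
qed

lemma component_G [measurable (raw)]:
  assumes "j \<in> J" "f \<in> measurable M G"
  shows "(\<lambda>\<omega>. f \<omega> j) \<in> borel_measurable M"
proof -
  have "(\<lambda>y. y j) \<in> measurable G gauss" using assms(1) by (rule measurable_component_singleton)
  from measurable_compose[OF assms(2) this] show ?thesis by (simp cong: measurable_cong_sets)
qed

lemma En_measurable [measurable (raw)]:
  assumes [measurable]: "f \<in> measurable M G" "h \<in> measurable M Q"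
  shows "(\<lambda>\<omega>. En \<theta> (f \<omega>) (h \<omega>)) \<in> borel_measurable M"
  unfolding En_def by measurable

lemma En_measurable_Q [measurable]: "(\<lambda>x. En \<theta> y x) \<in> borel_measurable Q"
  unfolding En_def by measurable

definition Z :: "('j \<Rightarrow> real) \<Rightarrow> ('j \<Rightarrow> real) \<Rightarrow> real" where
  "Z \<theta> y = (\<integral>x. exp (En \<theta> y x) \<partial>Q)"

definition LZ :: "('j \<Rightarrow> real) \<Rightarrow> ('j \<Rightarrow> real) \<Rightarrow> real" where
  "LZ \<theta> y = ln (Z \<theta> y)"

lemma exp_En_integrable: "integrable Q (\<lambda>x. exp (En \<theta> y x))"
  by (rule integrable_const_bound[where B = "exp (bnd \<theta> y)"]) (use En_bound[of \<theta> y] in \<open>auto simp: abs_le_iff\<close>)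

lemma Z_pos: "Z \<theta> y > 0"
proof -
  have "exp (- bnd \<theta> y) \<le> Z \<theta> y"
    unfolding Z_def using En_bound[of \<theta> y] 
    by (intro integral_ge_const[OF exp_En_integrable] AE_I2) (auto simp: abs_le_iff minus_le_iff)
  then show ?thesis using exp_gt_zero[of "- bnd \<theta> y"] by linarith
qed

lemma LZ_diff:
  assumes "\<And>x. x \<in> space Q \<Longrightarrow> \<bar>En \<theta> y x - En \<theta>' y' x\<bar> \<le> e"
  shows "\<bar>LZ \<theta> y - LZ \<theta>' y'\<bar> \<le> e"
  unfolding LZ_def Z_def
  by (rule abs_ln_integral_exp_diff[OF prob_space_axioms exp_En_integrable exp_En_integrable
      Z_pos[unfolded Z_def] Z_pos[unfolded Z_def] assms])

lemma LZ_bound: "\<bar>LZ \<theta> y\<bar> \<le> bnd \<theta> y"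
proof -
  have "LZ (\<lambda>_. 0) y = 0" unfolding LZ_def Z_def En_def by (simp add: prob_space)
  moreover have "\<bar>LZ \<theta> y - LZ (\<lambda>_. 0) y\<bar> \<le> bnd \<theta> y"
    by (rule LZ_diff) (use En_bound[of \<theta> y] in \<open>simp add: En_def\<close>)
  ultimately show ?thesis by simp
qed

lemma Z_measurable [measurable (raw)]:
  assumes [measurable]: "f \<in> measurable M G"
  shows "(\<lambda>\<omega>. Z \<theta> (f \<omega>)) \<in> borel_measurable M"
  unfolding Z_def by measurable

lemma LZ_measurable [measurable (raw)]:
  assumes [measurable]: "f \<in> measurable M G"
  shows "(\<lambda>\<omega>. LZ \<theta> (f \<omega>)) \<in> borel_measurable M"
  unfolding LZ_def by measurable

definition wt :: "('j \<Rightarrow> real) \<Rightarrow> ('j \<Rightarrow> real) \<Rightarrow> 'x \<Rightarrow> real" where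
  "wt \<theta> y x = exp (En \<theta> y x) / Z \<theta> y"

lemma wt_nonneg: "wt \<theta> y x \<ge> 0" unfolding wt_def using Z_pos[of \<theta> y] by simp

lemma wt_measurable [measurable (raw)]:
  assumes [measurable]: "f \<in> measurable M G" "h \<in> measurable M Q"
  shows "(\<lambda>\<omega>. wt \<theta> (f \<omega>) (h \<omega>)) \<in> borel_measurable M"
  unfolding wt_def by measurable

lemma wt_measurable_Q [measurable]: "wt \<theta> y \<in> borel_measurable Q"
  unfolding wt_def[abs_def] by measurable

lemma nn_integral_wt: "(\<integral>\<^sup>+x. ennreal (wt \<theta> y x) \<partial>Q) = 1"
proof -
  have "(\<integral>\<^sup>+x. ennreal (wt \<theta> y x) \<partial>Q) = ennreal (\<integral>x. wt \<theta> y x \<partial>Q)"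
    unfolding wt_def using exp_En_integrable[of \<theta> y] Z_pos[of \<theta> y]
    by (intro nn_integral_eq_integral) (auto intro!: AE_I2 divide_nonneg_pos)
  also have "(\<integral>x. wt \<theta> y x \<partial>Q) = 1" unfolding wt_def using Z_pos[of \<theta> y] by (simp add: Z_def)
  finally show ?thesis by simp
qed

definition Gm :: "('j \<Rightarrow> real) \<Rightarrow> ('j \<Rightarrow> real) \<Rightarrow> 'x measure" where
  "Gm \<theta> y = density Q (\<lambda>x. ennreal (wt \<theta> y x))"

lemma prob_space_Gm: "prob_space (Gm \<theta> y)"
  unfolding Gm_def by (rule prob_spaceI) (simp add: emeasure_density nn_integral_wt cong: nn_integral_cong)

lemma sets_Gm [simp, measurable_cong]: "sets (Gm \<theta> y) = sets Q" and space_Gm [simp]: "space (Gm \<theta> y) = space Q"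
  unfolding Gm_def by auto

definition dat :: "('j \<Rightarrow> real) \<Rightarrow> 'x \<times> ('j \<Rightarrow> real) \<Rightarrow> 'j \<Rightarrow> real" where
  "dat \<theta> s = (\<lambda>j\<in>J. snd s j + \<theta> j * a j (fst s))"

lemma dat_measurable [measurable]: "dat \<theta> \<in> measurable S G"
  unfolding dat_def[abs_def] by (intro measurable_restrict) measurable

definition T :: "('j \<Rightarrow> real) \<Rightarrow> (('x \<times> ('j \<Rightarrow> real)) \<times> 'x) measure" where
  "T \<theta> = density (S \<Otimes>\<^sub>M Q) (\<lambda>z. ennreal (wt \<theta> (dat \<theta> (fst z)) (snd z)))"

lemma sets_T [simp, measurable_cong]: "sets (T \<theta>) = sets (S \<Otimes>\<^sub>M Q)" and space_T [simp]: "space (T \<theta>) = space (S \<Otimes>\<^sub>M Q)"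
  unfolding T_def by auto

lemma nn_integral_T:
  assumes [measurable]: "F \<in> borel_measurable (S \<Otimes>\<^sub>M Q)"
  shows "(\<integral>\<^sup>+z. F z \<partial>T \<theta>) = (\<integral>\<^sup>+s. (\<integral>\<^sup>+x. ennreal (wt \<theta> (dat \<theta> s) x) * F (s, x) \<partial>Q) \<partial>S)"
  unfolding T_def by (simp add: nn_integral_density nn_integral_fst[symmetric])

lemma distr_T_fst: "distr (T \<theta>) S fst = S"
proof (rule measure_eqI)
  fix A assume "A \<in> sets (distr (T \<theta>) S fst)"
  then have [measurable]: "A \<in> sets S" by simp
  have "emeasure (distr (T \<theta>) S fst) A = (\<integral>\<^sup>+z. indicator A z \<partial>distr (T \<theta>) S fst)" by simp
  also have "\<dots> = (\<integral>\<^sup>+z. indicator A (fst z) \<partial>T \<theta>)" by (subst nn_integral_distr) auto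
  also have "\<dots> = (\<integral>\<^sup>+s. (\<integral>\<^sup>+x. ennreal (wt \<theta> (dat \<theta> s) x) * indicator A s \<partial>Q) \<partial>S)"
    by (subst nn_integral_T) auto
  also have "\<dots> = (\<integral>\<^sup>+s. indicator A s \<partial>S)"
  proof (rule nn_integral_cong)
    fix s assume "s \<in> space S"
    then show "(\<integral>\<^sup>+x. ennreal (wt \<theta> (dat \<theta> s) x) * indicator A s \<partial>Q) = indicator A s"
      by (subst nn_integral_multc) (auto simp: nn_integral_wt)
  qed
  finally show "emeasure (distr (T \<theta>) S fst) A = emeasure S A" by simp
qed simp

lemma prob_space_T: "prob_space (T \<theta>)"
proof -
  have "emeasure (T \<theta>) (space (T \<theta>)) = emeasure (distr (T \<theta>) S fst) (space S)"
    by (subst emeasure_distr) (auto intro!: arg_cong2[where f = emeasure] simp: space_pair_measure)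
  then show ?thesis unfolding distr_T_fst by (intro prob_spaceI) (simp add: S.emeasure_space_1)
qed

text \<open>Shifting the noise by the signal makes the data \<open>y\<close> the integration
  variable. The likelihood of the signal and the Gibbs weight of the sample then appear as the same
  factor \<open>exp (En \<theta> y _)\<close>, so the joint weight is symmetric in signal and
  sample: the source of the Nishimori identity.\<close>

lemma nn_integral_T_canonical:
  assumes [measurable]: "F \<in> borel_measurable (S \<Otimes>\<^sub>M Q)"
  shows "(\<integral>\<^sup>+z. F z \<partial>T \<theta>) = (\<integral>\<^sup>+y. (\<integral>\<^sup>+xb. (\<integral>\<^sup>+x.
     ennreal (exp (En \<theta> y xb) * exp (En \<theta> y x) / Z \<theta> y) * F ((xb, \<lambda>j\<in>J. y j - \<theta> j * a j xb), x) \<partial>Q) \<partial>Q) \<partial>G)"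
proof -
  have [measurable]: "(\<lambda>z. \<lambda>j\<in>J. f z j - \<theta> j * a j (g z)) \<in> measurable M G"
    if [measurable]: "f \<in> measurable M G" "g \<in> measurable M Q" for f g M
    by (intro measurable_restrict) measurable
  have "(\<integral>\<^sup>+z. F z \<partial>T \<theta>) = (\<integral>\<^sup>+xb. (\<integral>\<^sup>+g. (\<integral>\<^sup>+x. ennreal (wt \<theta> (dat \<theta> (xb, g)) x) * F ((xb, g), x) \<partial>Q) \<partial>G) \<partial>Q)"
    by (simp add: nn_integral_T G.nn_integral_fst[symmetric])
  also have "\<dots> = (\<integral>\<^sup>+xb. (\<integral>\<^sup>+y. (\<integral>\<^sup>+x.
     ennreal (exp (En \<theta> y xb) * exp (En \<theta> y x) / Z \<theta> y) * F ((xb, \<lambda>j\<in>J. y j - \<theta> j * a j xb), x) \<partial>Q) \<partial>G) \<partial>Q)"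
  proof (rule nn_integral_cong)
    fix xb assume xb [measurable]: "xb \<in> space Q"
    define f where "f y = (\<integral>\<^sup>+x. ennreal (wt \<theta> y x) * F ((xb, \<lambda>j\<in>J. y j - \<theta> j * a j xb), x) \<partial>Q)" for y
    have f [measurable]: "f \<in> borel_measurable G" unfolding f_def using xb by measurable
    have "(\<integral>\<^sup>+g. (\<integral>\<^sup>+x. ennreal (wt \<theta> (dat \<theta> (xb, g)) x) * F ((xb, g), x) \<partial>Q) \<partial>G) =
       (\<integral>\<^sup>+g. f (\<lambda>j\<in>J. g j + \<theta> j * a j xb) \<partial>G)"
    proof (rule nn_integral_cong)
      fix g assume g: "g \<in> space G"
      have "(\<lambda>j\<in>J. (\<lambda>j\<in>J. g j + \<theta> j * a j xb) j - \<theta> j * a j xb) = g"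
        using g by (auto simp: space_PiM PiE_iff extensional_def fun_eq_iff)
      moreover have "dat \<theta> (xb, g) = (\<lambda>j\<in>J. g j + \<theta> j * a j xb)" by (simp add: dat_def)
      ultimately show "(\<integral>\<^sup>+x. ennreal (wt \<theta> (dat \<theta> (xb, g)) x) * F ((xb, g), x) \<partial>Q) = f (\<lambda>j\<in>J. g j + \<theta> j * a j xb)"
        unfolding f_def by simp
    qed
    also have "\<dots> = (\<integral>\<^sup>+y. ennreal (exp (\<Sum>j\<in>J. \<theta> j * a j xb * y j - (\<theta> j * a j xb)\<^sup>2 / 2)) * f y \<partial>G)"
      by (rule nn_integral_PiM_gauss_shift[OF finite_J f])
    also have "\<dots> = (\<integral>\<^sup>+y. (\<integral>\<^sup>+x.
       ennreal (exp (En \<theta> y xb) * exp (En \<theta> y x) / Z \<theta> y) * F ((xb, \<lambda>j\<in>J. y j - \<theta> j * a j xb), x) \<partial>Q) \<partial>G)"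
    proof (rule nn_integral_cong)
      fix y assume y [measurable]: "y \<in> space G"
      have "(\<Sum>j\<in>J. \<theta> j * a j xb * y j - (\<theta> j * a j xb)\<^sup>2 / 2) = En \<theta> y xb"
        unfolding En_def by (intro sum.cong) (auto simp: power_mult_distrib mult_ac)
      moreover have "ennreal (exp (En \<theta> y xb)) * f y =
         (\<integral>\<^sup>+x. ennreal (exp (En \<theta> y xb)) * (ennreal (wt \<theta> y x) * F ((xb, \<lambda>j\<in>J. y j - \<theta> j * a j xb), x)) \<partial>Q)"
        unfolding f_def using xb y by (intro nn_integral_cmult[symmetric]) measurable
      moreover have "ennreal (exp (En \<theta> y xb)) * (ennreal (wt \<theta> y x) * c) = ennreal (exp (En \<theta> y xb) * exp (En \<theta> y x) / Z \<theta> y) * c" for x c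
        using wt_nonneg[of \<theta> y x] unfolding wt_def by (simp add: ennreal_mult[symmetric] mult.assoc[symmetric])
      ultimately show "ennreal (exp (\<Sum>j\<in>J. \<theta> j * a j xb * y j - (\<theta> j * a j xb)\<^sup>2 / 2)) * f y =
        (\<integral>\<^sup>+x. ennreal (exp (En \<theta> y xb) * exp (En \<theta> y x) / Z \<theta> y) * F ((xb, \<lambda>j\<in>J. y j - \<theta> j * a j xb), x) \<partial>Q)"
        by simp
    qed
    finally show "(\<integral>\<^sup>+g. (\<integral>\<^sup>+x. ennreal (wt \<theta> (dat \<theta> (xb, g)) x) * F ((xb, g), x) \<partial>Q) \<partial>G) = \<dots>" .
  qed
  also have "\<dots> = (\<integral>\<^sup>+y. (\<integral>\<^sup>+xb. (\<integral>\<^sup>+x.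
     ennreal (exp (En \<theta> y xb) * exp (En \<theta> y x) / Z \<theta> y) * F ((xb, \<lambda>j\<in>J. y j - \<theta> j * a j xb), x) \<partial>Q) \<partial>Q) \<partial>G)"
    by (rule S.Fubini'[symmetric]) measurable
  finally show ?thesis .
qed

text \<open>The noise is chosen so that the data stay the same when signal and Gibbs sample are exchanged.\<close>

definition sig :: "('j \<Rightarrow> real) \<Rightarrow> ('x \<times> ('j \<Rightarrow> real)) \<times> 'x \<Rightarrow> ('x \<times> ('j \<Rightarrow> real)) \<times> 'x" where
  "sig \<theta> z = ((snd z, \<lambda>j\<in>J. dat \<theta> (fst z) j - \<theta> j * a j (snd z)), fst (fst z))"

lemma sig_measurable [measurable]: "sig \<theta> \<in> measurable (S \<Otimes>\<^sub>M Q) (S \<Otimes>\<^sub>M Q)"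
proof -
  have [measurable]: "(\<lambda>z. \<lambda>j\<in>J. dat \<theta> (fst z) j - \<theta> j * a j (snd z)) \<in> measurable (S \<Otimes>\<^sub>M Q) G"
    by (intro measurable_restrict) measurable
  show ?thesis unfolding sig_def[abs_def] by measurable
qed

text \<open>In the canonical coordinates \<open>sig\<close> interchanges signal and sample at fixed
  data. The weight is symmetric in the two, and what remains is Fubini.\<close>

lemma nishimori_nn:
  assumes [measurable]: "F \<in> borel_measurable (S \<Otimes>\<^sub>M Q)"
  shows "(\<integral>\<^sup>+z. F (sig \<theta> z) \<partial>T \<theta>) = (\<integral>\<^sup>+z. F z \<partial>T \<theta>)"
proof -
  have [measurable]: "(\<lambda>z. \<lambda>j\<in>J. f z j - \<theta> j * a j (g z)) \<in> measurable M G"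
    if [measurable]: "f \<in> measurable M G" "g \<in> measurable M Q" for f g M
    by (intro measurable_restrict) measurable
  interpret QQ: pair_sigma_finite Q Q ..
  have eq: "sig \<theta> ((xb, \<lambda>j\<in>J. y j - \<theta> j * a j xb), x) = ((x, \<lambda>j\<in>J. y j - \<theta> j * a j x), xb)" for y xb x
    by (auto simp: sig_def dat_def fun_eq_iff)
  have "(\<integral>\<^sup>+z. F (sig \<theta> z) \<partial>T \<theta>) = (\<integral>\<^sup>+y. (\<integral>\<^sup>+xb. (\<integral>\<^sup>+x.
     ennreal (exp (En \<theta> y xb) * exp (En \<theta> y x) / Z \<theta> y) * F ((x, \<lambda>j\<in>J. y j - \<theta> j * a j x), xb) \<partial>Q) \<partial>Q) \<partial>G)"
    by (subst nn_integral_T_canonical) (simp_all only: eq, measurable)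
  also have "\<dots> = (\<integral>\<^sup>+y. (\<integral>\<^sup>+x. (\<integral>\<^sup>+xb.
     ennreal (exp (En \<theta> y xb) * exp (En \<theta> y x) / Z \<theta> y) * F ((x, \<lambda>j\<in>J. y j - \<theta> j * a j x), xb) \<partial>Q) \<partial>Q) \<partial>G)"
  proof (rule nn_integral_cong)
    fix y assume y [measurable]: "y \<in> space G"
    show "(\<integral>\<^sup>+xb. (\<integral>\<^sup>+x. ennreal (exp (En \<theta> y xb) * exp (En \<theta> y x) / Z \<theta> y) * F ((x, \<lambda>j\<in>J. y j - \<theta> j * a j x), xb) \<partial>Q) \<partial>Q) =
      (\<integral>\<^sup>+x. (\<integral>\<^sup>+xb. ennreal (exp (En \<theta> y xb) * exp (En \<theta> y x) / Z \<theta> y) * F ((x, \<lambda>j\<in>J. y j - \<theta> j * a j x), xb) \<partial>Q) \<partial>Q)"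
      using y by (intro QQ.Fubini') measurable
  qed
  also have "\<dots> = (\<integral>\<^sup>+z. F z \<partial>T \<theta>)" by (subst nn_integral_T_canonical) (simp_all add: mult.commute)
  finally show ?thesis .
qed

lemma distr_T_sig: "distr (T \<theta>) (T \<theta>) (sig \<theta>) = T \<theta>"
proof (rule measure_eqI)
  fix A assume "A \<in> sets (distr (T \<theta>) (T \<theta>) (sig \<theta>))"
  then have [measurable]: "A \<in> sets (S \<Otimes>\<^sub>M Q)" by simp
  have "emeasure (distr (T \<theta>) (T \<theta>) (sig \<theta>)) A = (\<integral>\<^sup>+z. indicator A z \<partial>distr (T \<theta>) (T \<theta>) (sig \<theta>))" by simp
  also have "\<dots> = (\<integral>\<^sup>+z. indicator A (sig \<theta> z) \<partial>T \<theta>)" by (subst nn_integral_distr) auto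
  also have "\<dots> = (\<integral>\<^sup>+z. indicator A z \<partial>T \<theta>)" by (rule nishimori_nn) measurable
  finally show "emeasure (distr (T \<theta>) (T \<theta>) (sig \<theta>)) A = emeasure (T \<theta>) A" by simp
qed simp

lemma nishimori:
  fixes F :: "('x \<times> ('j \<Rightarrow> real)) \<times> 'x \<Rightarrow> real"
  assumes [measurable]: "F \<in> borel_measurable (S \<Otimes>\<^sub>M Q)"
  shows "(\<integral>z. F (sig \<theta> z) \<partial>T \<theta>) = (\<integral>z. F z \<partial>T \<theta>)"
    "integrable (T \<theta>) (\<lambda>z. F (sig \<theta> z)) \<longleftrightarrow> integrable (T \<theta>) F"
proof -
  have "(\<integral>z. F z \<partial>T \<theta>) = (\<integral>z. F z \<partial>distr (T \<theta>) (T \<theta>) (sig \<theta>))" by (simp only: distr_T_sig)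
  also have "\<dots> = (\<integral>z. F (sig \<theta> z) \<partial>T \<theta>)" by (rule integral_distr) auto
  finally show "(\<integral>z. F (sig \<theta> z) \<partial>T \<theta>) = (\<integral>z. F z \<partial>T \<theta>)" ..
  have "integrable (T \<theta>) F \<longleftrightarrow> integrable (distr (T \<theta>) (T \<theta>) (sig \<theta>)) F" by (simp only: distr_T_sig)
  also have "\<dots> \<longleftrightarrow> integrable (T \<theta>) (\<lambda>z. F (sig \<theta> z))" by (rule integrable_distr_eq) auto
  finally show "integrable (T \<theta>) (\<lambda>z. F (sig \<theta> z)) \<longleftrightarrow> integrable (T \<theta>) F" ..
qed

end

section \<open>Large deviations of the Gibbs measure\<close>

text \<open>The middle claim is Jensen, obtained from \<open>exp x \<ge> 1 + x\<close> at the
  normalised exponent. For the last, the positive part is dominated by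
  \<open>ln (1 + exp (D x - c))\<close>, whose mean is controlled by concavity of the logarithm. The
  price is an additive \<open>ln 2\<close>, whatever the size \<open>b\<close> of \<open>D\<close>,
  and this becomes negligible after division by \<open>N\<close>.\<close>

lemma (in prob_space) gibbs_bounds:
  fixes D :: "'a \<Rightarrow> real"
  assumes [measurable]: "D \<in> borel_measurable M" and b: "\<And>x. x \<in> space M \<Longrightarrow> \<bar>D x\<bar> \<le> b"
  shows "integrable M D" "(\<integral>x. D x \<partial>M) \<le> ln (\<integral>x. exp (D x) \<partial>M)"
    "(\<integral>x. max 0 (D x - c) \<partial>M) \<le> ln 2 + max 0 (ln (\<integral>x. exp (D x) \<partial>M) - c)"
proof -
  have bD: "D x \<le> b" "- b \<le> D x" if "x \<in> space M" for x using b[OF that] by auto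
  show iD: "integrable M D" by (rule integrable_const_bound[where B = b]) (use b in \<open>auto intro!: AE_I2\<close>)
  have iE: "integrable M (\<lambda>x. exp (D x))"
    by (rule integrable_const_bound[where B = "exp b"]) (use bD in \<open>auto intro!: AE_I2\<close>)
  have "exp (- b) \<le> (\<integral>x. exp (D x) \<partial>M)"
    using bD by (intro integral_ge_const[OF iE] AE_I2) auto
  then have pos: "(\<integral>x. exp (D x) \<partial>M) > 0" using exp_gt_zero[of "- b"] by linarith
  define l where "l = ln (\<integral>x. exp (D x) \<partial>M)"
  have el: "exp l = (\<integral>x. exp (D x) \<partial>M)" unfolding l_def using pos by simp
  have iS: "integrable M (\<lambda>x. exp (D x - k))" "(\<integral>x. exp (D x - k) \<partial>M) = exp (l - k)" for k
    using iE by (auto simp: exp_diff el)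
  have "(\<integral>x. D x - l + 1 \<partial>M) \<le> (\<integral>x. exp (D x - l) \<partial>M)"
    using iD iS by (intro integral_mono) (auto simp: add.commute)
  then show "(\<integral>x. D x \<partial>M) \<le> ln (\<integral>x. exp (D x) \<partial>M)"
    using iD by (simp add: iS prob_space flip: l_def)
  \<comment> \<open>\<open>U\<close> is the mean of \<open>exp (D x - c)\<close>; with the tangent
    to the logarithm at \<open>1 + U\<close> the linear term integrates to zero.\<close>
  define U where "U = exp (l - c)"
  have U: "U > 0" unfolding U_def by simp
  have iM: "integrable M (\<lambda>x. max 0 (D x - c))" using iD by auto
  have "(\<integral>x. max 0 (D x - c) \<partial>M) \<le> (\<integral>x. ln (1 + U) + (exp (D x - c) - U) / (1 + U) \<partial>M)"
  proof (rule integral_mono[OF iM])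
    fix x
    have pos1: "1 + exp (D x - c) > 0" by (intro add_pos_pos) auto
    have "max 0 (D x - c) \<le> ln (1 + exp (D x - c))"
    proof (rule max.boundedI)
      show "0 \<le> ln (1 + exp (D x - c))" by simp
      have "ln (exp (D x - c)) \<le> ln (1 + exp (D x - c))" using pos1 by (subst ln_le_cancel_iff) auto
      then show "D x - c \<le> ln (1 + exp (D x - c))" by simp
    qed
    also have "\<dots> - ln (1 + U) = ln ((1 + exp (D x - c)) / (1 + U))" using U pos1 by (subst ln_div) auto
    also have "\<dots> \<le> (1 + exp (D x - c)) / (1 + U) - 1" using U pos1 by (intro ln_le_minus_one) auto
    also have "\<dots> = (exp (D x - c) - U) / (1 + U)" using U by (simp add: field_simps)
    finally show "max 0 (D x - c) \<le> ln (1 + U) + (exp (D x - c) - U) / (1 + U)" by linarith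
  qed (use iS in auto)
  also have "\<dots> = ln (1 + U)" using iS by (simp add: prob_space U_def)
  also have "\<dots> \<le> ln 2 + max 0 (l - c)"
  proof (cases "U \<le> 1")
    case True
    then have "ln (1 + U) \<le> ln 2" using U by (subst ln_le_cancel_iff) auto
    then show ?thesis by linarith
  next
    case False
    then have "ln (1 + U) \<le> ln (2 * U)" using U by (subst ln_le_cancel_iff) auto
    also have "\<dots> = ln 2 + (l - c)" using U by (subst ln_mult) (auto simp: U_def)
    finally show ?thesis by linarith
  qed
  finally show "(\<integral>x. max 0 (D x - c) \<partial>M) \<le> ln 2 + max 0 (ln (\<integral>x. exp (D x) \<partial>M) - c)" by (simp add: l_def)
qed

lemma abs_exp_diff_le:
  fixes u v :: real assumes "\<bar>u - v\<bar> \<le> e"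
  shows "\<bar>exp u - exp v\<bar> \<le> (exp e - 1) * exp v"
proof -
  have "exp u = exp (u - v) * exp v" by (simp flip: exp_add)
  then have 1: "exp u - exp v = (exp (u - v) - 1) * exp v" by (simp add: algebra_simps)
  have "exp (u - v) \<le> exp e" "exp (- e) \<le> exp (u - v)" using assms by (auto simp: abs_le_iff)
  moreover have "1 - exp (- e) \<le> exp e - 1"
    using exp_ge_add_one_self[of e] exp_ge_add_one_self[of "- e"] by linarith
  ultimately have "\<bar>exp (u - v) - 1\<bar> \<le> exp e - 1" by linarith
  then have "\<bar>exp (u - v) - 1\<bar> * exp v \<le> (exp e - 1) * exp v" by (intro mult_right_mono) auto
  moreover have "\<bar>exp u - exp v\<bar> = \<bar>exp (u - v) - 1\<bar> * exp v" unfolding 1 by (simp add: abs_mult)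
  ultimately show ?thesis by simp
qed

context channel begin

lemma integrable_S_snd:
  fixes f :: "_ \<Rightarrow> real"
  assumes "integrable G f"
  shows "integrable S (\<lambda>s. f (snd s))" "(\<integral>s. f (snd s) \<partial>S) = (\<integral>g. f g \<partial>G)"
proof -
  have d: "distr S G snd = G" by (rule distr_pair_snd) (rule G.sigma_finite_measure_axioms)
  have [measurable]: "f \<in> borel_measurable G" using assms by auto
  have "integrable (distr S G snd) f" unfolding d by (rule assms)
  then show "integrable S (\<lambda>s. f (snd s))" by (subst (asm) integrable_distr_eq) auto
  have "(\<integral>g. f g \<partial>G) = (\<integral>g. f g \<partial>distr S G snd)" unfolding d ..
  also have "\<dots> = (\<integral>s. f (snd s) \<partial>S)" by (rule integral_distr) auto
  finally show "(\<integral>s. f (snd s) \<partial>S) = (\<integral>g. f g \<partial>G)" ..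
qed

lemma gauss_component:
  assumes "j \<in> J"
  shows "integrable G (\<lambda>g. g j)" "integrable G (\<lambda>g. \<bar>g j\<bar>)" "integrable G (\<lambda>g. (g j)\<^sup>2)"
    "(\<integral>g. g j \<partial>G) = 0" "(\<integral>g. (g j)\<^sup>2 \<partial>G) = 1"
  using integrable_PiM_component[of J "\<lambda>_. gauss" j "\<lambda>x. x"] integrable_PiM_component[of J "\<lambda>_. gauss" j "\<lambda>x. \<bar>x\<bar>"]
    integrable_PiM_component[of J "\<lambda>_. gauss" j "\<lambda>x. x\<^sup>2"] assms gauss_moments prob_space_gauss by auto

lemma bnd_dat_le:
  "bnd \<theta> (dat \<theta> s) \<le> (\<Sum>j\<in>J. 2 * (B\<^sup>2 * (\<theta> j)\<^sup>2)) + (\<Sum>j\<in>J. (B * \<bar>\<theta> j\<bar>) * \<bar>snd s j\<bar>)"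
  unfolding bnd_def sum.distrib[symmetric]
proof (rule sum_mono)
  fix j assume j: "j \<in> J"
  have "\<bar>dat \<theta> s j\<bar> \<le> \<bar>snd s j\<bar> + \<bar>\<theta> j\<bar> * B"
    using j abs_triangle_ineq[of "snd s j" "\<theta> j * a j (fst s)"] mult_left_mono[OF a_bound[of j "fst s"], of "\<bar>\<theta> j\<bar>"]
    by (simp add: dat_def abs_mult)
  then have "B * \<bar>\<theta> j\<bar> * \<bar>dat \<theta> s j\<bar> \<le> B * \<bar>\<theta> j\<bar> * (\<bar>snd s j\<bar> + \<bar>\<theta> j\<bar> * B)" using B by (intro mult_left_mono) auto
  also have "\<dots> = B * \<bar>\<theta> j\<bar> * \<bar>snd s j\<bar> + B\<^sup>2 * (\<theta> j)\<^sup>2" by (simp add: algebra_simps power2_eq_square)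
  finally show "B * \<bar>\<theta> j\<bar> * \<bar>dat \<theta> s j\<bar> + B\<^sup>2 * (\<theta> j)\<^sup>2 / 2 \<le> 2 * (B\<^sup>2 * (\<theta> j)\<^sup>2) + B * \<bar>\<theta> j\<bar> * \<bar>snd s j\<bar>"
    using mult_nonneg_nonneg[OF zero_le_power2[of B] zero_le_power2[of "\<theta> j"]] by linarith
qed

lemma integrable_S_linear: "integrable S (\<lambda>s. C + (\<Sum>j\<in>J. c j * \<bar>snd s j\<bar>))"
  by (intro Bochner_Integration.integrable_add Bochner_Integration.integrable_sum integrable_mult_right
      integrable_S_snd(1)[where f = "\<lambda>g. \<bar>g _\<bar>"] gauss_component) auto

lemma bnd_measurable [measurable (raw)]:
  assumes [measurable]: "f \<in> measurable M G"
  shows "(\<lambda>\<omega>. bnd \<theta> (f \<omega>)) \<in> borel_measurable M"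
  unfolding bnd_def by measurable

lemma integrable_bnd_dat: "integrable S (\<lambda>s. bnd \<theta> (dat \<theta> s))"
proof (rule Bochner_Integration.integrable_bound[OF integrable_S_linear])
  have "0 \<le> bnd \<theta> y" for y unfolding bnd_def using B by (intro sum_nonneg) auto
  then show "AE s in S. norm (bnd \<theta> (dat \<theta> s)) \<le> norm ((\<Sum>j\<in>J. 2 * (B\<^sup>2 * (\<theta> j)\<^sup>2)) + (\<Sum>j\<in>J. (B * \<bar>\<theta> j\<bar>) * \<bar>snd s j\<bar>))"
    using order_trans[OF bnd_dat_le abs_ge_self] by (intro AE_I2) (simp add: abs_of_nonneg)
qed measurable

definition FE :: "('j \<Rightarrow> real) \<Rightarrow> 'x \<times> ('j \<Rightarrow> real) \<Rightarrow> real" where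
  "FE \<theta> s = LZ \<theta> (dat \<theta> s)"

lemma FE_measurable [measurable]: "FE \<theta> \<in> borel_measurable S"
  unfolding FE_def[abs_def] by measurable

lemma integrable_FE: "integrable S (FE \<theta>)"
  by (rule Bochner_Integration.integrable_bound[OF integrable_bnd_dat])
    (use order_trans[OF LZ_bound abs_ge_self] in \<open>auto simp: FE_def\<close>)

definition mFE :: "('j \<Rightarrow> real) \<Rightarrow> real" where "mFE \<theta> = (\<integral>s. FE \<theta> s \<partial>S)"

definition flucts :: "('j \<Rightarrow> real) \<Rightarrow> real" where "flucts \<theta> = (\<integral>s. \<bar>FE \<theta> s - mFE \<theta>\<bar> \<partial>S)"

lemma T_integrable:
  fixes F :: "('x \<times> ('j \<Rightarrow> real)) \<times> 'x \<Rightarrow> real"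
  assumes [measurable]: "F \<in> borel_measurable (S \<Otimes>\<^sub>M Q)" and b: "integrable S b"
    and le: "\<And>z. z \<in> space (S \<Otimes>\<^sub>M Q) \<Longrightarrow> \<bar>F z\<bar> \<le> b (fst z)"
  shows "integrable (T \<theta>) F"
proof (rule Bochner_Integration.integrable_bound)
  have [measurable]: "b \<in> borel_measurable S" using b by auto
  have "integrable (distr (T \<theta>) S fst) b" unfolding distr_T_fst by (rule b)
  then show "integrable (T \<theta>) (\<lambda>z. b (fst z))" by (subst (asm) integrable_distr_eq) auto
  show "AE z in T \<theta>. norm (F z) \<le> norm (b (fst z))"
    using order_trans[OF le abs_ge_self] by (intro AE_I2) auto
qed measurable

lemma T_integral_fst:
  fixes f :: "_ \<Rightarrow> real" assumes [measurable]: "f \<in> borel_measurable S"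
  shows "(\<integral>z. f (fst z) \<partial>T \<theta>) = (\<integral>s. f s \<partial>S)"
proof -
  have "(\<integral>s. f s \<partial>S) = (\<integral>s. f s \<partial>distr (T \<theta>) S fst)" by (simp only: distr_T_fst)
  also have "\<dots> = (\<integral>z. f (fst z) \<partial>T \<theta>)" by (rule integral_distr) auto
  finally show ?thesis ..
qed

lemma T_integral:
  fixes F :: "('x \<times> ('j \<Rightarrow> real)) \<times> 'x \<Rightarrow> real"
  assumes [measurable]: "F \<in> borel_measurable (S \<Otimes>\<^sub>M Q)" and F: "integrable (T \<theta>) F"
  shows "(\<integral>z. F z \<partial>T \<theta>) = (\<integral>s. (\<integral>x. F (s, x) \<partial>Gm \<theta> (dat \<theta> s)) \<partial>S)"
    "integrable S (\<lambda>s. \<integral>x. F (s, x) \<partial>Gm \<theta> (dat \<theta> s))"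
proof -
  let ?w = "\<lambda>z. wt \<theta> (dat \<theta> (fst z)) (snd z)"
  have i: "integrable (S \<Otimes>\<^sub>M Q) (\<lambda>z. ?w z * F z)"
    using F unfolding T_def by (subst (asm) integrable_density) (auto simp: wt_nonneg)
  have e: "(\<integral>x. ?w (s, x) * F (s, x) \<partial>Q) = (\<integral>x. F (s, x) \<partial>Gm \<theta> (dat \<theta> s))" if [measurable]: "s \<in> space S" for s
    unfolding Gm_def by (subst integral_density) (auto simp: wt_nonneg)
  have "(\<integral>z. F z \<partial>T \<theta>) = (\<integral>z. ?w z * F z \<partial>(S \<Otimes>\<^sub>M Q))"
    unfolding T_def by (subst integral_density) (auto simp: wt_nonneg)
  also have "\<dots> = (\<integral>s. (\<integral>x. ?w (s, x) * F (s, x) \<partial>Q) \<partial>S)" by (rule SQ.integral_fst'[OF i, symmetric])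
  also have "\<dots> = (\<integral>s. (\<integral>x. F (s, x) \<partial>Gm \<theta> (dat \<theta> s)) \<partial>S)" by (rule Bochner_Integration.integral_cong[OF refl e])
  finally show "(\<integral>z. F z \<partial>T \<theta>) = (\<integral>s. (\<integral>x. F (s, x) \<partial>Gm \<theta> (dat \<theta> s)) \<partial>S)" .
  have "integrable S (\<lambda>s. \<integral>x. ?w (s, x) * F (s, x) \<partial>Q)" by (rule SQ.integrable_fst'[OF i])
  then show "integrable S (\<lambda>s. \<integral>x. F (s, x) \<partial>Gm \<theta> (dat \<theta> s))"
    by (rule Bochner_Integration.integrable_cong[THEN iffD1, OF refl e, rotated])
qed

text \<open>The change of energy when the strengths move from \<theta> to \<theta>' while signal,
  noise and sample stay fixed. Its exponential mean under the Gibbs measure at \<theta> is a ratio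
  of partition functions, so free energy differences control its fluctuations.\<close>

definition Dd :: "('j \<Rightarrow> real) \<Rightarrow> ('j \<Rightarrow> real) \<Rightarrow> ('x \<times> ('j \<Rightarrow> real)) \<times> 'x \<Rightarrow> real" where
  "Dd \<theta> \<theta>' z = En \<theta>' (dat \<theta>' (fst z)) (snd z) - En \<theta> (dat \<theta> (fst z)) (snd z)"

lemma Dd_measurable [measurable]: "Dd \<theta> \<theta>' \<in> borel_measurable (S \<Otimes>\<^sub>M Q)"
  unfolding Dd_def[abs_def] by measurable

lemma Dd_bound: "\<bar>Dd \<theta> \<theta>' z\<bar> \<le> bnd \<theta>' (dat \<theta>' (fst z)) + bnd \<theta> (dat \<theta> (fst z))"
  unfolding Dd_def using En_bound[of \<theta>' "dat \<theta>' (fst z)" "snd z"] En_bound[of \<theta> "dat \<theta> (fst z)" "snd z"] by linarith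

lemma Dd_integrable: "integrable (T \<theta>0) (Dd \<theta> \<theta>')"
  by (rule T_integrable[OF _ Bochner_Integration.integrable_add[OF integrable_bnd_dat[of \<theta>'] integrable_bnd_dat[of \<theta>]]])
    (use Dd_bound in auto)

lemma Gm_exp_Dd:
  assumes [measurable]: "s \<in> space S"
  shows "ln (\<integral>x. exp (Dd \<theta> \<theta>' (s, x)) \<partial>Gm \<theta> (dat \<theta> s)) = FE \<theta>' s - FE \<theta> s"
proof -
  have "(\<integral>x. exp (Dd \<theta> \<theta>' (s, x)) \<partial>Gm \<theta> (dat \<theta> s)) = (\<integral>x. wt \<theta> (dat \<theta> s) x * exp (Dd \<theta> \<theta>' (s, x)) \<partial>Q)"
    unfolding Gm_def by (subst integral_density) (auto simp: wt_nonneg)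
  also have "\<dots> = (\<integral>x. exp (En \<theta>' (dat \<theta>' s) x) / Z \<theta> (dat \<theta> s) \<partial>Q)"
    by (intro Bochner_Integration.integral_cong refl) (simp add: wt_def Dd_def exp_diff)
  also have "\<dots> = Z \<theta>' (dat \<theta>' s) / Z \<theta> (dat \<theta> s)" by (simp add: Z_def)
  finally show ?thesis
    unfolding FE_def LZ_def using Z_pos[of \<theta>' "dat \<theta>' s"] Z_pos[of \<theta> "dat \<theta> s"] by (simp add: ln_div)
qed

text \<open>The Gibbs-Bogoliubov inequality: Jensen under the Gibbs measure for each realisation of
  signal and noise, then averaging over these.\<close>

lemma bogoliubov: "(\<integral>z. Dd \<theta> \<theta>' z \<partial>T \<theta>) \<le> mFE \<theta>' - mFE \<theta>"
proof -
  have "(\<integral>z. Dd \<theta> \<theta>' z \<partial>T \<theta>) = (\<integral>s. (\<integral>x. Dd \<theta> \<theta>' (s, x) \<partial>Gm \<theta> (dat \<theta> s)) \<partial>S)"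
    by (rule T_integral[OF _ Dd_integrable]) measurable
  also have "\<dots> \<le> (\<integral>s. FE \<theta>' s - FE \<theta> s \<partial>S)"
  proof (rule integral_mono[OF T_integral(2)[OF _ Dd_integrable]])
    fix s assume s [measurable]: "s \<in> space S"
    interpret Gm: prob_space "Gm \<theta> (dat \<theta> s)" by (rule prob_space_Gm)
    show "(\<integral>x. Dd \<theta> \<theta>' (s, x) \<partial>Gm \<theta> (dat \<theta> s)) \<le> FE \<theta>' s - FE \<theta> s"
      unfolding Gm_exp_Dd[OF s, symmetric]
      using Dd_bound[of \<theta> \<theta>' "(s, _)"] s by (intro Gm.gibbs_bounds(2)) auto
  qed (auto intro!: integrable_FE)
  also have "\<dots> = mFE \<theta>' - mFE \<theta>" unfolding mFE_def by (simp add: integrable_FE)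
  finally show ?thesis .
qed

text \<open>Exponential moments control only the upper tail. The identity
  \<open>\<bar>x\<bar> = 2 * max 0 x - x\<close> makes the bound two-sided, at the price of the gap
  in the Bogoliubov inequality.\<close>

lemma T_deviation:
  defines "c \<equiv> \<lambda>\<theta> \<theta>'. mFE \<theta>' - mFE \<theta>"
  shows "(\<integral>z. \<bar>Dd \<theta> \<theta>' z - c \<theta> \<theta>'\<bar> \<partial>T \<theta>) \<le> 2 * (ln 2 + flucts \<theta>' + flucts \<theta>) + c \<theta> \<theta>' - (\<integral>z. Dd \<theta> \<theta>' z \<partial>T \<theta>)"
proof -
  interpret T: prob_space "T \<theta>" by (rule prob_space_T)
  let ?c = "c \<theta> \<theta>'"
  let ?D = "Dd \<theta> \<theta>'"
  have iD: "integrable (T \<theta>) ?D" by (rule Dd_integrable)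
  then have iM: "integrable (T \<theta>) (\<lambda>z. max 0 (?D z - ?c))" by auto
  have "(\<integral>z. max 0 (?D z - ?c) \<partial>T \<theta>) = (\<integral>s. (\<integral>x. max 0 (?D (s, x) - ?c) \<partial>Gm \<theta> (dat \<theta> s)) \<partial>S)"
    by (rule T_integral[OF _ iM]) measurable
  also have "\<dots> \<le> (\<integral>s. ln 2 + (\<bar>FE \<theta>' s - mFE \<theta>'\<bar> + \<bar>FE \<theta> s - mFE \<theta>\<bar>) \<partial>S)"
  proof (rule integral_mono[OF T_integral(2)[OF _ iM]])
    fix s assume s [measurable]: "s \<in> space S"
    interpret Gm: prob_space "Gm \<theta> (dat \<theta> s)" by (rule prob_space_Gm)
    have "(\<integral>x. max 0 (?D (s, x) - ?c) \<partial>Gm \<theta> (dat \<theta> s)) \<le> ln 2 + max 0 (FE \<theta>' s - FE \<theta> s - ?c)"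
      unfolding Gm_exp_Dd[OF s, symmetric]
      using Dd_bound[of \<theta> \<theta>' "(s, _)"] s by (intro Gm.gibbs_bounds(3)) auto
    also have "max 0 (FE \<theta>' s - FE \<theta> s - ?c) \<le> \<bar>FE \<theta>' s - mFE \<theta>'\<bar> + \<bar>FE \<theta> s - mFE \<theta>\<bar>"
      unfolding c_def by linarith
    finally show "(\<integral>x. max 0 (?D (s, x) - ?c) \<partial>Gm \<theta> (dat \<theta> s)) \<le> ln 2 + (\<bar>FE \<theta>' s - mFE \<theta>'\<bar> + \<bar>FE \<theta> s - mFE \<theta>\<bar>)" by simp
  qed (measurable, intro Bochner_Integration.integrable_add S.integrable_const integrable_abs
      Bochner_Integration.integrable_diff integrable_FE)
  also have "\<dots> = ln 2 + flucts \<theta>' + flucts \<theta>"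
    unfolding flucts_def by (simp add: integrable_FE S.prob_space)
  finally have 1: "(\<integral>z. max 0 (?D z - ?c) \<partial>T \<theta>) \<le> ln 2 + flucts \<theta>' + flucts \<theta>" .
  have "(\<integral>z. \<bar>?D z - ?c\<bar> \<partial>T \<theta>) = (\<integral>z. 2 * max 0 (?D z - ?c) - ?D z + ?c \<partial>T \<theta>)"
    by (intro Bochner_Integration.integral_cong refl) (simp add: max_def abs_if)
  also have "\<dots> = 2 * (\<integral>z. max 0 (?D z - ?c) \<partial>T \<theta>) - (\<integral>z. ?D z \<partial>T \<theta>) + ?c"
    using iM iD by (simp add: T.prob_space[simplified])
  finally show ?thesis using 1 by argo
qed

definition overlap :: "'j \<Rightarrow> ('x \<times> ('j \<Rightarrow> real)) \<times> 'x \<Rightarrow> real" where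
  "overlap j z = a j (snd z) * a j (fst (fst z))"

lemma overlap_measurable [measurable]: "overlap j \<in> borel_measurable (S \<Otimes>\<^sub>M Q)"
  unfolding overlap_def[abs_def] by measurable

lemma overlap_bound: "\<bar>overlap j z\<bar> \<le> B\<^sup>2"
  unfolding overlap_def power2_eq_square abs_mult by (intro mult_mono a_bound) (auto simp: B)

text \<open>After the exchange the noise multiplies the signal, which is independent of it, instead
  of the sample. The rest splits into a term linear in the overlaps, with coefficients that are
  increments of the squared strengths, and a term of second order in the increments of the
  strengths.\<close>

lemma Dd_sig:
  assumes "z \<in> space (S \<Otimes>\<^sub>M Q)"
  shows "Dd \<theta> \<theta>' (sig \<theta> z) = (\<Sum>j\<in>J. (\<theta>' j - \<theta> j) * (snd (fst z) j * a j (fst (fst z))))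
    + (\<Sum>j\<in>J. ((\<theta>' j)\<^sup>2 - (\<theta> j)\<^sup>2) / 2 * overlap j z)
    + (\<Sum>j\<in>J. (\<theta>' j - \<theta> j)\<^sup>2 / 2 * (overlap j z - (a j (fst (fst z)))\<^sup>2))"
  unfolding Dd_def En_def sum_subtractf[symmetric] sum.distrib[symmetric]
  by (intro sum.cong refl) (simp add: sig_def dat_def overlap_def field_simps power2_eq_square)

end

section \<open>Convexity and continuity in the signal strengths\<close>

text \<open>For a convex function, closeness at grid points implies closeness in between. From
  above, a point is interpolated between the corners of its cell, one coordinate at a time. From
  below, the lower corner is the midpoint between the point and its reflection, where the upper
  bound is already known. Reflection can leave the square by one mesh width, which explains the
  margin in the index range.\<close>

lemma convex_grid_bound:
  fixes G g :: "real \<Rightarrow> real \<Rightarrow> real" and n :: nat and \<delta> e w :: real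
  assumes convex: "\<And>a b a' b' l. 0 \<le> l \<Longrightarrow> l \<le> 1 \<Longrightarrow>
      G (l * a + (1 - l) * a') (l * b + (1 - l) * b') \<le> l * G a b + (1 - l) * G a' b'"
    and \<delta>: "\<delta> > 0"
    and close: "\<And>i j. i \<in> {-2..int n + 2} \<Longrightarrow> j \<in> {-2..int n + 2} \<Longrightarrow>
      \<bar>G (of_int i * \<delta>) (of_int j * \<delta>) - g (of_int i * \<delta>) (of_int j * \<delta>)\<bar> \<le> e"
    and mod: "\<And>a b a' b'. \<bar>a\<bar> \<le> (n + 2) * \<delta> \<Longrightarrow> \<bar>b\<bar> \<le> (n + 2) * \<delta> \<Longrightarrow> \<bar>a'\<bar> \<le> (n + 2) * \<delta> \<Longrightarrow> \<bar>b'\<bar> \<le> (n + 2) * \<delta> \<Longrightarrow>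
      \<bar>a - a'\<bar> \<le> 2 * \<delta> \<Longrightarrow> \<bar>b - b'\<bar> \<le> 2 * \<delta> \<Longrightarrow> \<bar>g a b - g a' b'\<bar> \<le> w"
    and ab: "0 \<le> a" "a \<le> n * \<delta>" "0 \<le> b" "b \<le> n * \<delta>"
  shows "\<bar>G a b - g a b\<bar> \<le> 3 * e + 4 * w"
proof -
  define P where "P = real n * \<delta>"
  have P: "P \<ge> 0" "real (n + 2) * \<delta> = P + 2 * \<delta>" "real n * \<delta> = P" unfolding P_def using \<delta> by (auto simp: algebra_simps)
  note mod = mod[unfolded P] and ab = ab[unfolded P]
  define lo where "lo x = of_int \<lfloor>x / \<delta>\<rfloor> * \<delta>" for x
  have lo: "lo x \<le> x" "x \<le> lo x + \<delta>" for x
  proof -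
    have "of_int \<lfloor>x / \<delta>\<rfloor> \<le> x / \<delta>" "x / \<delta> \<le> of_int \<lfloor>x / \<delta>\<rfloor> + 1" by linarith+
    then have "of_int \<lfloor>x / \<delta>\<rfloor> * \<delta> \<le> x" "x \<le> (of_int \<lfloor>x / \<delta>\<rfloor> + 1) * \<delta>"
      using \<delta> by (simp_all only: pos_le_divide_eq pos_divide_le_eq)
    then show "lo x \<le> x" "x \<le> lo x + \<delta>" unfolding lo_def distrib_right by simp_all
  qed
  have hi: "lo x + \<delta> = of_int (\<lfloor>x / \<delta>\<rfloor> + 1) * \<delta>" for x unfolding lo_def by (simp add: algebra_simps)
  have idx: "\<lfloor>x / \<delta>\<rfloor> \<in> {-2..int n + 2}" "\<lfloor>x / \<delta>\<rfloor> + 1 \<in> {-2..int n + 2}" if "- \<delta> \<le> x" "x \<le> P + \<delta>" for x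
  proof -
    have "- 1 \<le> x / \<delta>" "x / \<delta> \<le> real n + 1" using that \<delta> unfolding P_def by (simp_all add: field_simps)
    then have "- 1 \<le> \<lfloor>x / \<delta>\<rfloor>" "\<lfloor>x / \<delta>\<rfloor> \<le> int n + 1" by linarith+
    then show "\<lfloor>x / \<delta>\<rfloor> \<in> {-2..int n + 2}" "\<lfloor>x / \<delta>\<rfloor> + 1 \<in> {-2..int n + 2}"
      unfolding atLeastAtMost_iff by linarith+
  qed
  have between: "\<exists>l. 0 \<le> l \<and> l \<le> 1 \<and> x = l * lo x + (1 - l) * (lo x + \<delta>)" for x
  proof (intro exI[of _ "1 - (x - lo x) / \<delta>"] conjI)
    show "0 \<le> 1 - (x - lo x) / \<delta>" "1 - (x - lo x) / \<delta> \<le> 1" using lo[of x] \<delta> by (simp_all add: field_simps)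
    show "x = (1 - (x - lo x) / \<delta>) * lo x + (1 - (1 - (x - lo x) / \<delta>)) * (lo x + \<delta>)" using \<delta> by (simp add: field_simps)
  qed
  have mix: "l * u + (1 - l) * v \<le> c" if "0 \<le> l" "l \<le> 1" "u \<le> c" "v \<le> c" for l u v c :: real
  proof -
    have "l * u + (1 - l) * v \<le> l * c + (1 - l) * c" using that by (intro add_mono mult_left_mono) auto
    then show ?thesis by (simp add: algebra_simps)
  qed
  have upper: "G x y \<le> g x y + e + w" if x: "- \<delta> \<le> x" "x \<le> P + \<delta>" and y: "- \<delta> \<le> y" "y \<le> P + \<delta>" for x y
  proof -
    have near: "\<bar>u\<bar> \<le> P + 2 * \<delta>" "\<bar>u - z\<bar> \<le> 2 * \<delta>" if "- \<delta> \<le> z" "z \<le> P + \<delta>" "u = lo z \<or> u = lo z + \<delta>" for u z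
      using lo[of z] that P(1) \<delta> by (auto simp: abs_le_iff)
    have xy: "\<bar>x\<bar> \<le> P + 2 * \<delta>" "\<bar>y\<bar> \<le> P + 2 * \<delta>" using x y P(1) \<delta> by (auto simp: abs_le_iff)
    have corner: "G u v \<le> g x y + e + w" if u: "u = lo x \<or> u = lo x + \<delta>" and v: "v = lo y \<or> v = lo y + \<delta>" for u v
    proof -
      obtain i j where ij: "i \<in> {-2..int n + 2}" "j \<in> {-2..int n + 2}" "u = of_int i * \<delta>" "v = of_int j * \<delta>"
        using u v idx[OF x] idx[OF y] hi[of x] hi[of y] lo_def[of x] lo_def[of y] by metis
      have "\<bar>G u v - g u v\<bar> \<le> e" using close[OF ij(1,2)] ij(3,4) by simp
      moreover have "\<bar>g u v - g x y\<bar> \<le> w" using near[OF x u] near[OF y v] xy by (intro mod) auto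
      ultimately show ?thesis by linarith
    qed
    obtain l where l: "0 \<le> l" "l \<le> 1" "x = l * lo x + (1 - l) * (lo x + \<delta>)" using between by blast
    obtain k where k: "0 \<le> k" "k \<le> 1" "y = k * lo y + (1 - k) * (lo y + \<delta>)" using between by blast
    have edge: "G u y \<le> g x y + e + w" if u: "u = lo x \<or> u = lo x + \<delta>" for u
    proof -
      have "G (k * u + (1 - k) * u) (k * lo y + (1 - k) * (lo y + \<delta>)) \<le> k * G u (lo y) + (1 - k) * G u (lo y + \<delta>)"
        by (rule convex[OF k(1,2)])
      also have "\<dots> \<le> g x y + e + w" using corner[OF u] by (intro mix k(1,2)) auto
      also have "k * u + (1 - k) * u = u" by (simp add: algebra_simps)
      finally show ?thesis unfolding k(3)[symmetric] .
    qed
    have "G (l * lo x + (1 - l) * (lo x + \<delta>)) (l * y + (1 - l) * y) \<le> l * G (lo x) y + (1 - l) * G (lo x + \<delta>) y"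
      by (rule convex[OF l(1,2)])
    also have "\<dots> \<le> g x y + e + w" using edge by (intro mix l(1,2)) auto
    also have "l * y + (1 - l) * y = y" by (simp add: algebra_simps)
    finally show ?thesis unfolding l(3)[symmetric] .
  qed
  have up: "G a b \<le> g a b + e + w" using ab \<delta> P(1) by (intro upper) auto
  \<comment> \<open>The point reflected in the lower corner of its cell. Midpoint convexity gives
    \<open>G a b \<ge> 2 * G ?u ?v - G ?a ?b\<close>; the two corner terms and the reflected one add
    up to \<open>3 * e + 4 * w\<close>.\<close>
  let ?u = "lo a" and ?v = "lo b" and ?a = "2 * lo a - a" and ?b = "2 * lo b - b"
  have ra: "- \<delta> \<le> ?a" "?a \<le> P + \<delta>" "- \<delta> \<le> ?u" "?u \<le> P + \<delta>"
  proof -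
    have "0 \<le> \<lfloor>a / \<delta>\<rfloor>" using ab \<delta> by simp
    then have "0 \<le> lo a" unfolding lo_def using \<delta> by simp
    then show "- \<delta> \<le> ?a" "?a \<le> P + \<delta>" "- \<delta> \<le> ?u" "?u \<le> P + \<delta>"
      using lo[of a] ab \<delta> P(1) by linarith+
  qed
  have rb: "- \<delta> \<le> ?b" "?b \<le> P + \<delta>" "- \<delta> \<le> ?v" "?v \<le> P + \<delta>"
  proof -
    have "0 \<le> \<lfloor>b / \<delta>\<rfloor>" using ab \<delta> by simp
    then have "0 \<le> lo b" unfolding lo_def using \<delta> by simp
    then show "- \<delta> \<le> ?b" "?b \<le> P + \<delta>" "- \<delta> \<le> ?v" "?v \<le> P + \<delta>"
      using lo[of b] ab \<delta> P(1) by linarith+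
  qed
  have "\<bar>G ?u ?v - g ?u ?v\<bar> \<le> e" unfolding lo_def using ab \<delta> P(1) by (intro close idx) auto
  moreover have "G ?a ?b \<le> g ?a ?b + e + w" by (rule upper[OF ra(1,2) rb(1,2)])
  moreover have "\<bar>g ?u ?v - g a b\<bar> \<le> w"
    using lo[of a] lo[of b] ra rb ab \<delta> P(1) by (intro mod) (auto simp: abs_le_iff)
  moreover have "\<bar>g ?a ?b - g a b\<bar> \<le> w"
    using lo[of a] lo[of b] ra rb ab \<delta> P(1) by (intro mod) (auto simp: abs_le_iff)
  moreover have "G ?u ?v \<le> (1/2) * G a b + (1/2) * G ?a ?b"
    using convex[of "1/2" a ?a b ?b] by (simp add: field_simps)
  moreover have "e \<ge> 0" using close[of 0 0] by auto
  moreover have "w \<ge> 0" using \<open>\<bar>g ?u ?v - g a b\<bar> \<le> w\<close> by linarith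
  ultimately show ?thesis using up by (intro abs_leI) argo+
qed

context channel begin

lemma En_diff_le:
  "\<bar>En \<theta> y x - En \<theta>' y' x\<bar> \<le> (\<Sum>j\<in>J. B * \<bar>\<theta> j * y j - \<theta>' j * y' j\<bar> + B\<^sup>2 * \<bar>(\<theta> j)\<^sup>2 - (\<theta>' j)\<^sup>2\<bar> / 2)"
  unfolding En_def sum_subtractf[symmetric]
proof (rule order_trans[OF sum_abs sum_mono])
  fix j
  let ?p = "\<theta> j * y j - \<theta>' j * y' j" and ?q = "(\<theta> j)\<^sup>2 - (\<theta>' j)\<^sup>2"
  have "\<bar>?p * a j x\<bar> \<le> B * \<bar>?p\<bar>" using mult_left_mono[OF a_bound[of j x], of "\<bar>?p\<bar>"] by (simp add: abs_mult mult_ac)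
  moreover have "\<bar>?q * (a j x)\<^sup>2\<bar> \<le> B\<^sup>2 * \<bar>?q\<bar>"
    using mult_left_mono[OF a_square_bound[of j x], of "\<bar>?q\<bar>"] by (simp add: abs_mult mult_ac)
  moreover have "\<theta> j * y j * a j x - (\<theta> j)\<^sup>2 * (a j x)\<^sup>2 / 2 - (\<theta>' j * y' j * a j x - (\<theta>' j)\<^sup>2 * (a j x)\<^sup>2 / 2)
     = ?p * a j x - ?q * (a j x)\<^sup>2 / 2" by (simp add: field_simps)
  ultimately show "\<bar>\<theta> j * y j * a j x - (\<theta> j)\<^sup>2 * (a j x)\<^sup>2 / 2 - (\<theta>' j * y' j * a j x - (\<theta>' j)\<^sup>2 * (a j x)\<^sup>2 / 2)\<bar>
     \<le> B * \<bar>?p\<bar> + B\<^sup>2 * \<bar>?q\<bar> / 2" by linarith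
qed

lemma exp_mix_le:
  fixes u v l :: real assumes "0 \<le> l" "l \<le> 1"
  shows "exp (l * u + (1 - l) * v) \<le> l * exp u + (1 - l) * exp v"
proof -
  have "convex_on UNIV (exp :: real \<Rightarrow> real)" by (rule exp_convex)
  from convex_onD[OF this, of "1 - l" u v] assms show ?thesis by simp
qed

text \<open>Once the data are inserted, the energy is quadratic in each strength, with leading coefficient
  \<open>a b - a\<^sup>2 / 2 \<ge> - 3 B\<^sup>2 / 2\<close>; the added term makes it convex.\<close>

lemma FE_convex:
  assumes l: "0 \<le> l" "l \<le> 1" and \<theta>: "\<And>j. \<theta> j = l * \<theta>1 j + (1 - l) * \<theta>2 j"
  shows "FE \<theta> s + 2 * B\<^sup>2 * (\<Sum>j\<in>J. (\<theta> j)\<^sup>2) \<le>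
    l * (FE \<theta>1 s + 2 * B\<^sup>2 * (\<Sum>j\<in>J. (\<theta>1 j)\<^sup>2)) + (1 - l) * (FE \<theta>2 s + 2 * B\<^sup>2 * (\<Sum>j\<in>J. (\<theta>2 j)\<^sup>2))"
proof -
  define q where "q \<theta> = 2 * B\<^sup>2 * (\<Sum>j\<in>J. (\<theta> j)\<^sup>2)" for \<theta> :: "'j \<Rightarrow> real"
  define H where "H \<theta> x = En \<theta> (dat \<theta> s) x + q \<theta>" for \<theta> x
  have H_eq: "H \<theta> x = (\<Sum>j\<in>J. \<theta> j * (snd s j * a j x) + (\<theta> j)\<^sup>2 * (a j (fst s) * a j x - (a j x)\<^sup>2 / 2 + 2 * B\<^sup>2))" for \<theta> x
    unfolding H_def q_def En_def sum_distrib_left sum.distrib[symmetric]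
    by (intro sum.cong refl) (simp add: dat_def field_simps power2_eq_square)
  have H_convex: "H \<theta> x \<le> l * H \<theta>1 x + (1 - l) * H \<theta>2 x" for x
    unfolding H_eq sum_distrib_left sum.distrib[symmetric]
  proof (rule sum_mono)
    fix j
    let ?k = "a j (fst s) * a j x - (a j x)\<^sup>2 / 2 + 2 * B\<^sup>2" and ?c = "snd s j * a j x"
    have "\<bar>a j (fst s) * a j x\<bar> \<le> B\<^sup>2"
      unfolding abs_mult power2_eq_square by (intro mult_mono a_bound) (auto simp: B)
    then have k: "?k \<ge> 0" using a_square_bound[of j x] zero_le_power2[of B] unfolding abs_le_iff by linarith
    have "l * (\<theta>1 j)\<^sup>2 + (1 - l) * (\<theta>2 j)\<^sup>2 - (\<theta> j)\<^sup>2 = l * (1 - l) * (\<theta>1 j - \<theta>2 j)\<^sup>2"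
      unfolding \<theta> by (simp add: power2_eq_square algebra_simps)
    moreover have "l * (1 - l) * (\<theta>1 j - \<theta>2 j)\<^sup>2 \<ge> 0" using l by simp
    ultimately have "(\<theta> j)\<^sup>2 * ?k \<le> (l * (\<theta>1 j)\<^sup>2 + (1 - l) * (\<theta>2 j)\<^sup>2) * ?k" using k by (intro mult_right_mono) auto
    moreover have "\<theta> j * ?c = l * (\<theta>1 j * ?c) + (1 - l) * (\<theta>2 j * ?c)" unfolding \<theta> by (simp add: algebra_simps)
    moreover have "(l * (\<theta>1 j)\<^sup>2 + (1 - l) * (\<theta>2 j)\<^sup>2) * ?k = l * ((\<theta>1 j)\<^sup>2 * ?k) + (1 - l) * ((\<theta>2 j)\<^sup>2 * ?k)"
      by (simp only: distrib_right mult.assoc)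
    ultimately show "\<theta> j * ?c + (\<theta> j)\<^sup>2 * ?k \<le> l * (\<theta>1 j * ?c + (\<theta>1 j)\<^sup>2 * ?k) + (1 - l) * (\<theta>2 j * ?c + (\<theta>2 j)\<^sup>2 * ?k)"
      unfolding distrib_left by linarith
  qed
  define c where "c \<theta> = FE \<theta> s + q \<theta>" for \<theta>
  have one: "integrable Q (\<lambda>x. exp (H \<theta> x - k))" "(\<integral>x. exp (H \<theta> x - k) \<partial>Q) = exp (c \<theta> - k)" for \<theta> k
  proof -
    have e: "exp (H \<theta> x - k) = exp (q \<theta> - k) * exp (En \<theta> (dat \<theta> s) x)" for x unfolding H_def by (simp flip: exp_add)
    show "integrable Q (\<lambda>x. exp (H \<theta> x - k))" unfolding e by (intro integrable_mult_right exp_En_integrable)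
    have "(\<integral>x. exp (H \<theta> x - k) \<partial>Q) = exp (q \<theta> - k) * Z \<theta> (dat \<theta> s)" unfolding e Z_def by simp
    also have "Z \<theta> (dat \<theta> s) = exp (FE \<theta> s)" unfolding FE_def LZ_def using Z_pos[of \<theta> "dat \<theta> s"] by simp
    finally show "(\<integral>x. exp (H \<theta> x - k) \<partial>Q) = exp (c \<theta> - k)" unfolding c_def by (simp flip: exp_add add: algebra_simps)
  qed
  \<comment> \<open>Hoelder's inequality by normalisation:
    \<open>exp (H \<theta>1 x - c \<theta>1)\<close> and its counterpart for
    \<open>\<theta>2\<close> have integral one, so pointwise convexity of the exponential
    suffices.\<close>
  let ?m = "l * c \<theta>1 + (1 - l) * c \<theta>2"
  have "exp (c \<theta> - ?m) = (\<integral>x. exp (H \<theta> x - ?m) \<partial>Q)" by (rule one(2)[symmetric])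
  also have "\<dots> \<le> (\<integral>x. l * exp (H \<theta>1 x - c \<theta>1) + (1 - l) * exp (H \<theta>2 x - c \<theta>2) \<partial>Q)"
  proof (rule integral_mono[OF one(1)])
    show "integrable Q (\<lambda>x. l * exp (H \<theta>1 x - c \<theta>1) + (1 - l) * exp (H \<theta>2 x - c \<theta>2))"
      by (intro Bochner_Integration.integrable_add integrable_mult_right one)
    fix x
    have "H \<theta> x - ?m \<le> l * (H \<theta>1 x - c \<theta>1) + (1 - l) * (H \<theta>2 x - c \<theta>2)"
      using H_convex[of x] unfolding right_diff_distrib by linarith
    then have "exp (H \<theta> x - ?m) \<le> exp (l * (H \<theta>1 x - c \<theta>1) + (1 - l) * (H \<theta>2 x - c \<theta>2))" by simp
    also have "\<dots> \<le> l * exp (H \<theta>1 x - c \<theta>1) + (1 - l) * exp (H \<theta>2 x - c \<theta>2)" by (rule exp_mix_le[OF l])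
    finally show "exp (H \<theta> x - ?m) \<le> l * exp (H \<theta>1 x - c \<theta>1) + (1 - l) * exp (H \<theta>2 x - c \<theta>2)" .
  qed
  also have "\<dots> = l * exp (c \<theta>1 - c \<theta>1) + (1 - l) * exp (c \<theta>2 - c \<theta>2)"
    using one by (simp only: Bochner_Integration.integral_add integrable_mult_right integral_mult_right_zero)
  finally have "exp (c \<theta> - ?m) \<le> exp 0" by simp
  then have "c \<theta> \<le> ?m" by simp
  then show ?thesis unfolding c_def q_def .
qed

lemma dat_sig: "dat \<theta> (fst (sig \<theta> z)) = dat \<theta> (fst z)"
  by (auto simp: sig_def dat_def fun_eq_iff)

lemma T_bounded_integrable:
  fixes F :: "('x \<times> ('j \<Rightarrow> real)) \<times> 'x \<Rightarrow> real"
  assumes "F \<in> borel_measurable (S \<Otimes>\<^sub>M Q)" "\<And>z. \<bar>F z\<bar> \<le> C"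
  shows "integrable (T \<theta>) F"
  by (rule T_integrable[OF assms(1) S.integrable_const[of C]]) (use assms(2) in simp)

lemma overlap_integrable: "integrable (T \<theta>) (overlap j)"
  by (rule T_bounded_integrable[OF _ overlap_bound]) measurable

section \<open>Mean overlaps, tangent inequalities and concentration\<close>

definition mov :: "('j \<Rightarrow> real) \<Rightarrow> 'j \<Rightarrow> real" where "mov \<theta> j = (\<integral>z. overlap j z \<partial>T \<theta>)"

text \<open>Given the data, signal and sample have the same law, so the mean overlap is the mean
  square of the posterior mean \<open>m\<close>.\<close>

lemma mov_nonneg: "mov \<theta> j \<ge> 0"
proof -
  define m where "m y = (\<integral>x. a j x \<partial>Gm \<theta> y)" for y
  have m_eq: "m y = (\<integral>x. wt \<theta> y x * a j x \<partial>Q)" for y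
    unfolding m_def Gm_def by (subst integral_density) (auto simp: wt_nonneg)
  have m_meas [measurable (raw)]: "(\<lambda>\<omega>. m (f \<omega>)) \<in> borel_measurable M" if [measurable]: "f \<in> measurable M G" for f and M :: "'m measure"
    unfolding m_eq by measurable
  have m_bound: "\<bar>m y\<bar> \<le> B" for y
  proof -
    interpret Gm: prob_space "Gm \<theta> y" by (rule prob_space_Gm)
    have i: "integrable (Gm \<theta> y) (\<lambda>x. \<bar>a j x\<bar>)"
      by (rule Gm.integrable_const_bound[where B = B]) (use a_bound in auto)
    have "\<bar>m y\<bar> \<le> (\<integral>x. \<bar>a j x\<bar> \<partial>Gm \<theta> y)" unfolding m_def by (rule integral_abs_bound)
    also have "\<dots> \<le> B" using a_bound by (intro Gm.integral_le_const[OF i]) auto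
    finally show ?thesis .
  qed
  define F where "F z = a j (fst (fst z)) * m (dat \<theta> (fst z))" for z :: "('x \<times> ('j \<Rightarrow> real)) \<times> 'x"
  have F_meas [measurable]: "F \<in> borel_measurable (S \<Otimes>\<^sub>M Q)" unfolding F_def[abs_def] by measurable
  have "mov \<theta> j = (\<integral>s. (\<integral>x. overlap j (s, x) \<partial>Gm \<theta> (dat \<theta> s)) \<partial>S)"
    unfolding mov_def by (rule T_integral[OF _ overlap_integrable]) measurable
  also have "\<dots> = (\<integral>s. a j (fst s) * m (dat \<theta> s) \<partial>S)"
    unfolding overlap_def m_def by (simp add: mult.commute)
  also have "\<dots> = (\<integral>z. F z \<partial>T \<theta>)" unfolding F_def by (subst T_integral_fst[symmetric]) auto
  also have "\<dots> = (\<integral>z. F (sig \<theta> z) \<partial>T \<theta>)" by (rule nishimori(1)[symmetric]) measurable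
  also have "\<dots> = (\<integral>z. a j (snd z) * m (dat \<theta> (fst z)) \<partial>T \<theta>)"
    unfolding F_def dat_sig by (simp add: sig_def)
  also have "\<dots> = (\<integral>s. (\<integral>x. a j (snd (s, x)) * m (dat \<theta> (fst (s, x))) \<partial>Gm \<theta> (dat \<theta> s)) \<partial>S)"
  proof (rule T_integral)
    have "\<bar>a j (snd z) * m (dat \<theta> (fst z))\<bar> \<le> B * B" for z
      unfolding abs_mult by (intro mult_mono a_bound m_bound) (auto simp: B)
    then show "integrable (T \<theta>) (\<lambda>z. a j (snd z) * m (dat \<theta> (fst z)))"
      by (intro T_bounded_integrable) measurable
  qed measurable
  also have "\<dots> = (\<integral>s. m (dat \<theta> s) * m (dat \<theta> s) \<partial>S)" unfolding m_def by simp
  also have "\<dots> \<ge> 0" by (intro integral_nonneg_AE) simp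
  finally show ?thesis .
qed

definition noise :: "('j \<Rightarrow> real) \<Rightarrow> 'x \<times> ('j \<Rightarrow> real) \<Rightarrow> real" where
  "noise v s = (\<Sum>j\<in>J. v j * (snd s j * a j (fst s)))"

lemma noise_measurable [measurable]: "noise v \<in> borel_measurable S"
  unfolding noise_def[abs_def] by measurable

lemma noise_bound: "\<bar>noise v s\<bar> \<le> (\<Sum>j\<in>J. (\<bar>v j\<bar> * B) * \<bar>snd s j\<bar>)"
  unfolding noise_def
proof (rule order_trans[OF sum_abs sum_mono])
  fix j
  show "\<bar>v j * (snd s j * a j (fst s))\<bar> \<le> (\<bar>v j\<bar> * B) * \<bar>snd s j\<bar>"
    using mult_left_mono[OF a_bound[of j "fst s"], of "\<bar>v j\<bar> * \<bar>snd s j\<bar>"] by (simp add: abs_mult mult_ac)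
qed

lemma noise_integrable: "integrable S (noise v)"
  by (rule Bochner_Integration.integrable_bound[OF integrable_S_linear[of 0 "\<lambda>j. \<bar>v j\<bar> * B"]])
    (use order_trans[OF noise_bound abs_ge_self] in \<open>auto intro!: AE_I2\<close>)

lemma noise_mean: "(\<integral>s. noise v s \<partial>S) = 0"
proof -
  have "(\<integral>s. noise v s \<partial>S) = (\<integral>x. (\<integral>g. noise v (x, g) \<partial>G) \<partial>Q)"
    by (rule S.integral_fst'[OF noise_integrable, symmetric])
  also have "\<dots> = (\<integral>x. 0 \<partial>Q)"
  proof (rule Bochner_Integration.integral_cong[OF refl])
    fix x
    have "(\<integral>g. noise v (x, g) \<partial>G) = (\<Sum>j\<in>J. v j * ((\<integral>g. g j \<partial>G) * a j x))"
      unfolding noise_def by (simp add: Bochner_Integration.integral_sum gauss_component)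
    then show "(\<integral>g. noise v (x, g) \<partial>G) = 0" by (simp add: gauss_component)
  qed
  finally show ?thesis by simp
qed

text \<open>For a fixed signal this is a centred linear form in independent Gaussians. Its second
  moment is bounded by Efron-Stein with reference point 0, and the first absolute moment follows by
  Cauchy-Schwarz.\<close>

lemma noise_abs_mean: "(\<integral>s. \<bar>noise v s\<bar> \<partial>S) \<le> B * sqrt (\<Sum>j\<in>J. (v j)\<^sup>2)"
proof -
  have "(\<integral>s. \<bar>noise v s\<bar> \<partial>S) = (\<integral>x. (\<integral>g. \<bar>noise v (x, g)\<bar> \<partial>G) \<partial>Q)"
    by (rule S.integral_fst'[symmetric]) (rule integrable_abs[OF noise_integrable])
  also have "\<dots> \<le> B * sqrt (\<Sum>j\<in>J. (v j)\<^sup>2)"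
  proof (rule integral_le_const[OF S.integrable_fst'[OF integrable_abs[OF noise_integrable]]], rule AE_I2)
    fix x assume x: "x \<in> space Q"
    define f where "f g = noise v (x, g)" for g
    have f [measurable]: "f \<in> borel_measurable G" unfolding f_def using x by measurable
    have f_eq: "f g = (\<Sum>j\<in>J. v j * (g j * a j x))" for g unfolding f_def noise_def by simp
    define d where "d j y = \<bar>v j\<bar> * B * \<bar>y\<bar>" for j and y :: real
    have d2: "(d j y)\<^sup>2 = (v j)\<^sup>2 * B\<^sup>2 * y\<^sup>2" for j y unfolding d_def by (simp add: power_mult_distrib)
    have dm: "d j \<in> borel_measurable gauss" for j
    proof -
      have "(\<lambda>y::real. \<bar>v j\<bar> * B * \<bar>y\<bar>) \<in> borel_measurable borel"
        by (intro borel_measurable_continuous_onI continuous_intros)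
      then show ?thesis by (simp add: d_def[abs_def] cong: measurable_cong_sets)
    qed
    have di: "integrable gauss (\<lambda>y. (d j y)\<^sup>2)" "(\<integral>y. (d j y)\<^sup>2 \<partial>gauss) = (v j)\<^sup>2 * B\<^sup>2" for j
      unfolding d2 by (simp_all only: integrable_mult_right gauss_moments integral_mult_right_zero mult_1_right)
    note d = di(1) dm di(2)
    have fb: "\<bar>f g\<bar> \<le> 0 + (\<Sum>j\<in>J. d j (g j))" for g
      unfolding f_def d_def using noise_bound[of v "(x, g)"] by simp
    have osc: "\<bar>f (g(i := y)) - f (g(i := 0))\<bar> \<le> d i y" if i: "i \<in> J" for g i y
    proof -
      have "f (g(i := y)) - f (g(i := 0)) = (\<Sum>j\<in>J. v j * ((g(i := y)) j * a j x) - v j * ((g(i := 0)) j * a j x))"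
        unfolding f_eq sum_subtractf ..
      also have "\<dots> = (\<Sum>j\<in>J. if j = i then v i * (y * a i x) else 0)" by (intro sum.cong) auto
      also have "\<dots> = v i * (y * a i x)" using finite_J i by simp
      finally show ?thesis
        unfolding d_def using mult_left_mono[OF a_bound[of i x], of "\<bar>v i\<bar> * \<bar>y\<bar>"] by (simp add: abs_mult mult_ac)
    qed
    have "(\<integral>g. (f g)\<^sup>2 \<partial>G) - (\<integral>g. f g \<partial>G)\<^sup>2 \<le> (\<Sum>i\<in>J. \<integral>y. (d i y)\<^sup>2 \<partial>gauss)"
    proof (rule efron_stein[OF finite_J prob_space_gauss d(1,2) _ f])
      show "\<exists>C. \<forall>g\<in>space G. \<bar>f g\<bar> \<le> C + (\<Sum>j\<in>J. d j (g j))" by (intro exI[of _ 0] ballI fb)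
      show "\<bar>f (g(i := y)) - f (g(i := 0))\<bar> \<le> d i y" if "i \<in> J" for g i y by (rule osc[OF that])
    qed simp
    also have "\<dots> = B\<^sup>2 * (\<Sum>j\<in>J. (v j)\<^sup>2)" by (simp add: d(3) sum_distrib_left mult.commute)
    also have "(\<integral>g. f g \<partial>G) = 0" unfolding f_eq by (simp add: Bochner_Integration.integral_sum gauss_component)
    finally have 1: "(\<integral>g. (f g)\<^sup>2 \<partial>G) \<le> B\<^sup>2 * (\<Sum>j\<in>J. (v j)\<^sup>2)" by simp
    have fi: "integrable G (\<lambda>g. (f g)\<^sup>2)" "integrable G f"
      using integrable_PiM_growth[OF finite_J prob_space_gauss d(1,2) f fb] by auto
    have "(\<integral>g. \<bar>f g\<bar> \<partial>G)\<^sup>2 \<le> (\<integral>g. \<bar>f g\<bar>\<^sup>2 \<partial>G)"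
      using G.variance_positive[of "\<lambda>g. \<bar>f g\<bar>"] G.variance_eq[of "\<lambda>g. \<bar>f g\<bar>"] fi by simp
    also have "\<dots> \<le> (B * sqrt (\<Sum>j\<in>J. (v j)\<^sup>2))\<^sup>2" using 1 by (simp add: power_mult_distrib sum_nonneg)
    finally show "(\<integral>g. \<bar>noise v (x, g)\<bar> \<partial>G) \<le> B * sqrt (\<Sum>j\<in>J. (v j)\<^sup>2)"
      unfolding f_def by (rule power2_le_imp_le) (simp add: B sum_nonneg)
  qed
  finally show ?thesis .
qed

definition signal :: "('j \<Rightarrow> real) \<Rightarrow> ('j \<Rightarrow> real) \<Rightarrow> ('x \<times> ('j \<Rightarrow> real)) \<times> 'x \<Rightarrow> real" where
  "signal \<theta> \<theta>' z = (\<Sum>j\<in>J. ((\<theta>' j)\<^sup>2 - (\<theta> j)\<^sup>2) / 2 * overlap j z)"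

definition remainder :: "('j \<Rightarrow> real) \<Rightarrow> ('j \<Rightarrow> real) \<Rightarrow> ('x \<times> ('j \<Rightarrow> real)) \<times> 'x \<Rightarrow> real" where
  "remainder \<theta> \<theta>' z = (\<Sum>j\<in>J. (\<theta>' j - \<theta> j)\<^sup>2 / 2 * (overlap j z - (a j (fst (fst z)))\<^sup>2))"

lemma signal_measurable [measurable]: "signal \<theta> \<theta>' \<in> borel_measurable (S \<Otimes>\<^sub>M Q)"
  and remainder_measurable [measurable]: "remainder \<theta> \<theta>' \<in> borel_measurable (S \<Otimes>\<^sub>M Q)"
  unfolding signal_def[abs_def] remainder_def[abs_def] by measurable

lemma Dd_sig': "z \<in> space (S \<Otimes>\<^sub>M Q) \<Longrightarrow>
    Dd \<theta> \<theta>' (sig \<theta> z) = noise (\<lambda>j. \<theta>' j - \<theta> j) (fst z) + signal \<theta> \<theta>' z + remainder \<theta> \<theta>' z"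
  by (simp add: Dd_sig noise_def signal_def remainder_def)

lemma remainder_bound: "\<bar>remainder \<theta> \<theta>' z\<bar> \<le> B\<^sup>2 * (\<Sum>j\<in>J. (\<theta>' j - \<theta> j)\<^sup>2)"
  unfolding remainder_def sum_distrib_left
proof (rule order_trans[OF sum_abs sum_mono])
  fix j
  have "\<bar>overlap j z - (a j (fst (fst z)))\<^sup>2\<bar> \<le> 2 * B\<^sup>2"
    using overlap_bound[of j z] a_square_bound[of j "fst (fst z)"] zero_le_power2[of "a j (fst (fst z))"] by linarith
  then have "(\<theta>' j - \<theta> j)\<^sup>2 / 2 * \<bar>overlap j z - (a j (fst (fst z)))\<^sup>2\<bar> \<le> (\<theta>' j - \<theta> j)\<^sup>2 / 2 * (2 * B\<^sup>2)"
    by (intro mult_left_mono) auto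
  then show "\<bar>(\<theta>' j - \<theta> j)\<^sup>2 / 2 * (overlap j z - (a j (fst (fst z)))\<^sup>2)\<bar> \<le> B\<^sup>2 * (\<theta>' j - \<theta> j)\<^sup>2"
    by (simp add: abs_mult mult_ac)
qed

lemma signal_integrable: "integrable (T \<theta>0) (signal \<theta> \<theta>')"
  unfolding signal_def[abs_def] by (intro Bochner_Integration.integrable_sum integrable_mult_right overlap_integrable)

lemma signal_mean: "(\<integral>z. signal \<theta>1 \<theta>2 z \<partial>T \<theta>) = (\<Sum>j\<in>J. ((\<theta>2 j)\<^sup>2 - (\<theta>1 j)\<^sup>2) / 2 * mov \<theta> j)"
  unfolding signal_def mov_def by (simp add: Bochner_Integration.integral_sum overlap_integrable)

lemma remainder_integrable: "integrable (T \<theta>0) (remainder \<theta> \<theta>')"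
  by (rule T_bounded_integrable[OF _ remainder_bound]) measurable

lemma noise_T_integrable: "integrable (T \<theta>) (\<lambda>z. noise v (fst z))"
  by (rule T_integrable[OF _ integrable_abs[OF noise_integrable[of v]]]) auto

lemma Dd_mean_ge:
  "(\<integral>z. Dd \<theta> \<theta>' z \<partial>T \<theta>) \<ge> (\<Sum>j\<in>J. ((\<theta>' j)\<^sup>2 - (\<theta> j)\<^sup>2) / 2 * mov \<theta> j) - B\<^sup>2 * (\<Sum>j\<in>J. (\<theta>' j - \<theta> j)\<^sup>2)"
proof -
  interpret T: prob_space "T \<theta>" by (rule prob_space_T)
  have "(\<integral>z. Dd \<theta> \<theta>' z \<partial>T \<theta>) = (\<integral>z. Dd \<theta> \<theta>' (sig \<theta> z) \<partial>T \<theta>)" by (rule nishimori(1)[symmetric]) measurable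
  also have "\<dots> = (\<integral>z. noise (\<lambda>j. \<theta>' j - \<theta> j) (fst z) + signal \<theta> \<theta>' z + remainder \<theta> \<theta>' z \<partial>T \<theta>)"
    by (intro Bochner_Integration.integral_cong refl Dd_sig') simp
  also have "\<dots> = (\<integral>z. noise (\<lambda>j. \<theta>' j - \<theta> j) (fst z) \<partial>T \<theta>) + (\<integral>z. signal \<theta> \<theta>' z \<partial>T \<theta>) + (\<integral>z. remainder \<theta> \<theta>' z \<partial>T \<theta>)"
    by (simp add: noise_T_integrable signal_integrable remainder_integrable)
  also have "(\<integral>z. noise (\<lambda>j. \<theta>' j - \<theta> j) (fst z) \<partial>T \<theta>) = 0" by (simp add: T_integral_fst noise_mean)
  finally have "(\<integral>z. Dd \<theta> \<theta>' z \<partial>T \<theta>) = (\<Sum>j\<in>J. ((\<theta>' j)\<^sup>2 - (\<theta> j)\<^sup>2) / 2 * mov \<theta> j) + (\<integral>z. remainder \<theta> \<theta>' z \<partial>T \<theta>)"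
    by (simp add: signal_mean)
  moreover have "(\<integral>z. remainder \<theta> \<theta>' z \<partial>T \<theta>) \<ge> - (B\<^sup>2 * (\<Sum>j\<in>J. (\<theta>' j - \<theta> j)\<^sup>2))"
    using remainder_bound[of \<theta> \<theta>'] by (intro T.integral_ge_const[OF remainder_integrable] AE_I2) (auto simp: abs_le_iff minus_le_iff)
  ultimately show ?thesis by linarith
qed

text \<open>Up to an error quadratic in the increments, half the mean overlaps are subgradients of
  the mean free energy in the squared strengths. Semiconvexity, Lipschitz bounds and the derivatives
  of \<open>F\<close> all stem from this inequality.\<close>

theorem mFE_convexity:
  "mFE \<theta>' - mFE \<theta> \<ge> (\<Sum>j\<in>J. ((\<theta>' j)\<^sup>2 - (\<theta> j)\<^sup>2) / 2 * mov \<theta> j) - B\<^sup>2 * (\<Sum>j\<in>J. (\<theta>' j - \<theta> j)\<^sup>2)"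
  using bogoliubov[of \<theta> \<theta>'] Dd_mean_ge[of \<theta>' \<theta>] by linarith

text \<open>Invariance of \<open>T\<close> under \<open>sig\<close> turns the deviation bound for
  \<open>Dd\<close> into one for \<open>signal\<close>, up to noise and remainder. Of the two
  \<open>B\<^sup>2\<close> one bounds the remainder here, the other the loss in
  \<open>Dd_mean_ge\<close>.\<close>

theorem signal_concentration:
  "(\<integral>z. \<bar>signal \<theta> \<theta>' z - (mFE \<theta>' - mFE \<theta>)\<bar> \<partial>T \<theta>) \<le>
    2 * (ln 2 + flucts \<theta>' + flucts \<theta>) + (mFE \<theta>' - mFE \<theta> - (\<Sum>j\<in>J. ((\<theta>' j)\<^sup>2 - (\<theta> j)\<^sup>2) / 2 * mov \<theta> j))
    + 2 * B\<^sup>2 * (\<Sum>j\<in>J. (\<theta>' j - \<theta> j)\<^sup>2) + B * sqrt (\<Sum>j\<in>J. (\<theta>' j - \<theta> j)\<^sup>2)"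
proof -
  interpret T: prob_space "T \<theta>" by (rule prob_space_T)
  let ?c = "mFE \<theta>' - mFE \<theta>" and ?v = "\<lambda>j. \<theta>' j - \<theta> j"
  have iD: "integrable (T \<theta>) (\<lambda>z. \<bar>Dd \<theta> \<theta>' (sig \<theta> z) - ?c\<bar>)"
    using Dd_integrable[of \<theta> \<theta> \<theta>'] nishimori(2)[of "Dd \<theta> \<theta>'" \<theta>] by simp
  have "(\<integral>z. \<bar>signal \<theta> \<theta>' z - ?c\<bar> \<partial>T \<theta>) \<le>
     (\<integral>z. \<bar>Dd \<theta> \<theta>' (sig \<theta> z) - ?c\<bar> + \<bar>noise ?v (fst z)\<bar> + B\<^sup>2 * (\<Sum>j\<in>J. (?v j)\<^sup>2) \<partial>T \<theta>)"
  proof (rule integral_mono)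
    fix z assume "z \<in> space (T \<theta>)"
    then have "signal \<theta> \<theta>' z = Dd \<theta> \<theta>' (sig \<theta> z) - noise ?v (fst z) - remainder \<theta> \<theta>' z"
      by (subst Dd_sig') auto
    then show "\<bar>signal \<theta> \<theta>' z - ?c\<bar> \<le> \<bar>Dd \<theta> \<theta>' (sig \<theta> z) - ?c\<bar> + \<bar>noise ?v (fst z)\<bar> + B\<^sup>2 * (\<Sum>j\<in>J. (?v j)\<^sup>2)"
      using remainder_bound[of \<theta> \<theta>' z] by linarith
  next
    show "integrable (T \<theta>) (\<lambda>z. \<bar>signal \<theta> \<theta>' z - ?c\<bar>)"
      by (intro integrable_abs Bochner_Integration.integrable_diff signal_integrable T.integrable_const)
    show "integrable (T \<theta>) (\<lambda>z. \<bar>Dd \<theta> \<theta>' (sig \<theta> z) - ?c\<bar> + \<bar>noise ?v (fst z)\<bar> + B\<^sup>2 * (\<Sum>j\<in>J. (?v j)\<^sup>2))"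
      by (intro integrable_abs Bochner_Integration.integrable_add noise_T_integrable T.integrable_const iD)
  qed
  also have "\<dots> = (\<integral>z. \<bar>Dd \<theta> \<theta>' (sig \<theta> z) - ?c\<bar> \<partial>T \<theta>) + (\<integral>z. \<bar>noise ?v (fst z)\<bar> \<partial>T \<theta>) + B\<^sup>2 * (\<Sum>j\<in>J. (?v j)\<^sup>2)"
    using iD by (simp add: noise_T_integrable T.prob_space[simplified])
  also have "(\<integral>z. \<bar>Dd \<theta> \<theta>' (sig \<theta> z) - ?c\<bar> \<partial>T \<theta>) = (\<integral>z. \<bar>Dd \<theta> \<theta>' z - ?c\<bar> \<partial>T \<theta>)"
    by (rule nishimori(1)) measurable
  also have "(\<integral>z. \<bar>noise ?v (fst z)\<bar> \<partial>T \<theta>) = (\<integral>s. \<bar>noise ?v s\<bar> \<partial>S)" by (rule T_integral_fst) measurable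
  finally show ?thesis
    using T_deviation[of \<theta> \<theta>'] Dd_mean_ge[of \<theta>' \<theta>] noise_abs_mean[of ?v] by linarith
qed

text \<open>Together with the tangent inequalities, continuity of the mean overlaps gives
  differentiability of the mean free energy. Gibbs averages are quotients of integrals over
  \<open>Q\<close>; for fixed signal and noise the energies converge uniformly in the sample, and
  \<open>C\<close> dominates the outer integral.\<close>

theorem T_continuous:
  assumes \<theta>: "\<And>j. j \<in> J \<Longrightarrow> (\<lambda>n. \<theta> n j) \<longlonglongrightarrow> \<theta>' j"
    and \<phi> [measurable]: "\<phi> \<in> borel_measurable (Q \<Otimes>\<^sub>M Q)" and C: "\<And>z. \<bar>\<phi> z\<bar> \<le> (C::real)"
  shows "(\<lambda>n. \<integral>z. \<phi> (fst (fst z), snd z) \<partial>T (\<theta> n)) \<longlonglongrightarrow> (\<integral>z. \<phi> (fst (fst z), snd z) \<partial>T \<theta>')"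
proof -
  define N where "N \<theta> s f = (\<integral>x. f x * exp (En \<theta> (dat \<theta> s) x) \<partial>Q)" for \<theta> s and f :: "'x \<Rightarrow> real"
  have C0: "C \<ge> 0" using C[of undefined] abs_ge_zero order_trans by blast
  have Gm_N: "(\<integral>x. f x \<partial>Gm \<theta> (dat \<theta> s)) = N \<theta> s f / Z \<theta> (dat \<theta> s)"
    if [measurable]: "f \<in> borel_measurable Q" for f \<theta> s
  proof -
    have "(\<integral>x. f x \<partial>Gm \<theta> (dat \<theta> s)) = (\<integral>x. wt \<theta> (dat \<theta> s) x * f x \<partial>Q)"
      unfolding Gm_def by (subst integral_density) (auto simp: wt_nonneg)
    also have "\<dots> = (\<integral>x. f x * exp (En \<theta> (dat \<theta> s) x) / Z \<theta> (dat \<theta> s) \<partial>Q)"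
      by (simp add: wt_def mult.commute)
    finally show ?thesis unfolding N_def by simp
  qed
  define e where "e n s = (\<Sum>j\<in>J. B * \<bar>\<theta> n j * dat (\<theta> n) s j - \<theta>' j * dat \<theta>' s j\<bar> + B\<^sup>2 * \<bar>(\<theta> n j)\<^sup>2 - (\<theta>' j)\<^sup>2\<bar> / 2)" for n s
  have e_le: "\<bar>En (\<theta> n) (dat (\<theta> n) s) x - En \<theta>' (dat \<theta>' s) x\<bar> \<le> e n s" for n s x
    unfolding e_def by (rule En_diff_le)
  have e_lim: "(\<lambda>n. e n s) \<longlonglongrightarrow> 0" for s
  proof -
    have "(\<lambda>n. e n s) \<longlonglongrightarrow> (\<Sum>j\<in>J. B * \<bar>\<theta>' j * dat \<theta>' s j - \<theta>' j * dat \<theta>' s j\<bar> + B\<^sup>2 * \<bar>(\<theta>' j)\<^sup>2 - (\<theta>' j)\<^sup>2\<bar> / 2)"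
      unfolding e_def
    proof (rule tendsto_sum)
      fix j assume j: "j \<in> J"
      have "(\<lambda>n. dat (\<theta> n) s j) \<longlonglongrightarrow> dat \<theta>' s j"
        using j by (simp add: dat_def) (intro tendsto_intros \<theta>[OF j])
      then show "(\<lambda>n. B * \<bar>\<theta> n j * dat (\<theta> n) s j - \<theta>' j * dat \<theta>' s j\<bar> + B\<^sup>2 * \<bar>(\<theta> n j)\<^sup>2 - (\<theta>' j)\<^sup>2\<bar> / 2)
          \<longlonglongrightarrow> B * \<bar>\<theta>' j * dat \<theta>' s j - \<theta>' j * dat \<theta>' s j\<bar> + B\<^sup>2 * \<bar>(\<theta>' j)\<^sup>2 - (\<theta>' j)\<^sup>2\<bar> / 2"
        by (intro tendsto_intros \<theta>[OF j]) simp_all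
    qed
    then show ?thesis by simp
  qed
  have N_lim: "(\<lambda>n. N (\<theta> n) s f) \<longlonglongrightarrow> N \<theta>' s f" if [measurable]: "f \<in> borel_measurable Q" and D: "\<And>x. \<bar>f x\<bar> \<le> D" for f s D
  proof -
    have int: "integrable Q (\<lambda>x. f x * exp (En t y x))" for t y
      by (rule Bochner_Integration.integrable_bound[OF integrable_mult_right[OF exp_En_integrable[of t y], of D]])
        (use D in \<open>auto simp: abs_mult intro!: AE_I2 mult_right_mono order_trans[OF D abs_ge_self]\<close>)
    have "\<bar>N (\<theta> n) s f - N \<theta>' s f\<bar> \<le> D * ((exp (e n s) - 1) * Z \<theta>' (dat \<theta>' s))" for n
    proof -
      have "N (\<theta> n) s f - N \<theta>' s f = (\<integral>x. f x * exp (En (\<theta> n) (dat (\<theta> n) s) x) - f x * exp (En \<theta>' (dat \<theta>' s) x) \<partial>Q)"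
        unfolding N_def using int by simp
      then have "\<bar>N (\<theta> n) s f - N \<theta>' s f\<bar> \<le> (\<integral>x. \<bar>f x * exp (En (\<theta> n) (dat (\<theta> n) s) x) - f x * exp (En \<theta>' (dat \<theta>' s) x)\<bar> \<partial>Q)"
        by (metis integral_abs_bound)
      also have "\<dots> \<le> (\<integral>x. D * ((exp (e n s) - 1) * exp (En \<theta>' (dat \<theta>' s) x)) \<partial>Q)"
      proof (rule integral_mono)
        fix x
        have "\<bar>f x * exp (En (\<theta> n) (dat (\<theta> n) s) x) - f x * exp (En \<theta>' (dat \<theta>' s) x)\<bar>
            = \<bar>f x\<bar> * \<bar>exp (En (\<theta> n) (dat (\<theta> n) s) x) - exp (En \<theta>' (dat \<theta>' s) x)\<bar>"
          by (simp add: abs_mult flip: right_diff_distrib)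
        also have "\<dots> \<le> D * ((exp (e n s) - 1) * exp (En \<theta>' (dat \<theta>' s) x))"
          by (intro mult_mono D abs_exp_diff_le e_le) (use D[of x] in auto)
        finally show "\<bar>f x * exp (En (\<theta> n) (dat (\<theta> n) s) x) - f x * exp (En \<theta>' (dat \<theta>' s) x)\<bar>
            \<le> D * ((exp (e n s) - 1) * exp (En \<theta>' (dat \<theta>' s) x))" .
      qed (use int exp_En_integrable in auto)
      also have "\<dots> = D * ((exp (e n s) - 1) * Z \<theta>' (dat \<theta>' s))" unfolding Z_def by simp
      finally show ?thesis .
    qed
    then have le: "\<forall>\<^sub>F n in sequentially. norm (N (\<theta> n) s f - N \<theta>' s f) \<le> D * ((exp (e n s) - 1) * Z \<theta>' (dat \<theta>' s))"
      by (intro always_eventually allI) (simp only: real_norm_def)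
    have "(\<lambda>n. D * ((exp (e n s) - 1) * Z \<theta>' (dat \<theta>' s))) \<longlonglongrightarrow> D * ((exp 0 - 1) * Z \<theta>' (dat \<theta>' s))"
      by (intro tendsto_intros e_lim)
    then have "(\<lambda>n. D * ((exp (e n s) - 1) * Z \<theta>' (dat \<theta>' s))) \<longlonglongrightarrow> 0" by simp
    with le have "(\<lambda>n. N (\<theta> n) s f - N \<theta>' s f) \<longlonglongrightarrow> 0" by (rule Lim_null_comparison)
    then show ?thesis by (rule LIM_zero_cancel)
  qed
  let ?F = "\<lambda>z. \<phi> (fst (fst z), snd z)"
  have Fm: "?F \<in> borel_measurable (S \<Otimes>\<^sub>M Q)" by measurable
  have Fi: "integrable (T t) ?F" for t by (rule T_bounded_integrable[OF Fm C])
  have T_eq: "(\<integral>z. ?F z \<partial>T t) = (\<integral>s. (\<integral>x. \<phi> (fst s, x) \<partial>Gm t (dat t s)) \<partial>S)"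
    "integrable S (\<lambda>s. \<integral>x. \<phi> (fst s, x) \<partial>Gm t (dat t s))" for t
    using T_integral[OF Fm Fi] by (simp_all only: fst_conv snd_conv)
  show ?thesis unfolding T_eq(1)
  proof (rule integral_dominated_convergence[where w = "\<lambda>_. C"])
    show "AE s in S. (\<lambda>n. \<integral>x. \<phi> (fst s, x) \<partial>Gm (\<theta> n) (dat (\<theta> n) s)) \<longlonglongrightarrow> (\<integral>x. \<phi> (fst s, x) \<partial>Gm \<theta>' (dat \<theta>' s))"
    proof (rule AE_I2)
      fix s assume s: "s \<in> space S"
      then have "fst s \<in> space Q" by (auto simp: space_pair_measure)
      then have [measurable]: "(\<lambda>x. \<phi> (fst s, x)) \<in> borel_measurable Q" by measurable
      have Zl: "(\<lambda>n. Z (\<theta> n) (dat (\<theta> n) s)) \<longlonglongrightarrow> Z \<theta>' (dat \<theta>' s)"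
        using N_lim[of "\<lambda>_. 1" 1 s] unfolding N_def Z_def by simp
      have "(\<lambda>n. N (\<theta> n) s (\<lambda>x. \<phi> (fst s, x)) / Z (\<theta> n) (dat (\<theta> n) s)) \<longlonglongrightarrow> N \<theta>' s (\<lambda>x. \<phi> (fst s, x)) / Z \<theta>' (dat \<theta>' s)"
      proof (rule tendsto_divide[OF N_lim Zl])
        show "\<bar>\<phi> (fst s, x)\<bar> \<le> C" for x by (rule C)
        show "Z \<theta>' (dat \<theta>' s) \<noteq> 0" using Z_pos[of \<theta>' "dat \<theta>' s"] by linarith
      qed measurable
      then show "(\<lambda>n. \<integral>x. \<phi> (fst s, x) \<partial>Gm (\<theta> n) (dat (\<theta> n) s)) \<longlonglongrightarrow> (\<integral>x. \<phi> (fst s, x) \<partial>Gm \<theta>' (dat \<theta>' s))"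
        by (simp add: Gm_N)
    qed
    fix n
    show "AE s in S. norm (\<integral>x. \<phi> (fst s, x) \<partial>Gm (\<theta> n) (dat (\<theta> n) s)) \<le> C"
    proof (rule AE_I2)
      fix s assume s: "s \<in> space S"
      then have "fst s \<in> space Q" by (auto simp: space_pair_measure)
      then have [measurable]: "(\<lambda>x. \<phi> (fst s, x)) \<in> borel_measurable Q" by measurable
      interpret Gm: prob_space "Gm (\<theta> n) (dat (\<theta> n) s)" by (rule prob_space_Gm)
      have i: "integrable (Gm (\<theta> n) (dat (\<theta> n) s)) (\<lambda>x. \<bar>\<phi> (fst s, x)\<bar>)"
        by (rule Gm.integrable_const_bound[where B = C]) (use C in auto)
      have "\<bar>\<integral>x. \<phi> (fst s, x) \<partial>Gm (\<theta> n) (dat (\<theta> n) s)\<bar> \<le> (\<integral>x. \<bar>\<phi> (fst s, x)\<bar> \<partial>Gm (\<theta> n) (dat (\<theta> n) s))"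
        by (rule integral_abs_bound)
      also have "\<dots> \<le> C" using C by (intro Gm.integral_le_const[OF i]) auto
      finally show "norm (\<integral>x. \<phi> (fst s, x) \<partial>Gm (\<theta> n) (dat (\<theta> n) s)) \<le> C" by simp
    qed
  qed (rule borel_measurable_integrable[OF T_eq(2)] S.integrable_const)+
qed

end

section \<open>The tensor model as a Gaussian channel\<close>

lemma finite_tidx: "finite (tidx N p)"
proof -
  have "tidx N p = {xs. set xs \<subseteq> {..<N} \<and> length xs = p}" by (auto simp: tidx_def)
  then show ?thesis by (simp add: finite_lists_length_eq)
qed

text \<open>The power expanded over ordered index tuples. For coordinatewise products it says that
  the inner product of two \<open>p\<close>-fold tensor powers is the \<open>p\<close>-th power of
  the inner product.\<close>

lemma sum_tidx_prod:
  fixes u :: "nat \<Rightarrow> real"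
  shows "(\<Sum>is\<in>tidx N p. prod_list (map u is)) = (\<Sum>i<N. u i) ^ p"
proof (induction p)
  case 0
  have "tidx N 0 = {[]}" by (auto simp: tidx_def)
  then show ?case by simp
next
  case (Suc p)
  have eq: "tidx N (Suc p) = (\<lambda>(i, is). i # is) ` ({..<N} \<times> tidx N p)"
    by (auto simp: tidx_def length_Suc_conv image_iff)
  have "inj_on (\<lambda>(i, is). i # is) ({..<N} \<times> tidx N p)" by (auto simp: inj_on_def)
  then have "(\<Sum>is\<in>tidx N (Suc p). prod_list (map u is)) = (\<Sum>(i, is)\<in>{..<N} \<times> tidx N p. u i * prod_list (map u is))"
    unfolding eq by (subst sum.reindex) (auto simp: case_prod_beta intro!: sum.cong)
  also have "\<dots> = (\<Sum>i<N. u i) * (\<Sum>is\<in>tidx N p. prod_list (map u is))"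
    by (simp add: sum.cartesian_product[symmetric] sum_product)
  finally show ?case using Suc by simp
qed

lemma prod_list_map_mult:
  fixes u v :: "nat \<Rightarrow> real"
  shows "prod_list (map u is) * prod_list (map v is) = prod_list (map (\<lambda>i. u i * v i) is)"
  by (induction "is") (auto simp: mult_ac)

lemma card_tidx: "real (card (tidx N p)) = real N ^ p"
proof -
  have "prod_list (map (\<lambda>_. 1::real) is) = 1" for "is" :: "nat list" by (induction "is") auto
  then show ?thesis using sum_tidx_prod[of "\<lambda>_. 1" N p] by simp
qed

text \<open>Translates errors quadratic in the square roots into the parameters themselves: here
  quadratic with a factor \<open>1 / y\<close>, in \<open>sqrt_diff_square_le_abs\<close> linear but
  valid up to zero.\<close>

lemma sqrt_diff_square_le:
  assumes "x \<ge> 0" "y > 0"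
  shows "(sqrt x - sqrt y)\<^sup>2 \<le> (x - y)\<^sup>2 / y"
proof -
  have "x - y = (sqrt x - sqrt y) * (sqrt x + sqrt y)" using assms by (simp add: algebra_simps)
  then have "(x - y)\<^sup>2 = (sqrt x - sqrt y)\<^sup>2 * (sqrt x + sqrt y)\<^sup>2" by (simp add: power_mult_distrib)
  moreover have "(sqrt y)\<^sup>2 \<le> (sqrt x + sqrt y)\<^sup>2" using assms by (intro power_mono) auto
  ultimately have "(sqrt x - sqrt y)\<^sup>2 * y \<le> (x - y)\<^sup>2" using assms by (simp add: mult_left_mono)
  then show ?thesis using assms by (simp add: field_simps)
qed

lemma sqrt_diff_square_le_abs:
  assumes "x \<ge> 0" "y \<ge> 0"
  shows "(sqrt x - sqrt y)\<^sup>2 \<le> \<bar>x - y\<bar>"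
proof -
  have "\<bar>sqrt x - sqrt y\<bar> * \<bar>sqrt x - sqrt y\<bar> \<le> \<bar>sqrt x - sqrt y\<bar> * (sqrt x + sqrt y)"
    using assms by (intro mult_left_mono) (auto simp: abs_le_iff)
  also have "\<dots> = \<bar>(sqrt x - sqrt y) * (sqrt x + sqrt y)\<bar>" using assms by (simp add: abs_mult)
  also have "(sqrt x - sqrt y) * (sqrt x + sqrt y) = x - y" using assms by (simp add: algebra_simps)
  finally show ?thesis by (simp add: power2_eq_square abs_mult_self_eq)
qed

text \<open>The tangent at \<open>y\<close> bounds the increment on one side and the tangent at
  \<open>x\<close> on the other; they differ by \<open>D x - D y\<close> and a quadratic error.
  Continuity of \<open>D\<close> therefore suffices, without differentiating under an
  integral.\<close>

lemma derivative_of_tangents: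
  fixes f D :: "real \<Rightarrow> real"
  assumes y: "y > 0" and C: "C \<ge> 0"
    and tan: "\<And>u v. u \<ge> 0 \<Longrightarrow> v \<ge> 0 \<Longrightarrow> f v - f u \<ge> D u * (v - u) - C * (sqrt v - sqrt u)\<^sup>2"
    and cont: "isCont D y"
  shows "(f has_real_derivative D y) (at y)"
  unfolding has_field_derivative_iff
proof (rule LIM_zero_cancel, rule Lim_null_comparison)
  have "((\<lambda>x. \<bar>D x - D y\<bar> + C * \<bar>x - y\<bar> / y) \<longlongrightarrow> \<bar>D y - D y\<bar> + C * \<bar>y - y\<bar> / y) (at y)"
    using cont y unfolding isCont_def by (intro tendsto_intros) auto
  then show "((\<lambda>x. \<bar>D x - D y\<bar> + C * \<bar>x - y\<bar> / y) \<longlongrightarrow> 0) (at y)" by simp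
  have "eventually (\<lambda>x. x > 0) (at y)" using order_tendstoD(1)[OF tendsto_ident_at y] .
  moreover have "eventually (\<lambda>x. x \<noteq> y) (at y)" by (rule eventually_neq_at_within)
  ultimately show "\<forall>\<^sub>F x in at y. norm ((f x - f y) / (x - y) - D y) \<le> \<bar>D x - D y\<bar> + C * \<bar>x - y\<bar> / y"
  proof eventually_elim
    case (elim x)
    have s: "C * (sqrt x - sqrt y)\<^sup>2 \<le> C * ((x - y)\<^sup>2 / y)"
      using elim y by (intro mult_left_mono sqrt_diff_square_le C) auto
    have 1: "f x - f y \<ge> D y * (x - y) - C * ((x - y)\<^sup>2 / y)" using tan[of y x] elim y s by linarith
    have 2: "f y - f x \<ge> D x * (y - x) - C * ((x - y)\<^sup>2 / y)"
      using tan[of x y] elim y s by (simp add: power2_commute)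
    have 3: "\<bar>(D x - D y) * (x - y)\<bar> = \<bar>D x - D y\<bar> * \<bar>x - y\<bar>" by (rule abs_mult)
    have "\<bar>f x - f y - D y * (x - y)\<bar> \<le> \<bar>D x - D y\<bar> * \<bar>x - y\<bar> + C * ((x - y)\<^sup>2 / y)"
    proof (rule abs_leI)
      have "f x - f y - D y * (x - y) \<le> (D x - D y) * (x - y) + C * ((x - y)\<^sup>2 / y)"
        using 2 by (simp add: algebra_simps)
      then show "f x - f y - D y * (x - y) \<le> \<bar>D x - D y\<bar> * \<bar>x - y\<bar> + C * ((x - y)\<^sup>2 / y)" using 3 by linarith
      have "\<bar>D x - D y\<bar> * \<bar>x - y\<bar> \<ge> 0" by simp
      then show "- (f x - f y - D y * (x - y)) \<le> \<bar>D x - D y\<bar> * \<bar>x - y\<bar> + C * ((x - y)\<^sup>2 / y)" using 1 by linarith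
    qed
    also have "\<dots> = (\<bar>D x - D y\<bar> + C * \<bar>x - y\<bar> / y) * \<bar>x - y\<bar>" by (simp add: algebra_simps power2_eq_square)
    finally have "\<bar>f x - f y - D y * (x - y)\<bar> / \<bar>x - y\<bar> \<le> \<bar>D x - D y\<bar> + C * \<bar>x - y\<bar> / y"
      using elim by (simp add: pos_divide_le_eq)
    moreover have "(f x - f y) / (x - y) - D y = (f x - f y - D y * (x - y)) / (x - y)" using elim by (simp add: field_simps)
    ultimately show ?case by (simp add: abs_divide)
  qed
qed

lemma (in prob_space) mean_abs_le_sqrt:
  fixes f :: "'a \<Rightarrow> real"
  assumes "integrable M f" "integrable M (\<lambda>x. (f x)\<^sup>2)"
  shows "(\<integral>x. \<bar>f x - (\<integral>x. f x \<partial>M)\<bar> \<partial>M) \<le> sqrt ((\<integral>x. (f x)\<^sup>2 \<partial>M) - (\<integral>x. f x \<partial>M)\<^sup>2)"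
proof -
  let ?m = "\<integral>x. f x \<partial>M"
  have i: "integrable M (\<lambda>x. (f x - ?m)\<^sup>2)" using assms by (simp add: power2_diff)
  have ia: "integrable M (\<lambda>x. \<bar>f x - ?m\<bar>)" using assms by simp
  have "(\<integral>x. \<bar>f x - ?m\<bar> \<partial>M)\<^sup>2 \<le> (\<integral>x. \<bar>f x - ?m\<bar>\<^sup>2 \<partial>M)"
    using variance_positive[of "\<lambda>x. \<bar>f x - ?m\<bar>"] variance_eq[of "\<lambda>x. \<bar>f x - ?m\<bar>"] i ia by simp
  also have "\<dots> = (\<integral>x. (f x)\<^sup>2 \<partial>M) - ?m\<^sup>2" using variance_eq[OF assms] by simp
  finally show ?thesis by (rule real_le_rsqrt)
qed

text \<open>Channels \<open>Inl is\<close> carry the tensor entries and \<open>Inr i\<close> the vector entries. Coordinates are clipped to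
  \<open>[-K, K]\<close>, which changes nothing almost surely but makes all features bounded. The strengths are
  parametrised by \<open>s = sqrt t\<close> and \<open>r = sqrt h\<close>, in which the free energy is smooth up to the
  boundary and convex up to a quadratic; \<open>F t h\<close> is the expectation of \<open>FN P p N t h\<close>.\<close>

locale model = P: prob_space P for P :: "real measure" +
  fixes p :: nat and K :: real and N :: nat
  assumes sets_P: "sets P = sets borel" and p: "p \<ge> 1" and K: "K \<ge> 1"
    and P_bound: "AE x in P. \<bar>x\<bar> \<le> K" and N: "N \<ge> 1"
begin

definition clip :: "real \<Rightarrow> real" where "clip x = max (- K) (min K x)"

lemma clip_bound: "\<bar>clip x\<bar> \<le> K" unfolding clip_def using K by auto

lemma clip_measurable [measurable]: "clip \<in> borel_measurable borel" unfolding clip_def[abs_def] by measurable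

abbreviation "QN \<equiv> PiM {..<N} (\<lambda>_. P)"

definition J :: "(nat list + nat) set" where "J = tidx N p <+> {..<N}"

text \<open>The value 0 off the index set makes measurability and boundedness hold for every
  \<open>j\<close>, as the channel locale asks without restriction to \<open>J\<close>.\<close>

definition feature :: "nat list + nat \<Rightarrow> (nat \<Rightarrow> real) \<Rightarrow> real" where
  "feature j x = (case j of Inl is \<Rightarrow> if is \<in> tidx N p then prod_list (map (\<lambda>i. clip (x i)) is) else 0
     | Inr i \<Rightarrow> if i < N then clip (x i) else 0)"

definition wN :: real where "wN = real N powr ((real p - 1) / 2)"

definition strength :: "real \<Rightarrow> real \<Rightarrow> nat list + nat \<Rightarrow> real" where
  "strength s r j = (case j of Inl _ \<Rightarrow> s / wN | Inr _ \<Rightarrow> r)"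

definition clip_dot :: "(nat \<Rightarrow> real) \<Rightarrow> (nat \<Rightarrow> real) \<Rightarrow> real" where
  "clip_dot x y = (\<Sum>i<N. clip (x i) * clip (y i))"

lemma component_QN [measurable (raw)]:
  assumes "i < N" "f \<in> measurable M QN"
  shows "(\<lambda>\<omega>. f \<omega> i) \<in> borel_measurable M"
proof -
  have "(\<lambda>x. x i) \<in> measurable QN P" using assms(1) by (intro measurable_component_singleton) auto
  from measurable_compose[OF assms(2) this] show ?thesis by (simp add: sets_P cong: measurable_cong_sets)
qed

lemma prod_list_measurable:
  fixes g :: "real \<Rightarrow> real"
  assumes "set is \<subseteq> {..<N}" and [measurable]: "g \<in> borel_measurable borel"
  shows "(\<lambda>x. prod_list (map (\<lambda>i. g (x i)) is)) \<in> borel_measurable QN"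
  using assms(1)
proof (induction "is")
  case (Cons i "is")
  then have m: "(\<lambda>x. prod_list (map (\<lambda>i. g (x i)) is)) \<in> borel_measurable QN" and i: "i < N" by auto
  have "(\<lambda>x. x i) \<in> borel_measurable QN" by (rule component_QN[OF i]) simp
  then have "(\<lambda>x. g (x i)) \<in> borel_measurable QN" by (rule measurable_compose[OF _ assms(2)])
  from borel_measurable_times[OF this m] show ?case unfolding list.map prod_list.Cons .
qed simp

lemma feature_measurable [measurable]: "feature j \<in> borel_measurable QN"
proof (cases j)
  case (Inl "is")
  show ?thesis
  proof (cases "is \<in> tidx N p")
    case True
    then show ?thesis using prod_list_measurable[of "is" clip] by (simp add: feature_def[abs_def] Inl tidx_def)
  qed (simp add: feature_def[abs_def] Inl)
next
  case (Inr i)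
  show ?thesis
  proof (cases "i < N")
    case True
    have "(\<lambda>x. x i) \<in> borel_measurable QN" by (rule component_QN[OF True]) simp
    then have "(\<lambda>x. clip (x i)) \<in> borel_measurable QN" by (rule measurable_compose[OF _ clip_measurable])
    then show ?thesis using True by (simp add: feature_def[abs_def] Inr)
  qed (simp add: feature_def[abs_def] Inr)
qed

lemma K_le: "K \<le> K ^ p" using power_increasing[OF p K] by simp

lemma feature_bound: "\<bar>feature j x\<bar> \<le> K ^ p"
proof (cases j)
  case (Inl "is")
  have "\<bar>prod_list (map (\<lambda>i. clip (x i)) xs)\<bar> \<le> K ^ length xs" for xs
  proof (induction xs)
    case (Cons i xs)
    then show ?case using mult_mono[OF clip_bound[of "x i"] Cons] K by (simp add: abs_mult)
  qed simp
  then show ?thesis using K by (force simp: feature_def Inl tidx_def)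
next
  case (Inr i)
  then show ?thesis using order_trans[OF clip_bound K_le, of "x i"] K by (auto simp: feature_def)
qed

sublocale channel QN J feature "K ^ p"
proof (rule channel.intro)
  show "prob_space QN" by (rule prob_space_PiM) (rule P.prob_space_axioms)
  show "channel_axioms QN J feature (K ^ p)"
    by unfold_locales (use K feature_bound in \<open>auto simp: J_def finite_tidx\<close>)
qed

lemma wN: "wN > 0" "wN\<^sup>2 = real N ^ (p - 1)"
proof -
  show "wN > 0" unfolding wN_def using N by simp
  have "wN\<^sup>2 = real N powr ((real p - 1) / 2 + (real p - 1) / 2)"
    unfolding wN_def power2_eq_square powr_add ..
  also have "\<dots> = real N powr (real (p - 1))" using p by (simp add: of_nat_diff)
  also have "\<dots> = real N ^ (p - 1)" using N by (subst powr_realpow) auto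
  finally show "wN\<^sup>2 = real N ^ (p - 1)" .
qed

lemma N_power: "real N ^ p = real N * wN\<^sup>2"
  unfolding wN(2) using p by (metis Suc_pred' less_eq_Suc_le One_nat_def power_Suc)

lemma sum_J: "(\<Sum>j\<in>J. f j) = (\<Sum>is\<in>tidx N p. f (Inl is)) + (\<Sum>i<N. f (Inr i))" for f :: "_ \<Rightarrow> real"
  unfolding J_def by (subst sum.Plus) (auto simp: finite_tidx)

lemma sum_af:
  "(\<Sum>is\<in>tidx N p. feature (Inl is) x * feature (Inl is) y) = clip_dot x y ^ p"
  "(\<Sum>i<N. feature (Inr i) x * feature (Inr i) y) = clip_dot x y"
proof -
  have "(\<Sum>is\<in>tidx N p. feature (Inl is) x * feature (Inl is) y) = (\<Sum>is\<in>tidx N p. prod_list (map (\<lambda>i. clip (x i) * clip (y i)) is))"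
    by (intro sum.cong) (auto simp: feature_def prod_list_map_mult)
  then show "(\<Sum>is\<in>tidx N p. feature (Inl is) x * feature (Inl is) y) = clip_dot x y ^ p"
    by (simp add: sum_tidx_prod clip_dot_def)
  show "(\<Sum>i<N. feature (Inr i) x * feature (Inr i) y) = clip_dot x y"
    unfolding clip_dot_def by (intro sum.cong) (auto simp: feature_def)
qed

lemma strength_diff: "strength s' r' j - strength s r j = strength (s' - s) (r' - r) j"
  by (auto simp: strength_def diff_divide_distrib split: sum.splits)

lemma sum_th_square: fixes s r :: real shows "(\<Sum>j\<in>J. (strength s r j)\<^sup>2) = N * (s\<^sup>2 + r\<^sup>2)"
proof -
  have "(\<Sum>j\<in>J. (strength s r j)\<^sup>2) = real N ^ p * (s / wN)\<^sup>2 + N * r\<^sup>2"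
    unfolding sum_J by (simp add: strength_def card_tidx)
  also have "\<dots> = N * (s\<^sup>2 + r\<^sup>2)" unfolding N_power using wN(1) by (simp add: power_divide field_simps)
  finally show ?thesis .
qed

lemma clip_dot_bound: "\<bar>clip_dot x y / N\<bar> \<le> K\<^sup>2"
proof -
  have "\<bar>clip_dot x y\<bar> \<le> (\<Sum>i<N. \<bar>clip (x i)\<bar> * \<bar>clip (y i)\<bar>)" unfolding clip_dot_def abs_mult[symmetric] by (rule sum_abs)
  also have "\<dots> \<le> (\<Sum>i<N. K * K)" using K by (intro sum_mono mult_mono clip_bound) auto
  finally show ?thesis using N by (simp add: power2_eq_square field_simps)
qed

lemma clip_dot_measurable [measurable (raw)]:
  assumes [measurable]: "f \<in> measurable M QN" "g \<in> measurable M QN"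
  shows "(\<lambda>\<omega>. clip_dot (f \<omega>) (g \<omega>)) \<in> borel_measurable M"
  unfolding clip_dot_def by measurable

definition R :: "((nat \<Rightarrow> real) \<times> (nat list + nat \<Rightarrow> real)) \<times> (nat \<Rightarrow> real) \<Rightarrow> real" where
  "R z = clip_dot (snd z) (fst (fst z)) / N"

lemma R_measurable [measurable]: "R \<in> borel_measurable (S \<Otimes>\<^sub>M QN)"
  unfolding R_def[abs_def] by measurable

lemma R_bound: "\<bar>R z\<bar> \<le> K\<^sup>2" unfolding R_def by (rule clip_dot_bound)

lemma Rp_bound: "\<bar>R z ^ p\<bar> \<le> (K\<^sup>2) ^ p"
  unfolding power_abs by (intro power_mono R_bound) auto

lemma R_integrable: "integrable (T \<theta>) R" "integrable (T \<theta>) (\<lambda>z. R z ^ p)"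
  by (rule T_bounded_integrable[OF _ R_bound] T_bounded_integrable[OF _ Rp_bound], measurable)+

definition mR :: "real \<Rightarrow> real \<Rightarrow> real" where "mR s r = (\<integral>z. R z \<partial>T (strength s r))"
definition mRp :: "real \<Rightarrow> real \<Rightarrow> real" where "mRp s r = (\<integral>z. R z ^ p \<partial>T (strength s r))"

text \<open>The tensor channels sum to \<open>R z ^ p\<close> and the vector channels to
  \<open>R z\<close>, with the common factor \<open>N\<close> provided by the scaling
  \<open>wN\<close>. This is where the \<open>p\<close>-th power of the limiting equation
  originates.\<close>

lemma signal_eq:
  "signal (strength s r) (strength s' r') z = N * ((s'\<^sup>2 - s\<^sup>2) / 2 * R z ^ p + (r'\<^sup>2 - r\<^sup>2) / 2 * R z)"
proof -
  have ipR: "clip_dot (snd z) (fst (fst z)) = N * R z" unfolding R_def using N by simp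
  have "signal (strength s r) (strength s' r') z =
     ((s' / wN)\<^sup>2 - (s / wN)\<^sup>2) / 2 * (\<Sum>is\<in>tidx N p. feature (Inl is) (snd z) * feature (Inl is) (fst (fst z)))
     + (r'\<^sup>2 - r\<^sup>2) / 2 * (\<Sum>i<N. feature (Inr i) (snd z) * feature (Inr i) (fst (fst z)))"
    unfolding signal_def sum_J overlap_def strength_def by (simp add: sum_distrib_left)
  also have "\<dots> = ((s' / wN)\<^sup>2 - (s / wN)\<^sup>2) / 2 * (N * R z) ^ p + (r'\<^sup>2 - r\<^sup>2) / 2 * (N * R z)"
    unfolding sum_af ipR ..
  also have "\<dots> = N * ((s'\<^sup>2 - s\<^sup>2) / 2 * R z ^ p + (r'\<^sup>2 - r\<^sup>2) / 2 * R z)"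
    unfolding power_mult_distrib N_power using wN(1) by (simp add: power_divide field_simps)
  finally show ?thesis .
qed

lemma mov_sum:
  "(\<Sum>j\<in>J. ((strength s' r' j)\<^sup>2 - (strength s r j)\<^sup>2) / 2 * mov (strength s r) j) = N * ((s'\<^sup>2 - s\<^sup>2) / 2 * mRp s r + (r'\<^sup>2 - r\<^sup>2) / 2 * mR s r)"
  unfolding signal_mean[symmetric] signal_eq mR_def mRp_def by (simp add: R_integrable)

text \<open>Nonnegativity is inherited from the vector channels, each of which contributes a mean
  square of posterior means.\<close>

lemma mR_bounds: "0 \<le> mR s r" "mR s r \<le> K\<^sup>2" "\<bar>mRp s r\<bar> \<le> (K\<^sup>2) ^ p"
proof -
  interpret T: prob_space "T (strength s r)" by (rule prob_space_T)
  have "mR s r = (\<integral>z. (\<Sum>i<N. overlap (Inr i) z) / N \<partial>T (strength s r))"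
    unfolding mR_def R_def overlap_def sum_af ..
  also have "\<dots> = (\<Sum>i<N. mov (strength s r) (Inr i)) / N"
    by (simp add: Bochner_Integration.integral_sum overlap_integrable mov_def)
  finally show "0 \<le> mR s r" using mov_nonneg by (simp add: sum_nonneg)
  show "mR s r \<le> K\<^sup>2" unfolding mR_def
    using R_bound by (intro T.integral_le_const[OF R_integrable(1)] AE_I2) (auto simp: abs_le_iff)
  have "\<bar>mRp s r\<bar> \<le> (\<integral>z. \<bar>R z ^ p\<bar> \<partial>T (strength s r))" unfolding mRp_def by (rule integral_abs_bound)
  also have "\<dots> \<le> (K\<^sup>2) ^ p" using Rp_bound by (intro T.integral_le_const integrable_abs R_integrable AE_I2) auto
  finally show "\<bar>mRp s r\<bar> \<le> (K\<^sup>2) ^ p" .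
qed

lemma mR_sequential:
  assumes "s \<longlonglongrightarrow> s'" "r \<longlonglongrightarrow> r'"
  shows "(\<lambda>n. mR (s n) (r n)) \<longlonglongrightarrow> mR s' r'" "(\<lambda>n. mRp (s n) (r n)) \<longlonglongrightarrow> mRp s' r'"
proof -
  have strength: "(\<lambda>n. strength (s n) (r n) j) \<longlonglongrightarrow> strength s' r' j" for j
    unfolding strength_def using assms wN(1) by (auto intro!: tendsto_intros split: sum.splits)
  have eq: "R z = (\<lambda>u. clip_dot (snd u) (fst u) / N) (fst (fst z), snd z)"
    "R z ^ p = (\<lambda>u. (clip_dot (snd u) (fst u) / N) ^ p) (fst (fst z), snd z)" for z
    by (auto simp: R_def)
  show "(\<lambda>n. mR (s n) (r n)) \<longlonglongrightarrow> mR s' r'"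
    unfolding mR_def eq(1)
    by (rule T_continuous[where \<phi> = "\<lambda>u. clip_dot (snd u) (fst u) / N" and C = "K\<^sup>2", OF strength]) (measurable, rule clip_dot_bound)
  have b: "\<bar>(clip_dot x y / N) ^ p\<bar> \<le> (K\<^sup>2) ^ p" for x y
    unfolding power_abs by (intro power_mono clip_dot_bound) auto
  show "(\<lambda>n. mRp (s n) (r n)) \<longlonglongrightarrow> mRp s' r'"
    unfolding mRp_def eq(2)
    by (rule T_continuous[where \<phi> = "\<lambda>u. (clip_dot (snd u) (fst u) / N) ^ p" and C = "(K\<^sup>2) ^ p", OF strength]) (measurable, rule b)
qed

section \<open>The mean free energy in the parameters \<open>s\<close>, \<open>r\<close> and in
  \<open>t\<close>, \<open>h\<close>\<close>

definition Fb :: "real \<Rightarrow> real \<Rightarrow> real" where "Fb s r = mFE (strength s r) / N"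

abbreviation "B2 \<equiv> (K ^ p)\<^sup>2"

lemma B2: "B2 \<ge> 1" "(K\<^sup>2) ^ p = B2" "K\<^sup>2 \<le> B2"
proof -
  show "B2 \<ge> 1" using one_le_power[OF one_le_power[OF K, of p], of 2] .
  show "(K\<^sup>2) ^ p = B2" by (simp add: power_mult[symmetric] mult.commute)
  show "K\<^sup>2 \<le> B2" using K K_le by (intro power_mono) auto
qed

lemma Fb_tangent:
  "Fb s' r' - Fb s r \<ge> (s'\<^sup>2 - s\<^sup>2) / 2 * mRp s r + (r'\<^sup>2 - r\<^sup>2) / 2 * mR s r - B2 * ((s' - s)\<^sup>2 + (r' - r)\<^sup>2)"
proof -
  have "mFE (strength s' r') - mFE (strength s r) \<ge> N * ((s'\<^sup>2 - s\<^sup>2) / 2 * mRp s r + (r'\<^sup>2 - r\<^sup>2) / 2 * mR s r) - B2 * (N * ((s' - s)\<^sup>2 + (r' - r)\<^sup>2))"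
    using mFE_convexity[of "strength s' r'" "strength s r"] by (simp only: mov_sum strength_diff sum_th_square)
  then have "(mFE (strength s' r') - mFE (strength s r)) / N \<ge> (N * ((s'\<^sup>2 - s\<^sup>2) / 2 * mRp s r + (r'\<^sup>2 - r\<^sup>2) / 2 * mR s r) - B2 * (N * ((s' - s)\<^sup>2 + (r' - r)\<^sup>2))) / N"
    using N by (intro divide_right_mono) auto
  also have "(N * ((s'\<^sup>2 - s\<^sup>2) / 2 * mRp s r + (r'\<^sup>2 - r\<^sup>2) / 2 * mR s r) - B2 * (N * ((s' - s)\<^sup>2 + (r' - r)\<^sup>2))) / N
    = (s'\<^sup>2 - s\<^sup>2) / 2 * mRp s r + (r'\<^sup>2 - r\<^sup>2) / 2 * mR s r - B2 * ((s' - s)\<^sup>2 + (r' - r)\<^sup>2)"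
    using N by (simp add: field_simps)
  finally show ?thesis unfolding Fb_def by (simp add: diff_divide_distrib)
qed

text \<open>The tangent inequality is used from both end points, so no derivative is involved and
  strengths of either sign are allowed.\<close>

lemma Fb_diff_le:
  "\<bar>Fb s' r' - Fb s r\<bar> \<le> B2 * (\<bar>s'\<^sup>2 - s\<^sup>2\<bar> / 2 + \<bar>r'\<^sup>2 - r\<^sup>2\<bar> / 2 + (s' - s)\<^sup>2 + (r' - r)\<^sup>2)"
proof -
  have 1: "Fb s r - Fb s' r' \<le> B2 * (\<bar>s'\<^sup>2 - s\<^sup>2\<bar> / 2 + \<bar>r'\<^sup>2 - r\<^sup>2\<bar> / 2 + (s' - s)\<^sup>2 + (r' - r)\<^sup>2)" for s r s' r'
  proof -
    have bd: "\<bar>x / 2 * m\<bar> \<le> B2 * (\<bar>x\<bar> / 2)" if "\<bar>m\<bar> \<le> B2" for x m :: real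
      using mult_left_mono[OF that, of "\<bar>x\<bar> / 2"] by (simp add: abs_mult mult_ac)
    have "\<bar>mR s r\<bar> \<le> B2" "\<bar>mRp s r\<bar> \<le> B2" using mR_bounds[of s r] B2 by auto
    then have "- ((s'\<^sup>2 - s\<^sup>2) / 2 * mRp s r) \<le> B2 * (\<bar>s'\<^sup>2 - s\<^sup>2\<bar> / 2)" "- ((r'\<^sup>2 - r\<^sup>2) / 2 * mR s r) \<le> B2 * (\<bar>r'\<^sup>2 - r\<^sup>2\<bar> / 2)"
      using bd[of "mRp s r" "s'\<^sup>2 - s\<^sup>2"] bd[of "mR s r" "r'\<^sup>2 - r\<^sup>2"] by linarith+
    then show ?thesis using Fb_tangent[where s = s and r = r and s' = s' and r' = r'] unfolding distrib_left by linarith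
  qed
  show ?thesis
    using 1[of s r s' r'] 1[of s' r' s r] by (simp add: abs_le_iff abs_minus_commute power2_commute)
qed

definition F :: "real \<Rightarrow> real \<Rightarrow> real" where "F t h = Fb (sqrt t) (sqrt h)"
definition Ft :: "real \<Rightarrow> real \<Rightarrow> real" where "Ft t h = mRp (sqrt t) (sqrt h) / 2"
definition Fh :: "real \<Rightarrow> real \<Rightarrow> real" where "Fh t h = mR (sqrt t) (sqrt h) / 2"

lemma F_tangent:
  assumes "t \<ge> 0" "h \<ge> 0" "t' \<ge> 0" "h' \<ge> 0"
  shows "F t' h' - F t h \<ge> Ft t h * (t' - t) + Fh t h * (h' - h) - B2 * ((sqrt t' - sqrt t)\<^sup>2 + (sqrt h' - sqrt h)\<^sup>2)"
  using Fb_tangent[where s = "sqrt t" and s' = "sqrt t'" and r = "sqrt h" and r' = "sqrt h'"] assms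
  by (simp add: F_def Ft_def Fh_def mult.commute)

lemma F_lip:
  assumes "t \<ge> 0" "h \<ge> 0" "t' \<ge> 0" "h' \<ge> 0"
  shows "\<bar>F t h - F t' h'\<bar> \<le> 2 * B2 * (\<bar>t - t'\<bar> + \<bar>h - h'\<bar>)"
proof -
  have "\<bar>F t h - F t' h'\<bar> \<le> B2 * (\<bar>t - t'\<bar> / 2 + \<bar>h - h'\<bar> / 2 + (sqrt t - sqrt t')\<^sup>2 + (sqrt h - sqrt h')\<^sup>2)"
    using Fb_diff_le[where s = "sqrt t'" and s' = "sqrt t" and r = "sqrt h'" and r' = "sqrt h"] assms by (simp add: F_def)
  also have "\<dots> \<le> B2 * (2 * (\<bar>t - t'\<bar> + \<bar>h - h'\<bar>))"
    using sqrt_diff_square_le_abs[of t t'] sqrt_diff_square_le_abs[of h h'] assms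
      abs_ge_zero[of "t - t'"] abs_ge_zero[of "h - h'"] by (intro mult_left_mono) (argo, simp)
  also have "\<dots> = 2 * B2 * (\<bar>t - t'\<bar> + \<bar>h - h'\<bar>)" by (simp only: mult_ac)
  finally show ?thesis .
qed

lemma Fh_bounds: "0 \<le> Fh t h" "Fh t h \<le> 2 * B2"
proof -
  show "0 \<le> Fh t h" using mR_bounds[of "sqrt t" "sqrt h"] by (simp add: Fh_def)
  have "mR (sqrt t) (sqrt h) \<le> B2" using mR_bounds(2)[of "sqrt t" "sqrt h"] B2(3) by linarith
  then show "Fh t h \<le> 2 * B2" unfolding Fh_def using B2(1) by linarith
qed

lemma F_dt:
  assumes "t > 0" "h \<ge> 0"
  shows "((\<lambda>t. F t h) has_real_derivative Ft t h) (at t)"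
proof (rule derivative_of_tangents[where D = "\<lambda>t. Ft t h" and C = B2])
  show "F v h - F u h \<ge> Ft u h * (v - u) - B2 * (sqrt v - sqrt u)\<^sup>2" if "u \<ge> 0" "v \<ge> 0" for u v
    using F_tangent[of u h v h] that assms by simp
  show "isCont (\<lambda>t. Ft t h) t"
    unfolding continuous_at_sequentially comp_def Ft_def
    by (intro allI impI tendsto_intros mR_sequential) auto
qed (use assms in auto)

lemma F_dh:
  assumes "t \<ge> 0" "h > 0"
  shows "((\<lambda>h. F t h) has_real_derivative Fh t h) (at h)"
proof (rule derivative_of_tangents[where D = "\<lambda>h. Fh t h" and C = B2])
  show "F t v - F t u \<ge> Fh t u * (v - u) - B2 * (sqrt v - sqrt u)\<^sup>2" if "u \<ge> 0" "v \<ge> 0" for u v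
    using F_tangent[of t u t v] that assms by simp
  show "isCont (\<lambda>h. Fh t h) h"
    unfolding continuous_at_sequentially comp_def Fh_def
    by (intro allI impI tendsto_intros mR_sequential) auto
qed (use assms in auto)

lemma F_semiconvex:
  assumes "t \<ge> 0" "h > 0" "h' \<ge> 0"
  shows "F t h' \<ge> F t h + Fh t h * (h' - h) - B2 * (h' - h)\<^sup>2 / h"
proof -
  have "B2 * (sqrt h' - sqrt h)\<^sup>2 \<le> B2 * ((h' - h)\<^sup>2 / h)"
    using assms by (intro mult_left_mono sqrt_diff_square_le) auto
  then show ?thesis using F_tangent[of t h t h'] assms by simp
qed

section \<open>Concentration of the free energy\<close>

text \<open>Bounds the effect of a single signal entry on the unnormalised free energy; it is free
  of \<open>N\<close>.\<close>

definition osc :: "real \<Rightarrow> real \<Rightarrow> real" where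
  "osc s r = s\<^sup>2 * (2 * real p * B2 * K\<^sup>2) + r\<^sup>2 * (2 * K\<^sup>2)"

lemma clip_dot_update:
  assumes i: "i < N"
  shows "\<bar>clip_dot x' (x(i := u)) - clip_dot x' (x(i := v))\<bar> \<le> 2 * K\<^sup>2"
proof -
  have "clip_dot x' (x(i := u)) - clip_dot x' (x(i := v)) = (\<Sum>k<N. if k = i then clip (x' i) * (clip u - clip v) else 0)"
    unfolding clip_dot_def sum_subtractf[symmetric] by (intro sum.cong) (auto simp: algebra_simps)
  also have "\<dots> = clip (x' i) * (clip u - clip v)" using i by simp
  finally have "\<bar>clip_dot x' (x(i := u)) - clip_dot x' (x(i := v))\<bar> = \<bar>clip (x' i) * (clip u - clip v)\<bar>" by (rule arg_cong)
  also have "\<dots> \<le> K * (2 * K)"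
    unfolding abs_mult using clip_bound[of "x' i"] clip_bound[of u] clip_bound[of v] K by (intro mult_mono) auto
  finally show ?thesis by (simp add: power2_eq_square)
qed

text \<open>The noise cancels in the difference of energies, which depends on the signal only
  through its inner product with the sample. One entry moves the normalised inner product by at most
  \<open>2 * K\<^sup>2 / N\<close>, and this compensates the factor \<open>N\<close> in front of the
  tensor term.\<close>

lemma FE_update_signal:
  assumes i: "i < N"
  shows "\<bar>FE (strength s r) (x(i := u), g) - FE (strength s r) (x(i := v), g)\<bar> \<le> osc s r"
  unfolding FE_def
proof (rule LZ_diff)
  fix x'
  let ?U = "clip_dot x' (x(i := u))" and ?V = "clip_dot x' (x(i := v))"
  have "En (strength s r) (dat (strength s r) (x(i := u), g)) x' - En (strength s r) (dat (strength s r) (x(i := v), g)) x'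
     = (\<Sum>j\<in>J. (strength s r j)\<^sup>2 * (feature j x' * feature j (x(i := u)) - feature j x' * feature j (x(i := v))))"
    unfolding En_def sum_subtractf[symmetric]
    by (intro sum.cong refl) (simp add: dat_def power2_eq_square algebra_simps)
  also have "\<dots> = (s / wN)\<^sup>2 * (?U ^ p - ?V ^ p) + r\<^sup>2 * (?U - ?V)"
    unfolding sum_J strength_def by (simp add: sum_distrib_left[symmetric] sum_subtractf sum_af)
  finally have eq: "En (strength s r) (dat (strength s r) (x(i := u), g)) x' - En (strength s r) (dat (strength s r) (x(i := v), g)) x'
     = (s / wN)\<^sup>2 * (?U ^ p - ?V ^ p) + r\<^sup>2 * (?U - ?V)" .
  have UV: "\<bar>?U - ?V\<bar> \<le> 2 * K\<^sup>2" by (rule clip_dot_update[OF i])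
  have "\<bar>(?U / N) ^ p - (?V / N) ^ p\<bar> \<le> p * (K\<^sup>2) ^ p * \<bar>?U / N - ?V / N\<bar>"
    using one_le_power[OF K, of 2] by (intro abs_power_diff_le clip_dot_bound) auto
  also have "\<dots> = p * B2 * (\<bar>?U - ?V\<bar> / N)" unfolding B2(2) by (simp add: abs_divide flip: diff_divide_distrib)
  also have "\<dots> \<le> p * B2 * (2 * K\<^sup>2 / N)" using UV by (intro mult_left_mono divide_right_mono) auto
  finally have 1: "\<bar>(?U / N) ^ p - (?V / N) ^ p\<bar> \<le> p * B2 * (2 * K\<^sup>2 / N)" .
  have "(s / wN)\<^sup>2 * (?U ^ p - ?V ^ p) = s\<^sup>2 * N * ((?U / N) ^ p - (?V / N) ^ p)"
    unfolding power_divide N_power using N wN(1) by (simp add: field_simps)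
  then have "\<bar>(s / wN)\<^sup>2 * (?U ^ p - ?V ^ p)\<bar> = s\<^sup>2 * N * \<bar>(?U / N) ^ p - (?V / N) ^ p\<bar>" by (simp add: abs_mult)
  also have "\<dots> \<le> s\<^sup>2 * N * (p * B2 * (2 * K\<^sup>2 / N))" using 1 by (intro mult_left_mono) auto
  also have "\<dots> = s\<^sup>2 * (2 * real p * B2 * K\<^sup>2)" using N by (simp add: field_simps)
  finally have 2: "\<bar>(s / wN)\<^sup>2 * (?U ^ p - ?V ^ p)\<bar> \<le> s\<^sup>2 * (2 * real p * B2 * K\<^sup>2)" .
  have 3: "\<bar>r\<^sup>2 * (?U - ?V)\<bar> \<le> r\<^sup>2 * (2 * K\<^sup>2)" unfolding abs_mult using UV by (intro mult_mono) auto
  show "\<bar>En (strength s r) (dat (strength s r) (x(i := u), g)) x' - En (strength s r) (dat (strength s r) (x(i := v), g)) x'\<bar> \<le> osc s r"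
    unfolding eq osc_def using 2 3 by linarith
qed

definition noise_lip :: "real \<Rightarrow> real \<Rightarrow> nat list + nat \<Rightarrow> real \<Rightarrow> real" where
  "noise_lip s r j y = K ^ p * \<bar>strength s r j\<bar> * \<bar>y\<bar>"

lemma noise_lip_facts:
  "noise_lip s r j \<in> borel_measurable gauss" "integrable gauss (\<lambda>y. (noise_lip s r j y)\<^sup>2)"
  "(\<integral>y. (noise_lip s r j y)\<^sup>2 \<partial>gauss) = B2 * (strength s r j)\<^sup>2" "noise_lip s r j y \<ge> 0"
proof -
  have "(\<lambda>y::real. K ^ p * \<bar>strength s r j\<bar> * \<bar>y\<bar>) \<in> borel_measurable borel"
    by (intro borel_measurable_continuous_onI continuous_intros)
  then show "noise_lip s r j \<in> borel_measurable gauss" by (simp add: noise_lip_def[abs_def] cong: measurable_cong_sets)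
  have d2: "(noise_lip s r j y)\<^sup>2 = B2 * (strength s r j)\<^sup>2 * y\<^sup>2" for y unfolding noise_lip_def by (simp add: power_mult_distrib)
  show "integrable gauss (\<lambda>y. (noise_lip s r j y)\<^sup>2)" "(\<integral>y. (noise_lip s r j y)\<^sup>2 \<partial>gauss) = B2 * (strength s r j)\<^sup>2"
    unfolding d2 by (simp_all only: integrable_mult_right gauss_moments integral_mult_right_zero mult_1_right)
  show "noise_lip s r j y \<ge> 0" unfolding noise_lip_def using K by simp
qed

lemma FE_growth: "\<exists>C\<ge>0. \<forall>x. \<bar>FE (strength s r) x\<bar> \<le> C + (\<Sum>j\<in>J. noise_lip s r j (snd x j))"
proof (intro exI[of _ "\<Sum>j\<in>J. 2 * (B2 * (strength s r j)\<^sup>2)"] conjI allI)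
  fix x :: "(nat \<Rightarrow> real) \<times> (nat list + nat \<Rightarrow> real)"
  show "\<bar>FE (strength s r) x\<bar> \<le> (\<Sum>j\<in>J. 2 * (B2 * (strength s r j)\<^sup>2)) + (\<Sum>j\<in>J. noise_lip s r j (snd x j))"
    unfolding FE_def noise_lip_def by (rule order_trans[OF LZ_bound bnd_dat_le])
qed (simp add: sum_nonneg)

lemma FE_update_noise:
  assumes j: "j \<in> J"
  shows "\<bar>FE (strength s r) (x, g(j := y)) - FE (strength s r) (x, g(j := 0))\<bar> \<le> noise_lip s r j y"
  unfolding FE_def
proof (rule LZ_diff)
  fix x'
  have "En (strength s r) (dat (strength s r) (x, g(j := y))) x' - En (strength s r) (dat (strength s r) (x, g(j := 0))) x'
     = (\<Sum>k\<in>J. if k = j then strength s r j * y * feature j x' else 0)"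
    unfolding En_def sum_subtractf[symmetric]
    by (intro sum.cong refl) (simp add: dat_def algebra_simps)
  also have "\<dots> = strength s r j * y * feature j x'" using j finite_J by simp
  finally have "\<bar>En (strength s r) (dat (strength s r) (x, g(j := y))) x' - En (strength s r) (dat (strength s r) (x, g(j := 0))) x'\<bar>
    = \<bar>strength s r j * y * feature j x'\<bar>" by (rule arg_cong)
  also have "\<dots> \<le> noise_lip s r j y"
    unfolding noise_lip_def using mult_left_mono[OF feature_bound[of j x'], of "\<bar>strength s r j\<bar> * \<bar>y\<bar>"] by (simp add: abs_mult mult_ac)
  finally show "\<bar>En (strength s r) (dat (strength s r) (x, g(j := y))) x' - En (strength s r) (dat (strength s r) (x, g(j := 0))) x'\<bar> \<le> noise_lip s r j y" .
qed

text \<open>Variance per coordinate: the first summand stems from the Gaussian noise, the second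
  from the signal entries.\<close>

definition vcon :: "real \<Rightarrow> real \<Rightarrow> real" where "vcon s r = B2 * (s\<^sup>2 + r\<^sup>2) + (osc s r)\<^sup>2"

lemma FE_square_integrable: "integrable S (\<lambda>x. (FE (strength s r) x)\<^sup>2)"
proof -
  obtain C where C: "C \<ge> 0" "\<And>x. \<bar>FE (strength s r) x\<bar> \<le> C + (\<Sum>j\<in>J. noise_lip s r j (snd x j))" using FE_growth[of s r] by blast
  show ?thesis
  proof (rule Bochner_Integration.integrable_bound)
    show "integrable S (\<lambda>x. (real (card J) + 1) * (C\<^sup>2 + (\<Sum>j\<in>J. (noise_lip s r j (snd x j))\<^sup>2)))"
      by (intro integrable_mult_right Bochner_Integration.integrable_add S.integrable_const
          Bochner_Integration.integrable_sum integrable_S_snd(1)[where f = "\<lambda>g. (noise_lip s r _ (g _))\<^sup>2"]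
          integrable_PiM_component(1)[where f = "\<lambda>y. (noise_lip s r _ y)\<^sup>2" and M = "\<lambda>_. gauss"] noise_lip_facts prob_space_gauss)
    show "AE x in S. norm ((FE (strength s r) x)\<^sup>2) \<le> norm ((real (card J) + 1) * (C\<^sup>2 + (\<Sum>j\<in>J. (noise_lip s r j (snd x j))\<^sup>2)))"
    proof (rule AE_I2)
      fix x
      have "\<bar>FE (strength s r) x\<bar>\<^sup>2 \<le> (C + (\<Sum>j\<in>J. noise_lip s r j (snd x j)))\<^sup>2" using C(2) by (intro power_mono) auto
      also have "\<dots> \<le> (real (card J) + 1) * (C\<^sup>2 + (\<Sum>j\<in>J. (noise_lip s r j (snd x j))\<^sup>2))" by (rule sum_square_le[OF finite_J])
      finally show "norm ((FE (strength s r) x)\<^sup>2) \<le> norm ((real (card J) + 1) * (C\<^sup>2 + (\<Sum>j\<in>J. (noise_lip s r j (snd x j))\<^sup>2)))"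
        by (simp add: sum_nonneg)
    qed
  qed measurable
qed

text \<open>Efron-Stein twice: over the noise for a fixed signal, then over the signal for the noise
  average \<open>m\<close>. The contributions add by the law of total variance.\<close>

theorem FE_variance:
  "(\<integral>x. (FE (strength s r) x)\<^sup>2 \<partial>S) - (mFE (strength s r))\<^sup>2 \<le> N * vcon s r"
proof -
  let ?f = "FE (strength s r)"
  obtain C where C: "C \<ge> 0" "\<And>x. \<bar>?f x\<bar> \<le> C + (\<Sum>j\<in>J. noise_lip s r j (snd x j))" using FE_growth[of s r] by blast
  define m where "m x = (\<integral>g. ?f (x, g) \<partial>G)" for x
  have fm: "(\<lambda>g. ?f (x, g)) \<in> borel_measurable G" if "x \<in> space QN" for x
    using that by measurable
  have fC: "\<bar>?f (x, g)\<bar> \<le> C + (\<Sum>j\<in>J. noise_lip s r j (g j))" for x g using C(2)[of "(x, g)"] by simp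
  note gi = integrable_PiM_growth[OF finite_J prob_space_gauss noise_lip_facts(2,1) fm fC]
  have m_meas: "m \<in> borel_measurable QN" unfolding m_def by measurable
  have Ci: "integrable G (\<lambda>g. C + (\<Sum>j\<in>J. noise_lip s r j (g j)))"
    unfolding noise_lip_def by (intro Bochner_Integration.integrable_add G.integrable_const
          Bochner_Integration.integrable_sum integrable_mult_right gauss_component)
  define C' where "C' = (\<integral>g. C + (\<Sum>j\<in>J. noise_lip s r j (g j)) \<partial>G)"
  have mC: "\<bar>m x\<bar> \<le> C'" if x: "x \<in> space QN" for x
  proof -
    have "\<bar>m x\<bar> \<le> (\<integral>g. \<bar>?f (x, g)\<bar> \<partial>G)" unfolding m_def by (rule integral_abs_bound)
    also have "\<dots> \<le> C'" unfolding C'_def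
      by (intro integral_mono integrable_abs gi(2)[OF x] Ci fC)
    finally show ?thesis .
  qed
  have osc0: "osc s r \<ge> 0" unfolding osc_def using K by simp
  have v1: "(\<integral>g. (?f (x, g))\<^sup>2 \<partial>G) - (m x)\<^sup>2 \<le> N * (B2 * (s\<^sup>2 + r\<^sup>2))" if x: "x \<in> space QN" for x
  proof -
    have "(\<integral>g. (?f (x, g))\<^sup>2 \<partial>G) - (m x)\<^sup>2 \<le> (\<Sum>j\<in>J. \<integral>y. (noise_lip s r j y)\<^sup>2 \<partial>gauss)"
      unfolding m_def
    proof (rule efron_stein[OF finite_J prob_space_gauss noise_lip_facts(2,1) _ fm[OF x]])
      show "\<exists>C. \<forall>g\<in>space G. \<bar>?f (x, g)\<bar> \<le> C + (\<Sum>j\<in>J. noise_lip s r j (g j))" by (intro exI[of _ C] ballI fC)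
      show "\<bar>?f (x, g(i := y)) - ?f (x, g(i := 0))\<bar> \<le> noise_lip s r i y" if "i \<in> J" for g i y by (rule FE_update_noise[OF that])
    qed simp
    also have "\<dots> = B2 * (\<Sum>j\<in>J. (strength s r j)\<^sup>2)" by (simp add: noise_lip_facts(3) sum_distrib_left)
    finally show ?thesis unfolding sum_th_square by (simp add: mult_ac)
  qed
  have v2: "(\<integral>x. (m x)\<^sup>2 \<partial>QN) - (\<integral>x. m x \<partial>QN)\<^sup>2 \<le> N * (osc s r)\<^sup>2"
  proof -
    have "(\<integral>x. (m x)\<^sup>2 \<partial>QN) - (\<integral>x. m x \<partial>QN)\<^sup>2 \<le> (\<Sum>i<N. \<integral>y. (osc s r)\<^sup>2 \<partial>P)"
    proof (rule efron_stein[where M = "\<lambda>_. P" and d = "\<lambda>_ _. osc s r" and ?y0.0 = "\<lambda>_. 0"])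
      show "\<exists>C. \<forall>x\<in>space QN. \<bar>m x\<bar> \<le> C + (\<Sum>i<N. osc s r)"
      proof (intro exI[of _ C'] ballI)
        fix x assume "x \<in> space QN"
        then have "\<bar>m x\<bar> \<le> C'" by (rule mC)
        moreover have "0 \<le> (\<Sum>i<N. osc s r)" by (rule sum_nonneg) (rule osc0)
        ultimately show "\<bar>m x\<bar> \<le> C' + (\<Sum>i<N. osc s r)" by linarith
      qed
      show "0 \<in> space P" using sets_eq_imp_space_eq[OF sets_P] by simp
      fix x i y assume H: "x \<in> space QN" "i \<in> {..<N}" "y \<in> space P"
      have xi: "x(i := u) \<in> space QN" if "u \<in> space P" for u
        using H that by (auto simp: space_PiM PiE_iff extensional_def)
      have z: "0 \<in> space P" using sets_eq_imp_space_eq[OF sets_P] by simp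
      note ii = gi(2)[OF xi[OF H(3)]] gi(2)[OF xi[OF z]]
      have e: "m (x(i := y)) - m (x(i := 0)) = (\<integral>g. ?f (x(i := y), g) - ?f (x(i := 0), g) \<partial>G)"
        unfolding m_def by (rule Bochner_Integration.integral_diff[OF ii, symmetric])
      have "\<bar>m (x(i := y)) - m (x(i := 0))\<bar> \<le> (\<integral>g. \<bar>?f (x(i := y), g) - ?f (x(i := 0), g)\<bar> \<partial>G)"
        unfolding e by (rule integral_abs_bound)
      also have "\<dots> \<le> osc s r"
        by (intro G.integral_le_const AE_I2 FE_update_signal integrable_abs Bochner_Integration.integrable_diff ii) (use H(2) in simp)
      finally show "\<bar>m (x(i := y)) - m (x(i := 0))\<bar> \<le> osc s r" .
    qed (use m_meas P.prob_space_axioms in auto)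
    then show ?thesis by (simp add: P.prob_space)
  qed
  have m2: "integrable QN (\<lambda>x. (m x)\<^sup>2)"
  proof (rule integrable_const_bound[where B = "C'\<^sup>2"])
    show "AE x in QN. norm ((m x)\<^sup>2) \<le> C'\<^sup>2"
      using power_mono[OF mC abs_ge_zero, of _ 2] by (intro AE_I2) simp
  qed (use m_meas in simp)
  have "(\<integral>x. (?f x)\<^sup>2 \<partial>S) = (\<integral>x. (\<integral>g. (?f (x, g))\<^sup>2 \<partial>G) \<partial>QN)"
    by (rule S.integral_fst'[OF FE_square_integrable, symmetric])
  also have "\<dots> \<le> (\<integral>x. N * (B2 * (s\<^sup>2 + r\<^sup>2)) + (m x)\<^sup>2 \<partial>QN)"
    using v1 by (intro integral_mono S.integrable_fst'[OF FE_square_integrable] Bochner_Integration.integrable_add integrable_const m2) force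
  also have "\<dots> = N * (B2 * (s\<^sup>2 + r\<^sup>2)) + (\<integral>x. (m x)\<^sup>2 \<partial>QN)" using m2 by (simp add: prob_space)
  finally have 1: "(\<integral>x. (?f x)\<^sup>2 \<partial>S) \<le> N * (B2 * (s\<^sup>2 + r\<^sup>2)) + (\<integral>x. (m x)\<^sup>2 \<partial>QN)" .
  have 2: "mFE (strength s r) = (\<integral>x. m x \<partial>QN)"
    unfolding mFE_def m_def by (rule S.integral_fst'[OF integrable_FE, symmetric])
  show ?thesis using 1 v2 unfolding 2 vcon_def by (simp add: distrib_left)
qed

lemma flucts_le: "flucts (strength s r) \<le> sqrt N * sqrt (vcon s r)"
proof -
  have "flucts (strength s r) \<le> sqrt ((\<integral>x. (FE (strength s r) x)\<^sup>2 \<partial>S) - (mFE (strength s r))\<^sup>2)"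
    unfolding flucts_def mFE_def by (rule S.mean_abs_le_sqrt[OF integrable_FE FE_square_integrable])
  also have "\<dots> \<le> sqrt (N * vcon s r)" using FE_variance by simp
  finally show ?thesis by (simp add: real_sqrt_mult)
qed

lemma vcon_mono: "s\<^sup>2 \<le> s'\<^sup>2 \<Longrightarrow> r\<^sup>2 \<le> r'\<^sup>2 \<Longrightarrow> vcon s r \<le> vcon s' r'"
proof -
  assume le: "s\<^sup>2 \<le> s'\<^sup>2" "r\<^sup>2 \<le> r'\<^sup>2"
  have "0 \<le> osc s r" unfolding osc_def using K by simp
  moreover have "osc s r \<le> osc s' r'" unfolding osc_def using K by (intro add_mono mult_right_mono le) auto
  ultimately have "(osc s r)\<^sup>2 \<le> (osc s' r')\<^sup>2" by (rule power_mono[rotated])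
  moreover have "B2 * (s\<^sup>2 + r\<^sup>2) \<le> B2 * (s'\<^sup>2 + r'\<^sup>2)" by (rule mult_left_mono[OF add_mono[OF le]]) simp
  ultimately show ?thesis unfolding vcon_def by linarith
qed

text \<open>Only \<open>h\<close> is moved, by \<open>l\<close>, so that \<open>signal\<close> is
  \<open>N * l / 2\<close> times the overlap. Division by this factor turns fluctuations of order
  \<open>sqrt N\<close> into order \<open>1 / (l * sqrt N)\<close> and centres the overlap at twice
  the difference quotient.\<close>

lemma overlap_deviation:
  assumes t: "0 \<le> t" and h: "h > 0" and l: "l > 0"
  defines "\<Delta> \<equiv> F t (h + l) - F t h"
  shows "(\<integral>z. \<bar>R z - 2 * \<Delta> / l\<bar> \<partial>T (strength (sqrt t) (sqrt h))) \<le>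
    (4 * ln 2 + 8 * sqrt (vcon (sqrt t) (sqrt (h + l)))) / (l * sqrt N) + 2 * (\<Delta> / l - Fh t h)
     + 4 * B2 * (l / h) + 2 * K ^ p / (sqrt h * sqrt N)"
proof -
  let ?s = "sqrt t" and ?r = "sqrt h" and ?r' = "sqrt (h + l)"
  let ?\<theta> = "strength ?s ?r" and ?\<theta>' = "strength ?s ?r'"
  define \<beta> where "\<beta> = ?r' - ?r"
  have \<beta>0: "\<beta> \<ge> 0" unfolding \<beta>_def using l by simp
  have \<beta>2: "\<beta>\<^sup>2 \<le> l\<^sup>2 / h" unfolding \<beta>_def using sqrt_diff_square_le[of "h + l" h] h l by simp
  have \<beta>1: "\<beta> \<le> l / ?r"
  proof -
    have "\<beta>\<^sup>2 \<le> (l / ?r)\<^sup>2" using \<beta>2 h by (simp add: power_divide)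
    then show ?thesis by (rule power2_le_imp_le) (use h l in simp)
  qed
  have N0: "real N > 0" "sqrt N \<ge> 1" using N by auto
  have c: "mFE ?\<theta>' - mFE ?\<theta> = N * \<Delta>" unfolding \<Delta>_def F_def Fb_def using N0 by (simp add: field_simps)
  have sq: "?r'\<^sup>2 - ?r\<^sup>2 = l" using h l by simp
  have sg: "signal ?\<theta> ?\<theta>' z = N * (l / 2 * R z)" for z unfolding signal_eq sq by simp
  have mv: "(\<Sum>j\<in>J. ((?\<theta>' j)\<^sup>2 - (?\<theta> j)\<^sup>2) / 2 * mov ?\<theta> j) = N * (l * Fh t h)" unfolding mov_sum sq Fh_def by simp
  have th2: "(\<Sum>j\<in>J. (?\<theta>' j - ?\<theta> j)\<^sup>2) = N * \<beta>\<^sup>2" unfolding strength_diff sum_th_square \<beta>_def by simp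
  have vm: "sqrt (vcon ?s ?r) \<le> sqrt (vcon ?s ?r')" using h l by (intro real_sqrt_le_mono vcon_mono) auto
  define v where "v = sqrt (vcon ?s ?r')"
  have fl: "flucts ?\<theta>' + flucts ?\<theta> \<le> 2 * (sqrt N * v)"
    using flucts_le[of ?s ?r'] flucts_le[of ?s ?r] mult_left_mono[OF vm, of "sqrt N"] unfolding v_def by simp
  have b: "(\<integral>z. \<bar>N * (l / 2 * R z) - N * \<Delta>\<bar> \<partial>T ?\<theta>) \<le> 2 * (ln 2 + flucts ?\<theta>' + flucts ?\<theta>) + (N * \<Delta> - N * (l * Fh t h))
     + 2 * B2 * (N * \<beta>\<^sup>2) + K ^ p * sqrt (N * \<beta>\<^sup>2)"
    using signal_concentration[of ?\<theta> ?\<theta>'] by (simp only: c sg mv th2)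
  have "(\<integral>z. \<bar>N * (l / 2 * R z) - N * \<Delta>\<bar> \<partial>T ?\<theta>) = (\<integral>z. (N * l / 2) * \<bar>R z - 2 * \<Delta> / l\<bar> \<partial>T ?\<theta>)"
  proof (rule Bochner_Integration.integral_cong[OF refl])
    fix z
    have e: "N * (l / 2 * R z) - N * \<Delta> = (N * l / 2) * (R z - 2 * \<Delta> / l)" using l by (simp add: field_simps)
    show "\<bar>N * (l / 2 * R z) - N * \<Delta>\<bar> = (N * l / 2) * \<bar>R z - 2 * \<Delta> / l\<bar>" unfolding e abs_mult using N0 l by simp
  qed
  also have "\<dots> = (N * l / 2) * (\<integral>z. \<bar>R z - 2 * \<Delta> / l\<bar> \<partial>T ?\<theta>)" by simp
  finally have "(\<integral>z. \<bar>N * (l / 2 * R z) - N * \<Delta>\<bar> \<partial>T ?\<theta>) = (N * l / 2) * (\<integral>z. \<bar>R z - 2 * \<Delta> / l\<bar> \<partial>T ?\<theta>)" .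
  from b[unfolded this] have 1: "(N * l / 2) * (\<integral>z. \<bar>R z - 2 * \<Delta> / l\<bar> \<partial>T ?\<theta>) \<le>
     2 * (ln 2 + flucts ?\<theta>' + flucts ?\<theta>) + (N * \<Delta> - N * (l * Fh t h)) + 2 * B2 * (N * \<beta>\<^sup>2) + K ^ p * sqrt (N * \<beta>\<^sup>2)" .
  have "2 * (ln 2 + flucts ?\<theta>' + flucts ?\<theta>) \<le> sqrt N * (2 * ln 2 + 4 * v)"
  proof -
    have "1 * ln 2 \<le> sqrt N * ln (2::real)" using N0 by (intro mult_right_mono) auto
    then have "2 * (ln 2 + (flucts ?\<theta>' + flucts ?\<theta>)) \<le> 2 * (sqrt N * ln 2 + 2 * (sqrt N * v))" using fl by argo
    also have "\<dots> = sqrt N * (2 * ln 2 + 4 * v)" by (simp add: algebra_simps)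
    finally show ?thesis by (simp add: add.assoc)
  qed
  moreover have "2 * B2 * (N * \<beta>\<^sup>2) \<le> 2 * B2 * (N * (l\<^sup>2 / h))" using \<beta>2 by (intro mult_left_mono) auto
  moreover have "K ^ p * sqrt (N * \<beta>\<^sup>2) \<le> K ^ p * (sqrt N * (l / ?r))"
  proof -
    have e: "sqrt (N * \<beta>\<^sup>2) = sqrt N * \<beta>" using \<beta>0 by (simp add: real_sqrt_mult)
    show ?thesis unfolding e using K by (intro mult_left_mono \<beta>1) auto
  qed
  ultimately have 2: "(N * l / 2) * (\<integral>z. \<bar>R z - 2 * \<Delta> / l\<bar> \<partial>T ?\<theta>) \<le>
     sqrt N * (2 * ln 2 + 4 * v) + (N * \<Delta> - N * (l * Fh t h)) + 2 * B2 * (N * (l\<^sup>2 / h)) + K ^ p * (sqrt N * (l / ?r))"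
    using 1 by linarith
  have "(N * l / 2) * ((4 * ln 2 + 8 * v) / (l * sqrt N) + 2 * (\<Delta> / l - Fh t h) + 4 * B2 * (l / h) + 2 * K ^ p / (sqrt h * sqrt N))
    = sqrt N * (2 * ln 2 + 4 * v) + (N * \<Delta> - N * (l * Fh t h)) + 2 * B2 * (N * (l\<^sup>2 / h)) + K ^ p * (sqrt N * (l / ?r))"
  proof -
    have q: "real N / sqrt N = sqrt N" by (rule real_div_sqrt) simp
    have gen: "(N * l / 2) * (X / (l * q)) = (N / q) * (X / 2)" if "q > 0" for q X :: real
      using that l by (simp add: field_simps)
    have "(N * l / 2) * ((4 * ln 2 + 8 * v) / (l * sqrt N)) = N / sqrt N * ((4 * ln 2 + 8 * v) / 2)"
      by (rule gen) (use N in simp)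
    also have "\<dots> = sqrt N * (2 * ln 2 + 4 * v)" unfolding q by simp
    finally have "(N * l / 2) * ((4 * ln 2 + 8 * v) / (l * sqrt N)) = sqrt N * (2 * ln 2 + 4 * v)" .
    moreover have "(N * l / 2) * (2 * (\<Delta> / l - Fh t h)) = N * \<Delta> - N * (l * Fh t h)" using l by (simp add: field_simps)
    moreover have "(N * l / 2) * (4 * B2 * (l / h)) = 2 * B2 * (N * (l\<^sup>2 / h))" by (simp add: power2_eq_square)
    moreover have "(N * l / 2) * (2 * k / (u * q)) = k * ((N / q) * (l / u))" for k u q :: real by (simp add: mult_ac)
    then have "(N * l / 2) * (2 * K ^ p / (sqrt h * sqrt N)) = K ^ p * (sqrt N * (l / ?r))" by (simp only: q)
    ultimately show ?thesis by (simp only: distrib_left)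
  qed
  with 2 have "(N * l / 2) * (\<integral>z. \<bar>R z - 2 * \<Delta> / l\<bar> \<partial>T ?\<theta>) \<le> (N * l / 2) *
    ((4 * ln 2 + 8 * v) / (l * sqrt N) + 2 * (\<Delta> / l - Fh t h) + 4 * B2 * (l / h) + 2 * K ^ p / (sqrt h * sqrt N))" by simp
  then show ?thesis unfolding v_def using N0 l by (subst (asm) mult_le_cancel_left_pos) auto
qed

text \<open>The left-hand side is half the difference between the mean of \<open>R z ^ p\<close> and
  the \<open>p\<close>-th power of the mean of \<open>R z\<close>, hence at most a Lipschitz
  constant times the mean deviation of \<open>R\<close>. That deviation is at most twice the mean
  distance of \<open>R\<close> to any constant, here the one of
  \<open>overlap_deviation\<close>.\<close>

lemma err_bound:
  assumes t: "0 \<le> t" "t \<le> \<tau>" and h: "h > 0" "h \<le> \<tau>" and l: "l > 0" "l \<le> 1"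
  shows "\<bar>Ft t h - 2 ^ (p - 1) * Fh t h ^ p\<bar> \<le>
    real p * B2 * (2 + (4 * ln 2 + 8 * sqrt (vcon (sqrt \<tau>) (sqrt (\<tau> + 1)))) + 2 * K ^ p) *
      ((F t (h + l) - F t h) / l - Fh t h + 2 * B2 * l / h + 1 / (l * sqrt N) + 1 / (sqrt h * sqrt N))"
proof -
  let ?\<theta> = "strength (sqrt t) (sqrt h)"
  interpret T: prob_space "T ?\<theta>" by (rule prob_space_T)
  define X where "X = (F t (h + l) - F t h) / l - Fh t h"
  define c where "c = 2 * (F t (h + l) - F t h) / l"
  define m where "m = 4 * ln 2 + 8 * sqrt (vcon (sqrt \<tau>) (sqrt (\<tau> + 1)))"
  define A where "A = 1 / (l * sqrt N)"
  define D where "D = 1 / (sqrt h * sqrt N)"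
  define e where "e = (\<integral>z. \<bar>R z - c\<bar> \<partial>T ?\<theta>)"
  let ?r = "mR (sqrt t) (sqrt h)"
  have vc: "sqrt (vcon (sqrt t) (sqrt (h + l))) \<le> sqrt (vcon (sqrt \<tau>) (sqrt (\<tau> + 1)))"
    using t h l by (intro real_sqrt_le_mono vcon_mono) auto
  have A: "A \<ge> 0" "D \<ge> 0" unfolding A_def D_def using l h by auto
  have m0: "m \<ge> 0" unfolding m_def
    by (intro add_nonneg_nonneg mult_nonneg_nonneg real_sqrt_ge_zero) (auto simp: vcon_def intro!: add_nonneg_nonneg)
  have "e \<le> (4 * ln 2 + 8 * sqrt (vcon (sqrt t) (sqrt (h + l)))) / (l * sqrt N) + 2 * X + 4 * B2 * (l / h) + 2 * K ^ p / (sqrt h * sqrt N)"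
    unfolding e_def X_def c_def by (rule overlap_deviation[OF t(1) h(1) l(1)])
  moreover have "(4 * ln 2 + 8 * sqrt (vcon (sqrt t) (sqrt (h + l)))) / (l * sqrt N) \<le> m / (l * sqrt N)"
    unfolding m_def using vc l by (intro divide_right_mono) auto
  ultimately have "e \<le> m / (l * sqrt N) + 2 * X + 4 * B2 * (l / h) + 2 * K ^ p / (sqrt h * sqrt N)" by argo
  then have e1: "e \<le> m * A + 2 * X + 4 * B2 * (l / h) + 2 * K ^ p * D" unfolding A_def D_def by simp
  \<comment> \<open>\<open>X\<close> itself may be negative, but semiconvexity makes this sum
    nonnegative. The unequal coefficients in \<open>e1\<close> can therefore be enlarged to the
    common factor in front of \<open>Y\<close>.\<close>
  have X: "X + B2 * (l / h) \<ge> 0"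
  proof -
    have "F t (h + l) - F t h \<ge> Fh t h * l - B2 * l\<^sup>2 / h" using F_semiconvex[of t h "h + l"] t h l by simp
    then have "(F t (h + l) - F t h) / l \<ge> (Fh t h * l - B2 * l\<^sup>2 / h) / l" using l by (intro divide_right_mono) auto
    moreover have "(Fh t h * l - B2 * l\<^sup>2 / h) / l = Fh t h - B2 * (l / h)" using l h by (simp add: field_simps power2_eq_square)
    ultimately show ?thesis unfolding X_def by argo
  qed
  define q where "q = B2 * (l / h)"
  define Y where "Y = X + 2 * q + A + D"
  have e2: "e \<le> (2 + m + 2 * K ^ p) * Y"
  proof -
    have b: "q \<ge> 0" unfolding q_def using h l by simp
    have k: "K ^ p \<ge> 0" using K by simp
    have "(2 + m + 2 * K ^ p) * Y = (2 * X + 4 * q) + (m + 2 * K ^ p) * (X + 2 * q)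
       + m * A + 2 * A + 2 * K ^ p * A + 2 * K ^ p * D + 2 * D + m * D" unfolding Y_def by (simp add: algebra_simps)
    moreover have "(m + 2 * K ^ p) * (X + 2 * q) \<ge> 0"
      using m0 k X b unfolding q_def[symmetric] by (intro mult_nonneg_nonneg) auto
    moreover have "2 * A \<ge> 0" "2 * K ^ p * A \<ge> 0" "2 * D \<ge> 0" "m * D \<ge> 0" using A m0 k by auto
    moreover have "4 * B2 * (l / h) = 4 * q" unfolding q_def by simp
    ultimately show ?thesis using e1 by linarith
  qed
  have Ri: "integrable (T ?\<theta>) R" "integrable (T ?\<theta>) (\<lambda>z. R z ^ p)" by (rule R_integrable)+
  have "\<bar>?r - c\<bar> \<le> e"
  proof -
    have "?r - c = (\<integral>z. R z - c \<partial>T ?\<theta>)" unfolding mR_def using Ri by (simp add: T.prob_space[simplified])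
    then show ?thesis unfolding e_def by (metis integral_abs_bound)
  qed
  moreover have "(\<integral>z. \<bar>R z - ?r\<bar> \<partial>T ?\<theta>) \<le> e + \<bar>?r - c\<bar>"
  proof -
    have "(\<integral>z. \<bar>R z - ?r\<bar> \<partial>T ?\<theta>) \<le> (\<integral>z. \<bar>R z - c\<bar> + \<bar>?r - c\<bar> \<partial>T ?\<theta>)" using Ri by (intro integral_mono) auto
    also have "\<dots> = e + \<bar>?r - c\<bar>" unfolding e_def using Ri by (simp add: T.prob_space[simplified])
    finally show ?thesis .
  qed
  ultimately have er: "(\<integral>z. \<bar>R z - ?r\<bar> \<partial>T ?\<theta>) \<le> 2 * e" by linarith
  have "mRp (sqrt t) (sqrt h) - ?r ^ p = (\<integral>z. R z ^ p - ?r ^ p \<partial>T ?\<theta>)"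
    unfolding mRp_def using Ri by (simp add: T.prob_space[simplified])
  then have "\<bar>mRp (sqrt t) (sqrt h) - ?r ^ p\<bar> \<le> (\<integral>z. \<bar>R z ^ p - ?r ^ p\<bar> \<partial>T ?\<theta>)" by (metis integral_abs_bound)
  also have "\<dots> \<le> (\<integral>z. real p * B2 * \<bar>R z - ?r\<bar> \<partial>T ?\<theta>)"
  proof (rule integral_mono)
    fix z
    show "\<bar>R z ^ p - ?r ^ p\<bar> \<le> real p * B2 * \<bar>R z - ?r\<bar>"
      using abs_power_diff_le[of "R z" "K\<^sup>2" ?r p] R_bound[of z] mR_bounds[of "sqrt t" "sqrt h"] one_le_power[OF K, of 2]
      unfolding B2(2) by simp
  qed (use Ri in auto)
  also have "\<dots> = real p * B2 * (\<integral>z. \<bar>R z - ?r\<bar> \<partial>T ?\<theta>)" by simp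
  also have "\<dots> \<le> real p * B2 * (2 * e)" using er by (intro mult_left_mono) auto
  finally have d: "\<bar>mRp (sqrt t) (sqrt h) - ?r ^ p\<bar> \<le> real p * B2 * (2 * e)" .
  have "2 * (2 ^ (p - 1) * (?r / 2) ^ p) = ?r ^ p"
    using p by (cases p) (auto simp: power_divide)
  then have "Ft t h - 2 ^ (p - 1) * Fh t h ^ p = (mRp (sqrt t) (sqrt h) - ?r ^ p) / 2"
    unfolding Ft_def Fh_def by simp
  then have "\<bar>Ft t h - 2 ^ (p - 1) * Fh t h ^ p\<bar> \<le> real p * B2 * e" using d by (simp add: abs_divide)
  also have "\<dots> \<le> real p * B2 * ((2 + m + 2 * K ^ p) * Y)" using e2 by (intro mult_left_mono) auto
  also have "\<dots> = real p * B2 * (2 + m + 2 * K ^ p) * (X + 2 * B2 * l / h + A + D)" unfolding Y_def q_def by simp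
  finally show ?thesis unfolding X_def m_def A_def D_def by simp
qed

end

section \<open>Transfer to the sample space\<close>

lemma product_sigma_finite_gauss: "product_sigma_finite (\<lambda>_. gauss)"
  unfolding product_sigma_finite_def using prob_space_imp_sigma_finite[OF prob_space_gauss] by simp

context channel begin

lemma LZ_restrict: "LZ \<theta> (\<lambda>j\<in>J. y j) = LZ \<theta> y"
proof -
  have "En \<theta> (\<lambda>j\<in>J. y j) x = En \<theta> y x" for x unfolding En_def by (intro sum.cong) auto
  then show ?thesis unfolding LZ_def Z_def by simp
qed

end

context model begin

text \<open>The data built from the unclipped signal, as in \<open>HN\<close>.\<close>

definition yraw :: "real \<Rightarrow> real \<Rightarrow> (nat \<Rightarrow> real) \<times> (nat list \<Rightarrow> real) \<times> (nat \<Rightarrow> real) \<Rightarrow> nat list + nat \<Rightarrow> real" where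
  "yraw s r \<omega> j = (case j of Inl is \<Rightarrow> fst (snd \<omega>) is + s / wN * prod_list (map (fst \<omega>) is)
     | Inr i \<Rightarrow> snd (snd \<omega>) i + r * fst \<omega> i)"

lemma En_yraw:
  fixes x :: "nat \<Rightarrow> real"
  defines "X \<equiv> \<lambda>i. clip (x i)"
  shows "En (strength s r) (yraw s r (xb, W, z)) x = s / wN * tensor_contr N p W X + (s / wN)\<^sup>2 * (dotN N X xb) ^ p
    - (s / wN)\<^sup>2 / 2 * (dotN N X X) ^ p + r * dotN N z X + r\<^sup>2 * dotN N X xb - r\<^sup>2 / 2 * dotN N X X"
proof -
  have pw: "(\<Sum>is\<in>tidx N p. prod_list (map X is) * prod_list (map v is)) = (dotN N X v) ^ p" for v :: "nat \<Rightarrow> real"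
    unfolding prod_list_map_mult sum_tidx_prod dotN_def ..
  have af1: "feature (Inl is) x = prod_list (map X is)" if "is \<in> tidx N p" for "is"
    using that by (simp add: feature_def X_def)
  have af2: "feature (Inr i) x = X i" if "i < N" for i using that by (simp add: feature_def X_def)
  have "(\<Sum>is\<in>tidx N p. strength s r (Inl is) * yraw s r (xb, W, z) (Inl is) * feature (Inl is) x - (strength s r (Inl is))\<^sup>2 * (feature (Inl is) x)\<^sup>2 / 2)
    = (\<Sum>is\<in>tidx N p. s / wN * (W is * prod_list (map X is)) + (s / wN)\<^sup>2 * (prod_list (map X is) * prod_list (map xb is))
       - (s / wN)\<^sup>2 / 2 * (prod_list (map X is) * prod_list (map X is)))"
    by (intro sum.cong refl) (simp add: af1 strength_def yraw_def power2_eq_square algebra_simps)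
  also have "\<dots> = s / wN * tensor_contr N p W X + (s / wN)\<^sup>2 * (dotN N X xb) ^ p - (s / wN)\<^sup>2 / 2 * (dotN N X X) ^ p"
    unfolding sum_subtractf sum.distrib sum_distrib_left[symmetric] pw tensor_contr_def ..
  finally have 1: "(\<Sum>is\<in>tidx N p. strength s r (Inl is) * yraw s r (xb, W, z) (Inl is) * feature (Inl is) x - (strength s r (Inl is))\<^sup>2 * (feature (Inl is) x)\<^sup>2 / 2)
    = s / wN * tensor_contr N p W X + (s / wN)\<^sup>2 * (dotN N X xb) ^ p - (s / wN)\<^sup>2 / 2 * (dotN N X X) ^ p" .
  have "(\<Sum>i<N. strength s r (Inr i) * yraw s r (xb, W, z) (Inr i) * feature (Inr i) x - (strength s r (Inr i))\<^sup>2 * (feature (Inr i) x)\<^sup>2 / 2)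
    = (\<Sum>i<N. r * (z i * X i) + r\<^sup>2 * (X i * xb i) - r\<^sup>2 / 2 * (X i * X i))"
    by (intro sum.cong refl) (simp add: af2 strength_def yraw_def power2_eq_square algebra_simps)
  also have "\<dots> = r * dotN N z X + r\<^sup>2 * dotN N X xb - r\<^sup>2 / 2 * dotN N X X"
    unfolding sum_subtractf sum.distrib sum_distrib_left[symmetric] dotN_def ..
  finally have 2: "(\<Sum>i<N. strength s r (Inr i) * yraw s r (xb, W, z) (Inr i) * feature (Inr i) x - (strength s r (Inr i))\<^sup>2 * (feature (Inr i) x)\<^sup>2 / 2)
    = r * dotN N z X + r\<^sup>2 * dotN N X xb - r\<^sup>2 / 2 * dotN N X X" .
  show ?thesis unfolding En_def sum_J 1 2 by simp
qed

lemma HN_eq: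
  assumes "t \<ge> 0" "h \<ge> 0" and x: "\<And>i. i < N \<Longrightarrow> \<bar>x i\<bar> \<le> K"
  shows "HN p N t h xb W z x = En (strength (sqrt t) (sqrt h)) (yraw (sqrt t) (sqrt h) (xb, W, z)) x"
proof -
  have cx: "clip (x i) = x i" if "i < N" for i using x[OF that] by (auto simp: clip_def)
  have d: "dotN N (\<lambda>i. clip (x i)) v = dotN N x v" "dotN N v (\<lambda>i. clip (x i)) = dotN N v x" for v
    unfolding dotN_def by (auto intro!: sum.cong simp: cx)
  have m: "map (\<lambda>i. clip (x i)) is = map x is" if "is \<in> tidx N p" for "is"
    using that cx by (auto simp: tidx_def)
  have tc: "tensor_contr N p W (\<lambda>i. clip (x i)) = tensor_contr N p W x"
    unfolding tensor_contr_def by (intro sum.cong refl) (simp only: m)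
  have w2: "(sqrt t / wN)\<^sup>2 = t / real N ^ (p - 1)" using assms(1) by (simp add: power_divide wN(2))
  show ?thesis unfolding En_yraw d tc w2 HN_def wN_def[symmetric] using assms(2) by simp
qed

lemma component_measurable': "i < N \<Longrightarrow> (\<lambda>x. x i) \<in> borel_measurable QN"
  by (rule component_QN) simp_all

lemma prod_list_measurable': "is \<in> tidx N p \<Longrightarrow> (\<lambda>x. prod_list (map x is)) \<in> borel_measurable QN"
  using prod_list_measurable[of "is" "\<lambda>x. x"] by (simp add: tidx_def)

lemma HN_measurable: "(\<lambda>x. HN p N t h xb W z x) \<in> borel_measurable QN"
proof -
  have m1: "(\<lambda>x. dotN N x y) \<in> borel_measurable QN" for y
    unfolding dotN_def by (intro borel_measurable_sum borel_measurable_times component_measurable') auto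
  have m2: "(\<lambda>x. dotN N y x) \<in> borel_measurable QN" for y
    unfolding dotN_def by (intro borel_measurable_sum borel_measurable_times component_measurable') auto
  have m3: "(\<lambda>x. dotN N x x) \<in> borel_measurable QN"
    unfolding dotN_def by (intro borel_measurable_sum borel_measurable_times component_measurable') auto
  have m4: "(\<lambda>x. tensor_contr N p W x) \<in> borel_measurable QN"
    unfolding tensor_contr_def by (intro borel_measurable_sum borel_measurable_times prod_list_measurable') auto
  show ?thesis unfolding HN_def
    by (intro borel_measurable_add borel_measurable_diff borel_measurable_times borel_measurable_power borel_measurable_const m1 m2 m3 m4)
qed

lemma AE_QN_bound: "AE x in QN. \<forall>i<N. \<bar>x i\<bar> \<le> K"
proof -
  have "AE x in QN. \<bar>x i\<bar> \<le> K" if "i \<in> {..<N}" for i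
    by (rule AE_PiM_component[where P = "\<lambda>x. \<bar>x\<bar> \<le> K"]) (use that P_bound P.prob_space_axioms in auto)
  then have "AE x in QN. \<forall>i\<in>{..<N}. \<bar>x i\<bar> \<le> K" by (intro AE_finite_allI) auto
  then show ?thesis by (simp only: Ball_def lessThan_iff)
qed

text \<open>Only the integration variable is clipped here, which is harmless under
  \<open>QN\<close>; the signal stays raw. The identity thus holds for every \<omega>, as
  measurability and continuity of \<open>FN\<close> require.\<close>

lemma FN_eq:
  assumes "t \<ge> 0" "h \<ge> 0"
  shows "FN P p N t h \<omega> = LZ (strength (sqrt t) (sqrt h)) (yraw (sqrt t) (sqrt h) \<omega>) / N"
proof -
  obtain xb W z where \<omega>: "\<omega> = (xb, W, z)" by (cases \<omega>)
  have "(LINT x | QN. exp (HN p N t h xb W z x)) = Z (strength (sqrt t) (sqrt h)) (yraw (sqrt t) (sqrt h) \<omega>)"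
    unfolding Z_def \<omega>
  proof (rule integral_cong_AE)
    show "(\<lambda>x. exp (HN p N t h xb W z x)) \<in> borel_measurable QN"
      using HN_measurable[of t h xb W z] by simp
    show "AE x in QN. exp (HN p N t h xb W z x) = exp (En (strength (sqrt t) (sqrt h)) (yraw (sqrt t) (sqrt h) (xb, W, z)) x)"
      using AE_QN_bound by eventually_elim (simp add: HN_eq[OF assms])
  qed measurable
  then show ?thesis unfolding FN_def \<omega> LZ_def by simp
qed

section \<open>Identification of the sample space with signal and noise of the channel\<close>

abbreviation "GW \<equiv> PiM (tidx N p) (\<lambda>_. gauss)"
abbreviation "Gz \<equiv> PiM {..<N} (\<lambda>_. gauss)"
abbreviation "SS \<equiv> sample_space P p N"

lemma SS_eq: "SS = QN \<Otimes>\<^sub>M (GW \<Otimes>\<^sub>M Gz)" by (simp add: sample_space_def)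

definition merge_noise :: "(nat list \<Rightarrow> real) \<times> (nat \<Rightarrow> real) \<Rightarrow> nat list + nat \<Rightarrow> real" where
  "merge_noise v = (\<lambda>j\<in>J. case j of Inl is \<Rightarrow> fst v is | Inr i \<Rightarrow> snd v i)"

lemma W_measurable: "is \<in> tidx N p \<Longrightarrow> (\<lambda>v. fst v is) \<in> borel_measurable (GW \<Otimes>\<^sub>M Gz)"
  and z_measurable: "i < N \<Longrightarrow> (\<lambda>v. snd v i) \<in> borel_measurable (GW \<Otimes>\<^sub>M Gz)"
proof -
  show "(\<lambda>v. fst v is) \<in> borel_measurable (GW \<Otimes>\<^sub>M Gz)" if "is \<in> tidx N p"
    using measurable_compose[OF measurable_fst measurable_component_singleton[OF that, of "\<lambda>_. gauss"]]
    by (simp cong: measurable_cong_sets)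
  show "(\<lambda>v. snd v i) \<in> borel_measurable (GW \<Otimes>\<^sub>M Gz)" if "i < N"
    using measurable_compose[OF measurable_snd measurable_component_singleton[of i "{..<N}" "\<lambda>_. gauss"]] that
    by (simp cong: measurable_cong_sets)
qed

lemma merge_noise_measurable: "merge_noise \<in> measurable (GW \<Otimes>\<^sub>M Gz) G"
  unfolding merge_noise_def[abs_def]
proof (rule measurable_restrict)
  fix j assume "j \<in> J"
  then show "(\<lambda>v. case j of Inl is \<Rightarrow> fst v is | Inr i \<Rightarrow> snd v i) \<in> measurable (GW \<Otimes>\<^sub>M Gz) gauss"
    by (auto simp: J_def W_measurable z_measurable cong: measurable_cong_sets)
qed

lemma prob_GW: "prob_space GW" and prob_Gz: "prob_space Gz"
  by (auto intro!: prob_space_PiM prob_space_gauss)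

text \<open>A finite product measure is determined by boxes, and a box over \<open>J\<close> splits
  into one over tensor indices and one over vector indices.\<close>

lemma distr_mg: "distr (GW \<Otimes>\<^sub>M Gz) G merge_noise = G"
proof -
  interpret g: product_sigma_finite "\<lambda>_::nat list + nat. gauss" by (rule product_sigma_finite_gauss)
  interpret gW: product_sigma_finite "\<lambda>_::nat list. gauss" by (rule product_sigma_finite_gauss)
  interpret gz: product_sigma_finite "\<lambda>_::nat. gauss" by (rule product_sigma_finite_gauss)
  interpret Gz: prob_space Gz by (rule prob_Gz)
  show ?thesis
  proof (rule g.PiM_eqI[OF finite_J])
    fix A :: "nat list + nat \<Rightarrow> real set" assume A: "\<And>j. j \<in> J \<Longrightarrow> A j \<in> sets gauss"
    have A1: "\<And>is. is \<in> tidx N p \<Longrightarrow> A (Inl is) \<in> sets gauss" and A2: "\<And>i. i \<in> {..<N} \<Longrightarrow> A (Inr i) \<in> sets gauss"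
      using A by (auto simp: J_def)
    have pre: "merge_noise -` (PiE J A) \<inter> space (GW \<Otimes>\<^sub>M Gz) = (PiE (tidx N p) (\<lambda>is. A (Inl is))) \<times> (PiE {..<N} (\<lambda>i. A (Inr i)))"
    proof (intro set_eqI)
      fix v
      have "merge_noise v \<in> PiE J A \<longleftrightarrow> (\<forall>is\<in>tidx N p. fst v is \<in> A (Inl is)) \<and> (\<forall>i<N. snd v i \<in> A (Inr i))"
      proof -
        have ball_J: "(\<forall>j\<in>J. Q j) \<longleftrightarrow> (\<forall>is\<in>tidx N p. Q (Inl is)) \<and> (\<forall>i<N. Q (Inr i))" for Q
          unfolding J_def Plus_def by blast
        have "merge_noise v \<in> PiE J A \<longleftrightarrow> (\<forall>j\<in>J. (case j of Inl is \<Rightarrow> fst v is | Inr i \<Rightarrow> snd v i) \<in> A j)"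
          unfolding PiE_iff merge_noise_def by auto
        then show ?thesis by (simp only: ball_J sum.case)
      qed
      then show "v \<in> merge_noise -` (PiE J A) \<inter> space (GW \<Otimes>\<^sub>M Gz) \<longleftrightarrow> v \<in> (PiE (tidx N p) (\<lambda>is. A (Inl is))) \<times> (PiE {..<N} (\<lambda>i. A (Inr i)))"
        by (cases v) (auto simp: space_pair_measure space_PiM PiE_iff)
    qed
    have "emeasure (distr (GW \<Otimes>\<^sub>M Gz) G merge_noise) (PiE J A) = emeasure (GW \<Otimes>\<^sub>M Gz) (merge_noise -` (PiE J A) \<inter> space (GW \<Otimes>\<^sub>M Gz))"
      by (rule emeasure_distr[OF merge_noise_measurable sets_PiM_I_finite[OF finite_J A]])
    also have "\<dots> = emeasure GW (PiE (tidx N p) (\<lambda>is. A (Inl is))) * emeasure Gz (PiE {..<N} (\<lambda>i. A (Inr i)))"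
      unfolding pre by (rule Gz.emeasure_pair_measure_Times[OF sets_PiM_I_finite[OF finite_tidx A1] sets_PiM_I_finite[OF finite_lessThan A2]])
    also have "\<dots> = (\<Prod>is\<in>tidx N p. emeasure gauss (A (Inl is))) * (\<Prod>i<N. emeasure gauss (A (Inr i)))"
      by (simp only: gW.emeasure_PiM[OF finite_tidx A1] gz.emeasure_PiM[OF finite_lessThan A2])
    also have "\<dots> = (\<Prod>j\<in>J. emeasure gauss (A j))"
      unfolding J_def by (subst prod.Plus) (auto simp: finite_tidx)
    finally show "emeasure (distr (GW \<Otimes>\<^sub>M Gz) G merge_noise) (PiE J A) = (\<Prod>j\<in>J. emeasure gauss (A j))" .
  qed simp
qed

definition to_channel :: "(nat \<Rightarrow> real) \<times> (nat list \<Rightarrow> real) \<times> (nat \<Rightarrow> real) \<Rightarrow> (nat \<Rightarrow> real) \<times> (nat list + nat \<Rightarrow> real)" where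
  "to_channel \<omega> = (fst \<omega>, merge_noise (snd \<omega>))"

lemma distr_tr: "distr SS S to_channel = S" and to_channel_measurable: "to_channel \<in> measurable SS S"
proof -
  have "distr QN QN (\<lambda>x. x) \<Otimes>\<^sub>M distr (GW \<Otimes>\<^sub>M Gz) G merge_noise = distr (QN \<Otimes>\<^sub>M (GW \<Otimes>\<^sub>M Gz)) S (\<lambda>(x, y). (x, merge_noise y))"
    by (rule pair_measure_distr) (auto simp: merge_noise_measurable distr_mg G.sigma_finite_measure_axioms)
  moreover have "to_channel = (\<lambda>(x, y). (x, merge_noise y))" by (auto simp: to_channel_def fun_eq_iff)
  ultimately show "distr SS S to_channel = S" unfolding SS_eq distr_mg by (simp add: distr_id)
  show "to_channel \<in> measurable SS S"
    unfolding SS_eq to_channel_def[abs_def]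
    by (intro measurable_Pair measurable_fst measurable_compose[OF measurable_snd merge_noise_measurable])
qed

lemma AE_SS_bound: "AE \<omega> in SS. \<forall>i<N. \<bar>fst \<omega> i\<bar> \<le> K"
proof -
  interpret GW: prob_space GW by (rule prob_GW)
  interpret Gz: prob_space Gz by (rule prob_Gz)
  interpret A: pair_prob_space GW Gz ..
  have d: "distr (QN \<Otimes>\<^sub>M (GW \<Otimes>\<^sub>M Gz)) QN fst = QN" by (rule A.distr_pair_fst)
  have "AE x in distr (QN \<Otimes>\<^sub>M (GW \<Otimes>\<^sub>M Gz)) QN fst. \<forall>i<N. \<bar>x i\<bar> \<le> K" unfolding d by (rule AE_QN_bound)
  from AE_distrD[OF measurable_fst this] show ?thesis unfolding SS_eq .
qed

text \<open>\<open>yraw\<close> is built from the raw signal and the channel from clipped features,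
  so the two free energies are identified on the almost sure event that the signal obeys the
  bound.\<close>

lemma FN_eq_FE:
  assumes "t \<ge> 0" "h \<ge> 0" and \<omega>: "\<forall>i<N. \<bar>fst \<omega> i\<bar> \<le> K"
  shows "FN P p N t h \<omega> = FE (strength (sqrt t) (sqrt h)) (to_channel \<omega>) / N"
proof -
  have c: "clip (fst \<omega> i) = fst \<omega> i" if "i < N" for i using \<omega> that by (auto simp: clip_def)
  have m: "map (\<lambda>i. clip (fst \<omega> i)) is = map (fst \<omega>) is" if "is \<in> tidx N p" for "is"
    using that c by (auto simp: tidx_def)
  have "(\<lambda>j\<in>J. yraw (sqrt t) (sqrt h) \<omega> j) = dat (strength (sqrt t) (sqrt h)) (to_channel \<omega>)"
  proof (rule ext)
    fix j show "(\<lambda>j\<in>J. yraw (sqrt t) (sqrt h) \<omega> j) j = dat (strength (sqrt t) (sqrt h)) (to_channel \<omega>) j"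
    proof (cases "j \<in> J")
      case True
      show ?thesis
      proof (cases j)
        case (Inl "is")
        then have i: "is \<in> tidx N p" using True by (auto simp: J_def)
        have "prod_list (map (\<lambda>i. clip (fst \<omega> i)) is) = prod_list (map (fst \<omega>) is)" by (simp only: m[OF i])
        then show ?thesis using True i by (simp add: dat_def to_channel_def merge_noise_def yraw_def strength_def feature_def Inl)
      next
        case (Inr i)
        then have "i < N" using True by (auto simp: J_def)
        then show ?thesis using True c by (simp add: dat_def to_channel_def merge_noise_def yraw_def strength_def feature_def Inr)
      qed
    qed (simp add: dat_def)
  qed
  then show ?thesis unfolding FN_eq[OF assms(1,2)] FE_def by (metis LZ_restrict)
qed

lemma yraw_measurable: "(\<lambda>\<omega>. \<lambda>j\<in>J. yraw s r \<omega> j) \<in> measurable SS G"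
proof (rule measurable_restrict)
  fix j assume j: "j \<in> J"
  have "(\<lambda>\<omega>. yraw s r \<omega> j) \<in> borel_measurable SS"
  proof (cases j)
    case (Inl "is")
    then have i: "is \<in> tidx N p" using j by (auto simp: J_def)
    have "(\<lambda>\<omega>. fst (snd \<omega>) is) \<in> borel_measurable SS" "(\<lambda>\<omega>. prod_list (map (fst \<omega>) is)) \<in> borel_measurable SS"
      unfolding SS_eq using measurable_compose[OF measurable_snd W_measurable[OF i]]
        measurable_compose[OF measurable_fst prod_list_measurable'[OF i]] by auto
    then show ?thesis unfolding yraw_def Inl sum.case by (intro borel_measurable_add borel_measurable_times borel_measurable_const)
  next
    case (Inr i)
    then have i: "i < N" using j by (auto simp: J_def)
    have "(\<lambda>\<omega>. snd (snd \<omega>) i) \<in> borel_measurable SS" "(\<lambda>\<omega>. fst \<omega> i) \<in> borel_measurable SS"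
      unfolding SS_eq using measurable_compose[OF measurable_snd z_measurable[OF i]]
        measurable_compose[OF measurable_fst component_measurable'[OF i]] by auto
    then show ?thesis unfolding yraw_def Inr sum.case by (intro borel_measurable_add borel_measurable_times borel_measurable_const)
  qed
  then show "(\<lambda>\<omega>. yraw s r \<omega> j) \<in> measurable SS gauss" by (simp cong: measurable_cong_sets)
qed

lemma FN_measurable:
  assumes "t \<ge> 0" "h \<ge> 0"
  shows "(\<lambda>\<omega>. FN P p N t h \<omega>) \<in> borel_measurable SS"
proof -
  have "(\<lambda>\<omega>. LZ (strength (sqrt t) (sqrt h)) (\<lambda>j\<in>J. yraw (sqrt t) (sqrt h) \<omega> j)) \<in> borel_measurable SS"
    by (rule LZ_measurable[OF yraw_measurable])
  then show ?thesis unfolding FN_eq[OF assms] LZ_restrict by (intro borel_measurable_divide borel_measurable_const)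
qed

text \<open>Continuity for each fixed \<omega> allows the supremum over the square to be taken over
  a countable dense set, hence to be measurable.\<close>

lemma FN_continuous: "continuous_on ({0..} \<times> {0..}) (\<lambda>u. FN P p N (fst u) (snd u) \<omega>)"
proof -
  define y where "y u = yraw (sqrt (fst u)) (sqrt (snd u)) \<omega>" for u :: "real \<times> real"
  define q where "q u = strength (sqrt (fst u)) (sqrt (snd u))" for u :: "real \<times> real"
  have qc: "continuous_on UNIV (\<lambda>u. q u j)" for j
    unfolding q_def strength_def by (cases j) (auto intro!: continuous_intros simp: wN(1)[THEN less_imp_neq, symmetric])
  have yc: "continuous_on UNIV (\<lambda>u. y u j)" for j
    unfolding y_def yraw_def by (cases j) (auto intro!: continuous_intros simp: wN(1)[THEN less_imp_neq, symmetric])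
  have "continuous_on UNIV (\<lambda>u. LZ (q u) (y u))"
    unfolding continuous_on_sequentially comp_def
  proof (intro allI ballI impI)
    fix X :: "nat \<Rightarrow> real \<times> real" and u assume "u \<in> UNIV" and X: "(\<forall>n. X n \<in> UNIV) \<and> X \<longlonglongrightarrow> u"
    then have X: "X \<longlonglongrightarrow> u" by simp
    have ql: "(\<lambda>n. q (X n) j) \<longlonglongrightarrow> q u j" and yl: "(\<lambda>n. y (X n) j) \<longlonglongrightarrow> y u j" for j
      using continuous_on_tendsto_compose[OF qc X] continuous_on_tendsto_compose[OF yc X] by auto
    define e where "e n = (\<Sum>j\<in>J. K ^ p * \<bar>q (X n) j * y (X n) j - q u j * y u j\<bar> + (K ^ p)\<^sup>2 * \<bar>(q (X n) j)\<^sup>2 - (q u j)\<^sup>2\<bar> / 2)" for n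
    have "e \<longlonglongrightarrow> (\<Sum>j\<in>J. K ^ p * \<bar>q u j * y u j - q u j * y u j\<bar> + (K ^ p)\<^sup>2 * \<bar>(q u j)\<^sup>2 - (q u j)\<^sup>2\<bar> / 2)"
      unfolding e_def by (intro tendsto_intros ql yl) simp_all
    then have e0: "e \<longlonglongrightarrow> 0" by simp
    have "norm (LZ (q (X n)) (y (X n)) - LZ (q u) (y u)) \<le> e n" for n
      unfolding real_norm_def e_def by (rule LZ_diff) (rule En_diff_le)
    then have "(\<lambda>n. LZ (q (X n)) (y (X n)) - LZ (q u) (y u)) \<longlonglongrightarrow> 0"
      by (intro Lim_null_comparison[OF always_eventually[OF allI] e0])
    then show "(\<lambda>n. LZ (q (X n)) (y (X n))) \<longlonglongrightarrow> LZ (q u) (y u)" by (rule LIM_zero_cancel)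
  qed
  then have "continuous_on ({0..} \<times> {0..}) (\<lambda>u. LZ (q u) (y u) / N)"
    using N by (intro continuous_on_divide continuous_on_const) (auto intro: continuous_on_subset)
  then show ?thesis
    by (rule continuous_on_cong[THEN iffD1, OF refl, rotated]) (auto simp: FN_eq q_def y_def)
qed

section \<open>From deviations on a grid to the uniform deviation\<close>

definition deviation :: "real \<Rightarrow> real \<Rightarrow> (nat \<Rightarrow> real) \<times> (nat list + nat \<Rightarrow> real) \<Rightarrow> real" where
  "deviation s r \<omega> = FE (strength s r) \<omega> / N - Fb s r"

lemma deviation_square: "integrable S (\<lambda>\<omega>. (deviation s r \<omega>)\<^sup>2)" "(\<integral>\<omega>. (deviation s r \<omega>)\<^sup>2 \<partial>S) \<le> vcon s r / N"
proof -
  let ?f = "FE (strength s r)" and ?m = "mFE (strength s r)"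
  have eq: "(deviation s r \<omega>)\<^sup>2 = ((?f \<omega>)\<^sup>2 - 2 * ?m * ?f \<omega> + ?m\<^sup>2) / (real N)\<^sup>2" for \<omega>
    unfolding deviation_def Fb_def diff_divide_distrib[symmetric] power_divide by (simp add: power2_eq_square algebra_simps)
  have i: "integrable S (\<lambda>\<omega>. (?f \<omega>)\<^sup>2 - 2 * ?m * ?f \<omega> + ?m\<^sup>2)"
    by (intro Bochner_Integration.integrable_add Bochner_Integration.integrable_diff integrable_mult_right FE_square_integrable integrable_FE S.integrable_const)
  show "integrable S (\<lambda>\<omega>. (deviation s r \<omega>)\<^sup>2)" unfolding eq by (intro integrable_divide_zero i)
  have "(\<integral>\<omega>. (?f \<omega>)\<^sup>2 - 2 * ?m * ?f \<omega> + ?m\<^sup>2 \<partial>S) = (\<integral>\<omega>. (?f \<omega>)\<^sup>2 \<partial>S) - 2 * ?m * (\<integral>\<omega>. ?f \<omega> \<partial>S) + ?m\<^sup>2"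
    using FE_square_integrable[of s r] integrable_FE[of "strength s r"] by (simp add: S.prob_space)
  also have "\<dots> = (\<integral>\<omega>. (?f \<omega>)\<^sup>2 \<partial>S) - ?m\<^sup>2" unfolding mFE_def[symmetric] by (simp add: power2_eq_square)
  also have "\<dots> \<le> N * vcon s r" by (rule FE_variance)
  finally have le: "(\<integral>\<omega>. (?f \<omega>)\<^sup>2 - 2 * ?m * ?f \<omega> + ?m\<^sup>2 \<partial>S) \<le> N * vcon s r" .
  have "(\<integral>\<omega>. (deviation s r \<omega>)\<^sup>2 \<partial>S) = (\<integral>\<omega>. (?f \<omega>)\<^sup>2 - 2 * ?m * ?f \<omega> + ?m\<^sup>2 \<partial>S) / (real N)\<^sup>2"
    unfolding eq by (rule integral_divide_zero)
  also have "\<dots> \<le> N * vcon s r / (real N)\<^sup>2" using le by (rule divide_right_mono) simp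
  also have "\<dots> = vcon s r / N" using N by (simp add: power2_eq_square)
  finally show "(\<integral>\<omega>. (deviation s r \<omega>)\<^sup>2 \<partial>S) \<le> vcon s r / N" .
qed

definition grid_idx :: "nat \<Rightarrow> (int \<times> int) set" where "grid_idx n = {-2..int n + 2} \<times> {-2..int n + 2}"

lemma finite_idx: "finite (grid_idx n)" unfolding grid_idx_def by simp

text \<open>The same quadratic is added to the random and to the mean free energy: it makes the
  former convex and cancels in the difference. The grid also visits negative strengths, which the
  channel admits. The modulus constant is \<open>68 = 20 + 2 * 24\<close>, from \<open>Fb\<close>
  and from the quadratic. The largest grid deviation is replaced by the sum, whose square is easy to
  integrate.\<close>

lemma deviation_uniform:
  assumes M: "M > 0" and n: "n > 0" and s: "0 \<le> s" "s \<le> M" and r: "0 \<le> r" "r \<le> M"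
  shows "\<bar>deviation s r \<omega>\<bar> \<le> 3 * (\<Sum>(i, j)\<in>grid_idx n. \<bar>deviation (of_int i * (M / n)) (of_int j * (M / n)) \<omega>\<bar>) + 4 * (68 * B2 * M * (M / n))"
proof -
  define \<delta> where "\<delta> = M / n"
  have \<delta>: "\<delta> > 0" "\<delta> \<le> M" unfolding \<delta>_def using M n by (auto simp: field_simps)
  have n\<delta>: "n * \<delta> = M" "real (n + 2) * \<delta> \<le> 3 * M" unfolding \<delta>_def using n M by (auto simp: field_simps)
  define e where "e = (\<Sum>(i, j)\<in>grid_idx n. \<bar>deviation (of_int i * \<delta>) (of_int j * \<delta>) \<omega>\<bar>)"
  define G where "G s r = FE (strength s r) \<omega> / N + 2 * B2 * (s\<^sup>2 + r\<^sup>2)" for s r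
  define g where "g s r = Fb s r + 2 * B2 * (s\<^sup>2 + r\<^sup>2)" for s r
  have Gg: "G s r - g s r = deviation s r \<omega>" for s r by (simp add: G_def g_def deviation_def)
  have "\<bar>G s r - g s r\<bar> \<le> 3 * e + 4 * (68 * B2 * M * \<delta>)"
  proof (rule convex_grid_bound[where G = G and g = g and a = s and b = r and \<delta> = \<delta> and n = n])
    fix a b a' b' l :: real assume l: "0 \<le> l" "l \<le> 1"
    have sc: "FE (strength s r) \<omega> + 2 * B2 * (\<Sum>j\<in>J. (strength s r j)\<^sup>2) = N * G s r" for s r
      unfolding G_def sum_th_square using N by (simp add: field_simps)
    have "strength (l * a + (1 - l) * a') (l * b + (1 - l) * b') j = l * strength a b j + (1 - l) * strength a' b' j" for j
      by (cases j) (simp_all add: strength_def add_divide_distrib)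
    from FE_convex[where s = \<omega> and \<theta> = "strength (l * a + (1 - l) * a') (l * b + (1 - l) * b')" and ?\<theta>1.0 = "strength a b" and ?\<theta>2.0 = "strength a' b'", OF l this]
    have "N * G (l * a + (1 - l) * a') (l * b + (1 - l) * b') \<le> l * (N * G a b) + (1 - l) * (N * G a' b')" unfolding sc .
    also have "\<dots> = N * (l * G a b + (1 - l) * G a' b')" by (simp add: algebra_simps)
    finally show "G (l * a + (1 - l) * a') (l * b + (1 - l) * b') \<le> l * G a b + (1 - l) * G a' b'"
      using N by (subst (asm) mult_le_cancel_left_pos) auto
  next
    fix i j assume ij: "i \<in> {-2..int n + 2}" "j \<in> {-2..int n + 2}"
    have "(\<lambda>(i, j). \<bar>deviation (of_int i * \<delta>) (of_int j * \<delta>) \<omega>\<bar>) (i, j) \<le> e" unfolding e_def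
      by (rule member_le_sum) (use ij finite_idx in \<open>auto simp: grid_idx_def\<close>)
    then show "\<bar>G (of_int i * \<delta>) (of_int j * \<delta>) - g (of_int i * \<delta>) (of_int j * \<delta>)\<bar> \<le> e" by (simp add: Gg)
  next
    fix a b a' b' assume H: "\<bar>a\<bar> \<le> real (n + 2) * \<delta>" "\<bar>b\<bar> \<le> real (n + 2) * \<delta>" "\<bar>a'\<bar> \<le> real (n + 2) * \<delta>" "\<bar>b'\<bar> \<le> real (n + 2) * \<delta>"
      "\<bar>a - a'\<bar> \<le> 2 * \<delta>" "\<bar>b - b'\<bar> \<le> 2 * \<delta>"
    have sq: "\<bar>x\<^sup>2 - y\<^sup>2\<bar> \<le> 12 * M * \<delta>" "(x - y)\<^sup>2 \<le> 4 * M * \<delta>"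
      if "\<bar>x\<bar> \<le> real (n + 2) * \<delta>" "\<bar>y\<bar> \<le> real (n + 2) * \<delta>" "\<bar>x - y\<bar> \<le> 2 * \<delta>" for x y
    proof -
      have "\<bar>x + y\<bar> \<le> 6 * M" using that n\<delta>(2) by linarith
      then have "\<bar>x - y\<bar> * \<bar>x + y\<bar> \<le> (2 * \<delta>) * (6 * M)" using that \<delta> by (intro mult_mono) auto
      moreover have "\<bar>x\<^sup>2 - y\<^sup>2\<bar> = \<bar>x - y\<bar> * \<bar>x + y\<bar>" unfolding abs_mult[symmetric] by (simp add: power2_eq_square algebra_simps)
      ultimately show "\<bar>x\<^sup>2 - y\<^sup>2\<bar> \<le> 12 * M * \<delta>" by (simp add: mult_ac)
      have "\<bar>x - y\<bar> * \<bar>x - y\<bar> \<le> (2 * \<delta>) * (2 * M)" using that \<delta> by (intro mult_mono) auto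
      then show "(x - y)\<^sup>2 \<le> 4 * M * \<delta>" by (simp add: power2_eq_square mult_ac)
    qed
    note sa = sq[OF H(1,3,5)] and sb = sq[OF H(2,4,6)]
    have "\<bar>Fb a b - Fb a' b'\<bar> \<le> B2 * (\<bar>a\<^sup>2 - a'\<^sup>2\<bar> / 2 + \<bar>b\<^sup>2 - b'\<^sup>2\<bar> / 2 + (a - a')\<^sup>2 + (b - b')\<^sup>2)"
      by (rule Fb_diff_le)
    also have "\<dots> \<le> B2 * (20 * M * \<delta>)" using sa sb by (intro mult_left_mono) auto
    finally have 1: "\<bar>Fb a b - Fb a' b'\<bar> \<le> B2 * (20 * M * \<delta>)" .
    have "\<bar>(a\<^sup>2 + b\<^sup>2) - (a'\<^sup>2 + b'\<^sup>2)\<bar> \<le> 24 * M * \<delta>" using sa(1) sb(1) by linarith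
    then have "B2 * \<bar>(a\<^sup>2 + b\<^sup>2) - (a'\<^sup>2 + b'\<^sup>2)\<bar> \<le> B2 * (24 * M * \<delta>)" by (intro mult_left_mono) auto
    moreover have "\<bar>B2 * (a\<^sup>2 + b\<^sup>2) - B2 * (a'\<^sup>2 + b'\<^sup>2)\<bar> = B2 * \<bar>(a\<^sup>2 + b\<^sup>2) - (a'\<^sup>2 + b'\<^sup>2)\<bar>"
      unfolding right_diff_distrib[symmetric] abs_mult by simp
    moreover have "g a b - g a' b' = (Fb a b - Fb a' b') + 2 * (B2 * (a\<^sup>2 + b\<^sup>2) - B2 * (a'\<^sup>2 + b'\<^sup>2))"
      unfolding g_def by (simp add: algebra_simps)
    moreover have "68 * B2 * M * \<delta> = B2 * (20 * M * \<delta>) + 2 * (B2 * (24 * M * \<delta>))" by simp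
    moreover have "\<bar>d\<bar> \<le> m" if "q \<le> u" "\<bar>y\<bar> = q" "d = x + 2 * y" "m = v + 2 * u" "\<bar>x\<bar> \<le> v" for d m q u y x v :: real
      using that by linarith
    ultimately show "\<bar>g a b - g a' b'\<bar> \<le> 68 * B2 * M * \<delta>" using 1 by blast
  qed (use \<delta> s r n\<delta> in auto)
  then show ?thesis unfolding Gg e_def \<delta>_def .
qed

lemma integral_tr:
  fixes f :: "_ \<Rightarrow> real"
  assumes "integrable S f"
  shows "integrable SS (\<lambda>\<omega>. f (to_channel \<omega>))" "(\<integral>\<omega>. f (to_channel \<omega>) \<partial>SS) = (\<integral>\<omega>. f \<omega> \<partial>S)"
proof -
  have m: "f \<in> borel_measurable S" using assms by auto
  have "integrable (distr SS S to_channel) f" unfolding distr_tr by (rule assms)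
  then show "integrable SS (\<lambda>\<omega>. f (to_channel \<omega>))" by (subst (asm) integrable_distr_eq[OF to_channel_measurable m])
  have "(\<integral>\<omega>. f \<omega> \<partial>S) = (\<integral>\<omega>. f \<omega> \<partial>distr SS S to_channel)" by (simp only: distr_tr)
  also have "\<dots> = (\<integral>\<omega>. f (to_channel \<omega>) \<partial>SS)" by (rule integral_distr[OF to_channel_measurable m])
  finally show "(\<integral>\<omega>. f (to_channel \<omega>) \<partial>SS) = (\<integral>\<omega>. f \<omega> \<partial>S)" ..
qed

text \<open>The square of a sum of three terms is at most three times the sum of their squares. With
  the factors 3 and 4 of \<open>deviation_uniform\<close> this gives
  \<open>27 = 3 * 3\<^sup>2\<close> and \<open>48 = 3 * 4\<^sup>2\<close>; the cardinality comes
  from Cauchy-Schwarz over the grid.\<close>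

definition sup_bound :: "real \<Rightarrow> nat \<Rightarrow> real \<Rightarrow> (nat \<Rightarrow> real) \<times> (nat list + nat \<Rightarrow> real) \<Rightarrow> real" where
  "sup_bound M n \<eta> \<omega> = 27 * ((real (card (grid_idx n)) + 1) * (\<Sum>(i, j)\<in>grid_idx n. (deviation (of_int i * (M / n)) (of_int j * (M / n)) \<omega>)\<^sup>2))
     + 48 * (68 * B2 * M * (M / n))\<^sup>2 + 3 * \<eta>\<^sup>2"

lemma sup_bound_integrable: "integrable S (sup_bound M n \<eta>)"
  unfolding sup_bound_def[abs_def] case_prod_beta
  by (intro Bochner_Integration.integrable_add integrable_mult_right Bochner_Integration.integrable_sum deviation_square(1) S.integrable_const)

lemma sup_bound_integral:
  "(\<integral>\<omega>. sup_bound M n \<eta> \<omega> \<partial>S) \<le> 27 * ((real (card (grid_idx n)) + 1) * (\<Sum>(i, j)\<in>grid_idx n. vcon (of_int i * (M / n)) (of_int j * (M / n)))) / N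
     + 48 * (68 * B2 * M * (M / n))\<^sup>2 + 3 * \<eta>\<^sup>2"
proof -
  let ?u = "\<lambda>x. deviation (of_int (fst x) * (M / n)) (of_int (snd x) * (M / n))"
  let ?v = "\<lambda>x. vcon (of_int (fst x) * (M / n)) (of_int (snd x) * (M / n))"
  let ?c = "real (card (grid_idx n)) + 1" and ?k = "48 * (68 * B2 * M * (M / n))\<^sup>2"
  have i: "integrable S (\<lambda>\<omega>. \<Sum>x\<in>grid_idx n. (?u x \<omega>)\<^sup>2)" by (intro Bochner_Integration.integrable_sum deviation_square(1))
  have "(\<integral>\<omega>. sup_bound M n \<eta> \<omega> \<partial>S) = (\<integral>\<omega>. 27 * (?c * (\<Sum>x\<in>grid_idx n. (?u x \<omega>)\<^sup>2)) + (?k + 3 * \<eta>\<^sup>2) \<partial>S)"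
    unfolding sup_bound_def case_prod_beta by (simp only: add.assoc)
  also have "\<dots> = 27 * (?c * (\<integral>\<omega>. (\<Sum>x\<in>grid_idx n. (?u x \<omega>)\<^sup>2) \<partial>S)) + (?k + 3 * \<eta>\<^sup>2)"
    by (subst Bochner_Integration.integral_add[OF integrable_mult_right[OF integrable_mult_right[OF i]] S.integrable_const])
      (simp add: S.prob_space)
  also have "(\<integral>\<omega>. (\<Sum>x\<in>grid_idx n. (?u x \<omega>)\<^sup>2) \<partial>S) = (\<Sum>x\<in>grid_idx n. \<integral>\<omega>. (?u x \<omega>)\<^sup>2 \<partial>S)"
    by (intro Bochner_Integration.integral_sum deviation_square(1))
  finally have eq: "(\<integral>\<omega>. sup_bound M n \<eta> \<omega> \<partial>S) = 27 * (?c * (\<Sum>x\<in>grid_idx n. \<integral>\<omega>. (?u x \<omega>)\<^sup>2 \<partial>S)) + (?k + 3 * \<eta>\<^sup>2)" .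
  have "(\<Sum>x\<in>grid_idx n. \<integral>\<omega>. (?u x \<omega>)\<^sup>2 \<partial>S) \<le> (\<Sum>x\<in>grid_idx n. ?v x / N)" by (intro sum_mono deviation_square(2))
  then have "27 * (?c * (\<Sum>x\<in>grid_idx n. \<integral>\<omega>. (?u x \<omega>)\<^sup>2 \<partial>S)) \<le> 27 * (?c * (\<Sum>x\<in>grid_idx n. ?v x / N))" by (intro mult_left_mono) auto
  also have "\<dots> = 27 * (?c * (\<Sum>x\<in>grid_idx n. ?v x)) / N" by (simp only: sum_divide_distrib[symmetric] times_divide_eq_right)
  finally show ?thesis unfolding eq case_prod_beta by linarith
qed

text \<open>At \<open>t = 0\<close> the tensor channels are switched off and the energy is a sum
  over coordinates. The partition function factorises, its logarithm is a sum of \<open>N\<close>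
  identically distributed terms, and the initial condition holds exactly for every
  \<open>N\<close>.\<close>

lemma F_zero:
  assumes h: "h \<ge> 0"
  shows "F 0 h = psi P h"
proof -
  define r where "r = sqrt h"
  have r2: "r\<^sup>2 = h" unfolding r_def using h by simp
  define k where "k z b x = r * z * clip x + r\<^sup>2 * (clip b * clip x) - r\<^sup>2 / 2 * (clip x)\<^sup>2" for z b x
  define L where "L z b = ln (\<integral>x. exp (k z b x) \<partial>P)" for z b
  have clP [measurable]: "clip \<in> borel_measurable P" using clip_measurable sets_P by (simp cong: measurable_cong_sets)
  have kb: "\<bar>k z b x\<bar> \<le> K * \<bar>r\<bar> * \<bar>z\<bar> + 2 * (r\<^sup>2 * K\<^sup>2)" for z b x
  proof -
    have "\<bar>r * z * clip x\<bar> \<le> K * \<bar>r\<bar> * \<bar>z\<bar>" using mult_left_mono[OF clip_bound[of x], of "\<bar>r\<bar> * \<bar>z\<bar>"] by (simp add: abs_mult mult_ac)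
    moreover have "\<bar>clip b * clip x\<bar> \<le> K\<^sup>2" unfolding abs_mult power2_eq_square using K by (intro mult_mono clip_bound) auto
    then have "\<bar>r\<^sup>2 * (clip b * clip x)\<bar> \<le> r\<^sup>2 * K\<^sup>2" unfolding abs_mult[of "r\<^sup>2"] by (intro mult_mono) auto
    moreover have "(clip x)\<^sup>2 \<le> K\<^sup>2" using power_mono[OF clip_bound[of x] abs_ge_zero, of 2] by simp
    then have "r\<^sup>2 / 2 * (clip x)\<^sup>2 \<le> r\<^sup>2 / 2 * K\<^sup>2" by (intro mult_left_mono) auto
    moreover have "0 \<le> r\<^sup>2 / 2 * (clip x)\<^sup>2" "0 \<le> r\<^sup>2 * K\<^sup>2" by auto
    ultimately show ?thesis unfolding k_def by linarith
  qed
  have kP: "(\<lambda>x. k z b x) \<in> borel_measurable P" for z b unfolding k_def by measurable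
  have ki: "integrable P (\<lambda>x. exp (k z b x))" for z b
    by (rule P.integrable_const_bound[where B = "exp (K * \<bar>r\<bar> * \<bar>z\<bar> + 2 * (r\<^sup>2 * K\<^sup>2))"])
      (use kb[of z b] kP[of z b] in \<open>auto simp: abs_le_iff\<close>)
  have kpos: "(\<integral>x. exp (k z b x) \<partial>P) > 0" for z b
  proof -
    have "exp (- (K * \<bar>r\<bar> * \<bar>z\<bar> + 2 * (r\<^sup>2 * K\<^sup>2))) \<le> (\<integral>x. exp (k z b x) \<partial>P)"
    proof (rule P.integral_ge_const[OF ki], rule AE_I2)
      fix x show "exp (- (K * \<bar>r\<bar> * \<bar>z\<bar> + 2 * (r\<^sup>2 * K\<^sup>2))) \<le> exp (k z b x)"
        using kb[of z b x] unfolding exp_le_cancel_iff by linarith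
    qed
    then show ?thesis using exp_gt_zero order_less_le_trans by blast
  qed
  have L0: "ln (\<integral>x. exp (0::real) \<partial>P) = 0" by (simp add: P.prob_space)
  have Lb: "\<bar>L z b\<bar> \<le> K * \<bar>r\<bar> * \<bar>z\<bar> + 2 * (r\<^sup>2 * K\<^sup>2)" for z b
    using abs_ln_integral_exp_diff[OF P.prob_space_axioms ki[of z b], of "\<lambda>_. 0" "K * \<bar>r\<bar> * \<bar>z\<bar> + 2 * (r\<^sup>2 * K\<^sup>2)"] kb[of z b] kpos[of z b]
    unfolding L_def[symmetric] L0 by (simp add: P.prob_space)
  have En0: "En (strength 0 r) (dat (strength 0 r) \<omega>) x = (\<Sum>i<N. k (snd \<omega> (Inr i)) (fst \<omega> i) (x i))" for \<omega> x
  proof -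
    have "(\<Sum>is\<in>tidx N p. strength 0 r (Inl is) * dat (strength 0 r) \<omega> (Inl is) * feature (Inl is) x - (strength 0 r (Inl is))\<^sup>2 * (feature (Inl is) x)\<^sup>2 / 2) = 0"
      by (simp add: strength_def)
    moreover have "(\<Sum>i<N. strength 0 r (Inr i) * dat (strength 0 r) \<omega> (Inr i) * feature (Inr i) x - (strength 0 r (Inr i))\<^sup>2 * (feature (Inr i) x)\<^sup>2 / 2)
       = (\<Sum>i<N. k (snd \<omega> (Inr i)) (fst \<omega> i) (x i))"
    proof (rule sum.cong[OF refl])
      fix i assume "i \<in> {..<N}"
      then have "i < N" "Inr i \<in> J" by (auto simp: J_def)
      then show "strength 0 r (Inr i) * dat (strength 0 r) \<omega> (Inr i) * feature (Inr i) x - (strength 0 r (Inr i))\<^sup>2 * (feature (Inr i) x)\<^sup>2 / 2 = k (snd \<omega> (Inr i)) (fst \<omega> i) (x i)"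
        by (simp add: strength_def dat_def feature_def k_def power2_eq_square algebra_simps)
    qed
    ultimately show ?thesis unfolding En_def sum_J by simp
  qed
  interpret psf: product_sigma_finite "\<lambda>_::nat. P"
    unfolding product_sigma_finite_def using P.sigma_finite_measure_axioms by simp
  have FE0: "FE (strength 0 r) \<omega> = (\<Sum>i<N. L (snd \<omega> (Inr i)) (fst \<omega> i))" for \<omega>
  proof -
    have "Z (strength 0 r) (dat (strength 0 r) \<omega>) = (\<integral>x. (\<Prod>i<N. exp (k (snd \<omega> (Inr i)) (fst \<omega> i) (x i))) \<partial>QN)"
      unfolding Z_def En0 by (simp add: exp_sum)
    also have "\<dots> = (\<Prod>i<N. \<integral>x. exp (k (snd \<omega> (Inr i)) (fst \<omega> i) x) \<partial>P)"
      by (rule psf.product_integral_prod) (auto intro: ki)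
    finally show ?thesis unfolding FE_def LZ_def L_def by (simp only: ln_prod[OF finite_lessThan less_imp_neq[OF kpos, symmetric]])
  qed
  have cl2 [measurable]: "clip \<in> borel_measurable borel" by (rule clip_measurable)
  have kj: "(\<lambda>(v, x). k (snd v) (fst v) x) \<in> borel_measurable ((P \<Otimes>\<^sub>M gauss) \<Otimes>\<^sub>M P)"
  proof -
    have s: "(\<lambda>v. snd (fst v)) \<in> borel_measurable ((P \<Otimes>\<^sub>M gauss) \<Otimes>\<^sub>M P)"
      using measurable_compose[OF measurable_fst[of "P \<Otimes>\<^sub>M gauss" P] measurable_snd[of P gauss]] by (simp cong: measurable_cong_sets)
    have f: "(\<lambda>v. clip (fst (fst v))) \<in> borel_measurable ((P \<Otimes>\<^sub>M gauss) \<Otimes>\<^sub>M P)"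
      by (intro measurable_compose[OF _ clP] measurable_compose[OF measurable_fst measurable_fst])
    have g: "(\<lambda>v. clip (snd v)) \<in> borel_measurable ((P \<Otimes>\<^sub>M gauss) \<Otimes>\<^sub>M P)"
      by (intro measurable_compose[OF _ clP] measurable_snd)
    show ?thesis unfolding k_def case_prod_beta
      by (intro borel_measurable_add borel_measurable_diff borel_measurable_times borel_measurable_const borel_measurable_power s f g)
  qed
  have Lm: "(\<lambda>v. L (snd v) (fst v)) \<in> borel_measurable (P \<Otimes>\<^sub>M gauss)"
    unfolding L_def
  proof (intro borel_measurable_ln P.borel_measurable_lebesgue_integral)
    show "(\<lambda>(v, x). exp (k (snd v) (fst v) x)) \<in> borel_measurable ((P \<Otimes>\<^sub>M gauss) \<Otimes>\<^sub>M P)"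
      using measurable_compose[OF kj borel_measurable_exp] by (simp add: case_prod_beta)
  qed
  define c where "c = (\<integral>v. L (snd v) (fst v) \<partial>(P \<Otimes>\<^sub>M gauss))"
  interpret ga: prob_space gauss by (rule prob_space_gauss)
  interpret PG: pair_prob_space P gauss ..
  have comp: "(\<integral>\<omega>. L (snd \<omega> (Inr i)) (fst \<omega> i) \<partial>S) = c" "integrable S (\<lambda>\<omega>. L (snd \<omega> (Inr i)) (fst \<omega> i))" if i: "i < N" for i
  proof -
    have iJ: "Inr i \<in> J" unfolding J_def by (rule InrI) (use i in simp)
    have d1: "distr QN P (\<lambda>x. x i) = P" by (rule distr_PiM_component) (use i P.prob_space_axioms in auto)
    have d2: "distr G gauss (\<lambda>g. g (Inr i)) = gauss" by (rule distr_PiM_component[OF prob_space_gauss iJ])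
    have m1: "(\<lambda>x. x i) \<in> measurable QN P" using i by (intro measurable_component_singleton) auto
    have m2: "(\<lambda>g. g (Inr i)) \<in> measurable G gauss" by (rule measurable_component_singleton[OF iJ])
    have "distr QN P (\<lambda>x. x i) \<Otimes>\<^sub>M distr G gauss (\<lambda>g. g (Inr i)) = distr (QN \<Otimes>\<^sub>M G) (P \<Otimes>\<^sub>M gauss) (\<lambda>(x, g). (x i, g (Inr i)))"
      by (rule pair_measure_distr[OF m1 m2]) (simp add: d2 ga.sigma_finite_measure_axioms)
    then have d: "distr S (P \<Otimes>\<^sub>M gauss) (\<lambda>\<omega>. (fst \<omega> i, snd \<omega> (Inr i))) = P \<Otimes>\<^sub>M gauss" unfolding d1 d2 by (simp add: case_prod_beta')
    have m: "(\<lambda>\<omega>. (fst \<omega> i, snd \<omega> (Inr i))) \<in> measurable S (P \<Otimes>\<^sub>M gauss)"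
      by (intro measurable_Pair measurable_compose[OF measurable_fst m1] measurable_compose[OF measurable_snd m2])
    have "c = (\<integral>v. L (snd v) (fst v) \<partial>distr S (P \<Otimes>\<^sub>M gauss) (\<lambda>\<omega>. (fst \<omega> i, snd \<omega> (Inr i))))" unfolding c_def d ..
    also have "\<dots> = (\<integral>\<omega>. L (snd \<omega> (Inr i)) (fst \<omega> i) \<partial>S)" by (subst integral_distr[OF m Lm]) simp
    finally show "(\<integral>\<omega>. L (snd \<omega> (Inr i)) (fst \<omega> i) \<partial>S) = c" ..
    show "integrable S (\<lambda>\<omega>. L (snd \<omega> (Inr i)) (fst \<omega> i))"
    proof (rule Bochner_Integration.integrable_bound)
      show "integrable S (\<lambda>\<omega>. K * \<bar>r\<bar> * \<bar>snd \<omega> (Inr i)\<bar> + 2 * (r\<^sup>2 * K\<^sup>2))"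
        by (intro Bochner_Integration.integrable_add integrable_mult_right integrable_S_snd(1)[where f = "\<lambda>g. \<bar>g (Inr i)\<bar>"] gauss_component iJ S.integrable_const)
      show "(\<lambda>\<omega>. L (snd \<omega> (Inr i)) (fst \<omega> i)) \<in> borel_measurable S"
        using measurable_compose[OF m Lm] by simp
      show "AE \<omega> in S. norm (L (snd \<omega> (Inr i)) (fst \<omega> i)) \<le> norm (K * \<bar>r\<bar> * \<bar>snd \<omega> (Inr i)\<bar> + 2 * (r\<^sup>2 * K\<^sup>2))"
        unfolding real_norm_def by (intro AE_I2 order_trans[OF Lb abs_ge_self])
    qed
  qed
  have "mFE (strength 0 r) = (\<Sum>i<N. \<integral>\<omega>. L (snd \<omega> (Inr i)) (fst \<omega> i) \<partial>S)"
    unfolding mFE_def FE0 by (rule Bochner_Integration.integral_sum) (use comp(2) in simp)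
  also have "\<dots> = N * c" using comp(1) by simp
  finally have "F 0 h = c" unfolding F_def Fb_def r_def[symmetric] using N by simp
  \<comment> \<open>\<open>psi\<close> has the Gaussian as first factor, hence the swap. What
    follows replaces clipped by raw variables, an almost sure identity.\<close>
  also have "c = (\<integral>v. L (fst v) (snd v) \<partial>(gauss \<Otimes>\<^sub>M P))"
    unfolding c_def using PG.integral_product_swap[of "\<lambda>v. L (snd v) (fst v)"] Lm by (simp add: case_prod_beta')
  also have "\<dots> = psi P h"
    unfolding psi_def
  proof (rule integral_cong_AE)
    have Pc: "AE x in P. clip x = x" using P_bound by eventually_elim (auto simp: clip_def)
    have inner: "(LINT x | P. exp (sqrt h * z * x + h * x * b - h / 2 * x ^ 2)) = (\<integral>x. exp (k z b x) \<partial>P)" if b: "clip b = b" for z b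
    proof (rule integral_cong_AE)
      have "(\<lambda>x. exp (sqrt h * z * x + h * x * b - h / 2 * x ^ 2)) \<in> borel_measurable borel"
        by (intro borel_measurable_continuous_onI continuous_intros)
      then show "(\<lambda>x. exp (sqrt h * z * x + h * x * b - h / 2 * x ^ 2)) \<in> borel_measurable P"
        by (simp add: sets_P cong: measurable_cong_sets)
      show "(\<lambda>x. exp (k z b x)) \<in> borel_measurable P" using measurable_compose[OF kP borel_measurable_exp] .
      show "AE x in P. exp (sqrt h * z * x + h * x * b - h / 2 * x ^ 2) = exp (k z b x)"
        using Pc by eventually_elim (simp add: k_def b r2 flip: r_def)
    qed
    have "AE v in P \<Otimes>\<^sub>M gauss. clip (fst v) = fst v"
    proof -
      have e: "distr (P \<Otimes>\<^sub>M gauss) P fst = P" by (rule ga.distr_pair_fst)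
      have "AE x in distr (P \<Otimes>\<^sub>M gauss) P fst. clip x = x" unfolding e by (rule Pc)
      from AE_distrD[OF measurable_fst this] show ?thesis .
    qed
    then have "AE v in distr (gauss \<Otimes>\<^sub>M P) (P \<Otimes>\<^sub>M gauss) (\<lambda>(x, y). (y, x)). clip (fst v) = fst v"
      unfolding PG.distr_pair_swap[symmetric] .
    then have "AE v in gauss \<Otimes>\<^sub>M P. clip (snd v) = snd v"
      by (rule AE_distrD[rotated, THEN AE_mp]) (auto intro!: AE_I2 simp: case_prod_beta')
    then show "AE v in gauss \<Otimes>\<^sub>M P. L (fst v) (snd v) = (case v of (z1, xb1) \<Rightarrow>
      ln (LINT x | P. exp (sqrt h * z1 * x + h * x * xb1 - h / 2 * x ^ 2)))"
      by eventually_elim (simp only: L_def inner case_prod_beta')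
    show "(\<lambda>v. L (fst v) (snd v)) \<in> borel_measurable (gauss \<Otimes>\<^sub>M P)"
      using measurable_compose[OF measurable_Pair[OF measurable_snd measurable_fst] Lm] by simp
    have "(\<lambda>v. exp (sqrt h * fst (fst v) * snd v + h * snd v * snd (fst v) - h / 2 * (snd v) ^ 2)) \<in> borel_measurable ((borel \<Otimes>\<^sub>M borel) \<Otimes>\<^sub>M borel)"
      by measurable
    moreover have "sets ((gauss \<Otimes>\<^sub>M P) \<Otimes>\<^sub>M P) = sets ((borel \<Otimes>\<^sub>M borel) \<Otimes>\<^sub>M borel)"
      by (intro sets_pair_measure_cong sets_gauss sets_P)
    ultimately have "(\<lambda>v. exp (sqrt h * fst (fst v) * snd v + h * snd v * snd (fst v) - h / 2 * (snd v) ^ 2)) \<in> borel_measurable ((gauss \<Otimes>\<^sub>M P) \<Otimes>\<^sub>M P)"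
      by (simp cong: measurable_cong_sets)
    then show "(\<lambda>v. case v of (z1, xb1) \<Rightarrow> ln (LINT x | P. exp (sqrt h * z1 * x + h * x * xb1 - h / 2 * x ^ 2))) \<in> borel_measurable (gauss \<Otimes>\<^sub>M P)"
      unfolding case_prod_beta' by (intro borel_measurable_ln P.borel_measurable_lebesgue_integral) (simp add: case_prod_beta')
  qed
  finally show ?thesis .
qed

end

section \<open>The uniform estimate\<close>

text \<open>The points of \<open>A\<close> where \<open>g\<close> is at most the supremum over
  \<open>D\<close> form a closed set containing \<open>D\<close>, hence all of
  \<open>A\<close>.\<close>

lemma SUP_dense:
  fixes g :: "'a::t2_space \<Rightarrow> real"
  assumes g: "continuous_on A g" and A: "compact A" and D: "D \<subseteq> A" "A \<subseteq> closure D"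
  shows "(SUP x\<in>A. g x) = (SUP x\<in>D. g x)"
proof (cases "A = {}")
  case False
  then have ne: "D \<noteq> {}" using D by auto
  have bdd: "bdd_above (g ` A)"
    by (intro bounded_imp_bdd_above compact_imp_bounded compact_continuous_image g A)
  then have bddD: "bdd_above (g ` D)" by (rule bdd_above_mono) (use D in auto)
  let ?c = "SUP x\<in>D. g x"
  have "closed (A \<inter> g -` {..?c})"
    by (rule continuous_closed_preimage[OF g compact_imp_closed[OF A] closed_atMost])
  moreover have "D \<subseteq> A \<inter> g -` {..?c}" using D cSUP_upper[OF _ bddD] by auto
  ultimately have "A \<subseteq> A \<inter> g -` {..?c}" using D closure_minimal by blast
  then have "(SUP x\<in>A. g x) \<le> ?c" by (intro cSUP_least False) auto
  moreover have "?c \<le> (SUP x\<in>A. g x)" by (rule cSUP_subset_mono[OF ne bdd]) (use D in auto)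
  ultimately show ?thesis by (rule antisym)
qed (use D in simp)

context model begin

abbreviation sup_error :: "(real \<Rightarrow> real \<Rightarrow> real) \<Rightarrow> real \<Rightarrow> _ \<Rightarrow> real" where
  "sup_error f M \<omega> \<equiv> SUP th\<in>{0..M} \<times> {0..M}. (FN P p N (fst th) (snd th) \<omega> - f (fst th) (snd th))\<^sup>2"

lemma sup_error_measurable:
  assumes f: "continuous_on ({0..} \<times> {0..}) (\<lambda>y. f (fst y) (snd y))"
  shows "sup_error f M \<in> borel_measurable SS"
proof -
  let ?A = "{0..M} \<times> {0..M}"
  let ?g = "\<lambda>th \<omega>. (FN P p N (fst th) (snd th) \<omega> - f (fst th) (snd th))\<^sup>2"
  obtain D where D: "countable D" "D \<subseteq> ?A" "?A \<subseteq> closure D" by (rule separable)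
  have cont: "continuous_on ?A (\<lambda>th. ?g th \<omega>)" for \<omega>
    by (intro continuous_on_power continuous_on_diff continuous_on_subset[OF FN_continuous] continuous_on_subset[OF f]) auto
  have A: "compact ?A" by (intro compact_Times compact_Icc)
  have "(SUP th\<in>?A. ?g th \<omega>) = (SUP th\<in>D. ?g th \<omega>)" for \<omega> by (rule SUP_dense[OF cont A D(2,3)])
  moreover have "(\<lambda>\<omega>. SUP th\<in>D. ?g th \<omega>) \<in> borel_measurable SS"
  proof (rule borel_measurable_cSUP[OF D(1)])
    fix th assume "th \<in> D"
    then have "fst th \<ge> 0" "snd th \<ge> 0" using D(2) by auto
    then show "?g th \<in> borel_measurable SS"
      by (intro borel_measurable_power borel_measurable_diff FN_measurable borel_measurable_const)
  next
    fix \<omega>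
    have "bdd_above ((\<lambda>th. ?g th \<omega>) ` ?A)"
      by (intro bounded_imp_bdd_above compact_imp_bounded compact_continuous_image cont A)
    then show "bdd_above ((\<lambda>th. ?g th \<omega>) ` D)" by (rule bdd_above_mono) (use D in auto)
  qed
  ultimately show ?thesis by simp
qed

lemma sup_error_le:
  assumes M: "M \<ge> 1" and n: "n > 0"
    and close: "\<And>t h. t \<in> {0..M} \<Longrightarrow> h \<in> {0..M} \<Longrightarrow> \<bar>F t h - f t h\<bar> \<le> \<eta>"
    and \<omega>: "\<forall>i<N. \<bar>fst \<omega> i\<bar> \<le> K"
  shows "0 \<le> sup_error f M \<omega>" "sup_error f M \<omega> \<le> sup_bound M n \<eta> (to_channel \<omega>)"
proof -
  let ?A = "{0..M} \<times> {0..M}"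
  let ?g = "\<lambda>th. (FN P p N (fst th) (snd th) \<omega> - f (fst th) (snd th))\<^sup>2"
  let ?u = "\<lambda>x. deviation (of_int (fst x) * (M / n)) (of_int (snd x) * (M / n)) (to_channel \<omega>)"
  define w where "w = 4 * (68 * B2 * M * (M / n))"
  define s where "s = (\<Sum>x\<in>grid_idx n. \<bar>?u x\<bar>)"
  have le: "?g th \<le> sup_bound M n \<eta> (to_channel \<omega>)" if th: "th \<in> ?A" for th
  proof -
    define t h where "t = fst th" and "h = snd th"
    have t: "0 \<le> t" "t \<le> M" and h: "0 \<le> h" "h \<le> M" using th by (auto simp: t_def h_def)
    \<comment> \<open>Here \<open>M \<ge> 1\<close> is used: square roots of parameters in
      \<open>[0, M]\<close> stay in \<open>[0, M]\<close>, so one grid serves both scales.\<close>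
    have sq: "sqrt x \<le> M" if "0 \<le> x" "x \<le> M" for x
    proof (rule real_le_lsqrt)
      show "x \<le> M\<^sup>2" using that M mult_mono[of 1 M x M] by (simp add: power2_eq_square)
    qed (use that M in auto)
    have "\<bar>deviation (sqrt t) (sqrt h) (to_channel \<omega>)\<bar> \<le> 3 * s + w" unfolding s_def w_def
      using deviation_uniform[OF _ n _ sq[OF t] _ sq[OF h], of "to_channel \<omega>"] M t h by (simp add: case_prod_beta)
    moreover have "FN P p N t h \<omega> - F t h = deviation (sqrt t) (sqrt h) (to_channel \<omega>)"
      unfolding FN_eq_FE[OF t(1) h(1) \<omega>] deviation_def F_def ..
    ultimately have "\<bar>FN P p N t h \<omega> - f t h\<bar> \<le> 3 * s + w + \<eta>" using close[of t h] t h by force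
    then have "(FN P p N t h \<omega> - f t h)\<^sup>2 \<le> (3 * s + w + \<eta>)\<^sup>2" using power_mono[OF _ abs_ge_zero, of _ _ 2] by fastforce
    also have "\<dots> \<le> 3 * ((3 * s)\<^sup>2 + w\<^sup>2 + \<eta>\<^sup>2)"
    proof -
      have "3 * (a\<^sup>2 + b\<^sup>2 + c\<^sup>2) - (a + b + c)\<^sup>2 = (a - b)\<^sup>2 + (b - c)\<^sup>2 + (a - c)\<^sup>2" for a b c :: real
        by (simp add: power2_eq_square algebra_simps)
      from this[of "3 * s" w \<eta>] show ?thesis by (smt (verit) zero_le_power2)
    qed
    also have "\<dots> = 27 * s\<^sup>2 + 3 * w\<^sup>2 + 3 * \<eta>\<^sup>2" by (simp add: power_mult_distrib)
    also have "\<dots> \<le> 27 * ((real (card (grid_idx n)) + 1) * (\<Sum>x\<in>grid_idx n. (?u x)\<^sup>2)) + 3 * w\<^sup>2 + 3 * \<eta>\<^sup>2"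
      using sum_square_le[OF finite_idx, of 0 "\<lambda>x. \<bar>?u x\<bar>" n] unfolding s_def by simp
    also have "\<dots> = sup_bound M n \<eta> (to_channel \<omega>)" unfolding sup_bound_def w_def case_prod_beta power_mult_distrib[of 4] by simp
    finally show ?thesis unfolding t_def h_def .
  qed
  have A: "(0, 0) \<in> ?A" using M by simp
  show "sup_error f M \<omega> \<le> sup_bound M n \<eta> (to_channel \<omega>)" by (rule cSUP_least) (use A le in blast)+
  have "0 \<le> ?g (0, 0)" by simp
  also have "\<dots> \<le> sup_error f M \<omega>"
  proof (rule cSUP_upper[OF A])
    show "bdd_above (?g ` ?A)" by (rule bdd_aboveI2[OF le])
  qed
  finally show "0 \<le> sup_error f M \<omega>" .
qed

lemma sup_error_integral:
  assumes f: "continuous_on ({0..} \<times> {0..}) (\<lambda>y. f (fst y) (snd y))" and M: "M \<ge> 1" and n: "n > 0"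
    and close: "\<And>t h. t \<in> {0..M} \<Longrightarrow> h \<in> {0..M} \<Longrightarrow> \<bar>F t h - f t h\<bar> \<le> \<eta>"
  shows "integrable SS (sup_error f M)" "0 \<le> (\<integral>\<omega>. sup_error f M \<omega> \<partial>SS)"
    "(\<integral>\<omega>. sup_error f M \<omega> \<partial>SS) \<le> 27 * ((real (card (grid_idx n)) + 1) * (\<Sum>(i, j)\<in>grid_idx n. vcon (of_int i * (M / n)) (of_int j * (M / n)))) / N
     + 48 * (68 * B2 * M * (M / n))\<^sup>2 + 3 * \<eta>\<^sup>2"
proof -
  note b = integral_tr[OF sup_bound_integrable[of M n \<eta>]]
  have 0: "AE \<omega> in SS. 0 \<le> sup_error f M \<omega>"
    using AE_SS_bound by eventually_elim (rule sup_error_le(1)[OF M n close])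
  have 1: "AE \<omega> in SS. sup_error f M \<omega> \<le> sup_bound M n \<eta> (to_channel \<omega>)"
    using AE_SS_bound by eventually_elim (rule sup_error_le(2)[OF M n close])
  show i: "integrable SS (sup_error f M)"
  proof (rule Bochner_Integration.integrable_bound[OF b(1) sup_error_measurable[OF f]])
    show "AE \<omega> in SS. norm (sup_error f M \<omega>) \<le> norm (sup_bound M n \<eta> (to_channel \<omega>))"
      using 0 1 by eventually_elim simp
  qed
  show "0 \<le> (\<integral>\<omega>. sup_error f M \<omega> \<partial>SS)" by (rule integral_nonneg_AE[OF 0])
  have "(\<integral>\<omega>. sup_error f M \<omega> \<partial>SS) \<le> (\<integral>\<omega>. sup_bound M n \<eta> (to_channel \<omega>) \<partial>SS)"
    by (rule integral_mono_AE[OF i b(1) 1])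
  also have "\<dots> = (\<integral>\<omega>. sup_bound M n \<eta> \<omega> \<partial>S)" by (rule b(2))
  also note sup_bound_integral
  finally show "(\<integral>\<omega>. sup_error f M \<omega> \<partial>SS) \<le> 27 * ((real (card (grid_idx n)) + 1) * (\<Sum>(i, j)\<in>grid_idx n. vcon (of_int i * (M / n)) (of_int j * (M / n)))) / N
     + 48 * (68 * B2 * M * (M / n))\<^sup>2 + 3 * \<eta>\<^sup>2" .
qed

end

theorem theorem5p1:
  fixes P :: "real measure" and p :: nat and f :: "real \<Rightarrow> real \<Rightarrow> real" and M :: real
  assumes "prob_space P" and "sets P = sets borel"
    and "\<exists>K. AE x in P. \<bar>x\<bar> \<le> K"
    and "p \<ge> 1"
    and "visc_sol p f"
    and "\<exists>L. L-lipschitz_on ({0..} \<times> {0..}) (\<lambda>(t, h). f t h)"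
    and "\<forall>h\<ge>0. f 0 h = psi P h"
    and "M \<ge> 1"
  shows "(\<forall>N\<ge>1. integrable (sample_space P p N)
            (\<lambda>\<omega>. SUP th\<in>{0..M} \<times> {0..M}. (FN P p N (fst th) (snd th) \<omega> - f (fst th) (snd th))\<^sup>2))
       \<and> (\<lambda>N. LINT \<omega> | sample_space P p N.
            (SUP th\<in>{0..M} \<times> {0..M}. (FN P p N (fst th) (snd th) \<omega> - f (fst th) (snd th))\<^sup>2))
         \<longlonglongrightarrow> 0"
proof -
  interpret P: prob_space P by (rule assms(1))
  obtain K0 where "AE x in P. \<bar>x\<bar> \<le> K0" using assms(3) by blast
  define K where "K = max 1 K0"
  have K: "AE x in P. \<bar>x\<bar> \<le> K" using \<open>AE x in P. \<bar>x\<bar> \<le> K0\<close> by eventually_elim (simp add: K_def)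
  have md: "model P p K N" if "N \<ge> 1" for N
    by unfold_locales (use assms K that in \<open>auto simp: K_def\<close>)
  define B where "B = (K ^ p)\<^sup>2"
  obtain L1 where L1: "L1-lipschitz_on ({0..} \<times> {0..}) (\<lambda>(t, h). f t h)" using assms(6) by blast
  \<comment> \<open>One constant that serves \<open>f\<close> and all the \<open>F N\<close>, as the
    comparison requires.\<close>
  define L where "L = max L1 (2 * B)"
  have L: "L \<ge> 0" "L1 \<le> L" "2 * B \<le> L" and B: "B \<ge> 0" unfolding L_def B_def by (auto simp: le_max_iff_disj)
  have lf: "lip1 L f" unfolding lip1_def
  proof (intro allI impI)
    fix t h t' h' :: real assume "0 \<le> t" "0 \<le> h" "0 \<le> t'" "0 \<le> h'"
    then have "\<bar>f t h - f t' h'\<bar> \<le> L1 * dist (t, h) (t', h')"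
      using lipschitz_onD[OF L1, of "(t, h)" "(t', h')"] by (simp add: dist_real_def)
    also have "\<dots> \<le> L * dist (t, h) (t', h')" using L by (intro mult_right_mono) auto
    also have "dist (t, h) (t', h') \<le> \<bar>t - t'\<bar> + \<bar>h - h'\<bar>"
      unfolding dist_Pair_Pair dist_real_def using sqrt_sum_squares_le_sum_abs[of "\<bar>t - t'\<bar>" "\<bar>h - h'\<bar>"] by simp
    then have "L * dist (t, h) (t', h') \<le> L * (\<bar>t - t'\<bar> + \<bar>h - h'\<bar>)" using L(1) by (rule mult_left_mono)
    finally show "\<bar>f t h - f t' h'\<bar> \<le> L * (\<bar>t - t'\<bar> + \<bar>h - h'\<bar>)" .
  qed
  have fc: "continuous_on ({0..} \<times> {0..}) (\<lambda>y. f (fst y) (snd y))" by (rule lip1_continuous[OF lf L(1)])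
  let ?F = "\<lambda>N. model.F P p K N" and ?Ft = "\<lambda>N. model.Ft P p K N" and ?Fh = "\<lambda>N. model.Fh P p K N"
  have lF: "lip1 L (?F N)" if N: "N \<ge> 1" for N unfolding lip1_def
  proof (intro allI impI)
    fix t h t' h' :: real assume H: "0 \<le> t" "0 \<le> h" "0 \<le> t'" "0 \<le> h'"
    have "\<bar>?F N t h - ?F N t' h'\<bar> \<le> 2 * B * (\<bar>t - t'\<bar> + \<bar>h - h'\<bar>)"
      unfolding B_def by (rule model.F_lip[OF md[OF N] H])
    also have "\<dots> \<le> L * (\<bar>t - t'\<bar> + \<bar>h - h'\<bar>)" by (rule mult_right_mono[OF L(3)]) simp
    finally show "\<bar>?F N t h - ?F N t' h'\<bar> \<le> L * (\<bar>t - t'\<bar> + \<bar>h - h'\<bar>)" .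
  qed
  have init: "?F N 0 h = f 0 h" if "N \<ge> 1" "h \<ge> 0" for N h
    using model.F_zero[OF md[OF that(1)] that(2)] assms(7) that(2) by simp
  interpret approx_HJ p f L "2 * B" ?F ?Ft ?Fh
  proof (rule approx_HJ.intro[OF assms(5) lf L(1) _ lF init])
    show "2 * B \<ge> 0" using B by simp
    fix N :: nat and t h :: real assume N: "N \<ge> 1" and t: "t > 0" and h: "h > 0"
    show "((\<lambda>t. ?F N t h) has_real_derivative ?Ft N t h) (at t)"
      by (rule model.F_dt[OF md[OF N]]) (use t h in auto)
    show "((\<lambda>h. ?F N t h) has_real_derivative ?Fh N t h) (at h)"
      by (rule model.F_dh[OF md[OF N]]) (use t h in auto)
    show "0 \<le> ?Fh N t h \<and> ?Fh N t h \<le> L"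
      using model.Fh_bounds[OF md[OF N], of t h] L(3) unfolding B_def by linarith
    fix h' :: real assume h': "h' \<ge> 0"
    \<comment> \<open>The locale has a single \<open>C0\<close> for semiconvexity and error bound;
      the latter needs \<open>2 * B\<close>, so the former is weakened to it.\<close>
    have "B * (h' - h)\<^sup>2 / h \<le> 2 * B * (h' - h)\<^sup>2 / h"
      using B h by (intro divide_right_mono mult_right_mono) auto
    then show "?F N t h + ?Fh N t h * (h' - h) - 2 * B * (h' - h)\<^sup>2 / h \<le> ?F N t h'"
      using model.F_semiconvex[OF md[OF N] less_imp_le[OF t] h h'] unfolding B_def by linarith
  next
    fix T :: real
    show "\<exists>C\<ge>0. \<forall>N\<ge>1. \<forall>t h l. 0 < t \<and> t \<le> T \<and> 0 < h \<and> h \<le> T \<and> 0 < l \<and> l \<le> 1 \<longrightarrow>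
        \<bar>?Ft N t h - 2 ^ (p - 1) * ?Fh N t h ^ p\<bar> \<le>
          C * ((?F N t (h + l) - ?F N t h) / l - ?Fh N t h + 2 * B * l / h + 1 / (l * sqrt N) + 1 / (sqrt h * sqrt N))"
    proof (cases "T \<le> 0")
      case False
      define C where "C = real p * B * (2 + (4 * ln 2 + 8 * sqrt (model.vcon p K (sqrt T) (sqrt (T + 1)))) + 2 * K ^ p)"
      have "model.vcon p K (sqrt T) (sqrt (T + 1)) \<ge> 0"
        unfolding model.vcon_def[OF md[of 1, simplified]] by (intro add_nonneg_nonneg mult_nonneg_nonneg zero_le_power2)
      then have "C \<ge> 0" unfolding C_def using B by (auto simp: K_def)
      moreover have "\<forall>N\<ge>1. \<forall>t h l. 0 < t \<and> t \<le> T \<and> 0 < h \<and> h \<le> T \<and> 0 < l \<and> l \<le> 1 \<longrightarrow>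
        \<bar>?Ft N t h - 2 ^ (p - 1) * ?Fh N t h ^ p\<bar> \<le>
          C * ((?F N t (h + l) - ?F N t h) / l - ?Fh N t h + 2 * B * l / h + 1 / (l * sqrt N) + 1 / (sqrt h * sqrt N))"
      proof (intro allI impI, elim conjE)
        fix N :: nat and t h l :: real
        assume "N \<ge> 1" "0 < t" "t \<le> T" "0 < h" "h \<le> T" "0 < l" "l \<le> 1"
        then show "\<bar>?Ft N t h - 2 ^ (p - 1) * ?Fh N t h ^ p\<bar> \<le>
          C * ((?F N t (h + l) - ?F N t h) / l - ?Fh N t h + 2 * B * l / h + 1 / (l * sqrt N) + 1 / (sqrt h * sqrt N))"
          unfolding C_def B_def by (intro model.err_bound md) auto
      qed
      ultimately show ?thesis by blast
    qed (auto intro!: exI[of _ 0])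
  qed
  let ?E = "\<lambda>N. \<integral>\<omega>. (SUP th\<in>{0..M} \<times> {0..M}. (FN P p N (fst th) (snd th) \<omega> - f (fst th) (snd th))\<^sup>2) \<partial>sample_space P p N"
  define A where "A n = 27 * ((real (card (model.grid_idx n)) + 1) * (\<Sum>(i, j)\<in>model.grid_idx n. model.vcon p K (of_int i * (M / n)) (of_int j * (M / n))))" for n :: nat
  define w where "w = 68 * B * M * M"
  have sup: "integrable (sample_space P p N)
        (\<lambda>\<omega>. SUP th\<in>{0..M} \<times> {0..M}. (FN P p N (fst th) (snd th) \<omega> - f (fst th) (snd th))\<^sup>2)"
      "0 \<le> ?E N" "?E N \<le> A n / N + 48 * (w / n)\<^sup>2 + 3 * \<eta>\<^sup>2"
    if N: "N \<ge> 1" and n: "n > 0" and close: "\<And>t h. t \<in> {0..M} \<Longrightarrow> h \<in> {0..M} \<Longrightarrow> \<bar>?F N t h - f t h\<bar> \<le> \<eta>"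
    for N n \<eta>
    using model.sup_error_integral[OF md[OF N] fc assms(8) n close] unfolding A_def w_def B_def by simp_all
  \<comment> \<open>A Bochner integral of a nonintegrable function is 0 by convention, so
    integrability is what gives the limit its content. A crude bound on the distance of
    \<open>F\<close> and \<open>f\<close>, through time zero where they agree, is enough here, with
    \<open>n = 1\<close>.\<close>
  have "integrable (sample_space P p N)
        (\<lambda>\<omega>. SUP th\<in>{0..M} \<times> {0..M}. (FN P p N (fst th) (snd th) \<omega> - f (fst th) (snd th))\<^sup>2)" if N: "N \<ge> 1" for N
  proof -
    have "\<bar>?F N t h - f t h\<bar> \<le> 2 * (L * M)" if th: "t \<in> {0..M}" "h \<in> {0..M}" for t h
    proof -
      have "\<bar>?F N t h - ?F N 0 h\<bar> \<le> L * t" "\<bar>f t h - f 0 h\<bar> \<le> L * t"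
        using lip1D[OF lF[OF N], of t h 0 h] lip1D[OF lf, of t h 0 h] th by auto
      moreover have "L * t \<le> L * M" using th L(1) by (intro mult_left_mono) auto
      ultimately show ?thesis using init[OF N, of h] th by auto
    qed
    from sup(1)[OF N zero_less_one this] show ?thesis .
  qed
  moreover have "?E \<longlonglongrightarrow> 0"
  proof (rule LIMSEQ_I)
    fix \<epsilon> :: real assume \<epsilon>: "\<epsilon> > 0"
    \<comment> \<open>Each of the three error terms gets \<open>\<epsilon> / 4\<close>. The mesh
      parameter \<open>n\<close> is fixed before \<open>N\<close> grows, since the fluctuation term
      \<open>A n / N\<close> is not uniform in \<open>n\<close>.\<close>
    define \<eta> where "\<eta> = sqrt (\<epsilon> / 12)"
    have \<eta>: "\<eta> > 0" "3 * \<eta>\<^sup>2 = \<epsilon> / 4" unfolding \<eta>_def using \<epsilon> by auto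
    have "M \<ge> 0" using assms(8) by simp
    from uniform_limit[OF this \<eta>(1)] obtain N0 where N0: "\<And>N t h. N \<ge> N0 \<Longrightarrow> t \<in> {0..M} \<Longrightarrow> h \<in> {0..M} \<Longrightarrow> \<bar>?F N t h - f t h\<bar> \<le> \<eta>"
      by blast
    have "(\<lambda>n. 48 * (w / real n)\<^sup>2) \<longlonglongrightarrow> 48 * 0\<^sup>2" by (intro tendsto_intros lim_const_over_n)
    then have "eventually (\<lambda>n. 48 * (w / real n)\<^sup>2 < \<epsilon> / 4) sequentially" by (rule order_tendstoD(2)) (use \<epsilon> in simp)
    from eventually_happens'[OF _ eventually_conj[OF this eventually_gt_at_top[of 0]]]
    obtain n where n: "48 * (w / real n)\<^sup>2 < \<epsilon> / 4" "n > 0" by auto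
    have "eventually (\<lambda>N. A n / real N < \<epsilon> / 4) sequentially"
      using \<epsilon> by (intro order_tendstoD(2)[OF lim_const_over_n]) auto
    then obtain N1 where N1: "\<And>N. N \<ge> N1 \<Longrightarrow> A n / real N < \<epsilon> / 4" unfolding eventually_sequentially by blast
    show "\<exists>N2. \<forall>N\<ge>N2. norm (?E N - 0) < \<epsilon>"
    proof (intro exI allI impI)
      fix N assume "N \<ge> max 1 (max N0 N1)"
      then have N: "N \<ge> 1" "N \<ge> N0" "N \<ge> N1" by auto
      have "0 \<le> ?E N" "?E N \<le> A n / N + 48 * (w / n)\<^sup>2 + 3 * \<eta>\<^sup>2"
        using sup(2,3)[OF N(1) n(2) N0[OF N(2)]] by blast+
      then show "norm (?E N - 0) < \<epsilon>" unfolding real_norm_def using n(1) N1[OF N(3)] \<eta>(2) by linarith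
    qed
  qed
  ultimately show ?thesis by blast
qed

end
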